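(* Let $e>0$, $L>0$, $k_m=2\pi m/L$, $\omega_m=\sqrt{k_m^2+e^2/\pi}$, and let $C_0$ be a real constant. With $\mathcal K$, $\mathcal D$, $\mathcal F_0$, $Q^5$ and $\rho^{R},\rho^L$ as in the context, define the operator $\mathbf H$ on $\mathcal D\subset\mathcal K$ by $$(\mathbf H\Psi)(a)=-\frac{e^2}{2L}\Psi''(a)+\frac{\pi}{2L}\Bigl(Q^5-\frac{aL}{\pi}-1\Bigr)^2\Psi(a)+\sum_{m\in\mathbb N}\frac{\omega_m}{m}\Bigl(\rho^R(m)\rho^R(-m)+\rho^L(-m)\rho^L(m)\Bigr)\Psi(a)+C_0\Psi(a).$$ Then $\mathbf H$ is a symmetric operator on $\mathcal K$ which is essentially self-adjoint on $\mathcal D$.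
   Context: Fermionic Fock space: operators $b_n,c_n$ ($n\in\mathbb Z$) with $\{b_n,b_{n'}^\dagger\}=\{c_n,c_{n'}^\dagger\}=\delta_{nn'}$, other anticommutators zero, acting on the space generated from a unit vacuum $\Omega_0$ with $b_n\Omega_0=c_n\Omega_0=0$; for finite subsets $\mathbf m=\{m_1<\dots<m_M\}$, $\mathbf n=\{n_1<\dots<n_N\}$ of $\mathbb Z$ the vectors $b_{m_1}^\dagger\cdots b_{m_M}^\dagger c_{n_1}^\dagger\cdots c_{n_N}^\dagger\Omega_0$ form an orthonormal basis. $\mathcal F_0$ is the algebraic span of those with $M=N$, and $\mathcal H_0$ its closure. The axial charge $Q^5=\sum_{n\ge0}b_n^\dagger b_n-\sum_{n<0}b_n^\dagger b_n-\sum_{n>0}c_n^\dagger c_n+\sum_{n\le0}c_n^\dagger c_n$ on $\mathcal F_0$. For $m\in\mathbb N$ (positive integers) define on $\mathcal F_0$ (where the sums are finite): $\rho^R(m)=-\sum_{k>m}c_k^\dagger c_{k-m}+\sum_{0<k\le m}b_{m-k}^\dagger c_k^\dagger+\sum_{k\ge0}b_{k+m}^\dagger b_k$, $\rho^R(-m)=-\sum_{k>m}c_{k-m}^\dagger c_k+\sum_{0<k\le m}c_k b_{m-k}+\sum_{k\ge0}b_k^\dagger b_{k+m}$, $\rho^L(m)=\sum_{k<-m}b_{k+m}^\dagger b_k+\sum_{-m\le k<0}c_{-k-m}b_k-\sum_{k\le0}c_k^\dagger c_{k-m}$, $\rho^L(-m)=\sum_{k<-m}b_k^\dagger b_{k+m}+\sum_{-m\le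 k<0}b_k^\dagger c_{-k-m}^\dagger-\sum_{k\le0}c_{k-m}^\dagger c_k$. The large gauge transformation $\mathbf\Gamma$ is the unitary operator on the Fock space (preserving $\mathcal H_0$ and $\mathcal F_0$) determined by $\mathbf\Gamma\Omega_0=b_{-1}^\dagger c_1^\dagger\Omega_0$, $\mathbf\Gamma b_n\mathbf\Gamma^{-1}=b_{n-1}$ and $\mathbf\Gamma c_n\mathbf\Gamma^{-1}=c_{n+1}$ for $n\ne0$, $\mathbf\Gamma b_0\mathbf\Gamma^{-1}=c_1^\dagger$, $\mathbf\Gamma c_0\mathbf\Gamma^{-1}=b_{-1}^\dagger$ (with the adjoint relations). $\mathcal K=L^2([0,\tfrac{2\pi}{L}];\mathcal H_0)$ with $\|\Psi\|_{\mathcal K}^2=\int_0^{2\pi/L}\|\Psi(a)\|^2da$, and $\mathcal D$ is the set of restrictions to $[0,\tfrac{2\pi}{L}]$ of smooth $\Psi:\mathbb R\to\mathcal F_0$ with $\Psi(a+\tfrac{2\pi}{L})=\mathbf\Gamma^{-1}\Psi(a)$ for all $a\in\mathbb R$; $\Psi''$ denotes $d^2\Psi/da^2$. (In the paper $C_0$ is a specific negative constant arising from a Bogoliubov transformation, and $\mathbf H$ is the dressed Hamiltonian of the Schwinger model on a circle of length $L$ in Coulomb gauge.) *)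

theory Defs
  imports "HOL-Analysis.Analysis"
begin

text \<open>A basis vector b_{m_1}^* ... b_{m_M}^* c_{n_1}^* ... c_{n_N}^* Omega_0 (m_1<...<m_M,
  n_1<...<n_N) is labelled by the pair of finite sets (M,N). A (possibly infinite) vector is
  represented by its coefficient function on these labels.\<close>

type_synonym fb = "int set \<times> int set"
type_synonym fvec = "fb \<Rightarrow> complex"

definition fock_basis :: "fb set" where
  "fock_basis = {(M,N). finite M \<and> finite N}"

definition charge0_basis :: "fb set" where
  "charge0_basis = {(M,N). finite M \<and> finite N \<and> card M = card N}"

definition supp_vec :: "fvec \<Rightarrow> fb set" where
  "supp_vec \<psi> = {\<beta>. \<psi> \<beta> \<noteq> 0}"

definition fin_vec :: "fvec \<Rightarrow> bool" where
  "fin_vec \<psi> \<longleftrightarrow> finite (supp_vec \<psi>) \<and> supp_vec \<psi> \<subseteq> fock_basis"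

definition F0 :: "fvec set" where
  "F0 = {\<psi>. finite (supp_vec \<psi>) \<and> supp_vec \<psi> \<subseteq> charge0_basis}"

definition vac :: fvec where
  "vac = (\<lambda>\<beta>. if \<beta> = ({}, {}) then 1 else 0)"

definition cnt_less :: "int set \<Rightarrow> int \<Rightarrow> nat" where
  "cnt_less A n = card {k\<in>A. k < n}"

definition bdag :: "int \<Rightarrow> fvec \<Rightarrow> fvec" where
  "bdag n \<psi> = (\<lambda>(M,N). if (M,N) \<in> fock_basis \<and> n \<in> M
       then (-1) ^ cnt_less M n * \<psi> (M - {n}, N) else 0)"

definition bann :: "int \<Rightarrow> fvec \<Rightarrow> fvec" where
  "bann n \<psi> = (\<lambda>(M,N). if (M,N) \<in> fock_basis \<and> n \<notin> M
       then (-1) ^ cnt_less M n * \<psi> (insert n M, N) else 0)"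

definition cdag :: "int \<Rightarrow> fvec \<Rightarrow> fvec" where
  "cdag n \<psi> = (\<lambda>(M,N). if (M,N) \<in> fock_basis \<and> n \<in> N
       then (-1) ^ (card M + cnt_less N n) * \<psi> (M, N - {n}) else 0)"

definition cann :: "int \<Rightarrow> fvec \<Rightarrow> fvec" where
  "cann n \<psi> = (\<lambda>(M,N). if (M,N) \<in> fock_basis \<and> n \<notin> N
       then (-1) ^ (card M + cnt_less N n) * \<psi> (M, insert n N) else 0)"

section \<open>Axial charge and currents (infinite sums are pointwise finite on F_0)\<close>

definition Q5 :: "fvec \<Rightarrow> fvec" where
  "Q5 \<psi> = (\<lambda>\<beta>. (\<Sum>\<^sub>\<infinity>n\<in>{0..}. bdag n (bann n \<psi>) \<beta>) - (\<Sum>\<^sub>\<infinity>n\<in>{..<0}. bdag n (bann n \<psi>) \<beta>)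
     - (\<Sum>\<^sub>\<infinity>n\<in>{0<..}. cdag n (cann n \<psi>) \<beta>) + (\<Sum>\<^sub>\<infinity>n\<in>{..0}. cdag n (cann n \<psi>) \<beta>))"

definition rhoR_pos :: "nat \<Rightarrow> fvec \<Rightarrow> fvec" where
  "rhoR_pos m \<psi> = (\<lambda>\<beta>.
      - (\<Sum>\<^sub>\<infinity>k\<in>{int m<..}. cdag k (cann (k - int m) \<psi>) \<beta>)
      + (\<Sum>k\<in>{0<..int m}. bdag (int m - k) (cdag k \<psi>) \<beta>)
      + (\<Sum>\<^sub>\<infinity>k\<in>{0..}. bdag (k + int m) (bann k \<psi>) \<beta>))"

definition rhoR_neg :: "nat \<Rightarrow> fvec \<Rightarrow> fvec" where
  "rhoR_neg m \<psi> = (\<lambda>\<beta>.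
      - (\<Sum>\<^sub>\<infinity>k\<in>{int m<..}. cdag (k - int m) (cann k \<psi>) \<beta>)
      + (\<Sum>k\<in>{0<..int m}. cann k (bann (int m - k) \<psi>) \<beta>)
      + (\<Sum>\<^sub>\<infinity>k\<in>{0..}. bdag k (bann (k + int m) \<psi>) \<beta>))"

definition rhoL_pos :: "nat \<Rightarrow> fvec \<Rightarrow> fvec" where
  "rhoL_pos m \<psi> = (\<lambda>\<beta>.
      (\<Sum>\<^sub>\<infinity>k\<in>{..< - int m}. bdag (k + int m) (bann k \<psi>) \<beta>)
      + (\<Sum>k\<in>{- int m..<0}. cann (- k - int m) (bann k \<psi>) \<beta>)
      - (\<Sum>\<^sub>\<infinity>k\<in>{..0}. cdag k (cann (k - int m) \<psi>) \<beta>))"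

definition rhoL_neg :: "nat \<Rightarrow> fvec \<Rightarrow> fvec" where
  "rhoL_neg m \<psi> = (\<lambda>\<beta>.
      (\<Sum>\<^sub>\<infinity>k\<in>{..< - int m}. bdag k (bann (k + int m) \<psi>) \<beta>)
      + (\<Sum>k\<in>{- int m..<0}. bdag k (cdag (- k - int m) \<psi>) \<beta>)
      - (\<Sum>\<^sub>\<infinity>k\<in>{..0}. cdag (k - int m) (cann k \<psi>) \<beta>))"

text \<open>Characterisation of Gamma on the finite vectors of the Fock space: linearity, its value
  on the vacuum and the intertwining relations Gamma b_n^* Gamma^{-1} = b_{n-1}^* (n /= 0),
  Gamma b_0^* Gamma^{-1} = c_1, Gamma c_n^* Gamma^{-1} = c_{n+1}^* (n /= 0),
  Gamma c_0^* Gamma^{-1} = b_{-1}. These determine Gamma uniquely on finite vectors.\<close>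
definition is_large_gauge :: "(fvec \<Rightarrow> fvec) \<Rightarrow> bool" where
  "is_large_gauge G \<longleftrightarrow>
     (\<forall>\<psi> \<phi>. fin_vec \<psi> \<longrightarrow> fin_vec \<phi> \<longrightarrow> G (\<lambda>\<beta>. \<psi> \<beta> + \<phi> \<beta>) = (\<lambda>\<beta>. G \<psi> \<beta> + G \<phi> \<beta>)) \<and>
     (\<forall>\<psi> z. fin_vec \<psi> \<longrightarrow> G (\<lambda>\<beta>. z * \<psi> \<beta>) = (\<lambda>\<beta>. z * G \<psi> \<beta>)) \<and>
     G vac = bdag (-1) (cdag 1 vac) \<and>
     (\<forall>\<psi> n. fin_vec \<psi> \<longrightarrow> n \<noteq> 0 \<longrightarrow> G (bdag n \<psi>) = bdag (n - 1) (G \<psi>)) \<and>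
     (\<forall>\<psi>. fin_vec \<psi> \<longrightarrow> G (bdag 0 \<psi>) = cann 1 (G \<psi>)) \<and>
     (\<forall>\<psi> n. fin_vec \<psi> \<longrightarrow> n \<noteq> 0 \<longrightarrow> G (cdag n \<psi>) = cdag (n + 1) (G \<psi>)) \<and>
     (\<forall>\<psi>. fin_vec \<psi> \<longrightarrow> G (cdag 0 \<psi>) = bann (-1) (G \<psi>))"

definition Iv :: "real \<Rightarrow> real set" where
  "Iv L = {0 .. 2 * pi / L}"

definition Knorm2 :: "real \<Rightarrow> (real \<Rightarrow> fvec) \<Rightarrow> ennreal" where
  "Knorm2 L \<Psi> = (\<integral>\<^sup>+ a\<in>Iv L. (\<integral>\<^sup>+ \<beta>. ennreal ((cmod (\<Psi> a \<beta>))\<^sup>2) \<partial>count_space UNIV) \<partial>lebesgue)"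

definition Kspace :: "real \<Rightarrow> (real \<Rightarrow> fvec) set" where
  "Kspace L = {\<Psi>. (\<forall>\<beta>. set_borel_measurable lebesgue (Iv L) (\<lambda>a. \<Psi> a \<beta>)) \<and>
                  (\<forall>a\<in>Iv L. supp_vec (\<Psi> a) \<subseteq> charge0_basis) \<and> Knorm2 L \<Psi> < \<infinity>}"

definition Kinner :: "real \<Rightarrow> (real \<Rightarrow> fvec) \<Rightarrow> (real \<Rightarrow> fvec) \<Rightarrow> complex" where
  "Kinner L \<Phi> \<Psi> = (LINT a:Iv L|lebesgue. (\<Sum>\<^sub>\<infinity>\<beta>. cnj (\<Phi> a \<beta>) * \<Psi> a \<beta>))"

definition op_graph :: "(real \<Rightarrow> fvec) set \<Rightarrow> ((real \<Rightarrow> fvec) \<Rightarrow> (real \<Rightarrow> fvec))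
     \<Rightarrow> ((real \<Rightarrow> fvec) \<times> (real \<Rightarrow> fvec)) set" where
  "op_graph D T = {(x, T x) | x. x \<in> D}"

definition dense_in_K :: "real \<Rightarrow> (real \<Rightarrow> fvec) set \<Rightarrow> bool" where
  "dense_in_K L S \<longleftrightarrow> S \<subseteq> Kspace L \<and>
     (\<forall>x\<in>Kspace L. \<forall>\<epsilon>>0. \<exists>y\<in>S. Knorm2 L (x - y) < ennreal \<epsilon>)"

definition closure_graph :: "real \<Rightarrow> ((real \<Rightarrow> fvec) \<times> (real \<Rightarrow> fvec)) set
     \<Rightarrow> ((real \<Rightarrow> fvec) \<times> (real \<Rightarrow> fvec)) set" where
  "closure_graph L G = {(x, y). x \<in> Kspace L \<and> y \<in> Kspace L \<and>
     (\<forall>\<epsilon>>0. \<exists>(u, v)\<in>G. Knorm2 L (u - x) < ennreal \<epsilon> \<and> Knorm2 L (v - y) < ennreal \<epsilon>)}"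

definition adjoint_graph :: "real \<Rightarrow> ((real \<Rightarrow> fvec) \<times> (real \<Rightarrow> fvec)) set
     \<Rightarrow> ((real \<Rightarrow> fvec) \<times> (real \<Rightarrow> fvec)) set" where
  "adjoint_graph L G = {(x, y). x \<in> Kspace L \<and> y \<in> Kspace L \<and>
     (\<forall>(u, v)\<in>G. Kinner L v x = Kinner L u y)}"

text \<open>(Graphs are considered modulo null functions; both the closure and the adjoint graph are
  saturated under this equivalence, so set equality is the right notion.)\<close>
definition self_adjoint_graph :: "real \<Rightarrow> ((real \<Rightarrow> fvec) \<times> (real \<Rightarrow> fvec)) set \<Rightarrow> bool" where
  "self_adjoint_graph L G \<longleftrightarrow> G \<subseteq> Kspace L \<times> Kspace L \<and> dense_in_K L (fst ` G) \<and>
     adjoint_graph L G = G"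

definition symmetric_op :: "real \<Rightarrow> (real \<Rightarrow> fvec) set \<Rightarrow> ((real \<Rightarrow> fvec) \<Rightarrow> (real \<Rightarrow> fvec)) \<Rightarrow> bool" where
  "symmetric_op L D T \<longleftrightarrow> dense_in_K L D \<and> (\<forall>x\<in>D. T x \<in> Kspace L) \<and>
     (\<forall>x\<in>D. \<forall>y\<in>D. Kinner L (T x) y = Kinner L x (T y))"

definition essentially_self_adjoint ::
    "real \<Rightarrow> (real \<Rightarrow> fvec) set \<Rightarrow> ((real \<Rightarrow> fvec) \<Rightarrow> (real \<Rightarrow> fvec)) \<Rightarrow> bool" where
  "essentially_self_adjoint L D T \<longleftrightarrow> self_adjoint_graph L (closure_graph L (op_graph D T))"

definition cderiv :: "(real \<Rightarrow> complex) \<Rightarrow> real \<Rightarrow> complex" where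
  "cderiv f = (\<lambda>t. vector_derivative f (at t))"

definition csmooth :: "(real \<Rightarrow> complex) \<Rightarrow> bool" where
  "csmooth f \<longleftrightarrow> (\<forall>j x. (cderiv ^^ j) f differentiable (at x))"

definition F0_smooth :: "(real \<Rightarrow> fvec) \<Rightarrow> bool" where
  "F0_smooth \<Psi> \<longleftrightarrow> (\<forall>a. \<Psi> a \<in> F0) \<and>
     (\<forall>a. \<exists>\<epsilon>>0. finite (\<Union>t\<in>{a - \<epsilon> <..< a + \<epsilon>}. supp_vec (\<Psi> t))) \<and>
     (\<forall>\<beta>. csmooth (\<lambda>t. \<Psi> t \<beta>))"

definition DomH :: "real \<Rightarrow> (fvec \<Rightarrow> fvec) \<Rightarrow> (real \<Rightarrow> fvec) set" where
  "DomH L G = {\<Psi>. F0_smooth \<Psi> \<and> (\<forall>a. G (\<Psi> (a + 2 * pi / L)) = \<Psi> a)}"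

definition omega :: "real \<Rightarrow> real \<Rightarrow> nat \<Rightarrow> real" where
  "omega e L m = sqrt ((2 * pi * real m / L)\<^sup>2 + e\<^sup>2 / pi)"

definition shiftQ :: "real \<Rightarrow> real \<Rightarrow> fvec \<Rightarrow> fvec" where
  "shiftQ L a \<psi> = (\<lambda>\<beta>. Q5 \<psi> \<beta> - complex_of_real (a * L / pi + 1) * \<psi> \<beta>)"

definition Hop :: "real \<Rightarrow> real \<Rightarrow> real \<Rightarrow> (real \<Rightarrow> fvec) \<Rightarrow> (real \<Rightarrow> fvec)" where
  "Hop e L C0 \<Psi> = (\<lambda>a \<beta>.
      - complex_of_real (e\<^sup>2 / (2 * L)) * (cderiv ^^ 2) (\<lambda>t. \<Psi> t \<beta>) a
      + complex_of_real (pi / (2 * L)) * shiftQ L a (shiftQ L a (\<Psi> a)) \<beta>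
      + (\<Sum>\<^sub>\<infinity>m\<in>{1::nat..}. complex_of_real (omega e L m / real m) *
            (rhoR_pos m (rhoR_neg m (\<Psi> a)) \<beta> + rhoL_neg m (rhoL_pos m (\<Psi> a)) \<beta>))
      + complex_of_real C0 * \<Psi> a \<beta>)"

end

theory Submission
  imports Defs
begin

text \<open>Every basis vector is reached from one of axial charge zero by a unique power of \<open>\<Gamma>\<close>, and
  \<open>\<Gamma>\<close> lowers the charge by two. Hence a vector of the domain is determined by its components of
  charge zero, followed along the whole line, and the domain becomes the space of finitely many
  compactly supported smooth functions on the line. In this picture \<open>Q\<^sup>5 - aL/\<pi> - 1\<close> is
  multiplication by an affine function of \<open>t\<close>, and the current terms act as a nonnegative
  hermitian matrix, piecewise constant in \<open>t\<close>. That matrix preserves total charge, axial charge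
  and kinetic energy \<open>\<Sum>|k|\<close>, so it splits into finite blocks; bosonization is not needed.
  On each block the operator is \<open>-\<alpha> u'' + V(t) u\<close> with \<open>V\<close> locally bounded and bounded
  below. If \<open>(X, Y)\<close> satisfies \<open>-\<alpha> X'' + V X = Y\<close> weakly in the space of square-integrable
  functions, then \<open>X\<close> is approximated on large intervals by smooth \<open>P\<close> with \<open>P''\<close> close to
  \<open>(V X - Y)/\<alpha>\<close>, and cutting \<open>P\<close> off at scale \<open>R\<close> changes the operator by terms that the
  Caccioppoli inequality bounds by \<open>O(1/R)\<close>. So \<open>(X, Y)\<close> lies in the closure of the graph, and
  the adjoint is contained in the closure; the converse inclusion is symmetry.\<close>

section \<open>Smooth functions and cutoffs\<close>

text \<open>The growth of \<open>V\<close> dictates the order of the choices. In the unfolded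
  picture \<open>V\<close> is bounded below by the constant -|C0| at all times, but its upper bound
  on a window grows with the window, and its current part is only controlled cell by cell and may
  jump at multiples of \<open>ell\<close>. Hence the cutoff radius is fixed first, from constants
  that see \<open>V\<close> only through the lower bound; the accuracy of the smooth approximation
  is chosen afterwards, against the local upper bound. The possible jumps are the reason for
  approximating \<open>X\<close> together with its weak second derivative, rather than asking for
  classical regularity. A second obstacle is that one finite block has to serve all cells of the
  line at once, although the kinetic energy changes from cell to cell. The combination kin - Q(Q -
  2)/4, with Q the axial charge, is both conserved by the currents and invariant under \<Gamma>, and
  it reduces to the kinetic energy at axial charge 0. Truncating the kinetic energy of the labels of
  axial charge 0 therefore cuts out a finite set that the operator preserves in every cell.\<close>

primrec Ck :: "nat \<Rightarrow> (real \<Rightarrow> complex) \<Rightarrow> bool" where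
  "Ck 0 f = True"
| "Ck (Suc n) f = ((\<forall>x. f differentiable (at x)) \<and> Ck n (cderiv f))"

text \<open>Closure under products and affine substitution calls for an induction that strips one
  derivative at a time while the function varies. \<open>Ck\<close> is the recursive form suited to
  it; the two agree because the derivative commutes with its own iterates.\<close>

lemma csmooth_iff_Ck: "csmooth f \<longleftrightarrow> (\<forall>n. Ck n f)"
proof -
  have *: "(\<forall>j<n. \<forall>x. (cderiv ^^ j) f differentiable (at x)) \<longleftrightarrow> Ck n f" for n f
  proof (induction n arbitrary: f)
    case (Suc n)
    have "(\<forall>j<Suc n. \<forall>x. (cderiv ^^ j) f differentiable (at x)) \<longleftrightarrow>
      (\<forall>x. f differentiable (at x)) \<and> (\<forall>j<n. \<forall>x. (cderiv ^^ (Suc j)) f differentiable (at x))"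
      unfolding less_Suc_eq_0_disj by (force simp del: funpow.simps simp: funpow_0)
    also have "\<dots> \<longleftrightarrow> Ck (Suc n) f"
      by (simp add: Suc.IH[symmetric] funpow_swap1)
    finally show ?case .
  qed simp
  show ?thesis
    unfolding csmooth_def *[symmetric] by auto
qed

lemma cderiv_eqI: "(\<And>x. (f has_vector_derivative f' x) (at x)) \<Longrightarrow> cderiv f = f'"
  by (auto simp: cderiv_def fun_eq_iff intro: vector_derivative_at)

lemma Ck_SucI: "(\<And>x. (f has_vector_derivative f' x) (at x)) \<Longrightarrow> Ck n f' \<Longrightarrow> Ck (Suc n) f"
  using cderiv_eqI[of f f'] by (auto intro: differentiableI_vector)

lemma Ck_Suc_deriv: "Ck (Suc n) f \<Longrightarrow> (f has_vector_derivative cderiv f x) (at x)"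
  by (simp add: cderiv_def vector_derivative_works)

lemma Ck_mono: "Ck (Suc n) f \<Longrightarrow> Ck n f"
  by (induction n arbitrary: f) auto

lemma Ck_const: "Ck n (\<lambda>x. c)"
proof (induction n arbitrary: c)
  case (Suc n)
  show ?case by (rule Ck_SucI[where f'="\<lambda>_. 0"]) (auto simp: Suc)
qed simp

lemma Ck_add: "Ck n f \<Longrightarrow> Ck n g \<Longrightarrow> Ck n (\<lambda>x. f x + g x)"
proof (induction n arbitrary: f g)
  case (Suc n)
  show ?case
    by (rule Ck_SucI[where f'="\<lambda>x. cderiv f x + cderiv g x"])
       (use Suc in \<open>auto intro!: has_vector_derivative_add Ck_Suc_deriv simp del: Ck.simps(2)\<close>, use Suc in auto)
qed simp

lemma Ck_mult: "Ck n f \<Longrightarrow> Ck n g \<Longrightarrow> Ck n (\<lambda>x. f x * g x)"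
proof (induction n arbitrary: f g)
  case (Suc n)
  have "((\<lambda>x. f x * g x) has_vector_derivative f x * cderiv g x + cderiv f x * g x) (at x)" for x
    using has_vector_derivative_mult[OF Ck_Suc_deriv[OF Suc.prems(1)] Ck_Suc_deriv[OF Suc.prems(2)]] .
  moreover have "Ck n (\<lambda>x. f x * cderiv g x + cderiv f x * g x)"
    using Suc.prems Ck_mono[OF Suc.prems(1)] Ck_mono[OF Suc.prems(2)]
    by (intro Ck_add Suc.IH) auto
  ultimately show ?case by (rule Ck_SucI)
qed simp

lemma Ck_affine: "Ck n f \<Longrightarrow> Ck n (\<lambda>x. f (a * x + b))"
proof (induction n arbitrary: f)
  case (Suc n)
  have "((\<lambda>x. f (a * x + b)) has_vector_derivative a *\<^sub>R cderiv f (a * x + b)) (at x)" for x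
  proof -
    have "((\<lambda>x. a * x + b) has_vector_derivative a) (at x)"
      by (auto intro!: derivative_eq_intros simp: has_vector_derivative_def)
    from vector_diff_chain_at[OF this Ck_Suc_deriv[OF Suc.prems]] show ?thesis
      by (simp add: o_def)
  qed
  moreover have "Ck n (\<lambda>x. a *\<^sub>R cderiv f (a * x + b))"
    unfolding scaleR_conv_of_real using Suc by (intro Ck_mult Ck_const) auto
  ultimately show ?case by (rule Ck_SucI)
qed simp

lemma csmoothI: "(\<And>x. (f has_vector_derivative f' x) (at x)) \<Longrightarrow> csmooth f' \<Longrightarrow> csmooth f"
  unfolding csmooth_iff_Ck
proof
  fix n
  assume "\<And>x. (f has_vector_derivative f' x) (at x)" "\<forall>n. Ck n f'"
  then show "Ck n f" using Ck_SucI[of f f'] by (cases n) (auto simp del: Ck.simps(2))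
qed

lemma csmooth_const [simp, intro]: "csmooth (\<lambda>x. c)"
  by (simp add: csmooth_iff_Ck Ck_const)

lemma csmooth_add [intro]: "csmooth f \<Longrightarrow> csmooth g \<Longrightarrow> csmooth (\<lambda>x. f x + g x)"
  by (simp add: csmooth_iff_Ck Ck_add)

lemma csmooth_mult [intro]: "csmooth f \<Longrightarrow> csmooth g \<Longrightarrow> csmooth (\<lambda>x. f x * g x)"
  by (simp add: csmooth_iff_Ck Ck_mult)

lemma csmooth_uminus [intro]: "csmooth f \<Longrightarrow> csmooth (\<lambda>x. - f x)"
  using csmooth_mult[of "\<lambda>x. -1" f] by auto

lemma csmooth_diff [intro]: "csmooth f \<Longrightarrow> csmooth g \<Longrightarrow> csmooth (\<lambda>x. f x - g x)"
  using csmooth_add[of f "\<lambda>x. - g x"] by auto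

lemma csmooth_sum [intro]: "(\<And>i. i \<in> I \<Longrightarrow> csmooth (f i)) \<Longrightarrow> csmooth (\<lambda>x. \<Sum>i\<in>I. f i x)"
  by (induction I rule: infinite_finite_induct) auto

lemma csmooth_affine: "csmooth f \<Longrightarrow> csmooth (\<lambda>x. f (a * x + b))"
  by (simp add: csmooth_iff_Ck Ck_affine)

lemma csmooth_shift: "csmooth f \<Longrightarrow> csmooth (\<lambda>x. f (x + b))"
  using csmooth_affine[of f 1 b] by simp

lemma csmooth_deriv: "csmooth f \<Longrightarrow> (f has_vector_derivative cderiv f x) (at x)"
  using Ck_Suc_deriv[of 0 f x] unfolding csmooth_iff_Ck by blast

lemma csmooth_cderiv [intro]: "csmooth f \<Longrightarrow> csmooth (cderiv f)"
  unfolding csmooth_iff_Ck using Ck.simps(2) by blast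

lemma csmooth_cont: "csmooth f \<Longrightarrow> continuous_on S f"
  by (rule continuous_at_imp_continuous_on)
     (auto intro: has_vector_derivative_continuous[OF csmooth_deriv])

lemma cderiv_mult: "csmooth f \<Longrightarrow> csmooth g \<Longrightarrow> cderiv (\<lambda>x. f x * g x) = (\<lambda>x. f x * cderiv g x + cderiv f x * g x)"
  by (intro cderiv_eqI has_vector_derivative_mult csmooth_deriv)

lemma cderiv_add: "csmooth f \<Longrightarrow> csmooth g \<Longrightarrow> cderiv (\<lambda>x. f x + g x) = (\<lambda>x. cderiv f x + cderiv g x)"
  by (intro cderiv_eqI has_vector_derivative_add csmooth_deriv)

lemma cderiv_cmult: "csmooth f \<Longrightarrow> cderiv (\<lambda>x. c * f x) = (\<lambda>x. c * cderiv f x)"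
  by (intro cderiv_eqI has_vector_derivative_mult_right csmooth_deriv)

lemma cderiv_affine: "csmooth f \<Longrightarrow> cderiv (\<lambda>x. f (a * x + b)) = (\<lambda>x. of_real a * cderiv f (a * x + b))"
proof (rule cderiv_eqI)
  fix x assume "csmooth f"
  have "((\<lambda>x. a * x + b) has_vector_derivative a) (at x)"
    by (auto intro!: derivative_eq_intros simp: has_vector_derivative_def)
  from vector_diff_chain_at[OF this csmooth_deriv[OF \<open>csmooth f\<close>]]
  show "((\<lambda>x. f (a * x + b)) has_vector_derivative of_real a * cderiv f (a * x + b)) (at x)"
    by (simp add: o_def scaleR_conv_of_real)
qed

lemma cderiv_shift: "csmooth f \<Longrightarrow> cderiv (\<lambda>x. f (x + b)) = (\<lambda>x. cderiv f (x + b))"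
  using cderiv_affine[of f 1 b] by simp

lemma cderiv_zero_outside:
  assumes "\<And>t. t \<notin> {a..b} \<Longrightarrow> f t = 0" "t \<notin> {a..b}"
  shows "cderiv f t = 0"
proof -
  have o: "open (- {a..b})" "t \<in> - {a..b}" using assms(2) by auto
  have "((\<lambda>x. 0) has_vector_derivative 0) (at t)" by simp
  then have "(f has_vector_derivative 0) (at t)"
    by (rule has_vector_derivative_transform_within_open[OF _ o]) (use assms in auto)
  then show ?thesis by (simp add: cderiv_def vector_derivative_at)
qed

section \<open>Flat functions and primitives\<close>

definition exp_tail :: "nat \<Rightarrow> real \<Rightarrow> complex" where
  "exp_tail k x = (if x > 0 then of_real (exp (- (1/x)) / x ^ k) else 0)"

text \<open>The powers of 1/x make the family closed under differentiation, so that smoothness of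
  all members follows from a single induction.\<close>

lemma exp_tail_deriv:
  "(exp_tail k has_vector_derivative (exp_tail (k + 2) x - of_nat k * exp_tail (k + 1) x)) (at x)"
proof -
  consider "x > 0" | "x < 0" | "x = 0" by linarith
  then show ?thesis
  proof cases
    case 1
    have "((\<lambda>x. exp (- (1/x)) / x ^ k) has_real_derivative
       (exp (- (1/x)) / x ^ (k+2) - of_nat k * (exp (- (1/x)) / x ^ (k+1)))) (at x)"
    proof (cases k)
      case (Suc n)
      have "x ^ k = x * x ^ n" "k - 1 = n" using Suc by auto
      then show ?thesis using 1
        by (auto intro!: derivative_eq_intros simp: field_simps power2_eq_square)
    qed (use 1 in \<open>auto intro!: derivative_eq_intros simp: field_simps power2_eq_square\<close>)
    then have "((\<lambda>x. complex_of_real (exp (- (1/x)) / x ^ k)) has_vector_derivative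
       of_real (exp (- (1/x)) / x ^ (k+2) - of_nat k * (exp (- (1/x)) / x ^ (k+1)))) (at x)"
      by (intro has_vector_derivative_of_real) (simp add: has_real_derivative_iff_has_vector_derivative)
    then have "(exp_tail k has_vector_derivative
       of_real (exp (- (1/x)) / x ^ (k+2) - of_nat k * (exp (- (1/x)) / x ^ (k+1)))) (at x)"
      by (rule has_vector_derivative_transform_within_open[of _ _ _ "{0<..}"]) (use 1 in \<open>auto simp: exp_tail_def\<close>)
    then show ?thesis using 1 by (simp add: exp_tail_def)
  next
    case 2
    have "((\<lambda>x. 0) has_vector_derivative 0) (at x)" by simp
    then have "(exp_tail k has_vector_derivative 0) (at x)"
      by (rule has_vector_derivative_transform_within_open[of _ _ _ "{..<0}"]) (use 2 in \<open>auto simp: exp_tail_def\<close>)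
    then show ?thesis using 2 by (simp add: exp_tail_def)
  next
    case 3
    \<comment> \<open>With y = 1/h the difference quotient at 0 from the right is y^(k+1) exp(-y);
      from the left it vanishes.\<close>
    have "((\<lambda>y::real. y ^ (k+1) / exp y) \<longlongrightarrow> 0) at_top"
      by (rule tendsto_power_div_exp_0)
    from filterlim_compose[OF this filterlim_inverse_at_top_right]
    have lim: "((\<lambda>h::real. inverse h ^ (k+1) / exp (inverse h)) \<longlongrightarrow> 0) (at_right 0)" .
    have "((\<lambda>h. exp_tail k h /\<^sub>R h) \<longlongrightarrow> 0) (at_right 0)"
    proof (rule tendsto_norm_zero_cancel, rule Lim_transform_eventually[OF lim])
      show "\<forall>\<^sub>F h in at_right 0. inverse h ^ (k+1) / exp (inverse h) = norm (exp_tail k h /\<^sub>R h)"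
        by (auto simp: eventually_at_filter exp_tail_def norm_mult norm_divide norm_power exp_minus field_simps
            simp del: of_real_divide of_real_power intro!: always_eventually)
    qed
    moreover have "((\<lambda>h. exp_tail k h /\<^sub>R h) \<longlongrightarrow> 0) (at_left 0)"
      by (rule Lim_transform_eventually[of "\<lambda>_. 0"])
         (auto simp: eventually_at_filter exp_tail_def intro!: always_eventually)
    ultimately have "((\<lambda>h. exp_tail k h /\<^sub>R h) \<longlongrightarrow> 0) (at 0)"
      by (simp add: filterlim_split_at)
    then have "((\<lambda>h. norm (exp_tail k h) / norm h) \<longlongrightarrow> 0) (at 0)"
      using tendsto_norm_zero by (fastforce simp: divide_inverse mult.commute)
    then have "(exp_tail k has_vector_derivative 0) (at 0)"
      by (simp add: has_vector_derivative_def has_derivative_at exp_tail_def[of k 0])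
    then show ?thesis using 3 by (simp add: exp_tail_def)
  qed
qed

lemma csmooth_exp_tail: "csmooth (exp_tail k)"
proof -
  have "Ck n (exp_tail k)" for n
  proof (induction n arbitrary: k)
    case (Suc n)
    have "Ck n (\<lambda>x. exp_tail (k + 2) x + (- of_nat k) * exp_tail (k + 1) x)"
      by (intro Ck_add Ck_mult Ck_const Suc)
    then show ?case by (intro Ck_SucI[OF exp_tail_deriv]) simp
  qed simp
  then show ?thesis by (simp add: csmooth_iff_Ck)
qed

lemma csmooth_antideriv:
  assumes "csmooth f"
  obtains F where "csmooth F" "cderiv F = f" "F a = 0"
proof -
  define F where "F = (\<lambda>u. LBINT y=ereal a..ereal u. f y)"
  have "(F has_vector_derivative f x) (at x)" for x
  proof -
    \<comment> \<open>The fundamental theorem gives a derivative within a compact interval around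
      the base point \<open>a\<close>; the margin of 1 puts \<open>x\<close> in its interior and
      makes the derivative two-sided.\<close>
    define l u where "l = min a x - 1" and "u = max a x + 1"
    have "((\<lambda>u. LBINT y=ereal a..ereal u. f y) has_vector_derivative f x) (at x within {l..u})"
      by (rule interval_integral_FTC2) (auto simp: l_def u_def intro: csmooth_cont assms)
    moreover have "at x within {l..u} = at x"
      by (rule at_within_interior) (auto simp: l_def u_def)
    ultimately show ?thesis by (simp add: F_def)
  qed
  then have "csmooth F" "cderiv F = f"
    using csmoothI assms cderiv_eqI by blast+
  moreover have "F a = 0" by (simp add: F_def)
  ultimately show ?thesis by (rule that)
qed

lemma csmooth_set_integrable: "csmooth f \<Longrightarrow> set_integrable lebesgue {a..b} f"
  using absolutely_integrable_continuous[of a b f] csmooth_cont by auto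

lemma csmooth_measurable: "csmooth f \<Longrightarrow> f \<in> borel_measurable lebesgue"
proof -
  assume "csmooth f"
  then have "f \<in> borel_measurable lborel"
    using borel_measurable_continuous_onI[OF csmooth_cont] by simp
  then show ?thesis by (rule measurable_completion)
qed

lemma csmooth_FTC:
  assumes "csmooth F" "a \<le> b"
  shows "(LINT t:{a..b}|lebesgue. cderiv F t) = F b - F a"
proof -
  have "(cderiv F has_integral F b - F a) {a..b}"
    by (rule fundamental_theorem_of_calculus[OF assms(2)])
       (rule has_vector_derivative_at_within[OF csmooth_deriv[OF assms(1)]])
  then have "integral {a..b} (cderiv F) = F b - F a" by (rule integral_unique)
  moreover have i: "set_integrable lebesgue {a..b} (cderiv F)"
    using assms by (intro csmooth_set_integrable csmooth_cderiv)
  ultimately show ?thesis by (simp only: set_lebesgue_integral_eq_integral(2)[OF i])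
qed

lemma set_integral_mono_set:
  fixes f :: "real \<Rightarrow> real"
  assumes "set_integrable M B f" "A \<in> sets M" "A \<subseteq> B" "\<And>t. t \<in> B \<Longrightarrow> 0 \<le> f t"
  shows "(LINT t:A|M. f t) \<le> (LINT t:B|M. f t)"
  unfolding set_lebesgue_integral_def
  by (rule integral_mono)
     (use assms set_integrable_subset[OF assms(1-3)] in \<open>auto simp: set_integrable_def split: split_indicator\<close>)

lemma csmooth_FTC_bound:
  assumes "csmooth F" "a \<le> b" "b \<le> c"
  shows "cmod (F b - F a) \<le> (LINT t:{a..c}|lebesgue. cmod (cderiv F t))"
proof -
  have i: "set_integrable lebesgue {a..b} (cderiv F)" for a b
    using assms(1) by (intro csmooth_set_integrable) auto
  have "cmod (F b - F a) \<le> (LINT t:{a..b}|lebesgue. cmod (cderiv F t))"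
    unfolding csmooth_FTC[OF assms(1,2), symmetric]
    using set_integral_norm_bound[OF i] by auto
  also have "\<dots> \<le> (LINT t:{a..c}|lebesgue. cmod (cderiv F t))"
    by (rule set_integral_mono_set) (use assms set_integrable_norm[OF i] in auto)
  finally show ?thesis .
qed

lemma cderiv_Reals:
  assumes "csmooth f" "\<And>t. f t \<in> \<real>"
  shows "cderiv f t \<in> \<real>"
proof -
  have "((\<lambda>t. Im (f t)) has_vector_derivative Im (cderiv f t)) (at t)"
    by (intro bounded_linear.has_vector_derivative[OF bounded_linear_Im] csmooth_deriv assms)
  moreover have "(\<lambda>t. Im (f t)) = (\<lambda>t. 0)" using assms(2) by (auto simp: complex_is_Real_iff)
  ultimately have "Im (cderiv f t) = 0"
    using vector_derivative_unique_at[of "\<lambda>t. 0::real" _ t 0] by auto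
  then show ?thesis by (simp add: complex_is_Real_iff)
qed

section \<open>Test functions on a symmetric interval\<close>

definition test_fun :: "real \<Rightarrow> (real \<Rightarrow> complex) \<Rightarrow> bool" where
  "test_fun R \<phi> \<longleftrightarrow> csmooth \<phi> \<and> (\<forall>t. R \<le> \<bar>t\<bar> \<longrightarrow> \<phi> t = 0)"

lemma test_fun_mono: "test_fun R \<phi> \<Longrightarrow> R \<le> R' \<Longrightarrow> test_fun R' \<phi>"
  by (auto simp: test_fun_def)

text \<open>Off the closed interval the function vanishes on an open set. The points |t| = R count
  as zeros too, so that integration by parts over \<open>{-R..R}\<close> leaves no boundary terms;
  there the derivative vanishes by continuity.\<close>

lemma test_fun_cderiv: "test_fun R \<phi> \<Longrightarrow> test_fun R (cderiv \<phi>)"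
  unfolding test_fun_def
proof (intro conjI allI impI)
  assume a: "csmooth \<phi> \<and> (\<forall>t. R \<le> \<bar>t\<bar> \<longrightarrow> \<phi> t = 0)"
  then show "csmooth (cderiv \<phi>)" by auto
  fix t assume "R \<le> \<bar>t\<bar>"
  then consider "R < \<bar>t\<bar>" | "\<bar>t\<bar> = R" by linarith
  then show "cderiv \<phi> t = 0"
  proof cases
    case 1
    then show ?thesis using a by (intro cderiv_zero_outside[of "-R" R]) auto
  next
    case 2
    show ?thesis
    proof (cases "R = 0")
      case True
      then have "\<phi> = (\<lambda>_. 0)" using a by auto
      then show ?thesis by (simp add: cderiv_def)
    next
      case False
      have c: "continuous_on UNIV (cderiv \<phi>)" using a by (auto intro: csmooth_cont)
      have "closed {t. cderiv \<phi> t = 0}"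
        using continuous_closed_vimage[of "{0}" "cderiv \<phi>"] c
        by (auto simp: vimage_def continuous_on_eq_continuous_at)
      moreover have "- {-R..R} \<subseteq> {t. cderiv \<phi> t = 0}"
        using a by (auto intro!: cderiv_zero_outside[of "-R" R])
      ultimately have "closure (- {-R..R}) \<subseteq> {t. cderiv \<phi> t = 0}"
        by (simp add: closure_minimal)
      moreover have "t \<in> closure (- {-R..R})"
      proof -
        have "t \<notin> interior {-R..R}" using 2 by auto
        then show ?thesis by (simp add: closure_complement)
      qed
      ultimately show ?thesis by auto
    qed
  qed
qed

lemma test_fun_antideriv:
  assumes "test_fun R f" "0 < R" "(LINT t:{-R..R}|lebesgue. f t) = 0"
  obtains F where "test_fun R F" "cderiv F = f" "\<And>t. cmod (F t) \<le> (LINT t:{-R..R}|lebesgue. cmod (f t))"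
proof -
  obtain F where F: "csmooth F" "cderiv F = f" "F (-R) = 0"
    using csmooth_antideriv[of f "-R"] assms by (auto simp: test_fun_def)
  have FR: "F R = 0" using csmooth_FTC[OF F(1), of "-R" R] assms F by auto
  have const: "F b = F a" if "a \<le> b" "\<And>t. t \<in> {a..b} \<Longrightarrow> f t = 0" for a b
    using csmooth_FTC[OF F(1) that(1)] that(2) F(2) set_lebesgue_integral_cong[of "{a..b}" lebesgue f "\<lambda>_. 0"]
    by (auto simp: set_lebesgue_integral_def)
  have z: "F t = 0" if "R \<le> \<bar>t\<bar>" for t
  proof (cases "t \<ge> 0")
    case True
    then show ?thesis using const[of R t] FR assms(1,2) that by (auto simp: test_fun_def abs_if)
  next
    case False
    then show ?thesis using const[of t "-R"] F assms(1,2) that by (auto simp: test_fun_def abs_if)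
  qed
  have b: "cmod (F t) \<le> (LINT t:{-R..R}|lebesgue. cmod (f t))" for t
  proof (cases "R \<le> \<bar>t\<bar>")
    case True
    then show ?thesis using z by (auto simp: set_lebesgue_integral_def)
  next
    case False
    then show ?thesis using csmooth_FTC_bound[OF F(1), of "-R" t R] F by auto
  qed
  show ?thesis by (rule that[of F]) (use F z b in \<open>auto simp: test_fun_def\<close>)
qed

lemma test_fun_by_parts:
  assumes "test_fun R \<phi>" "csmooth W" "0 < R"
  shows "(LINT t:{-R..R}|lebesgue. cderiv \<phi> t * W t) = - (LINT t:{-R..R}|lebesgue. \<phi> t * cderiv W t)"
proof -
  have s: "csmooth \<phi>" using assms by (simp add: test_fun_def)
  have "(LINT t:{-R..R}|lebesgue. cderiv (\<lambda>t. \<phi> t * W t) t) = 0"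
    using assms by (subst csmooth_FTC) (auto simp: test_fun_def)
  then have "(LINT t:{-R..R}|lebesgue. \<phi> t * cderiv W t + cderiv \<phi> t * W t) = 0"
    by (simp add: cderiv_mult s assms)
  also have "(LINT t:{-R..R}|lebesgue. \<phi> t * cderiv W t + cderiv \<phi> t * W t) =
    (LINT t:{-R..R}|lebesgue. \<phi> t * cderiv W t) + (LINT t:{-R..R}|lebesgue. cderiv \<phi> t * W t)"
    using s assms by (intro set_integral_add csmooth_set_integrable) auto
  finally show ?thesis by (simp add: add_eq_0_iff)
qed

section \<open>Smooth steps and plateaus\<close>

definition bump0 :: "real \<Rightarrow> complex" where
  "bump0 t = exp_tail 0 (1 + t) * exp_tail 0 (1 - t)"

lemma bump0: "csmooth bump0" "1 \<le> \<bar>t\<bar> \<Longrightarrow> bump0 t = 0" "bump0 t \<in> \<real>" "0 \<le> Re (bump0 t)"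
  "\<bar>t\<bar> < 1 \<Longrightarrow> 0 < Re (bump0 t)"
proof -
  show "csmooth bump0" unfolding bump0_def
    using csmooth_affine[OF csmooth_exp_tail, of 0 1 1] csmooth_affine[OF csmooth_exp_tail, of 0 "-1" 1]
    by (intro csmooth_mult) (auto simp: add.commute)
qed (auto simp: bump0_def exp_tail_def abs_if split: if_splits simp flip: of_real_mult)

text \<open>The step is the primitive of \<open>bump0\<close> from -1, divided by its total mass
  \<open>r 1\<close>; since the primitive is monotone, the values stay between 0 and 1.\<close>

lemma smooth_step:
  obtains S where "csmooth S" "\<And>t. t \<le> -1 \<Longrightarrow> S t = 0" "\<And>t. 1 \<le> t \<Longrightarrow> S t = 1" "\<And>t. S t \<in> \<real>"
    "\<And>t. cmod (S t) \<le> 1"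
proof -
  obtain F where F: "csmooth F" "cderiv F = bump0" "F (-1) = 0"
    using csmooth_antideriv[OF bump0(1)] by metis
  define r where "r = (\<lambda>t. Re (F t))"
  have dr: "(r has_real_derivative Re (bump0 t)) (at t)" for t
    using bounded_linear.has_vector_derivative[OF bounded_linear_Re csmooth_deriv[OF F(1), of t]] F(2)
    by (simp add: r_def has_real_derivative_iff_has_vector_derivative)
  have mono: "r s \<le> r t" if "s \<le> t" for s t
    using DERIV_nonneg_imp_nondecreasing[OF that, of r] dr bump0(4) by blast
  have im: "Im (F t) = 0" for t
  proof -
    have "((\<lambda>t. Im (F t)) has_real_derivative 0) (at t)" for t
      using bounded_linear.has_vector_derivative[OF bounded_linear_Im csmooth_deriv[OF F(1), of t]] F(2) bump0(3)[of t]
      by (simp add: has_real_derivative_iff_has_vector_derivative complex_is_Real_iff)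
    then have "Im (F t) = Im (F (-1))" by (metis DERIV_isconst_all)
    then show ?thesis using F by simp
  qed
  \<comment> \<open>Strict growth is taken on [-1/2, 1/2], where \<open>bump0\<close> is positive,
    and extended by weak monotonicity to the ends, where it vanishes.\<close>
  have "r (-1) < r 1"
  proof -
    have "r (-1) \<le> r (-1/2)" "r (1/2) \<le> r 1" by (auto intro: mono)
    moreover have "r (-1/2) < r (1/2)"
      by (rule DERIV_pos_imp_increasing[of "-1/2"]) (use dr bump0(5) in \<open>auto intro!: exI\<close>)
    ultimately show ?thesis by linarith
  qed
  then have r1: "0 < r 1" using F by (simp add: r_def)
  have c1: "r t = r 1" if "1 \<le> t" for t
  proof (rule ccontr)
    assume "r t \<noteq> r 1"
    then have "1 < t" using that by (cases "t = 1") auto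
    then obtain z where "z > 1" "r t - r 1 = (t - 1) * Re (bump0 z)"
      using MVT2[of 1 t r "\<lambda>z. Re (bump0 z)"] dr by auto
    then show False using bump0(2)[of z] \<open>r t \<noteq> r 1\<close> by auto
  qed
  have c2: "r t = 0" if "t \<le> -1" for t
  proof (rule ccontr)
    assume "r t \<noteq> 0"
    then have "t < -1" using that F by (cases "t = -1") (auto simp: r_def)
    then obtain z where "z < -1" "r (-1) - r t = (-1 - t) * Re (bump0 z)"
      using MVT2[of t "-1" r "\<lambda>z. Re (bump0 z)"] dr by auto
    then show False using bump0(2)[of z] \<open>r t \<noteq> 0\<close> F by (auto simp: r_def)
  qed
  have Fr: "F t = of_real (r t)" for t using im by (simp add: complex_eq_iff r_def)
  show ?thesis
  proof (rule that[of "\<lambda>t. of_real (1 / r 1) * F t"])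
    show "csmooth (\<lambda>t. of_real (1 / r 1) * F t)" by (intro csmooth_mult csmooth_const F)
    show "cmod (of_real (1 / r 1) * F t) \<le> 1" for t
    proof -
      have "0 \<le> r t" "r t \<le> r 1"
        using mono[of "-1" t] c2[of "-1"] c2[of t] mono[of t 1] c1[of t] r1 by (cases "t \<le> -1"; cases "t \<ge> 1"; auto)+
      then show ?thesis using r1 by (simp add: Fr norm_divide field_simps)
    qed
    show "of_real (1 / r 1) * F t = 0" if "t \<le> -1" for t using c2[OF that] by (simp add: Fr)
    show "of_real (1 / r 1) * F t = 1" if "1 \<le> t" for t using c1[OF that] r1 by (simp add: Fr del: of_real_divide flip: of_real_mult)
    show "of_real (1 / r 1) * F t \<in> \<real>" for t by (simp add: Fr)
  qed
qed

lemma smooth_plateau: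
  assumes "a < b" "b \<le> c" "c < d"
  obtains S where "csmooth S" "\<And>t. t \<le> a \<Longrightarrow> S t = 0" "\<And>t. d \<le> t \<Longrightarrow> S t = 0"
    "\<And>t. t \<in> {b..c} \<Longrightarrow> S t = 1" "\<And>t. S t \<in> \<real>" "\<And>t. cmod (S t) \<le> 1"
proof -
  obtain S where S: "csmooth S" "\<And>t. t \<le> -1 \<Longrightarrow> S t = 0" "\<And>t. 1 \<le> t \<Longrightarrow> S t = 1" "\<And>t. S t \<in> \<real>"
    "\<And>t. cmod (S t) \<le> 1" using smooth_step by blast
  \<comment> \<open>The slopes are chosen so that the first argument runs from -1 to 1 over [a, b]
    and the second from 1 to -1 over [c, d]; the product of a rising and a falling step is the
    plateau.\<close>
  define p q where "p = 2 / (b - a)" and "q = 2 / (d - c)"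
  have *: "2 / x * x = 2" if "x \<noteq> 0" for x :: real using that by simp
  have pq: "p > 0" "q > 0" "p * (b - a) = 2" "q * (d - c) = 2" using assms *[of "b - a"] *[of "d - c"] by (simp_all add: p_def q_def)
  let ?f = "\<lambda>t. S (p * t + (- p * a - 1))" and ?g = "\<lambda>t. S ((- q) * t + (q * d - 1))"
  show ?thesis
  proof (rule that[of "\<lambda>t. ?f t * ?g t"])
    show "csmooth (\<lambda>t. ?f t * ?g t)" by (intro csmooth_mult csmooth_affine S)
    show "?f t * ?g t = 0" if "t \<le> a" for t
    proof -
      have "p * t \<le> p * a" using that pq by simp
      then show ?thesis using S(2)[of "p * t + (- p * a - 1)"] by simp
    qed
    show "?f t * ?g t = 0" if "d \<le> t" for t
    proof -
      have "q * d \<le> q * t" using that pq by simp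
      then show ?thesis using S(2)[of "(- q) * t + (q * d - 1)"] by simp
    qed
    show "?f t * ?g t = 1" if "t \<in> {b..c}" for t
    proof -
      have "p * b \<le> p * t" "q * t \<le> q * c" using that pq by simp_all
      moreover have "p * b - p * a = 2" "q * d - q * c = 2" using pq by (auto simp: algebra_simps)
      ultimately have "1 \<le> p * t + (- p * a - 1)" "1 \<le> (- q) * t + (q * d - 1)" by (auto simp: algebra_simps)
      then show ?thesis using S(3) by simp
    qed
    show "?f t * ?g t \<in> \<real>" for t using S(4) by auto
    show "cmod (?f t * ?g t) \<le> 1" for t unfolding norm_mult using S(5) by (intro mult_le_one) auto
  qed
qed

section \<open>Square-integrable functions on the line\<close>

definition n2 :: "real set \<Rightarrow> (real \<Rightarrow> complex) \<Rightarrow> ennreal" where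
  "n2 S f = (\<integral>\<^sup>+t\<in>S. ennreal ((cmod (f t))\<^sup>2) \<partial>lebesgue)"

text \<open>Measurability is asked for on the whole line and only the integral is restricted to
  \<open>S\<close>, so that passing between sets is purely a matter of the norm.\<close>

definition L2 :: "real set \<Rightarrow> (real \<Rightarrow> complex) \<Rightarrow> bool" where
  "L2 S f \<longleftrightarrow> f \<in> borel_measurable lebesgue \<and> n2 S f < \<infinity>"

definition r2 :: "real set \<Rightarrow> (real \<Rightarrow> complex) \<Rightarrow> real" where
  "r2 S f = enn2real (n2 S f)"

lemma L2_meas: "L2 S f \<Longrightarrow> f \<in> borel_measurable lebesgue"
  by (simp add: L2_def)

lemma L2_n2: "L2 S f \<Longrightarrow> n2 S f = ennreal (r2 S f)"
  by (simp add: L2_def r2_def)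

lemma r2_nonneg [simp]: "0 \<le> r2 S f"
  by (simp add: r2_def)

lemma r2_less_iff: "L2 S f \<Longrightarrow> n2 S f < ennreal \<epsilon> \<longleftrightarrow> r2 S f < \<epsilon>"
  by (auto simp: L2_n2 ennreal_less_iff)

lemma n2_cong: "(\<And>t. t \<in> S \<Longrightarrow> cmod (f t) = cmod (g t)) \<Longrightarrow> n2 S f = n2 S g"
  unfolding n2_def by (intro nn_integral_cong) (auto split: split_indicator)

lemma n2_mono_set: "S \<subseteq> T \<Longrightarrow> n2 S f \<le> n2 T f"
  unfolding n2_def by (intro nn_integral_mono) (auto split: split_indicator)

lemma L2_mono_set: "L2 T f \<Longrightarrow> S \<subseteq> T \<Longrightarrow> L2 S f"
  unfolding L2_def using n2_mono_set order_le_less_trans by blast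

lemma r2_mono_set: "L2 T f \<Longrightarrow> S \<subseteq> T \<Longrightarrow> r2 S f \<le> r2 T f"
  unfolding r2_def L2_def by (intro enn2real_mono n2_mono_set) (auto simp: less_top)

text \<open>Norms stay squared throughout, and this inequality takes the place of the triangle
  inequality. The extra factors of 2 are harmless because they only multiply finitely many
  terms.\<close>

lemma sum_sq2: "(cmod (x + y))\<^sup>2 \<le> 2 * (cmod x)\<^sup>2 + 2 * (cmod y)\<^sup>2"
proof -
  have "(cmod (x + y))\<^sup>2 \<le> (cmod x + cmod y)\<^sup>2" by (intro power_mono norm_triangle_ineq) auto
  also have "\<dots> \<le> 2 * (cmod x)\<^sup>2 + 2 * (cmod y)\<^sup>2"
    using zero_le_power2[of "cmod x - cmod y"] by (simp add: power2_eq_square algebra_simps)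
  finally show ?thesis .
qed

lemma n2_add:
  assumes [measurable]: "f \<in> borel_measurable lebesgue" "g \<in> borel_measurable lebesgue" "S \<in> sets lebesgue"
  shows "n2 S (\<lambda>t. f t + g t) \<le> 2 * n2 S f + 2 * n2 S g"
proof -
  have "n2 S (\<lambda>t. f t + g t) \<le> (\<integral>\<^sup>+t. 2 * (ennreal ((cmod (f t))\<^sup>2) * indicator S t)
      + 2 * (ennreal ((cmod (g t))\<^sup>2) * indicator S t) \<partial>lebesgue)"
    unfolding n2_def
    by (intro nn_integral_mono)
       (auto split: split_indicator intro!: order_trans[OF ennreal_leI[OF sum_sq2]] simp: ennreal_plus ennreal_mult)
  also have "\<dots> = 2 * n2 S f + 2 * n2 S g"
    unfolding n2_def by (subst nn_integral_add) (auto simp: nn_integral_cmult)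
  finally show ?thesis .
qed

lemma L2_add: "L2 S f \<Longrightarrow> L2 S g \<Longrightarrow> S \<in> sets lebesgue \<Longrightarrow> L2 S (\<lambda>t. f t + g t)"
  unfolding L2_def
  by (auto intro!: le_less_trans[OF n2_add] simp: ennreal_mult_less_top less_top)

lemma r2_add: "L2 S f \<Longrightarrow> L2 S g \<Longrightarrow> S \<in> sets lebesgue \<Longrightarrow> r2 S (\<lambda>t. f t + g t) \<le> 2 * r2 S f + 2 * r2 S g"
  using n2_add[of f g S] L2_add[of S f g] by (simp add: L2_n2 L2_meas ennreal_plus[symmetric] ennreal_mult'[symmetric] del: ennreal_plus flip: ennreal_numeral)

lemma n2_mult_le:
  assumes "\<And>t. t \<in> S \<Longrightarrow> cmod (b t) \<le> M" "0 \<le> M"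
    and [measurable]: "f \<in> borel_measurable lebesgue" "S \<in> sets lebesgue"
  shows "n2 S (\<lambda>t. b t * f t) \<le> ennreal (M\<^sup>2) * n2 S f"
proof -
  have "n2 S (\<lambda>t. b t * f t) \<le> (\<integral>\<^sup>+t. ennreal (M\<^sup>2) * (ennreal ((cmod (f t))\<^sup>2) * indicator S t) \<partial>lebesgue)"
    unfolding n2_def
    by (intro nn_integral_mono)
       (use assms(1,2) in \<open>auto split: split_indicator intro!: ennreal_leI mult_right_mono power_mono
         simp: norm_mult power_mult_distrib simp flip: ennreal_mult'\<close>)
  also have "\<dots> = ennreal (M\<^sup>2) * n2 S f"
    unfolding n2_def by (rule nn_integral_cmult) measurable
  finally show ?thesis .
qed

lemma L2_mult:
  assumes "L2 S f" "\<And>t. t \<in> S \<Longrightarrow> cmod (b t) \<le> M" "0 \<le> M" "b \<in> borel_measurable lebesgue" "S \<in> sets lebesgue"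
  shows "L2 S (\<lambda>t. b t * f t)" "r2 S (\<lambda>t. b t * f t) \<le> M\<^sup>2 * r2 S f"
proof -
  have le: "n2 S (\<lambda>t. b t * f t) \<le> ennreal (M\<^sup>2 * r2 S f)"
    using n2_mult_le[of S b M f] assms L2_n2[OF assms(1)] by (simp add: L2_meas ennreal_mult')
  then show *: "L2 S (\<lambda>t. b t * f t)"
    using assms L2_meas[OF assms(1)] by (auto simp: L2_def intro: le_less_trans)
  then show "r2 S (\<lambda>t. b t * f t) \<le> M\<^sup>2 * r2 S f"
    using le by (simp add: L2_n2)
qed

lemma L2_cmult: "L2 S f \<Longrightarrow> S \<in> sets lebesgue \<Longrightarrow> L2 S (\<lambda>t. c * f t)"
  using L2_mult(1)[of S f "\<lambda>_. c" "cmod c"] by auto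

lemma r2_cmult: "L2 S f \<Longrightarrow> S \<in> sets lebesgue \<Longrightarrow> r2 S (\<lambda>t. c * f t) \<le> (cmod c)\<^sup>2 * r2 S f"
  using L2_mult(2)[of S f "\<lambda>_. c" "cmod c"] by auto

lemma n2_uminus: "n2 S (\<lambda>t. - f t) = n2 S f"
  by (simp add: n2_def)

lemma n2_minus_commute: "n2 S (\<lambda>t. f t - g t) = n2 S (\<lambda>t. g t - f t)"
  by (simp add: n2_def norm_minus_commute)

lemma L2_uminus: "L2 S f \<Longrightarrow> L2 S (\<lambda>t. - f t)"
  by (simp add: L2_def n2_uminus)

lemma L2_diff: "L2 S f \<Longrightarrow> L2 S g \<Longrightarrow> S \<in> sets lebesgue \<Longrightarrow> L2 S (\<lambda>t. f t - g t)"
  using L2_add[of S f "\<lambda>t. - g t"] L2_uminus by auto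

lemma r2_diff: "L2 S f \<Longrightarrow> L2 S g \<Longrightarrow> S \<in> sets lebesgue \<Longrightarrow> r2 S (\<lambda>t. f t - g t) \<le> 2 * r2 S f + 2 * r2 S g"
  using r2_add[of S f "\<lambda>t. - g t"] L2_uminus by (auto simp: r2_def n2_uminus)

lemma L2_sum: "(\<And>i. i \<in> I \<Longrightarrow> L2 S (f i)) \<Longrightarrow> S \<in> sets lebesgue \<Longrightarrow> L2 S (\<lambda>t. \<Sum>i\<in>I. f i t)"
proof (induction I rule: infinite_finite_induct)
  case (insert x F)
  then show ?case using L2_add[of S "f x" "\<lambda>t. \<Sum>i\<in>F. f i t"] by auto
qed (simp_all add: L2_def n2_def)

lemma cnj_measurable: "f \<in> borel_measurable M \<Longrightarrow> (\<lambda>t. cnj (f t)) \<in> borel_measurable M"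
  by (rule measurable_compose[where g=cnj, OF _ borel_measurable_continuous_onI])
     (auto intro: continuous_intros)

lemma L2_cnj: "L2 S f \<Longrightarrow> L2 S (\<lambda>t. cnj (f t))" "r2 S (\<lambda>t. cnj (f t)) = r2 S f"
  by (simp_all add: L2_def n2_def r2_def cnj_measurable)

lemma L2_bounded:
  assumes "f \<in> borel_measurable lebesgue" "\<And>t. t \<in> {a..b} \<Longrightarrow> cmod (f t) \<le> M" "a \<le> b"
  shows "L2 {a..b} f" "r2 {a..b} f \<le> M\<^sup>2 * (b - a)"
proof -
  have "cmod (f a) \<le> M" using assms(2)[of a] assms(3) by simp
  then have M: "0 \<le> M" by (rule order_trans[OF norm_ge_zero])
  have "n2 {a..b} f \<le> (\<integral>\<^sup>+t. ennreal (M\<^sup>2) * indicator {a..b} t \<partial>lebesgue)"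
    unfolding n2_def using assms(2) by (intro nn_integral_mono) (auto split: split_indicator intro!: ennreal_leI power_mono)
  also have "\<dots> = ennreal (M\<^sup>2 * (b - a))"
    using assms(3) M by (simp add: nn_integral_cmult_indicator ennreal_mult')
  finally have le: "n2 {a..b} f \<le> ennreal (M\<^sup>2 * (b - a))" .
  then show "L2 {a..b} f" using assms(1) by (auto simp: L2_def intro: le_less_trans)
  then show "r2 {a..b} f \<le> M\<^sup>2 * (b - a)" using le assms(3) by (simp add: L2_n2)
qed

lemma cont_bounded:
  fixes f :: "real \<Rightarrow> complex"
  assumes "continuous_on {a..b} f"
  obtains M where "0 < M" "\<And>t. t \<in> {a..b} \<Longrightarrow> cmod (f t) \<le> M"
proof -
  have "bounded (f ` {a..b})" using assms by (intro compact_imp_bounded compact_continuous_image) auto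
  then show ?thesis using that by (auto simp: bounded_pos)
qed

lemma L2_csmooth: "csmooth f \<Longrightarrow> L2 {a..b} f"
proof (cases "a \<le> b")
  case True
  assume f: "csmooth f"
  obtain M where "\<And>t. t \<in> {a..b} \<Longrightarrow> cmod (f t) \<le> M" using cont_bounded[OF csmooth_cont[OF f]] by metis
  then show ?thesis using L2_bounded True csmooth_measurable[OF f] by blast
qed (auto simp: L2_def n2_def csmooth_measurable)

lemma L2_set_integrable:
  assumes "L2 S f" "S \<in> sets lebesgue"
  shows "set_integrable lebesgue S (\<lambda>t. (cmod (f t))\<^sup>2)" "r2 S f = (LINT t:S|lebesgue. (cmod (f t))\<^sup>2)"
proof -
  have [measurable]: "f \<in> borel_measurable lebesgue" "S \<in> sets lebesgue" using assms by (auto simp: L2_def)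
  have eq: "n2 S f = (\<integral>\<^sup>+t. ennreal (indicator S t *\<^sub>R (cmod (f t))\<^sup>2) \<partial>lebesgue)"
    unfolding n2_def by (intro nn_integral_cong) (auto split: split_indicator)
  then show "set_integrable lebesgue S (\<lambda>t. (cmod (f t))\<^sup>2)"
    using assms unfolding set_integrable_def L2_def
    by (intro integrableI_nonneg) (auto simp: split: split_indicator)
  show "r2 S f = (LINT t:S|lebesgue. (cmod (f t))\<^sup>2)"
    unfolding set_lebesgue_integral_def r2_def eq
    by (rule integral_eq_nn_integral[symmetric]) (auto split: split_indicator)
qed

text \<open>Cauchy-Schwarz for nonnegative integrals is applied to the moduli: finiteness of its
  right-hand side yields integrability of the product, and the bound for the integral itself follows
  from the one for the modulus.\<close>

lemma L2_CS:
  assumes "L2 S f" "L2 S g" "S \<in> sets lebesgue"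
  shows "set_integrable lebesgue S (\<lambda>t. f t * g t)"
    "(LINT t:S|lebesgue. cmod (f t * g t))\<^sup>2 \<le> r2 S f * r2 S g"
    "(cmod (LINT t:S|lebesgue. f t * g t))\<^sup>2 \<le> r2 S f * r2 S g"
proof -
  have [measurable]: "f \<in> borel_measurable lebesgue" "g \<in> borel_measurable lebesgue" "S \<in> sets lebesgue"
    using assms by (auto simp: L2_def)
  let ?F = "\<lambda>t. ennreal (cmod (f t)) * indicator S t" and ?G = "\<lambda>t. ennreal (cmod (g t)) * indicator S t"
  have "(\<integral>\<^sup>+t. ?F t * ?G t \<partial>lebesgue)\<^sup>2 \<le> (\<integral>\<^sup>+t. (?F t)^2 \<partial>lebesgue) * (\<integral>\<^sup>+t. (?G t)^2 \<partial>lebesgue)"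
    by (rule Cauchy_Schwarz_nn_integral) measurable
  also have "(\<integral>\<^sup>+t. (?F t)^2 \<partial>lebesgue) = n2 S f"
    unfolding n2_def by (intro nn_integral_cong) (auto split: split_indicator simp: ennreal_power)
  also have "(\<integral>\<^sup>+t. (?G t)^2 \<partial>lebesgue) = n2 S g"
    unfolding n2_def by (intro nn_integral_cong) (auto split: split_indicator simp: ennreal_power)
  also have "(\<integral>\<^sup>+t. ?F t * ?G t \<partial>lebesgue) = (\<integral>\<^sup>+t. ennreal (norm (indicator S t *\<^sub>R (f t * g t))) \<partial>lebesgue)"
    by (intro nn_integral_cong) (auto split: split_indicator simp: norm_mult ennreal_mult)
  finally have le: "(\<integral>\<^sup>+t. ennreal (norm (indicator S t *\<^sub>R (f t * g t))) \<partial>lebesgue)\<^sup>2 \<le> ennreal (r2 S f * r2 S g)"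
    using assms by (simp add: L2_n2 ennreal_mult')
  then have "(\<integral>\<^sup>+t. ennreal (norm (indicator S t *\<^sub>R (f t * g t))) \<partial>lebesgue) < \<infinity>"
    by (metis ennreal_less_top infinity_ennreal_def le_less_trans power_less_top_ennreal pos2 gr0_conv_Suc power_eq_0_iff less_top top_neq_ennreal ennreal_top_eq_mult_iff power2_eq_square not_less)
  then show int: "set_integrable lebesgue S (\<lambda>t. f t * g t)"
    unfolding set_integrable_def by (intro integrableI_bounded) auto
  have "(\<integral>\<^sup>+t. ennreal (norm (indicator S t *\<^sub>R (f t * g t))) \<partial>lebesgue) = ennreal (LINT t|lebesgue. norm (indicator S t *\<^sub>R (f t * g t)))"
    using int unfolding set_integrable_def by (intro nn_integral_eq_integral integrable_norm) auto
  then show 2: "(LINT t:S|lebesgue. cmod (f t * g t))\<^sup>2 \<le> r2 S f * r2 S g"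
    using le unfolding set_lebesgue_integral_def
    by (simp add: ennreal_power)
  have "cmod (LINT t:S|lebesgue. f t * g t) \<le> (LINT t:S|lebesgue. cmod (f t * g t))"
    by (rule set_integral_norm_bound[OF int])
  then have "(cmod (LINT t:S|lebesgue. f t * g t))\<^sup>2 \<le> (LINT t:S|lebesgue. cmod (f t * g t))\<^sup>2"
    by (intro power_mono) auto
  with 2 show "(cmod (LINT t:S|lebesgue. f t * g t))\<^sup>2 \<le> r2 S f * r2 S g" by linarith
qed

section \<open>Density of smooth functions and of test functions\<close>

lemma csmooth_polynomial: "polynomial_function (p :: real \<Rightarrow> complex) \<Longrightarrow> csmooth p"
proof -
  have "polynomial_function p \<Longrightarrow> Ck n p" for n and p :: "real \<Rightarrow> complex"
  proof (induction n arbitrary: p)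
    case (Suc n)
    obtain p' where "polynomial_function p'" "\<And>x. (p has_vector_derivative p' x) (at x)"
      using has_vector_derivative_polynomial_function[OF Suc.prems] by metis
    then show ?case using Suc.IH Ck_SucI by blast
  qed simp
  then show "polynomial_function p \<Longrightarrow> csmooth p" by (simp add: csmooth_iff_Ck)
qed

text \<open>Three approximations are chained: truncation of the values at modulus n, continuous
  functions converging almost everywhere to the truncation, and polynomials by Weierstrass. The
  errors \<epsilon>/8, \<epsilon>/16 and \<epsilon>/32 still add up to less than \<epsilon> after
  two applications of the factor 2.\<close>

lemma L2_approx_csmooth:
  assumes "L2 {-R..R} f" "0 < \<epsilon>" "0 < R"
  obtains p where "csmooth p" "r2 {-R..R} (\<lambda>t. f t - p t) < \<epsilon>"
proof -
  let ?I = "{-R..R}"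
  have f [measurable]: "f \<in> borel_measurable lebesgue" and fi: "n2 ?I f < \<infinity>" using assms by (auto simp: L2_def)
  have [measurable]: "?I \<in> sets lebesgue" by simp
  define f0 where "f0 = (\<lambda>(n::nat) t. if cmod (f t) \<le> real n then f t else 0)"
  have f0m [measurable]: "f0 n \<in> borel_measurable lebesgue" for n unfolding f0_def by measurable
  have lim1: "(\<lambda>n. n2 ?I (\<lambda>t. f t - f0 n t)) \<longlonglongrightarrow> (\<integral>\<^sup>+(t::real). 0 \<partial>lebesgue)"
    unfolding n2_def
  proof (rule nn_integral_dominated_convergence[where w="\<lambda>t. ennreal ((cmod (f t))\<^sup>2) * indicator ?I t"])
    show "AE t in lebesgue. (\<lambda>n. ennreal ((cmod (f t - f0 n t))\<^sup>2) * indicator ?I t) \<longlonglongrightarrow> 0"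
    proof (rule AE_I2)
      fix t
      obtain k :: nat where "cmod (f t) \<le> real k" using real_arch_simple by blast
      then have "\<forall>n\<ge>k. ennreal ((cmod (f t - f0 n t))\<^sup>2) * indicator ?I t = 0" by (auto simp: f0_def)
      then have "\<forall>\<^sub>F n in sequentially. ennreal ((cmod (f t - f0 n t))\<^sup>2) * indicator ?I t = 0"
        by (auto simp: eventually_sequentially)
      then show "(\<lambda>n. ennreal ((cmod (f t - f0 n t))\<^sup>2) * indicator ?I t) \<longlonglongrightarrow> 0"
        by (rule tendsto_eventually)
    qed
    show "(\<lambda>t. ennreal ((cmod (f t - f0 n t))\<^sup>2) * indicator ?I t) \<in> borel_measurable lebesgue" for n
      by measurable
    show "(\<lambda>t. ennreal ((cmod (f t))\<^sup>2) * indicator ?I t) \<in> borel_measurable lebesgue" by measurable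
    show "AE t in lebesgue. ennreal ((cmod (f t - f0 n t))\<^sup>2) * indicator ?I t
      \<le> ennreal ((cmod (f t))\<^sup>2) * indicator ?I t" for n
      by (rule AE_I2) (auto simp: f0_def split: split_indicator)
  qed (use fi in \<open>simp_all add: n2_def\<close>)
  then have "\<forall>\<^sub>F n in sequentially. n2 ?I (\<lambda>t. f t - f0 n t) < ennreal (\<epsilon> / 8)"
    using assms(2) by (intro order_tendstoD) auto
  then obtain n where n: "n2 ?I (\<lambda>t. f t - f0 n t) < ennreal (\<epsilon> / 8)"
    by (auto simp: eventually_sequentially)
  obtain g N where g: "negligible N" "\<And>k. continuous_on UNIV (g k)" "\<And>t. t \<notin> N \<Longrightarrow> (\<lambda>k. g (k::nat) t) \<longlonglongrightarrow> f0 n t"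
    using lebesgue_measurable_imp_measurable_on[of "f0 n" UNIV] by (auto simp: measurable_on_def)
  \<comment> \<open>Projecting the continuous approximants onto the closed disc of radius n keeps
    continuity and, as \<open>f0 n\<close> takes its values in the disc, also the limit. It supplies
    the constant majorant for dominated convergence.\<close>
  define h where "h = (\<lambda>k t. closest_point (cball 0 (real n)) (g k t))"
  have cc: "continuous_on UNIV (closest_point (cball (0::complex) (real n)))"
    by (rule continuous_on_closest_point) auto
  have hc: "continuous_on UNIV (h k)" for k
    unfolding h_def using continuous_on_compose[OF g(2) continuous_on_subset[OF cc]] by (auto simp: o_def)
  have hb: "cmod (h k t) \<le> real n" for k t
    using closest_point_in_set[of "cball 0 (real n)" "g k t"] by (auto simp: h_def)
  have hm [measurable]: "h k \<in> borel_measurable lebesgue" for k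
    using borel_measurable_continuous_onI[OF hc[of k]] by (intro measurable_completion) simp
  have hl: "(\<lambda>k. h k t) \<longlonglongrightarrow> f0 n t" if "t \<notin> N" for t
  proof -
    have "isCont (closest_point (cball 0 (real n))) (f0 n t)"
      using cc by (simp add: continuous_on_eq_continuous_at)
    from isCont_tendsto_compose[OF this g(3)[OF that]]
    have "(\<lambda>k. h k t) \<longlonglongrightarrow> closest_point (cball 0 (real n)) (f0 n t)" by (simp add: h_def)
    also have "closest_point (cball 0 (real n)) (f0 n t) = f0 n t"
      by (rule closest_point_self) (auto simp: f0_def)
    finally show ?thesis .
  qed
  have lim2: "(\<lambda>k. n2 ?I (\<lambda>t. f0 n t - h k t)) \<longlonglongrightarrow> (\<integral>\<^sup>+(t::real). 0 \<partial>lebesgue)"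
    unfolding n2_def
  proof (rule nn_integral_dominated_convergence[where w="\<lambda>t. ennreal ((2 * real n)\<^sup>2) * indicator ?I t"])
    show "AE t in lebesgue. (\<lambda>k. ennreal ((cmod (f0 n t - h k t))\<^sup>2) * indicator ?I t) \<longlonglongrightarrow> 0"
    proof (rule AE_I')
      show "N \<in> null_sets lebesgue" using g(1) by (simp add: negligible_iff_null_sets)
      show "{t \<in> space lebesgue. \<not> (\<lambda>k. ennreal ((cmod (f0 n t - h k t))\<^sup>2) * indicator ?I t) \<longlonglongrightarrow> 0} \<subseteq> N"
      proof safe
        fix t assume nl: "\<not> (\<lambda>k. ennreal ((cmod (f0 n t - h k t))\<^sup>2) * indicator ?I t) \<longlonglongrightarrow> 0"
        show "t \<in> N"
        proof (rule ccontr)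
          assume "t \<notin> N"
          then have "(\<lambda>k. ennreal ((cmod (f0 n t - h k t))\<^sup>2)) \<longlonglongrightarrow> ennreal ((cmod (f0 n t - f0 n t))\<^sup>2)"
            by (intro tendsto_intros hl)
          then have "(\<lambda>k. ennreal ((cmod (f0 n t - h k t))\<^sup>2) * indicator ?I t) \<longlonglongrightarrow> 0"
            by (auto split: split_indicator)
          then show False using nl by simp
        qed
      qed
    qed
    show "AE t in lebesgue. ennreal ((cmod (f0 n t - h k t))\<^sup>2) * indicator ?I t \<le> ennreal ((2 * real n)\<^sup>2) * indicator ?I t" for k
    proof (rule AE_I2)
      fix t
      have "cmod (f0 n t - h k t) \<le> 2 * real n"
        using norm_triangle_ineq4[of "f0 n t" "h k t"] hb[of k t] by (auto simp: f0_def split: if_splits)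
      then have "ennreal ((cmod (f0 n t - h k t))\<^sup>2) \<le> ennreal ((2 * real n)\<^sup>2)"
        by (intro ennreal_leI power_mono) auto
      then show "ennreal ((cmod (f0 n t - h k t))\<^sup>2) * indicator ?I t \<le> ennreal ((2 * real n)\<^sup>2) * indicator ?I t"
        by (rule mult_right_mono) simp
    qed
    have "(\<integral>\<^sup>+t. ennreal ((2 * real n)\<^sup>2) * indicator ?I t \<partial>lebesgue) = ennreal ((2 * real n)\<^sup>2) * ennreal (2 * R)"
      using assms by (subst nn_integral_cmult_indicator) auto
    then show "(\<integral>\<^sup>+t. ennreal ((2 * real n)\<^sup>2) * indicator ?I t \<partial>lebesgue) < \<infinity>"
      by (simp only: infinity_ennreal_def ennreal_mult_less_top ennreal_less_top) simp
  qed auto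
  then have "\<forall>\<^sub>F k in sequentially. n2 ?I (\<lambda>t. f0 n t - h k t) < ennreal (\<epsilon> / 16)"
    using assms(2) by (intro order_tendstoD) auto
  then obtain k where k: "n2 ?I (\<lambda>t. f0 n t - h k t) < ennreal (\<epsilon> / 16)"
    by (auto simp: eventually_sequentially)
  \<comment> \<open>A uniform error \<delta> on an interval of length 2R has squared norm at most
    \<epsilon>/32.\<close>
  define \<delta> where "\<delta> = sqrt (\<epsilon> / (64 * R))"
  have \<delta>: "\<delta> > 0" "\<delta>\<^sup>2 * (2 * R) = \<epsilon> / 32" using assms by (auto simp: \<delta>_def)
  obtain p where p: "polynomial_function p" "\<And>t. t \<in> ?I \<Longrightarrow> norm (h k t - p t) < \<delta>"
    using Stone_Weierstrass_polynomial_function[of ?I "h k" \<delta>] \<delta> continuous_on_subset[OF hc] by auto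
  have ps: "csmooth p" using p csmooth_polynomial by auto
  have pm [measurable]: "p \<in> borel_measurable lebesgue" using csmooth_measurable[OF ps] .
  have hp: "r2 ?I (\<lambda>t. h k t - p t) \<le> \<delta>\<^sup>2 * (R - - R)" "L2 ?I (\<lambda>t. h k t - p t)"
    by (rule L2_bounded[where M=\<delta>]; use p(2) assms in \<open>auto simp: less_imp_le\<close>)+
  have l1: "L2 ?I (\<lambda>t. f t - f0 n t)" "L2 ?I (\<lambda>t. f0 n t - h k t)"
    using n k by (auto simp: L2_def intro: less_trans)
  have l2: "L2 ?I (\<lambda>t. f0 n t - p t)"
    using L2_add[OF l1(2) hp(2)] by simp
  have "r2 ?I (\<lambda>t. f0 n t - p t) \<le> 2 * r2 ?I (\<lambda>t. f0 n t - h k t) + 2 * r2 ?I (\<lambda>t. h k t - p t)"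
    using r2_add[OF l1(2) hp(2)] by simp
  moreover have "r2 ?I (\<lambda>t. f t - p t) \<le> 2 * r2 ?I (\<lambda>t. f t - f0 n t) + 2 * r2 ?I (\<lambda>t. f0 n t - p t)"
    using r2_add[OF l1(1) l2] by simp
  moreover have "r2 ?I (\<lambda>t. f t - f0 n t) < \<epsilon> / 8" "r2 ?I (\<lambda>t. f0 n t - h k t) < \<epsilon> / 16"
    using n k by (simp_all add: r2_less_iff[OF l1(1)] r2_less_iff[OF l1(2)])
  ultimately have "r2 ?I (\<lambda>t. f t - p t) < \<epsilon>" using hp(1) \<delta> assms by simp
  with ps show ?thesis by (rule that)
qed

lemma L2_approx_test_fun:
  assumes "L2 {-R..R} f" "0 < \<epsilon>" "0 < R"
  obtains p where "test_fun R p" "r2 {-R..R} (\<lambda>t. f t - p t) < \<epsilon>"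
proof -
  let ?I = "{-R..R}"
  obtain p where p: "csmooth p" "r2 ?I (\<lambda>t. f t - p t) < \<epsilon> / 4"
    using L2_approx_csmooth[OF assms(1) _ assms(3), of "\<epsilon>/4"] assms by auto
  obtain M where M: "0 < M" "\<And>t. t \<in> ?I \<Longrightarrow> cmod (p t) \<le> M" using cont_bounded[OF csmooth_cont[OF p(1)]] by metis
  \<comment> \<open>Cutting \<open>p\<close> off changes it by at most 2M on two end strips of
    length \<open>d\<close>, hence by at most 8 M^2 d in squared norm; the choice makes this at most
    \<epsilon>/4. The bound R/2 keeps the strips from overlapping.\<close>
  define d where "d = min (R / 2) (\<epsilon> / (32 * M\<^sup>2))"
  have d: "0 < d" "d < R" "d \<le> \<epsilon> / (32 * M\<^sup>2)" using assms M by (auto simp: d_def min_def)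
  have dM: "4 * M\<^sup>2 * d \<le> \<epsilon> / 8" using d M by (simp add: field_simps)
  obtain S where S: "csmooth S" "\<And>t. t \<le> -R \<Longrightarrow> S t = 0" "\<And>t. R \<le> t \<Longrightarrow> S t = 0"
    "\<And>t. t \<in> {-R+d..R-d} \<Longrightarrow> S t = 1" "\<And>t. cmod (S t) \<le> 1"
  proof -
    have "d \<le> R / 2" by (simp add: d_def)
    then have "-R < -R+d" "-R+d \<le> R-d" "R-d < R" using d assms(3) by auto
    then show ?thesis by (rule smooth_plateau) (rule that; assumption)
  qed
  have t: "test_fun R (\<lambda>t. S t * p t)" unfolding test_fun_def using S p by (auto simp: abs_if split: if_splits)
  have l: "L2 ?I (\<lambda>t. p t - S t * p t)" using S p by (intro L2_csmooth) auto
  have "n2 ?I (\<lambda>t. p t - S t * p t) \<le>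
      (\<integral>\<^sup>+t. ennreal ((2*M)\<^sup>2) * indicator {-R..-R+d} t + ennreal ((2*M)\<^sup>2) * indicator {R-d..R} t \<partial>lebesgue)"
    unfolding n2_def
  proof (rule nn_integral_mono)
    fix t
    show "ennreal ((cmod (p t - S t * p t))\<^sup>2) * indicator ?I t \<le>
       ennreal ((2*M)\<^sup>2) * indicator {-R..-R+d} t + ennreal ((2*M)\<^sup>2) * indicator {R-d..R} t"
    proof (cases "t \<in> ?I")
      case True
      show ?thesis
      proof (cases "t \<in> {-R+d..R-d}")
        case True
        then show ?thesis using S(4) by simp
      next
        case False
        have "cmod (p t - S t * p t) \<le> cmod (p t) + cmod (S t) * cmod (p t)"
          by (metis norm_mult norm_triangle_ineq4)
        also have "\<dots> \<le> M + 1 * M" using M(2)[OF True] S(5)[of t] M(1) by (intro add_mono mult_mono) auto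
        finally have "(cmod (p t - S t * p t))\<^sup>2 \<le> (2 * M)\<^sup>2" by (intro power_mono) auto
        then have le: "ennreal ((cmod (p t - S t * p t))\<^sup>2) \<le> ennreal ((2 * M)\<^sup>2)" by (rule ennreal_leI)
        define c where "c = ennreal ((2 * M)\<^sup>2)"
        from le show ?thesis unfolding c_def[symmetric] using True False
          by (auto split: split_indicator intro: add_increasing)
      qed
    qed auto
  qed
  also have "\<dots> = ennreal ((2*M)\<^sup>2) * ennreal d + ennreal ((2*M)\<^sup>2) * ennreal d"
  proof -
    have [measurable]: "{-R..-R+d} \<in> sets lebesgue" "{R-d..R} \<in> sets lebesgue" by auto
    show ?thesis using d by (subst nn_integral_add) (measurable, auto simp: nn_integral_cmult_indicator)
  qed
  also have "\<dots> = ennreal (8 * M\<^sup>2 * d)"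
    using d by (simp add: ennreal_plus[symmetric] ennreal_mult'[symmetric] power_mult_distrib del: ennreal_plus)
  finally have "r2 ?I (\<lambda>t. p t - S t * p t) \<le> 8 * M\<^sup>2 * d" using l d by (simp add: L2_n2)
  moreover have "r2 ?I (\<lambda>t. f t - S t * p t) \<le> 2 * r2 ?I (\<lambda>t. f t - p t) + 2 * r2 ?I (\<lambda>t. p t - S t * p t)"
    using r2_add[OF L2_diff[OF assms(1) L2_csmooth[OF p(1)]] l] by simp
  ultimately have "r2 ?I (\<lambda>t. f t - S t * p t) < \<epsilon>" using dM p(2) assms(2) by linarith
  with t show ?thesis by (rule that)
qed

section \<open>Weak second derivatives\<close>

lemma csmooth_id: "csmooth complex_of_real"
  by (rule csmoothI[where f'="\<lambda>_. 1"])
     (auto intro!: derivative_eq_intros simp: has_vector_derivative_def scaleR_conv_of_real)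

lemma cderiv_id: "cderiv complex_of_real = (\<lambda>_. 1)"
  by (rule cderiv_eqI)
     (auto intro!: derivative_eq_intros simp: has_vector_derivative_def scaleR_conv_of_real)

lemma test_fun_csmooth: "test_fun R \<phi> \<Longrightarrow> csmooth \<phi>"
  by (simp add: test_fun_def)

lemma test_fun_cmult: "test_fun R f \<Longrightarrow> test_fun R (\<lambda>t. c * f t)"
  unfolding test_fun_def by (auto intro: csmooth_mult csmooth_const)

lemma test_fun_diff: "test_fun R f \<Longrightarrow> test_fun R g \<Longrightarrow> test_fun R (\<lambda>t. f t - g t)"
  unfolding test_fun_def by (auto intro: csmooth_diff)

text \<open>A test function at squared distance less than R from the constant 1 cannot have mean
  zero: Cauchy-Schwarz would then give (2R)^2 <= R * 2R. Dividing by its mass gives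
  \<open>\<eta>\<close>.\<close>

lemma test_fun_mass:
  assumes "0 < R"
  obtains \<eta> where "test_fun R \<eta>" "(LINT t:{-R..R}|lebesgue. \<eta> t) = 1"
proof -
  let ?I = "{-R..R}"
  have one: "L2 ?I (\<lambda>_. 1)" by (rule L2_csmooth) auto
  obtain \<psi> where \<psi>: "test_fun R \<psi>" "r2 ?I (\<lambda>t. 1 - \<psi> t) < R"
    using L2_approx_test_fun[OF one assms assms] by auto
  note s = test_fun_csmooth[OF \<psi>(1)]
  have i: "set_integrable lebesgue ?I \<psi>" "set_integrable lebesgue ?I (\<lambda>t. 1::complex)"
    using s by (auto intro!: csmooth_set_integrable)
  have "(LINT t:?I|lebesgue. \<psi> t) \<noteq> 0"
  proof
    assume z: "(LINT t:?I|lebesgue. \<psi> t) = 0"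
    have "(LINT t:?I|lebesgue. (1 - \<psi> t) * 1) = 2 * of_real R"
      using assms i by (simp add: z) (simp add: set_lebesgue_integral_def scaleR_conv_of_real)
    moreover have "(cmod (LINT t:?I|lebesgue. (1 - \<psi> t) * 1))\<^sup>2 \<le> r2 ?I (\<lambda>t. 1 - \<psi> t) * r2 ?I (\<lambda>_. 1)"
      by (rule L2_CS) (use one L2_diff[OF one L2_csmooth[OF s]] in auto)
    moreover have "r2 ?I (\<lambda>_. 1) \<le> 1\<^sup>2 * (R - -R)"
      by (rule L2_bounded) (use assms in auto)
    ultimately have "(2 * R)\<^sup>2 \<le> R * (2 * R)"
      using \<psi>(2) assms mult_mono[of "r2 ?I (\<lambda>t. 1 - \<psi> t)" R "r2 ?I (\<lambda>_. 1)" "2*R"] by (simp add: norm_mult power_mult_distrib)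
    then show False using assms by (simp add: power2_eq_square)
  qed
  then show ?thesis
    by (intro that[of "\<lambda>t. (1 / (LINT t:?I|lebesgue. \<psi> t)) * \<psi> t"] test_fun_cmult \<psi>(1)) auto
qed

lemma set_integral_bound_const:
  fixes f :: "real \<Rightarrow> complex"
  assumes "set_integrable lebesgue {-R..R} f" "\<And>t. cmod (f t) \<le> M" "0 < R"
  shows "(LINT t:{-R..R}|lebesgue. cmod (f t)) \<le> M * (2 * R)"
proof -
  have "(LINT t:{-R..R}|lebesgue. cmod (f t)) \<le> (LINT t:{-R..R}|lebesgue. M)"
    by (rule set_integral_mono) (use assms set_integrable_norm[OF assms(1)] in auto)
  also have "\<dots> = M * (2 * R)" using assms(3) by (simp add: set_lebesgue_integral_def)
  finally show ?thesis .
qed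

lemma set_integral_norm_add_le:
  fixes f g :: "real \<Rightarrow> complex"
  assumes f: "set_integrable lebesgue S f" and g: "set_integrable lebesgue S g"
  shows "(LINT t:S|lebesgue. cmod (f t - c * g t)) \<le>
    (LINT t:S|lebesgue. cmod (f t)) + cmod c * (LINT t:S|lebesgue. cmod (g t))"
proof -
  have fn: "set_integrable lebesgue S (\<lambda>t. cmod (f t))" "set_integrable lebesgue S (\<lambda>t. cmod (g t))"
    using set_integrable_norm f g by auto
  have "(LINT t:S|lebesgue. cmod (f t - c * g t)) \<le> (LINT t:S|lebesgue. cmod (f t) + cmod c * cmod (g t))"
    by (rule set_integral_mono)
       (use f g fn in \<open>auto intro!: set_integrable_norm set_integral_diff set_integral_add
          order_trans[OF norm_triangle_ineq4] simp: norm_mult\<close>)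
  also have "\<dots> = (LINT t:S|lebesgue. cmod (f t)) + cmod c * (LINT t:S|lebesgue. cmod (g t))"
    using fn by (simp add: set_integral_add)
  finally show ?thesis .
qed

text \<open>A quantitative du Bois-Reymond lemma, by duality: every test function has the form \<open>c\<^sub>0 \<eta> + c\<^sub>1 \<eta>' + \<phi>''\<close> with a fixed \<open>\<eta>\<close> of mass one, and \<open>c\<^sub>0, c\<^sub>1, \<phi>\<close> are bounded by its \<open>L\<^sup>1\<close> norm.\<close>

lemma weak_second_derivative:
  assumes R: "0 < R"
  obtains C where "0 \<le> C"
    "\<And>X g p. L2 {-R..R} X \<Longrightarrow> L2 {-R..R} g \<Longrightarrow>
      (\<And>\<phi>. test_fun R \<phi> \<Longrightarrow> (LINT t:{-R..R}|lebesgue. cderiv (cderiv \<phi>) t * X t) = (LINT t:{-R..R}|lebesgue. \<phi> t * g t)) \<Longrightarrow>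
      csmooth p \<Longrightarrow>
      \<exists>P. csmooth P \<and> cderiv (cderiv P) = p \<and> r2 {-R..R} (\<lambda>t. X t - P t) \<le> C * r2 {-R..R} (\<lambda>t. g t - p t)"
proof -
  let ?I = "{-R..R}"
  have lebI: "?I \<in> sets lebesgue" by simp
  define J :: "(real \<Rightarrow> complex) \<Rightarrow> complex" where "J = (\<lambda>f. LINT t:?I|lebesgue. f t)"
  define N :: "(real \<Rightarrow> complex) \<Rightarrow> real" where "N = (\<lambda>f. LINT t:?I|lebesgue. cmod (f t))"
  have Jadd: "J (\<lambda>t. f t * g t + f' t * g' t) = J (\<lambda>t. f t * g t) + J (\<lambda>t. f' t * g' t)"
    if "L2 ?I f" "L2 ?I g" "L2 ?I f'" "L2 ?I g'" for f g f' g'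
    unfolding J_def using that by (intro set_integral_add L2_CS) auto
  have Jcm: "J (\<lambda>t. c * f t) = c * J f" "J (\<lambda>t. f t * c) = J f * c" for c f
    by (auto simp: J_def)
  have Neq: "N f = (LINT t:?I|lebesgue. cmod (f t))" for f by (simp add: N_def)
  have N0: "0 \<le> N f" for f unfolding N_def set_lebesgue_integral_def by (rule integral_nonneg_AE) auto
  have JN: "cmod (J f) \<le> N f" if "set_integrable lebesgue ?I f" for f
    unfolding J_def N_def by (rule set_integral_norm_bound[OF that])
  have one: "L2 ?I (\<lambda>_. 1)" by (rule L2_csmooth) auto
  have r1: "r2 ?I (\<lambda>_. 1) \<le> 2 * R"
    using L2_bounded(2)[of "\<lambda>_. 1" "-R" R 1] R by auto
  have N2: "(N f)\<^sup>2 \<le> 2 * R * r2 ?I f" if "L2 ?I f" for f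
  proof -
    have "(N f)\<^sup>2 \<le> r2 ?I f * r2 ?I (\<lambda>_. 1)" using L2_CS(2)[OF that one] by (simp add: N_def)
    also have "\<dots> \<le> r2 ?I f * (2 * R)" by (intro mult_left_mono r1) auto
    finally show ?thesis by (simp add: mult_ac)
  qed
  obtain \<eta> where \<eta>: "test_fun R \<eta>" "J \<eta> = 1" using test_fun_mass[OF R] unfolding J_def by metis
  define A where "A = N \<eta>"
  define m where "m = J (\<lambda>t. \<eta> t * of_real t)"
  \<comment> \<open>\<open>B\<close> collects the L1 cost of the decomposition of a test function: a
    factor 1 + A for each of the two subtractions of a multiple of \<open>\<eta>\<close>, and 2R for
    passing from a supremum bound to the L1 norm in between. \<open>K\<close> converts to squared L2
    norms, at a price of 2R for each of the two L1 norms.\<close>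
  define B where "B = (1 + A) * (1 + A) * (2 * R)"
  define K where "K = B\<^sup>2 * (2 * R)\<^sup>2"
  have A0: "0 \<le> A" by (simp add: A_def N0)
  have tL2: "L2 ?I f" if "test_fun R f" for f using that L2_csmooth test_fun_csmooth by blast
  have tin: "set_integrable lebesgue ?I f" if "test_fun R f" for f using that csmooth_set_integrable test_fun_csmooth by blast
  have idL2: "L2 ?I complex_of_real" by (rule L2_csmooth[OF csmooth_id])
  have main: "\<exists>P. csmooth P \<and> cderiv (cderiv P) = p \<and> r2 ?I (\<lambda>t. X t - P t) \<le> (4 * K) * r2 ?I (\<lambda>t. g t - p t)"
    if X: "L2 ?I X" and g: "L2 ?I g" and weak: "\<And>\<phi>. test_fun R \<phi> \<Longrightarrow> J (\<lambda>t. cderiv (cderiv \<phi>) t * X t) = J (\<lambda>t. \<phi> t * g t)"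
      and p: "csmooth p" for X g p
  proof -
    obtain P1 where P1: "csmooth P1" "cderiv P1 = p" using csmooth_antideriv[OF p] by metis
    obtain W where W: "csmooth W" "cderiv W = P1" using csmooth_antideriv[OF P1(1)] by metis
    \<comment> \<open>\<open>W\<close> is a second primitive of \<open>p\<close>, so
      \<open>Z\<close> has weak second derivative \<open>q = g - p\<close>. What remains is that
      \<open>Z\<close> is close to an affine function, with the distance controlled by
      \<open>q\<close>.\<close>
    define Z where "Z = (\<lambda>t. X t - W t)"
    have Z: "L2 ?I Z" unfolding Z_def using X L2_csmooth[OF W(1)] by (intro L2_diff) auto
    define q where "q = (\<lambda>t. g t - p t)"
    have q: "L2 ?I q" unfolding q_def using g L2_csmooth[OF p] by (intro L2_diff) auto
    have hw: "J (\<lambda>t. cderiv (cderiv \<phi>) t * Z t) = J (\<lambda>t. \<phi> t * q t)" if \<phi>: "test_fun R \<phi>" for \<phi>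
    proof -
      have "J (\<lambda>t. cderiv (cderiv \<phi>) t * W t) = - J (\<lambda>t. cderiv \<phi> t * P1 t)"
        using test_fun_by_parts[OF test_fun_cderiv[OF \<phi>] W(1) R] by (simp add: J_def W)
      also have "\<dots> = J (\<lambda>t. \<phi> t * p t)"
        using test_fun_by_parts[OF \<phi> P1(1) R] by (simp add: J_def P1)
      finally have *: "J (\<lambda>t. cderiv (cderiv \<phi>) t * W t) = J (\<lambda>t. \<phi> t * p t)" .
      have t2: "L2 ?I (cderiv (cderiv \<phi>))" "L2 ?I \<phi>" using \<phi> test_fun_cderiv tL2 by blast+
      have "J (\<lambda>t. cderiv (cderiv \<phi>) t * Z t) = J (\<lambda>t. cderiv (cderiv \<phi>) t * X t + cderiv (cderiv \<phi>) t * (- W t))"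
        by (simp add: Z_def algebra_simps)
      also have "\<dots> = J (\<lambda>t. cderiv (cderiv \<phi>) t * X t) + J (\<lambda>t. cderiv (cderiv \<phi>) t * (- W t))"
        by (intro Jadd t2 X L2_uminus L2_csmooth W)
      also have "\<dots> = J (\<lambda>t. \<phi> t * g t) + J (\<lambda>t. \<phi> t * (- p t))"
        using * weak[OF \<phi>] Jcm(1)[of "-1" "\<lambda>t. cderiv (cderiv \<phi>) t * W t"] Jcm(1)[of "-1" "\<lambda>t. \<phi> t * p t"] by simp
      also have "\<dots> = J (\<lambda>t. \<phi> t * g t + \<phi> t * (- p t))"
        by (intro Jadd[symmetric] t2 g L2_uminus L2_csmooth p)
      finally show ?thesis by (simp add: q_def algebra_simps)
    qed
    \<comment> \<open>The affine function is forced by the decomposition \<psi> = \<phi>2'' + c1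
      \<eta>' + c0 \<eta>. Besides the pairing of \<phi>2 with q, it gives J(\<psi> Z) the terms c1
      J(\<eta>' Z) + c0 J(\<eta> Z), where c0 = J(\<psi>) and c1 = - y + c0 m with y = J(\<psi> t).
      Collecting the coefficients of c0 and y yields \<open>a\<close> and \<open>b\<close>, so these
      terms equal J(\<psi> L).\<close>
    define a where "a = J (\<lambda>t. \<eta> t * Z t) + m * J (\<lambda>t. cderiv \<eta> t * Z t)"
    define b where "b = - J (\<lambda>t. cderiv \<eta> t * Z t)"
    define L where "L = (\<lambda>t. a + b * complex_of_real t)"
    have L: "csmooth L" unfolding L_def by (intro csmooth_add csmooth_mult csmooth_const csmooth_id)
    have L': "cderiv L = (\<lambda>_. b)"
      unfolding L_def
      by (subst cderiv_add) (auto intro!: csmooth_mult csmooth_id simp: cderiv_cmult csmooth_id cderiv_id cderiv_eqI[of "\<lambda>_. a" "\<lambda>_. 0"])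
    define h where "h = (\<lambda>t. Z t - L t)"
    have h: "L2 ?I h" unfolding h_def using Z L2_csmooth[OF L] by (intro L2_diff) auto
    have key: "cmod (J (\<lambda>t. \<psi> t * h t)) \<le> B * N \<psi> * N q" if \<psi>: "test_fun R \<psi>" for \<psi>
    proof -
      define c0 where "c0 = J \<psi>"
      define f1 where "f1 = (\<lambda>t. \<psi> t - c0 * \<eta> t)"
      have f1: "test_fun R f1" unfolding f1_def by (intro test_fun_diff test_fun_cmult \<psi> \<eta>(1))
      have "J f1 = J (\<lambda>t. \<psi> t * 1 + (- c0) * \<eta> t)" by (simp add: f1_def)
      also have "\<dots> = J (\<lambda>t. \<psi> t * 1) + J (\<lambda>t. (- c0) * \<eta> t)"
        by (intro Jadd tL2 \<psi> \<eta>(1) one L2_csmooth csmooth_const)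
      also have "\<dots> = 0" using \<eta>(2) Jcm(1)[of "-c0" \<eta>] by (simp add: c0_def)
      finally have f10: "J f1 = 0" .
      obtain \<phi>1 where \<phi>1: "test_fun R \<phi>1" "cderiv \<phi>1 = f1" "\<And>t. cmod (\<phi>1 t) \<le> N f1"
        using test_fun_antideriv[OF f1 R] f10 unfolding J_def N_def by metis
      define c1 where "c1 = J \<phi>1"
      define f2 where "f2 = (\<lambda>t. \<phi>1 t - c1 * \<eta> t)"
      have f2: "test_fun R f2" unfolding f2_def by (intro test_fun_diff test_fun_cmult \<phi>1(1) \<eta>(1))
      have "J f2 = J (\<lambda>t. \<phi>1 t * 1 + (- c1) * \<eta> t)" by (simp add: f2_def)
      also have "\<dots> = J (\<lambda>t. \<phi>1 t * 1) + J (\<lambda>t. (- c1) * \<eta> t)"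
        by (intro Jadd tL2 \<phi>1(1) \<eta>(1) one L2_csmooth csmooth_const)
      also have "\<dots> = 0" using \<eta>(2) Jcm(1)[of "-c1" \<eta>] by (simp add: c1_def)
      finally have f20: "J f2 = 0" .
      obtain \<phi>2 where \<phi>2: "test_fun R \<phi>2" "cderiv \<phi>2 = f2" "\<And>t. cmod (\<phi>2 t) \<le> N f2"
        using test_fun_antideriv[OF f2 R] f20 unfolding J_def N_def by metis
      have "\<phi>1 = (\<lambda>t. f2 t + c1 * \<eta> t)" by (simp add: f2_def)
      then have "f1 = cderiv (\<lambda>t. f2 t + c1 * \<eta> t)" using \<phi>1(2) by simp
      also have "\<dots> = (\<lambda>t. cderiv f2 t + c1 * cderiv \<eta> t)"
        using f2 \<eta>(1) by (subst cderiv_add) (auto simp: test_fun_def cderiv_cmult)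
      finally have dec: "\<psi> t = cderiv (cderiv \<phi>2) t + c1 * cderiv \<eta> t + c0 * \<eta> t" for t
        by (auto simp: f1_def fun_eq_iff \<phi>2(2) diff_eq_eq)
      have n1: "N f1 \<le> (1 + A) * N \<psi>"
      proof -
        have "N f1 \<le> N \<psi> + cmod c0 * A"
          unfolding f1_def N_def A_def by (intro set_integral_norm_add_le tin \<psi> \<eta>(1))
        also have "cmod c0 \<le> N \<psi>" unfolding c0_def by (intro JN tin \<psi>)
        finally show ?thesis using A0 by (simp add: algebra_simps mult_right_mono)
      qed
      have n2: "N \<phi>1 \<le> N f1 * (2 * R)"
        unfolding N_def by (rule set_integral_bound_const[OF tin[OF \<phi>1(1)] _ R]) (use \<phi>1(3) in \<open>simp add: N_def\<close>)
      have n3: "N f2 \<le> (1 + A) * N \<phi>1"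
      proof -
        have "N f2 \<le> N \<phi>1 + cmod c1 * A"
          unfolding f2_def N_def A_def by (intro set_integral_norm_add_le tin \<phi>1(1) \<eta>(1))
        also have "cmod c1 \<le> N \<phi>1" unfolding c1_def by (intro JN tin \<phi>1(1))
        finally show ?thesis using A0 by (simp add: algebra_simps mult_right_mono)
      qed
      have nB: "N f2 \<le> B * N \<psi>"
      proof -
        have "N f2 \<le> (1 + A) * (N f1 * (2 * R))" using n3 n2 A0 by (meson add_nonneg_nonneg mult_left_mono order_trans zero_le_one)
        also have "\<dots> \<le> (1 + A) * (((1 + A) * N \<psi>) * (2 * R))"
          using n1 A0 R by (intro mult_left_mono mult_right_mono) auto
        finally show ?thesis by (simp add: B_def mult_ac)
      qed
      have L2s: "L2 ?I (cderiv (cderiv \<phi>2))" "L2 ?I (cderiv \<eta>)" "L2 ?I \<eta>" "L2 ?I \<psi>" "L2 ?I \<phi>2" "L2 ?I f1" "L2 ?I \<phi>1"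
        using \<phi>2(1) \<eta>(1) \<psi> f1 \<phi>1(1) test_fun_cderiv tL2 by blast+
      have e1: "J (\<lambda>t. \<psi> t * Z t) = J (\<lambda>t. cderiv (cderiv \<phi>2) t * Z t) + c1 * J (\<lambda>t. cderiv \<eta> t * Z t) + c0 * J (\<lambda>t. \<eta> t * Z t)"
      proof -
        have "J (\<lambda>t. \<psi> t * Z t) = J (\<lambda>t. (cderiv (cderiv \<phi>2) t + c1 * cderiv \<eta> t) * Z t + (c0 * \<eta> t) * Z t)"
          unfolding dec by (simp add: algebra_simps)
        also have "\<dots> = J (\<lambda>t. (cderiv (cderiv \<phi>2) t + c1 * cderiv \<eta> t) * Z t) + J (\<lambda>t. (c0 * \<eta> t) * Z t)"
          by (intro Jadd Z L2_add L2_cmult L2s) auto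
        also have "J (\<lambda>t. (cderiv (cderiv \<phi>2) t + c1 * cderiv \<eta> t) * Z t) = J (\<lambda>t. cderiv (cderiv \<phi>2) t * Z t + (c1 * cderiv \<eta> t) * Z t)"
          by (simp add: algebra_simps)
        also have "\<dots> = J (\<lambda>t. cderiv (cderiv \<phi>2) t * Z t) + J (\<lambda>t. (c1 * cderiv \<eta> t) * Z t)"
          by (intro Jadd Z L2_cmult L2s) auto
        finally show ?thesis using Jcm(1)[of c1 "\<lambda>t. cderiv \<eta> t * Z t"] Jcm(1)[of c0 "\<lambda>t. \<eta> t * Z t"]
          by (simp add: mult.assoc)
      qed
      define y where "y = J (\<lambda>t. \<psi> t * of_real t)"
      have e2: "c1 = - y + c0 * m"
      proof -
        have "c1 = - J (\<lambda>t. f1 t * of_real t)"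
          using test_fun_by_parts[OF \<phi>1(1) csmooth_id R] by (simp add: c1_def J_def \<phi>1(2) cderiv_id)
        also have "J (\<lambda>t. f1 t * of_real t) = J (\<lambda>t. \<psi> t * of_real t + ((- c0) * \<eta> t) * of_real t)"
          by (simp add: f1_def algebra_simps)
        also have "\<dots> = J (\<lambda>t. \<psi> t * of_real t) + J (\<lambda>t. ((- c0) * \<eta> t) * of_real t)"
          by (intro Jadd L2_cmult L2s idL2) auto
        also have "J (\<lambda>t. ((- c0) * \<eta> t) * of_real t) = - c0 * m"
          unfolding m_def using Jcm(1)[of "-c0" "\<lambda>t. \<eta> t * of_real t"] by (simp add: mult.assoc)
        finally show ?thesis by (simp add: y_def)
      qed
      have e3: "J (\<lambda>t. \<psi> t * (- L t)) = - (a * c0 + b * y)"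
      proof -
        have "J (\<lambda>t. \<psi> t * (- L t)) = J (\<lambda>t. \<psi> t * (- a) + \<psi> t * ((- b) * of_real t))"
          by (simp add: L_def algebra_simps)
        also have "\<dots> = J (\<lambda>t. \<psi> t * (- a)) + J (\<lambda>t. \<psi> t * ((- b) * of_real t))"
          by (intro Jadd L2_cmult L2s idL2 L2_csmooth csmooth_const) auto
        also have "J (\<lambda>t. \<psi> t * (- a)) = - a * c0" using Jcm(2)[of \<psi> "-a"] by (simp add: c0_def)
        also have "J (\<lambda>t. \<psi> t * ((- b) * of_real t)) = - b * y"
          using Jcm(1)[of "-b" "\<lambda>t. \<psi> t * of_real t"] by (simp add: y_def mult_ac)
        finally show ?thesis by simp
      qed
      have "J (\<lambda>t. \<psi> t * h t) = J (\<lambda>t. \<psi> t * Z t + \<psi> t * (- L t))" by (simp add: h_def algebra_simps)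
      also have "\<dots> = J (\<lambda>t. \<psi> t * Z t) + J (\<lambda>t. \<psi> t * (- L t))"
        by (intro Jadd L2s Z L2_uminus L2_csmooth L)
      also have "\<dots> = J (\<lambda>t. \<phi>2 t * q t)"
        unfolding e1 e3 hw[OF \<phi>2(1)] by (simp add: a_def b_def e2 algebra_simps)
      finally have "cmod (J (\<lambda>t. \<psi> t * h t)) = cmod (J (\<lambda>t. \<phi>2 t * q t))" by simp
      also have "\<dots> \<le> N (\<lambda>t. \<phi>2 t * q t)" by (intro JN L2_CS L2s q) auto
      also have "\<dots> \<le> (LINT t:?I|lebesgue. N f2 * cmod (q t))"
        unfolding Neq[of "\<lambda>t. \<phi>2 t * q t"]
      proof (rule set_integral_mono)
        have "set_integrable lebesgue ?I q" using L2_CS(1)[OF q one] by simp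
        then show "set_integrable lebesgue ?I (\<lambda>t. N f2 * cmod (q t))"
          using set_integrable_norm[of lebesgue ?I q] by simp
        show "set_integrable lebesgue ?I (\<lambda>t. cmod (\<phi>2 t * q t))"
          by (intro set_integrable_norm L2_CS L2s q) auto
      qed (auto simp: norm_mult intro: mult_right_mono \<phi>2(3))
      also have "\<dots> = N f2 * N q" by (simp add: Neq[of q])
      also have "\<dots> \<le> B * N \<psi> * N q" by (intro mult_right_mono nB N0)
      finally show ?thesis .
    qed
    define H where "H = r2 ?I h"
    define G where "G = r2 ?I q"
    have K0: "0 \<le> K" by (simp add: K_def)
    have H0: "0 \<le> H" "0 \<le> G" by (auto simp: H_def G_def)
    \<comment> \<open>Ideally \<open>key\<close> would be tested on the conjugate of
      \<open>h\<close>, turning the pairing into the squared norm \<open>H\<close>. Since that is no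
      test function, one within \<delta> of it is used; the errors vanish with \<delta>.\<close>
    have est: "H\<^sup>2 \<le> 4 * K * G * H + 4 * K * G * \<delta> + 2 * \<delta> * H" if \<delta>: "0 < \<delta>" for \<delta>
    proof -
      have ch: "L2 ?I (\<lambda>t. cnj (h t))" using L2_cnj h by auto
      obtain \<psi> where \<psi>: "test_fun R \<psi>" "r2 ?I (\<lambda>t. cnj (h t) - \<psi> t) < \<delta>" using L2_approx_test_fun[OF ch \<delta> R] by auto
      have d: "L2 ?I (\<lambda>t. cnj (h t) - \<psi> t)" using ch tL2[OF \<psi>(1)] by (intro L2_diff) auto
      have "complex_of_real H = J (\<lambda>t. cnj (h t) * h t)"
      proof -
        have "J (\<lambda>t. cnj (h t) * h t) = J (\<lambda>t. complex_of_real ((cmod (h t))\<^sup>2))"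
          by (simp only: complex_norm_square mult.commute)
        also have "\<dots> = complex_of_real H"
          unfolding H_def J_def L2_set_integrable(2)[OF h lebI] by (rule set_integral_complex_of_real)
        finally show ?thesis ..
      qed
      also have "\<dots> = J (\<lambda>t. \<psi> t * h t + (cnj (h t) - \<psi> t) * h t)" by (simp add: algebra_simps)
      also have "\<dots> = J (\<lambda>t. \<psi> t * h t) + J (\<lambda>t. (cnj (h t) - \<psi> t) * h t)"
        by (intro Jadd tL2 \<psi>(1) h d)
      finally have "(cmod (complex_of_real H))\<^sup>2 \<le> 2 * (cmod (J (\<lambda>t. \<psi> t * h t)))\<^sup>2 + 2 * (cmod (J (\<lambda>t. (cnj (h t) - \<psi> t) * h t)))\<^sup>2"
        using sum_sq2 by metis
      also have "(cmod (J (\<lambda>t. \<psi> t * h t)))\<^sup>2 \<le> (B * N \<psi> * N q)\<^sup>2" by (intro power_mono key \<psi>) auto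
      also have "\<dots> = B\<^sup>2 * ((N \<psi>)\<^sup>2 * (N q)\<^sup>2)" by (simp add: power_mult_distrib)
      also have "\<dots> \<le> B\<^sup>2 * ((2 * R * r2 ?I \<psi>) * (2 * R * r2 ?I q))"
        using R by (intro mult_left_mono mult_mono N2 tL2 \<psi>(1) q) auto
      also have "\<dots> = K * G * r2 ?I \<psi>" by (simp add: K_def G_def power2_eq_square)
      also have "r2 ?I \<psi> \<le> 2 * H + 2 * \<delta>"
      proof -
        have "r2 ?I (\<lambda>t. cnj (h t) - (cnj (h t) - \<psi> t)) \<le> 2 * r2 ?I (\<lambda>t. cnj (h t)) + 2 * r2 ?I (\<lambda>t. cnj (h t) - \<psi> t)"
          by (rule r2_diff[OF ch d]) auto
        then show ?thesis using \<psi>(2) by (simp add: H_def L2_cnj)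
      qed
      also have "(cmod (J (\<lambda>t. (cnj (h t) - \<psi> t) * h t)))\<^sup>2 \<le> r2 ?I (\<lambda>t. cnj (h t) - \<psi> t) * H"
        unfolding J_def H_def by (rule L2_CS[OF d h]) auto
      also have "\<dots> \<le> \<delta> * H" using \<psi>(2) H0 by (intro mult_right_mono) auto
      finally show ?thesis using mult_nonneg_nonneg[OF H0(2) K0] by (simp add: algebra_simps mult_right_mono)
    qed
    have "H \<le> 4 * K * G"
    proof (rule ccontr)
      assume n: "\<not> H \<le> 4 * K * G"
      have KG: "0 \<le> K * G" using K0 H0 by simp
      have Hp: "0 < H" using n KG by simp
      define D where "D = H * (H - 4 * K * G)"
      have D: "0 < D" using Hp n by (simp add: D_def)
      \<comment> \<open>Chosen such that the total error \<delta> (4 K G + 2 H) in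
        \<open>est\<close> is half of the assumed excess \<open>D\<close>.\<close>
      define \<delta> where "\<delta> = D / (2 * (4 * K * G + 2 * H))"
      have den: "0 < 2 * (4 * K * G + 2 * H)" using Hp KG by simp
      have "0 < \<delta>" using D den by (simp add: \<delta>_def)
      from est[OF this] have "D \<le> \<delta> * (4 * K * G + 2 * H)" by (simp add: D_def power2_eq_square algebra_simps)
      also have "\<dots> = D / 2" using den by (simp add: \<delta>_def field_simps)
      finally show False using D by simp
    qed
    moreover have "h = (\<lambda>t. X t - (W t + L t))" by (simp add: h_def Z_def fun_eq_iff)
    moreover have "cderiv (cderiv (\<lambda>t. W t + L t)) = p"
      using W L L' P1 by (simp add: cderiv_add csmooth_const cderiv_eqI[of "\<lambda>_. b" "\<lambda>_. 0"])
    moreover have "csmooth (\<lambda>t. W t + L t)" using W L by auto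
    ultimately show ?thesis unfolding H_def G_def q_def by auto
  qed
  show ?thesis
    by (rule that[of "4 * K"]) (use main in \<open>auto simp: J_def K_def\<close>)
qed

section \<open>The Caccioppoli estimate and cutoffs at large scale\<close>

lemma cnj_deriv: "csmooth f \<Longrightarrow> ((\<lambda>t. cnj (f t)) has_vector_derivative cnj (cderiv f t)) (at t)"
  by (intro bounded_linear.has_vector_derivative[OF bounded_linear_cnj] csmooth_deriv)

lemma csmooth_cnj: "csmooth f \<Longrightarrow> csmooth (\<lambda>t. cnj (f t))"
proof -
  have "Ck n f \<Longrightarrow> Ck n (\<lambda>t. cnj (f t))" for n and f :: "real \<Rightarrow> complex"
  proof (induction n arbitrary: f)
    case (Suc n)
    have "((\<lambda>t. cnj (f t)) has_vector_derivative cnj (cderiv f t)) (at t)" for t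
      by (intro bounded_linear.has_vector_derivative[OF bounded_linear_cnj] Ck_Suc_deriv[OF Suc.prems])
    then show ?case by (rule Ck_SucI) (use Suc in auto)
  qed simp
  then show "csmooth f \<Longrightarrow> csmooth (\<lambda>t. cnj (f t))" by (simp add: csmooth_iff_Ck)
qed

lemma cderiv_cnj: "csmooth f \<Longrightarrow> cderiv (\<lambda>t. cnj (f t)) = (\<lambda>t. cnj (cderiv f t))"
  by (rule cderiv_eqI) (rule cnj_deriv)

lemma two_mult_le: "2 * a * b \<le> a\<^sup>2 / 2 + 2 * b\<^sup>2" for a b :: real
  using zero_le_power2[of "a - 2 * b"] by (simp add: power2_eq_square algebra_simps)

lemma set_integral_Re:
  fixes f :: "real \<Rightarrow> complex"
  assumes "set_integrable lebesgue S f"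
  shows "set_integrable lebesgue S (\<lambda>t. Re (f t))" "(LINT t:S|lebesgue. Re (f t)) = Re (LINT t:S|lebesgue. f t)"
proof -
  have eq: "(\<lambda>t. indicator S t *\<^sub>R Re (f t)) = (\<lambda>t. Re (indicator S t *\<^sub>R f t))" by simp
  show "set_integrable lebesgue S (\<lambda>t. Re (f t))"
    using assms unfolding set_integrable_def eq by (rule integrable_Re)
  show "(LINT t:S|lebesgue. Re (f t)) = Re (LINT t:S|lebesgue. f t)"
    using assms unfolding set_integrable_def set_lebesgue_integral_def eq by (rule integral_Re)
qed

text \<open>The Caccioppoli estimate: integrate the derivative of \<open>\<theta>\<^sup>2 cnj P P'\<close>.\<close>
lemma caccioppoli:
  assumes P: "csmooth P" and \<theta>: "test_fun \<rho> \<theta>" "\<And>t. \<theta> t \<in> \<real>" and \<rho>: "0 < \<rho>"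
  shows "r2 {-\<rho>..\<rho>} (\<lambda>t. \<theta> t * cderiv P t) / 2 \<le>
    2 * r2 {-\<rho>..\<rho>} (\<lambda>t. cderiv \<theta> t * P t)
    - (LINT t:{-\<rho>..\<rho>}|lebesgue. Re ((\<theta> t)\<^sup>2 * cnj (P t) * cderiv (cderiv P) t))"
proof -
  let ?I = "{-\<rho>..\<rho>}"
  have lebI: "?I \<in> sets lebesgue" by simp
  have \<theta>s: "csmooth \<theta>" using \<theta>(1) by (rule test_fun_csmooth)
  define F where "F = (\<lambda>t. \<theta> t * (\<theta> t * (cnj (P t) * cderiv P t)))"
  have Fs: "csmooth F" unfolding F_def by (intro csmooth_mult \<theta>s csmooth_cnj P csmooth_cderiv)
  have dF: "cderiv F t = \<theta> t * (\<theta> t * (cnj (P t) * cderiv (cderiv P) t + cnj (cderiv P t) * cderiv P t)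
      + cderiv \<theta> t * (cnj (P t) * cderiv P t)) + cderiv \<theta> t * (\<theta> t * (cnj (P t) * cderiv P t))" for t
    unfolding F_def using P \<theta>s by (simp add: cderiv_mult csmooth_mult csmooth_cnj csmooth_cderiv cderiv_cnj)
  have z: "(LINT t:?I|lebesgue. cderiv F t) = 0"
    using csmooth_FTC[OF Fs, of "-\<rho>" \<rho>] \<rho> \<theta>(1) by (simp add: F_def test_fun_def)
  have i1: "set_integrable lebesgue ?I (cderiv F)" by (intro csmooth_set_integrable csmooth_cderiv Fs)
  note i1' = set_integral_Re(1)[OF i1]
  have z': "(LINT t:?I|lebesgue. Re (cderiv F t)) = 0" using z set_integral_Re(2)[OF i1] by simp
  have l1: "L2 ?I (\<lambda>t. \<theta> t * cderiv P t)" and l2: "L2 ?I (\<lambda>t. cderiv \<theta> t * P t)"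
    by (intro L2_csmooth csmooth_mult \<theta>s P csmooth_cderiv)+
  have i2: "set_integrable lebesgue ?I (\<lambda>t. (\<theta> t)\<^sup>2 * cnj (P t) * cderiv (cderiv P) t)"
    unfolding power2_eq_square by (intro csmooth_set_integrable csmooth_mult \<theta>s csmooth_cnj P csmooth_cderiv)
  note i2' = set_integral_Re(1)[OF i2]
  \<comment> \<open>\<open>Re (cderiv F t)\<close> is kept on the right because it integrates to 0.
    The cross term between \<theta> P' and \<theta>' P is split by 2ab <= a^2/2 + 2b^2, so that half
    of |\<theta> P'|^2 is absorbed on the left.\<close>
  have pw: "(cmod (\<theta> t * cderiv P t))\<^sup>2 / 2 \<le> 2 * (cmod (cderiv \<theta> t * P t))\<^sup>2
     - Re ((\<theta> t)\<^sup>2 * cnj (P t) * cderiv (cderiv P) t) + Re (cderiv F t)" for t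
  proof -
    obtain th th' where th: "\<theta> t = of_real th" "cderiv \<theta> t = of_real th'"
      using \<theta>(2)[of t] cderiv_Reals[OF \<theta>s \<theta>(2), of t] by (auto elim!: Reals_cases)
    define w where "w = cnj (P t) * cderiv P t"
    have "Re (cderiv F t) = Re ((\<theta> t)\<^sup>2 * cnj (P t) * cderiv (cderiv P) t) + th\<^sup>2 * (cmod (cderiv P t))\<^sup>2 + 2 * th * th' * Re w"
      unfolding dF th cmod_power2 w_def by (simp add: power2_eq_square algebra_simps)
    moreover have "- (2 * th * th' * Re w) \<le> 2 * (\<bar>th\<bar> * cmod (cderiv P t)) * (\<bar>th'\<bar> * cmod (P t))"
    proof -
      have "- (2 * th * th' * Re w) \<le> \<bar>2 * th * th'\<bar> * \<bar>Re w\<bar>" by (metis abs_ge_minus_self abs_mult)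
      also have "\<dots> \<le> \<bar>2 * th * th'\<bar> * cmod w" by (intro mult_left_mono abs_Re_le_cmod) auto
      also have "\<dots> = 2 * (\<bar>th\<bar> * cmod (cderiv P t)) * (\<bar>th'\<bar> * cmod (P t))" by (simp add: w_def norm_mult abs_mult)
      finally show ?thesis .
    qed
    moreover note two_mult_le[of "\<bar>th\<bar> * cmod (cderiv P t)" "\<bar>th'\<bar> * cmod (P t)"]
    ultimately show ?thesis by (simp add: th norm_mult power_mult_distrib algebra_simps)
  qed
  have "r2 ?I (\<lambda>t. \<theta> t * cderiv P t) / 2 = (LINT t:?I|lebesgue. (cmod (\<theta> t * cderiv P t))\<^sup>2 / 2)"
    by (simp add: L2_set_integrable(2)[OF l1 lebI])
  also have "\<dots> \<le> (LINT t:?I|lebesgue. 2 * (cmod (cderiv \<theta> t * P t))\<^sup>2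
     - Re ((\<theta> t)\<^sup>2 * cnj (P t) * cderiv (cderiv P) t) + Re (cderiv F t))"
    by (rule set_integral_mono[OF _ _ pw])
       (intro set_integral_add set_integral_diff i1' i2' set_integrable_mult_right set_integrable_divide
         L2_set_integrable(1)[OF l1 lebI] L2_set_integrable(1)[OF l2 lebI] impI)+
  also have "\<dots> = (LINT t:?I|lebesgue. 2 * (cmod (cderiv \<theta> t * P t))\<^sup>2
     - Re ((\<theta> t)\<^sup>2 * cnj (P t) * cderiv (cderiv P) t)) + (LINT t:?I|lebesgue. Re (cderiv F t))"
    by (intro set_integral_add set_integral_diff i1' i2' set_integrable_mult_right L2_set_integrable(1)[OF l2 lebI] impI)
  also have "\<dots> = 2 * (LINT t:?I|lebesgue. (cmod (cderiv \<theta> t * P t))\<^sup>2)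
     - (LINT t:?I|lebesgue. Re ((\<theta> t)\<^sup>2 * cnj (P t) * cderiv (cderiv P) t))"
  proof -
    have i3: "set_integrable lebesgue ?I (\<lambda>t. 2 * (cmod (cderiv \<theta> t * P t))\<^sup>2)"
      by (intro set_integrable_mult_right L2_set_integrable(1)[OF l2 lebI] impI)
    show ?thesis unfolding z' set_integral_diff(2)[OF i3 i2'] set_integral_mult_right by simp
  qed
  finally show ?thesis by (simp add: L2_set_integrable(2)[OF l2 lebI])
qed

lemma n2_zero_outside:
  assumes "\<And>t. t \<notin> S \<Longrightarrow> f t = 0" "S \<subseteq> T"
  shows "n2 T f = n2 S f"
  unfolding n2_def using assms by (intro nn_integral_cong) (auto split: split_indicator)

lemma L2_tail:
  assumes "L2 UNIV f" "0 < \<epsilon>"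
  obtains R0 where "\<And>R. R0 \<le> R \<Longrightarrow> r2 (- {-R..R}) f < \<epsilon>"
proof -
  have f [measurable]: "f \<in> borel_measurable lebesgue" and fi: "n2 UNIV f < \<infinity>" using assms by (auto simp: L2_def)
  have [measurable]: "- {-(real n)..real n} \<in> sets lebesgue" for n by auto
  have "(\<lambda>n. n2 (- {-(real n)..real n}) f) \<longlonglongrightarrow> (\<integral>\<^sup>+(t::real). 0 \<partial>lebesgue)"
    unfolding n2_def
  proof (rule nn_integral_dominated_convergence[where w="\<lambda>t. ennreal ((cmod (f t))\<^sup>2)"])
    show "AE t in lebesgue. (\<lambda>n. ennreal ((cmod (f t))\<^sup>2) * indicator (- {-(real n)..real n}) t) \<longlonglongrightarrow> 0"
    proof (rule AE_I2)
      fix t :: real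
      obtain k :: nat where k: "\<bar>t\<bar> \<le> real k" using real_arch_simple by blast
      have "\<forall>\<^sub>F n in sequentially. ennreal ((cmod (f t))\<^sup>2) * indicator (- {-(real n)..real n}) t = 0"
        unfolding eventually_sequentially using k by (intro exI[of _ k]) (auto simp: abs_if split: if_splits)
      then show "(\<lambda>n. ennreal ((cmod (f t))\<^sup>2) * indicator (- {-(real n)..real n}) t) \<longlonglongrightarrow> 0"
        by (rule tendsto_eventually)
    qed
  qed (use fi in \<open>auto simp: n2_def split: split_indicator\<close>)
  then have "\<forall>\<^sub>F n in sequentially. n2 (- {-(real n)..real n}) f < ennreal \<epsilon>"
    using assms(2) by (intro order_tendstoD) auto
  then obtain n where n: "n2 (- {-(real n)..real n}) f < ennreal \<epsilon>" by (auto simp: eventually_sequentially)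
  have "r2 (- {-R..R}) f < \<epsilon>" if "real n \<le> R" for R
  proof -
    have "n2 (- {-R..R}) f \<le> n2 (- {-(real n)..real n}) f" using that by (intro n2_mono_set) auto
    with n have "n2 (- {-R..R}) f < ennreal \<epsilon>" by (rule le_less_trans[rotated])
    moreover have "L2 (- {-R..R}) f" using L2_mono_set[OF assms(1)] by auto
    ultimately show ?thesis by (simp add: r2_less_iff)
  qed
  then show ?thesis by (rule that)
qed

lemma r2_sum:
  assumes "finite J" "\<And>j. j \<in> J \<Longrightarrow> L2 S (f j)" "S \<in> sets lebesgue"
  shows "r2 S (\<lambda>t. \<Sum>j\<in>J. f j t) \<le> 2 ^ card J * (\<Sum>j\<in>J. r2 S (f j))"
  using assms(1,2)
proof (induction J)
  case empty
  then show ?case by (simp add: r2_def n2_def)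
next
  case (insert x J)
  have "r2 S (\<lambda>t. \<Sum>j\<in>insert x J. f j t) \<le> 2 * r2 S (f x) + 2 * r2 S (\<lambda>t. \<Sum>j\<in>J. f j t)"
    using insert assms(3) r2_add[of S "f x" "\<lambda>t. \<Sum>j\<in>J. f j t"] by (auto intro: L2_sum)
  also have "\<dots> \<le> 2 * r2 S (f x) + 2 * (2 ^ card J * (\<Sum>j\<in>J. r2 S (f j)))"
    using insert by auto
  also have "\<dots> \<le> 2 * 2 ^ card J * r2 S (f x) + 2 * (2 ^ card J * (\<Sum>j\<in>J. r2 S (f j)))"
    by (intro add_right_mono mult_right_mono) auto
  finally show ?case using insert by (simp add: algebra_simps)
qed

lemma cutoff_profile:
  obtains \<kappa> c1 c2 where "test_fun 2 \<kappa>" "\<And>t. \<bar>t\<bar> \<le> 1 \<Longrightarrow> \<kappa> t = 1" "\<And>t. \<kappa> t \<in> \<real>" "\<And>t. cmod (\<kappa> t) \<le> 1"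
    "0 < c1" "\<And>t. cmod (cderiv \<kappa> t) \<le> c1" "0 < c2" "\<And>t. cmod (cderiv (cderiv \<kappa>) t) \<le> c2"
proof -
  have *: "(- 2 :: real) < - 1" "(- 1 :: real) \<le> 1" "(1 :: real) < 2" by auto
  obtain \<kappa> where \<kappa>: "csmooth \<kappa>" "\<And>t. t \<le> -2 \<Longrightarrow> \<kappa> t = 0" "\<And>t. 2 \<le> t \<Longrightarrow> \<kappa> t = 0"
    "\<And>t. t \<in> {-1..1} \<Longrightarrow> \<kappa> t = 1" "\<And>t. \<kappa> t \<in> \<real>" "\<And>t. cmod (\<kappa> t) \<le> 1"
    by (rule smooth_plateau[OF *]) (rule that; assumption)
  have t: "test_fun 2 \<kappa>" using \<kappa> by (auto simp: test_fun_def abs_if split: if_splits)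
  have b: "\<exists>c>0. \<forall>t. cmod (f t) \<le> c" if f: "test_fun 2 f" for f
  proof -
    obtain M where M: "0 < M" "\<And>t. t \<in> {-2..2} \<Longrightarrow> cmod (f t) \<le> M"
      using cont_bounded[OF csmooth_cont[OF test_fun_csmooth[OF f]]] by metis
    have "cmod (f t) \<le> M" for t
    proof (cases "t \<in> {-2..2}")
      case False
      then have "2 \<le> \<bar>t\<bar>" by auto
      then show ?thesis using f M(1) by (auto simp: test_fun_def)
    qed (rule M)
    then show ?thesis using M by auto
  qed
  obtain c1 c2 where "0 < c1" "\<forall>t. cmod (cderiv \<kappa> t) \<le> c1" "0 < c2" "\<forall>t. cmod (cderiv (cderiv \<kappa>) t) \<le> c2"
    using b[OF test_fun_cderiv[OF t]] b[OF test_fun_cderiv[OF test_fun_cderiv[OF t]]] by metis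
  then show ?thesis using t \<kappa> by (intro that[of \<kappa> c1 c2]) (auto simp: abs_le_iff)
qed

section \<open>Matrix Schroedinger operators on the line\<close>

lemma test_fun_scale:
  assumes "test_fun 2 \<kappa>" "0 < R"
  shows "test_fun (2 * R) (\<lambda>t. \<kappa> (t / R))" "cderiv (\<lambda>t. \<kappa> (t / R)) = (\<lambda>t. of_real (1 / R) * cderiv \<kappa> (t / R))"
proof -
  have "csmooth (\<lambda>t. \<kappa> ((1 / R) * t + 0))" by (intro csmooth_affine test_fun_csmooth[OF assms(1)])
  then show "test_fun (2 * R) (\<lambda>t. \<kappa> (t / R))"
    using assms by (auto simp: test_fun_def field_simps)
  show "cderiv (\<lambda>t. \<kappa> (t / R)) = (\<lambda>t. of_real (1 / R) * cderiv \<kappa> (t / R))"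
    using cderiv_affine[OF test_fun_csmooth[OF assms(1)], of "1 / R" 0] by simp
qed

text \<open>This is the analytic heart: a weak solution pair is a limit, in the graph norm, of
  compactly supported smooth families. The hypotheses on \<open>V\<close> are asymmetric on purpose:
  the lower bound \<open>Vpos\<close> is uniform in time, while the upper bound \<open>Vb\<close> is
  only local, as for a potential growing at infinity. The weak equation pairs bilinearly, without
  conjugating \<open>\<phi>\<close>.\<close>

lemma schroedinger_core:
  fixes I :: "'i set" and X Y :: "'i \<Rightarrow> real \<Rightarrow> complex" and V :: "'i \<Rightarrow> 'i \<Rightarrow> real \<Rightarrow> complex"
  assumes fin: "finite I" and \<alpha>: "0 < \<alpha>" and c: "0 \<le> c" and \<epsilon>: "0 < \<epsilon>"
    and X: "\<And>i. i \<in> I \<Longrightarrow> L2 UNIV (X i)" and Y: "\<And>i. i \<in> I \<Longrightarrow> L2 UNIV (Y i)"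
    and V_entry: "\<And>i j. V i j \<in> borel_measurable lebesgue"
    and Vb: "\<And>R. \<exists>M. \<forall>i\<in>I. \<forall>j\<in>I. \<forall>t. \<bar>t\<bar> \<le> R \<longrightarrow> cmod (V i j t) \<le> M"
    and Vpos: "\<And>z t. - c * (\<Sum>i\<in>I. (cmod (z i))\<^sup>2) \<le> Re (\<Sum>i\<in>I. cnj (z i) * (\<Sum>j\<in>I. V i j t * z j))"
    and weak: "\<And>\<phi> i R. test_fun R \<phi> \<Longrightarrow> i \<in> I \<Longrightarrow> 0 < R \<Longrightarrow>
      (LINT t:{-R..R}|lebesgue. - of_real \<alpha> * cderiv (cderiv \<phi>) t * X i t + \<phi> t * (\<Sum>j\<in>I. V i j t * X j t))
      = (LINT t:{-R..R}|lebesgue. \<phi> t * Y i t)"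
  obtains u R where "\<And>i. i \<in> I \<Longrightarrow> test_fun R (u i)" "(\<Sum>i\<in>I. r2 UNIV (\<lambda>t. u i t - X i t)) < \<epsilon>"
    "(\<Sum>i\<in>I. r2 UNIV (\<lambda>t. - of_real \<alpha> * cderiv (cderiv (u i)) t + (\<Sum>j\<in>I. V i j t * u j t) - Y i t)) < \<epsilon>"
    "\<And>i. i \<in> I \<Longrightarrow> L2 UNIV (\<lambda>t. u i t - X i t)"
    "\<And>i. i \<in> I \<Longrightarrow> L2 UNIV (\<lambda>t. - of_real \<alpha> * cderiv (cderiv (u i)) t + (\<Sum>j\<in>I. V i j t * u j t) - Y i t)"
proof -
  obtain \<kappa> c1 c2 where \<kappa>: "test_fun 2 \<kappa>" "\<And>t. \<bar>t\<bar> \<le> 1 \<Longrightarrow> \<kappa> t = 1" "\<And>t. \<kappa> t \<in> \<real>" "\<And>t. cmod (\<kappa> t) \<le> 1"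
    and c1: "0 < c1" "\<And>t. cmod (cderiv \<kappa> t) \<le> c1" and c2: "0 < c2" "\<And>t. cmod (cderiv (cderiv \<kappa>) t) \<le> c2"
    using cutoff_profile by metis
  define n where "n = card I"
  define xx where "xx = (\<Sum>i\<in>I. r2 UNIV (X i))"
  define yy where "yy = (\<Sum>i\<in>I. r2 UNIV (Y i))"
  have xy0: "0 \<le> xx" "0 \<le> yy" by (auto simp: xx_def yy_def sum_nonneg)
  \<comment> \<open>\<open>pp\<close> bounds the squared norms of the approximants P on the window,
    \<open>K2\<close> / R^2 the squared norms of \<theta>' P', and \<open>KK\<close> / R^2
    everything the cutoff adds to the residual. None of these constants involves R or the local
    upper bound of \<open>V\<close>.\<close>
  define pp where "pp = 2 * xx + 2"
  define K1 where "K1 = (c / \<alpha> + 1 / \<alpha>) * pp + (1 + yy) / (2 * \<alpha>)"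
  define K2 where "K2 = 4 * c2\<^sup>2 * pp + 2 * c1\<^sup>2 * K1"
  define KK where "KK = 4 * (\<alpha>\<^sup>2 * c2\<^sup>2 * pp) + 4 * (4 * \<alpha>\<^sup>2 * K2)"
  have pp0: "0 < pp" using xy0 by (simp add: pp_def)
  have K10: "0 \<le> K1" using pp0 c \<alpha> xy0 by (auto simp: K1_def intro!: add_nonneg_nonneg mult_nonneg_nonneg)
  have K0: "0 \<le> K2" "0 \<le> KK" using pp0 K10 by (auto simp: K2_def KK_def intro!: add_nonneg_nonneg)
  define e3 where "e3 = \<epsilon> / (64 * (real n + 1))"
  have e3: "0 < e3" "16 * (real n * e3) \<le> \<epsilon> / 4"
    using \<epsilon> by (auto simp: e3_def field_simps)
  have "\<exists>R0. \<forall>i\<in>I. \<forall>R\<ge>R0. r2 (- {-R..R}) (X i) < e3 \<and> r2 (- {-R..R}) (Y i) < e3"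
  proof -
    have "\<exists>R0. \<forall>R\<ge>R0. r2 (- {-R..R}) (X i) < e3 \<and> r2 (- {-R..R}) (Y i) < e3" if ii: "i \<in> I" for i
    proof -
      obtain a b where "\<And>R. a \<le> R \<Longrightarrow> r2 (- {-R..R}) (X i) < e3" "\<And>R. b \<le> R \<Longrightarrow> r2 (- {-R..R}) (Y i) < e3"
        using L2_tail[OF X[OF ii] e3(1)] L2_tail[OF Y[OF ii] e3(1)] by metis
      then show ?thesis by (intro exI[of _ "max a b"]) auto
    qed
    then obtain r where r: "\<And>i R. i \<in> I \<Longrightarrow> r i \<le> R \<Longrightarrow> r2 (- {-R..R}) (X i) < e3 \<and> r2 (- {-R..R}) (Y i) < e3" by metis
    show ?thesis
    proof (intro exI ballI allI impI)
      fix i R assume "i \<in> I" "(\<Sum>i\<in>I. \<bar>r i\<bar>) \<le> R"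
      moreover have "\<bar>r i\<bar> \<le> (\<Sum>i\<in>I. \<bar>r i\<bar>)" using \<open>i \<in> I\<close> fin by (intro member_le_sum) auto
      ultimately show "r2 (- {-R..R}) (X i) < e3 \<and> r2 (- {-R..R}) (Y i) < e3" by (intro r) auto
    qed
  qed
  then obtain R0 where R0: "\<And>i R. i \<in> I \<Longrightarrow> R0 \<le> R \<Longrightarrow> r2 (- {-R..R}) (X i) < e3 \<and> r2 (- {-R..R}) (Y i) < e3" by blast
  \<comment> \<open>From R >= 1 follows R <= R^2, so R >= 4 KK / \<epsilon> already gives KK / R^2
    <= \<epsilon>/4; it also lets 1/R^4 be absorbed into 1/R^2. The bound by \<open>R0\<close> makes
    the tails of X and Y beyond R small.\<close>
  define R where "R = max 1 (max R0 (4 * KK / \<epsilon>))"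
  have R1: "1 \<le> R" "R0 \<le> R" "4 * KK / \<epsilon> \<le> R" by (auto simp: R_def)
  have KKR: "KK / R\<^sup>2 \<le> \<epsilon> / 4"
  proof -
    have "4 * KK \<le> R * \<epsilon>" using R1(3) \<epsilon> by (simp add: field_simps)
    also have "\<dots> \<le> R * R * \<epsilon>" using R1(1) \<epsilon> by (simp add: mult_le_cancel_right1)
    finally show ?thesis using R1(1) by (simp add: field_simps power2_eq_square)
  qed
  have R4: "x / R ^ 4 \<le> x / R\<^sup>2" if "0 \<le> x" for x
    using that R1(1) by (intro divide_left_mono power_increasing mult_pos_pos) auto
  let ?J = "{-(2*R)..2*R}"
  have lebJ: "?J \<in> sets lebesgue" by simp
  have rho_quad: "0 < 2 * R" using R1 by simp
  have XJ: "L2 ?J (X i)" and YJ: "L2 ?J (Y i)" if "i \<in> I" for i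
    using X[OF that] Y[OF that] L2_mono_set by blast+
  obtain M0 where M0: "\<And>i j t. i \<in> I \<Longrightarrow> j \<in> I \<Longrightarrow> \<bar>t\<bar> \<le> 2 * R \<Longrightarrow> cmod (V i j t) \<le> M0" using Vb[of "2*R"] by blast
  define M where "M = max M0 0"
  have M: "0 \<le> M" "\<And>i j t. i \<in> I \<Longrightarrow> j \<in> I \<Longrightarrow> t \<in> ?J \<Longrightarrow> cmod (V i j t) \<le> M"
    using M0 by (auto simp: M_def abs_le_iff max.coboundedI1)
  define g where "g = (\<lambda>i t. of_real (1 / \<alpha>) * ((\<Sum>j\<in>I. V i j t * X j t) - Y i t))"
  have VX: "L2 ?J (\<lambda>t. \<Sum>j\<in>I. V i j t * Z j t)" if "i \<in> I" "\<And>j. j \<in> I \<Longrightarrow> L2 ?J (Z j)" for i Z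
    using that M by (intro L2_sum L2_mult(1)[where M=M] V_entry lebJ) auto
  have gJ: "L2 ?J (g i)" if "i \<in> I" for i
    unfolding g_def by (intro L2_cmult L2_diff VX XJ YJ that lebJ)
  \<comment> \<open>Only now that R and hence \<open>M\<close> are fixed is the accuracy chosen:
    \<open>B\<close> is the factor by which an error \<delta> in X and X'' is magnified in the
    summed residuals. Keeping \<mu> below 1 makes \<open>pp\<close> valid whatever \<delta> turns
    out to be.\<close>
  define B where "B = real n * (2 * \<alpha>\<^sup>2 + 2 * (2 ^ n * (real n * M\<^sup>2)))"
  have B0: "0 \<le> B" by (simp add: B_def)
  define \<mu> where "\<mu> = min 1 (\<epsilon> / 32)"
  define \<delta> where "\<delta> = \<mu> / (B + real n + 1)"
  have \<mu>: "0 < \<mu>" "\<mu> \<le> 1" "\<mu> \<le> \<epsilon> / 32" using \<epsilon> by (auto simp: \<mu>_def)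
  have den: "0 < B + real n + 1" using B0 by linarith
  have \<delta>: "0 < \<delta>" using \<mu> den by (simp add: \<delta>_def)
  have \<delta>B: "B * \<delta> \<le> \<mu>" "real n * \<delta> \<le> \<mu>"
    using \<mu> den B0 by (auto simp: \<delta>_def field_simps)
  obtain C where C: "0 \<le> C" and Cw: "\<And>X g p. L2 ?J X \<Longrightarrow> L2 ?J g \<Longrightarrow>
      (\<And>\<phi>. test_fun (2*R) \<phi> \<Longrightarrow> (LINT t:?J|lebesgue. cderiv (cderiv \<phi>) t * X t) = (LINT t:?J|lebesgue. \<phi> t * g t)) \<Longrightarrow>
      csmooth p \<Longrightarrow>
      \<exists>P. csmooth P \<and> cderiv (cderiv P) = p \<and> r2 ?J (\<lambda>t. X t - P t) \<le> C * r2 ?J (\<lambda>t. g t - p t)"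
    by (rule weak_second_derivative[OF rho_quad]) blast
  have weak': "(LINT t:?J|lebesgue. cderiv (cderiv \<phi>) t * X i t) = (LINT t:?J|lebesgue. \<phi> t * g i t)"
    if \<phi>: "test_fun (2*R) \<phi>" and i: "i \<in> I" for \<phi> i
  proof -
    have l: "L2 ?J \<phi>" "L2 ?J (cderiv (cderiv \<phi>))" using L2_csmooth test_fun_csmooth \<phi> test_fun_cderiv by blast+
    have s: "set_integrable lebesgue ?J (\<lambda>t. cderiv (cderiv \<phi>) t * X i t)"
      "set_integrable lebesgue ?J (\<lambda>t. \<phi> t * (\<Sum>j\<in>I. V i j t * X j t))"
      "set_integrable lebesgue ?J (\<lambda>t. \<phi> t * Y i t)"
      using l i by (auto intro!: L2_CS(1) VX XJ YJ)
    have "- of_real \<alpha> * (LINT t:?J|lebesgue. cderiv (cderiv \<phi>) t * X i t) + (LINT t:?J|lebesgue. \<phi> t * (\<Sum>j\<in>I. V i j t * X j t))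
      = (LINT t:?J|lebesgue. (- of_real \<alpha>) * (cderiv (cderiv \<phi>) t * X i t) + \<phi> t * (\<Sum>j\<in>I. V i j t * X j t))"
    proof -
      have s1': "set_integrable lebesgue ?J (\<lambda>t. (- of_real \<alpha>) * (cderiv (cderiv \<phi>) t * X i t))"
        by (intro set_integrable_mult_right impI s)
      show ?thesis unfolding set_integral_add(2)[OF s1' s(2)] set_integral_mult_right ..
    qed
    also have "\<dots> = (LINT t:?J|lebesgue. \<phi> t * Y i t)"
      using weak[OF \<phi> i rho_quad] by (simp add: mult.assoc)
    finally have *: "of_real \<alpha> * (LINT t:?J|lebesgue. cderiv (cderiv \<phi>) t * X i t)
       = (LINT t:?J|lebesgue. \<phi> t * (\<Sum>j\<in>I. V i j t * X j t)) - (LINT t:?J|lebesgue. \<phi> t * Y i t)"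
      by (simp add: algebra_simps)
    have "(LINT t:?J|lebesgue. \<phi> t * g i t) = (LINT t:?J|lebesgue. of_real (1/\<alpha>) * (\<phi> t * (\<Sum>j\<in>I. V i j t * X j t) - \<phi> t * Y i t))"
      by (simp add: g_def algebra_simps)
    also have "\<dots> = of_real (1/\<alpha>) * (LINT t:?J|lebesgue. \<phi> t * (\<Sum>j\<in>I. V i j t * X j t) - \<phi> t * Y i t)"
      by (rule set_integral_mult_right)
    also have "\<dots> = of_real (1/\<alpha>) * (of_real \<alpha> * (LINT t:?J|lebesgue. cderiv (cderiv \<phi>) t * X i t))"
      unfolding * set_integral_diff(2)[OF s(2,3)] ..
    finally show ?thesis using \<alpha> by simp
  qed
  have "\<exists>P. csmooth P \<and> r2 ?J (\<lambda>t. X i t - P t) \<le> \<delta> \<and> r2 ?J (\<lambda>t. g i t - cderiv (cderiv P) t) \<le> \<delta>" if i: "i \<in> I" for i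
  proof -
    have d': "0 < \<delta> / (C + 1)" using \<delta> C by simp
    obtain p where p: "csmooth p" "r2 ?J (\<lambda>t. g i t - p t) < \<delta> / (C + 1)"
      using L2_approx_csmooth[OF gJ[OF i] d' rho_quad] by metis
    obtain P where P: "csmooth P" "cderiv (cderiv P) = p" "r2 ?J (\<lambda>t. X i t - P t) \<le> C * r2 ?J (\<lambda>t. g i t - p t)"
      using Cw[OF XJ[OF i] gJ[OF i] weak'[OF _ i] p(1)] by blast
    have "C * r2 ?J (\<lambda>t. g i t - p t) \<le> C * (\<delta> / (C + 1))" using p(2) C by (intro mult_left_mono) auto
    also have "\<dots> \<le> \<delta>" using \<delta> C by (simp add: field_simps)
    finally have "r2 ?J (\<lambda>t. X i t - P t) \<le> \<delta>" using P by simp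
    moreover have "\<delta> / (C + 1) \<le> \<delta>" using \<delta> C by (simp add: field_simps)
    ultimately show ?thesis using P p by (intro exI[of _ P]) auto
  qed
  then obtain P where P: "\<And>i. i \<in> I \<Longrightarrow> csmooth (P i)" "\<And>i. i \<in> I \<Longrightarrow> r2 ?J (\<lambda>t. X i t - P i t) \<le> \<delta>"
    "\<And>i. i \<in> I \<Longrightarrow> r2 ?J (\<lambda>t. g i t - cderiv (cderiv (P i)) t) \<le> \<delta>" by metis
  have PJ: "L2 ?J (P i)" and PdJ: "L2 ?J (cderiv (cderiv (P i)))" if "i \<in> I" for i
    using P(1)[OF that] by (auto intro: L2_csmooth)
  \<comment> \<open>The defect of P in the equation. Substituting the definition of \<open>g\<close>
    gives E = \<alpha> (g - P'') - V (X - P), so it is as small as the two approximation errors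
    allow.\<close>
  define E where "E = (\<lambda>i t. - of_real \<alpha> * cderiv (cderiv (P i)) t + (\<Sum>j\<in>I. V i j t * P j t) - Y i t)"
  have EJ: "L2 ?J (E i)" if "i \<in> I" for i
    unfolding E_def by (intro L2_diff L2_add L2_cmult VX PJ PdJ YJ that lebJ)
  have rX: "r2 ?J (X i) \<le> r2 UNIV (X i)" and rY: "r2 ?J (Y i) \<le> r2 UNIV (Y i)" if "i \<in> I" for i
    using r2_mono_set[OF X[OF that], of ?J] r2_mono_set[OF Y[OF that], of ?J] by auto
  have ee: "(\<Sum>i\<in>I. r2 ?J (E i)) \<le> \<mu>"
  proof -
    have "r2 ?J (E i) \<le> (2 * \<alpha>\<^sup>2 + 2 * (2 ^ n * (real n * M\<^sup>2))) * \<delta>" if i: "i \<in> I" for i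
    proof -
      have d1: "L2 ?J (\<lambda>t. g i t - cderiv (cderiv (P i)) t)" by (intro L2_diff gJ PdJ i lebJ)
      have d2: "L2 ?J (\<lambda>t. X j t - P j t)" if "j \<in> I" for j by (intro L2_diff XJ PJ that lebJ)
      have d3: "L2 ?J (\<lambda>t. V i j t * (X j t - P j t))" "r2 ?J (\<lambda>t. V i j t * (X j t - P j t)) \<le> M\<^sup>2 * r2 ?J (\<lambda>t. X j t - P j t)"
        if "j \<in> I" for j using L2_mult[OF d2[OF that], of "V i j" M] M i that V_entry by auto
      have "E i = (\<lambda>t. of_real \<alpha> * (g i t - cderiv (cderiv (P i)) t) - (\<Sum>j\<in>I. V i j t * (X j t - P j t)))"
        using \<alpha> by (auto simp: fun_eq_iff E_def g_def algebra_simps sum_subtractf)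
      then have "r2 ?J (E i) \<le> 2 * r2 ?J (\<lambda>t. of_real \<alpha> * (g i t - cderiv (cderiv (P i)) t)) + 2 * r2 ?J (\<lambda>t. \<Sum>j\<in>I. V i j t * (X j t - P j t))"
        using r2_diff[OF L2_cmult[OF d1 lebJ, of "of_real \<alpha>"] L2_sum[OF d3(1) lebJ, of I "\<lambda>j. j"] lebJ] by simp
      also have "r2 ?J (\<lambda>t. of_real \<alpha> * (g i t - cderiv (cderiv (P i)) t)) \<le> \<alpha>\<^sup>2 * \<delta>"
        using order_trans[OF r2_cmult[OF d1 lebJ, of "of_real \<alpha>"], of "\<alpha>\<^sup>2 * \<delta>"] P(3)[OF i] by (simp add: mult_left_mono)
      also have "r2 ?J (\<lambda>t. \<Sum>j\<in>I. V i j t * (X j t - P j t)) \<le> 2 ^ n * (\<Sum>j\<in>I. r2 ?J (\<lambda>t. V i j t * (X j t - P j t)))"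
        unfolding n_def by (intro r2_sum fin d3 lebJ)
      also have "(\<Sum>j\<in>I. r2 ?J (\<lambda>t. V i j t * (X j t - P j t))) \<le> (\<Sum>j\<in>I. M\<^sup>2 * \<delta>)"
        by (intro sum_mono order_trans[OF d3(2)] mult_left_mono P(2)) auto
      finally show ?thesis by (simp add: n_def algebra_simps)
    qed
    then have "(\<Sum>i\<in>I. r2 ?J (E i)) \<le> (\<Sum>i\<in>I. (2 * \<alpha>\<^sup>2 + 2 * (2 ^ n * (real n * M\<^sup>2))) * \<delta>)" by (intro sum_mono) auto
    also have "\<dots> = B * \<delta>" by (simp add: B_def n_def)
    finally show ?thesis using \<delta>B by linarith
  qed
  have pJ: "(\<Sum>i\<in>I. r2 ?J (P i)) \<le> pp"
  proof -
    have "r2 ?J (P i) \<le> 2 * r2 UNIV (X i) + 2 * \<delta>" if i: "i \<in> I" for i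
    proof -
      have "r2 ?J (\<lambda>t. X i t - (X i t - P i t)) \<le> 2 * r2 ?J (X i) + 2 * r2 ?J (\<lambda>t. X i t - P i t)"
        by (intro r2_diff L2_diff XJ PJ i lebJ)
      then show ?thesis using rX[OF i] P(2)[OF i] by simp
    qed
    then have "(\<Sum>i\<in>I. r2 ?J (P i)) \<le> (\<Sum>i\<in>I. 2 * r2 UNIV (X i) + 2 * \<delta>)" by (intro sum_mono) auto
    also have "\<dots> = 2 * xx + 2 * (real n * \<delta>)" by (simp add: sum.distrib xx_def n_def sum_distrib_left)
    finally show ?thesis using \<delta>B \<mu> by (simp add: pp_def)
  qed
  define \<theta> where "\<theta> = (\<lambda>t. \<kappa> (t / R))"
  have Rpos: "0 < R" using R1 by simp
  note ts = test_fun_scale[OF \<kappa>(1) Rpos] test_fun_scale[OF test_fun_cderiv[OF \<kappa>(1)] Rpos]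
  have \<theta>: "test_fun (2 * R) \<theta>" using ts(1) by (simp add: \<theta>_def)
  have \<theta>s: "csmooth \<theta>" using \<theta> by (rule test_fun_csmooth)
  have \<theta>1: "test_fun (2 * R) (cderiv \<theta>)" using \<theta> by (rule test_fun_cderiv)
  have \<theta>R: "\<theta> t \<in> \<real>" "cderiv \<theta> t \<in> \<real>" for t using \<kappa>(3) cderiv_Reals[OF \<theta>s] by (auto simp: \<theta>_def)
  have \<theta>b: "cmod (\<theta> t) \<le> 1" for t using \<kappa>(4) by (simp add: \<theta>_def)
  have \<theta>'b: "cmod (cderiv \<theta> t) \<le> c1 / R" for t
    using c1(2) Rpos by (simp add: \<theta>_def ts(2) norm_mult norm_divide divide_right_mono)
  have \<theta>''b: "cmod (cderiv (cderiv \<theta>) t) \<le> c2 / R\<^sup>2" for t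
  proof -
    have cs: "csmooth (\<lambda>x. cderiv \<kappa> (x / R))" using ts(3) by (rule test_fun_csmooth)
    have "cderiv (cderiv \<theta>) t = of_real (1 / R) * (of_real (1 / R) * cderiv (cderiv \<kappa>) (t / R))"
      unfolding \<theta>_def ts(2) cderiv_cmult[OF cs] ts(4) ..
    then show ?thesis using c2(2)[of "t / R"] Rpos by (simp add: norm_mult norm_divide power2_eq_square divide_right_mono)
  qed
  have s1: "r2 ?J (\<lambda>t. cderiv (cderiv \<theta>) t * P i t) \<le> (c2 / R\<^sup>2)\<^sup>2 * r2 ?J (P i)" if "i \<in> I" for i
    using c2 Rpos by (intro L2_mult(2) PJ that \<theta>''b csmooth_measurable csmooth_cderiv \<theta>s lebJ) auto
  have s2: "(\<Sum>i\<in>I. r2 ?J (\<lambda>t. cderiv (cderiv \<theta>) t * P i t)) \<le> c2\<^sup>2 * pp / R ^ 4"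
  proof -
    have "(\<Sum>i\<in>I. r2 ?J (\<lambda>t. cderiv (cderiv \<theta>) t * P i t)) \<le> (\<Sum>i\<in>I. (c2 / R\<^sup>2)\<^sup>2 * r2 ?J (P i))" by (intro sum_mono s1)
    also have "\<dots> = (c2 / R\<^sup>2)\<^sup>2 * (\<Sum>i\<in>I. r2 ?J (P i))" by (simp add: sum_distrib_left)
    also have "\<dots> \<le> (c2 / R\<^sup>2)\<^sup>2 * pp" by (intro mult_left_mono pJ) auto
    also have "\<dots> = c2\<^sup>2 * pp / R ^ 4" by (simp add: power_divide)
    finally show ?thesis .
  qed
  \<comment> \<open>The function inserted in the Caccioppoli estimate is \<theta>' rather than
    \<theta>, because \<theta>' P' is the term to be bounded; its size O(1/R) produces the decay.
    P'' is eliminated through \<alpha> P'' = V P - Y - E, after which \<open>V\<close> enters only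
    through its lower bound.\<close>
  have cacc: "(\<Sum>i\<in>I. r2 ?J (\<lambda>t. cderiv \<theta> t * cderiv (P i) t)) \<le> K2 / R\<^sup>2"
  proof -
    define w where "w = (\<lambda>i t. Re ((cderiv \<theta> t)\<^sup>2 * cnj (P i t) * cderiv (cderiv (P i)) t))"
    have wint: "set_integrable lebesgue ?J (w i)" if "i \<in> I" for i
      unfolding w_def power2_eq_square
      by (intro set_integral_Re csmooth_set_integrable csmooth_mult csmooth_cderiv \<theta>s csmooth_cnj P(1) that)
    have pw: "(\<Sum>i\<in>I. - w i t) \<le> (c1 / R)\<^sup>2 * ((c / \<alpha> + 1 / \<alpha>) * (\<Sum>i\<in>I. (cmod (P i t))\<^sup>2) + (1 / (2 * \<alpha>)) * (\<Sum>i\<in>I. (cmod (E i t))\<^sup>2 + (cmod (Y i t))\<^sup>2))" for t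
    proof -
      obtain th where th: "cderiv \<theta> t = of_real th" using \<theta>R(2)[of t] by (auto elim: Reals_cases)
      have th2: "th\<^sup>2 \<le> (c1 / R)\<^sup>2"
      proof -
        have "\<bar>th\<bar> \<le> c1 / R" using \<theta>'b[of t] by (simp add: th)
        then show ?thesis using abs_le_square_iff[of th "c1 / R"] by linarith
      qed
      have pd: "of_real \<alpha> * cderiv (cderiv (P i)) t = (\<Sum>j\<in>I. V i j t * P j t) - Y i t - E i t" for i
        by (simp add: E_def)
      have am: "\<bar>Re (cnj a * (b + d))\<bar> \<le> (cmod a)\<^sup>2 + ((cmod d)\<^sup>2 + (cmod b)\<^sup>2) / 2" for a b d
      proof -
        have "\<bar>Re (cnj a * (b + d))\<bar> \<le> cmod a * cmod (b + d)" by (metis abs_Re_le_cmod complex_mod_cnj norm_mult)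
        also have "\<dots> \<le> cmod a * (cmod b + cmod d)" by (intro mult_left_mono norm_triangle_ineq) auto
        also have "\<dots> \<le> (cmod a)\<^sup>2 + ((cmod d)\<^sup>2 + (cmod b)\<^sup>2) / 2"
          using sum_squares_bound[of "cmod a" "cmod b"] sum_squares_bound[of "cmod a" "cmod d"]
          by (simp add: field_simps)
        finally show ?thesis .
      qed
      have "\<alpha> * (\<Sum>i\<in>I. - Re (cnj (P i t) * cderiv (cderiv (P i)) t)) = (\<Sum>i\<in>I. - Re (cnj (P i t) * (of_real \<alpha> * cderiv (cderiv (P i)) t)))"
        by (simp add: sum_distrib_left algebra_simps)
      also have "\<dots> = (\<Sum>i\<in>I. - Re (cnj (P i t) * (\<Sum>j\<in>I. V i j t * P j t)) + Re (cnj (P i t) * (Y i t + E i t)))"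
        unfolding pd by (intro sum.cong refl) (simp add: algebra_simps)
      also have "\<dots> = - Re (\<Sum>i\<in>I. cnj (P i t) * (\<Sum>j\<in>I. V i j t * P j t)) + (\<Sum>i\<in>I. Re (cnj (P i t) * (Y i t + E i t)))"
        unfolding sum.distrib sum_negf Re_sum ..
      also have "\<dots> \<le> c * (\<Sum>i\<in>I. (cmod (P i t))\<^sup>2) + (\<Sum>i\<in>I. (cmod (P i t))\<^sup>2 + ((cmod (E i t))\<^sup>2 + (cmod (Y i t))\<^sup>2) / 2)"
        using Vpos[of "\<lambda>i. P i t" t] by (intro add_mono sum_mono order_trans[OF abs_ge_self am]) auto
      also have "\<dots> = \<alpha> * ((c / \<alpha> + 1 / \<alpha>) * (\<Sum>i\<in>I. (cmod (P i t))\<^sup>2) + (1 / (2 * \<alpha>)) * (\<Sum>i\<in>I. (cmod (E i t))\<^sup>2 + (cmod (Y i t))\<^sup>2))"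
        using \<alpha> by (simp add: sum.distrib field_simps sum_divide_distrib[symmetric] sum_distrib_left)
      finally have le: "(\<Sum>i\<in>I. - Re (cnj (P i t) * cderiv (cderiv (P i)) t)) \<le>
        (c / \<alpha> + 1 / \<alpha>) * (\<Sum>i\<in>I. (cmod (P i t))\<^sup>2) + (1 / (2 * \<alpha>)) * (\<Sum>i\<in>I. (cmod (E i t))\<^sup>2 + (cmod (Y i t))\<^sup>2)"
        using \<alpha> by simp
      have "(\<Sum>i\<in>I. - w i t) = th\<^sup>2 * (\<Sum>i\<in>I. - Re (cnj (P i t) * cderiv (cderiv (P i)) t))"
        unfolding th w_def by (simp add: sum_distrib_left power2_eq_square algebra_simps)
      also have "\<dots> \<le> th\<^sup>2 * ((c / \<alpha> + 1 / \<alpha>) * (\<Sum>i\<in>I. (cmod (P i t))\<^sup>2) + (1 / (2 * \<alpha>)) * (\<Sum>i\<in>I. (cmod (E i t))\<^sup>2 + (cmod (Y i t))\<^sup>2))"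
        by (intro mult_left_mono le) auto
      also have "\<dots> \<le> (c1 / R)\<^sup>2 * ((c / \<alpha> + 1 / \<alpha>) * (\<Sum>i\<in>I. (cmod (P i t))\<^sup>2) + (1 / (2 * \<alpha>)) * (\<Sum>i\<in>I. (cmod (E i t))\<^sup>2 + (cmod (Y i t))\<^sup>2))"
        using c \<alpha> by (intro mult_right_mono th2 add_nonneg_nonneg mult_nonneg_nonneg sum_nonneg) auto
      finally show ?thesis .
    qed
    note sqi = L2_set_integrable(1)[OF PJ lebJ] L2_set_integrable(1)[OF EJ lebJ] L2_set_integrable(1)[OF YJ lebJ]
    have ssum: "set_integrable lebesgue ?J (\<lambda>t. \<Sum>i\<in>I. f i t)" "(LINT t:?J|lebesgue. (\<Sum>i\<in>I. f i t)) = (\<Sum>i\<in>I. (LINT t:?J|lebesgue. f i t))"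
      if "\<And>i. i \<in> I \<Longrightarrow> set_integrable lebesgue ?J (f i)" for f :: "'i \<Rightarrow> real \<Rightarrow> real"
      unfolding set_integrable_def set_lebesgue_integral_def scaleR_sum_right
      by (rule Bochner_Integration.integrable_sum Bochner_Integration.integral_sum,
          erule that[unfolded set_integrable_def])+
    have neg: "set_integrable lebesgue ?J (\<lambda>t. - w i t)" "(LINT t:?J|lebesgue. - w i t) = - (LINT t:?J|lebesgue. w i t)"
      if "i \<in> I" for i
    proof -
      have "set_integrable lebesgue ?J (\<lambda>t. (-1) * w i t)"
        by (intro set_integrable_mult_right impI wint that)
      then show "set_integrable lebesgue ?J (\<lambda>t. - w i t)" by simp
      have "(LINT t:?J|lebesgue. (-1) * w i t) = (-1) * (LINT t:?J|lebesgue. w i t)"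
        by (rule set_integral_mult_right)
      then show "(LINT t:?J|lebesgue. - w i t) = - (LINT t:?J|lebesgue. w i t)" by simp
    qed
    have 3: "set_integrable lebesgue ?J (\<lambda>t. \<Sum>i\<in>I. (cmod (P i t))\<^sup>2)"
        "set_integrable lebesgue ?J (\<lambda>t. \<Sum>i\<in>I. (cmod (E i t))\<^sup>2 + (cmod (Y i t))\<^sup>2)"
      by (intro ssum(1) set_integral_add(1) sqi; assumption)+
    have "(\<Sum>i\<in>I. - (LINT t:?J|lebesgue. w i t)) = (\<Sum>i\<in>I. (LINT t:?J|lebesgue. - w i t))"
      by (intro sum.cong refl neg(2)[symmetric])
    also have "\<dots> = (LINT t:?J|lebesgue. (\<Sum>i\<in>I. - w i t))"
      by (intro ssum(2)[symmetric] neg(1))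
    also have "\<dots> \<le> (LINT t:?J|lebesgue. (c1 / R)\<^sup>2 * ((c / \<alpha> + 1 / \<alpha>) * (\<Sum>i\<in>I. (cmod (P i t))\<^sup>2) + (1 / (2 * \<alpha>)) * (\<Sum>i\<in>I. (cmod (E i t))\<^sup>2 + (cmod (Y i t))\<^sup>2)))"
      by (rule set_integral_mono[OF _ _ pw])
         (intro ssum(1) neg(1) set_integral_add(1) set_integrable_mult_right impI 3; assumption)+
    also have "\<dots> = (c1 / R)\<^sup>2 * ((c / \<alpha> + 1 / \<alpha>) * (\<Sum>i\<in>I. r2 ?J (P i)) + (1 / (2 * \<alpha>)) * (\<Sum>i\<in>I. r2 ?J (E i) + r2 ?J (Y i)))"
    proof -
      have 1: "(LINT t:?J|lebesgue. (\<Sum>i\<in>I. (cmod (P i t))\<^sup>2)) = (\<Sum>i\<in>I. r2 ?J (P i))"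
        using sqi(1) by (subst ssum(2)) (auto intro!: sum.cong L2_set_integrable(2)[OF PJ lebJ, symmetric])
      have 2: "(LINT t:?J|lebesgue. (\<Sum>i\<in>I. (cmod (E i t))\<^sup>2 + (cmod (Y i t))\<^sup>2)) = (\<Sum>i\<in>I. r2 ?J (E i) + r2 ?J (Y i))"
        using sqi(2,3)
        by (subst ssum(2)) (auto intro!: sum.cong set_integral_add(1) simp: set_integral_add(2) L2_set_integrable(2)[OF EJ lebJ] L2_set_integrable(2)[OF YJ lebJ])
      show ?thesis
        unfolding set_integral_mult_right 1[symmetric] 2[symmetric]
        by (subst set_integral_add(2)) (intro set_integrable_mult_right 3 impI, intro set_integrable_mult_right 3 impI, simp only: set_integral_mult_right)
    qed
    also have "\<dots> \<le> (c1 / R)\<^sup>2 * ((c / \<alpha> + 1 / \<alpha>) * pp + (1 / (2 * \<alpha>)) * (1 + yy))"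
    proof -
      have "(\<Sum>i\<in>I. r2 ?J (E i) + r2 ?J (Y i)) \<le> 1 + yy"
        unfolding sum.distrib yy_def using ee \<mu> by (intro add_mono sum_mono rY) auto
      then show ?thesis using c \<alpha> by (intro mult_left_mono add_mono pJ) auto
    qed
    also have "\<dots> = c1\<^sup>2 * K1 / R\<^sup>2" by (simp add: K1_def power_divide)
    finally have wle: "(\<Sum>i\<in>I. - (LINT t:?J|lebesgue. w i t)) \<le> c1\<^sup>2 * K1 / R\<^sup>2" .
    have "(\<Sum>i\<in>I. r2 ?J (\<lambda>t. cderiv \<theta> t * cderiv (P i) t)) / 2 = (\<Sum>i\<in>I. r2 ?J (\<lambda>t. cderiv \<theta> t * cderiv (P i) t) / 2)"
      by (rule sum_divide_distrib)
    also have "\<dots> \<le> (\<Sum>i\<in>I. 2 * r2 ?J (\<lambda>t. cderiv (cderiv \<theta>) t * P i t) + - (LINT t:?J|lebesgue. w i t))"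
    proof (rule sum_mono)
      fix i assume "i \<in> I"
      from caccioppoli[OF P(1)[OF this] \<theta>1 \<theta>R(2) rho_quad]
      show "r2 ?J (\<lambda>t. cderiv \<theta> t * cderiv (P i) t) / 2 \<le>
        2 * r2 ?J (\<lambda>t. cderiv (cderiv \<theta>) t * P i t) + - (LINT t:?J|lebesgue. w i t)"
        unfolding w_def by linarith
    qed
    also have "\<dots> = 2 * (\<Sum>i\<in>I. r2 ?J (\<lambda>t. cderiv (cderiv \<theta>) t * P i t)) + (\<Sum>i\<in>I. - (LINT t:?J|lebesgue. w i t))"
      by (simp only: sum.distrib sum_distrib_left)
    also have "\<dots> \<le> 2 * (c2\<^sup>2 * pp / R\<^sup>2) + c1\<^sup>2 * K1 / R\<^sup>2"
      using s2 R4[of "c2\<^sup>2 * pp"] pp0 wle by (intro add_mono mult_left_mono) auto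
    also have "\<dots> = K2 / R\<^sup>2 / 2" by (simp add: K2_def add_divide_distrib)
    finally show ?thesis by simp
  qed
  define u where "u = (\<lambda>i t. \<theta> t * P i t)"
  have ut: "test_fun (2 * R) (u i)" if "i \<in> I" for i
    unfolding u_def test_fun_def using \<theta> P(1)[OF that] by (auto simp: test_fun_def)
  have r2U: "r2 UNIV f = r2 ?J f" "L2 UNIV f \<longleftrightarrow> L2 ?J f" if "\<And>t. 2 * R \<le> \<bar>t\<bar> \<Longrightarrow> f t = 0" for f
  proof -
    have "f t = 0" if "t \<notin> ?J" for t using that \<open>\<And>t. 2 * R \<le> \<bar>t\<bar> \<Longrightarrow> f t = 0\<close>[of t] by (auto simp: abs_if split: if_splits)
    then have "n2 UNIV f = n2 ?J f" by (intro n2_zero_outside) auto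
    then show "r2 UNIV f = r2 ?J f" "L2 UNIV f \<longleftrightarrow> L2 ?J f" by (auto simp: r2_def L2_def)
  qed
  have tail: "L2 UNIV (\<lambda>t. (\<theta> t - 1) * f t)" "r2 UNIV (\<lambda>t. (\<theta> t - 1) * f t) \<le> 4 * r2 (- {-R..R}) f" if f: "L2 UNIV f" for f
  proof -
    have one: "\<theta> t = 1" if "t \<in> {-R..R}" for t
      unfolding \<theta>_def using that Rpos by (intro \<kappa>(2)) (auto simp: abs_le_iff field_simps)
    have "n2 UNIV (\<lambda>t. (\<theta> t - 1) * f t) = n2 (- {-R..R}) (\<lambda>t. (\<theta> t - 1) * f t)"
      using one by (intro n2_zero_outside) auto
    then have eq: "r2 UNIV (\<lambda>t. (\<theta> t - 1) * f t) = r2 (- {-R..R}) (\<lambda>t. (\<theta> t - 1) * f t)" by (simp add: r2_def)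
    have m: "(\<lambda>t. \<theta> t - 1) \<in> borel_measurable lebesgue" by (intro csmooth_measurable csmooth_diff \<theta>s csmooth_const)
    have b2: "cmod (\<theta> t - 1) \<le> 2" for t using norm_triangle_ineq4[of "\<theta> t" 1] \<theta>b[of t] by simp
    show "L2 UNIV (\<lambda>t. (\<theta> t - 1) * f t)" by (rule L2_mult(1)[OF f b2]) (use m in auto)
    have fl: "L2 (- {-R..R}) f" using L2_mono_set[OF f] by auto
    have "- {-R..R} \<in> sets lebesgue" by auto
    from L2_mult(2)[OF fl b2 _ m this] show "r2 UNIV (\<lambda>t. (\<theta> t - 1) * f t) \<le> 4 * r2 (- {-R..R}) f"
      unfolding eq by simp
  qed
  have le1: "L2 ?J (\<lambda>t. \<theta> t * f t)" "r2 ?J (\<lambda>t. \<theta> t * f t) \<le> r2 ?J f" if "L2 ?J f" for f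
    using L2_mult[OF that \<theta>b, of ] \<theta>s csmooth_measurable by (auto simp: lebJ)
  have z: "\<theta> t = 0" "cderiv \<theta> t = 0" "cderiv (cderiv \<theta>) t = 0" if "2 * R \<le> \<bar>t\<bar>" for t
    using \<theta> \<theta>1 test_fun_cderiv[OF \<theta>1] that by (auto simp: test_fun_def)
  have uX: "L2 UNIV (\<lambda>t. u i t - X i t) \<and> r2 UNIV (\<lambda>t. u i t - X i t) \<le> 2 * \<delta> + 8 * e3" if i: "i \<in> I" for i
  proof -
    have d: "L2 ?J (\<lambda>t. P i t - X i t)" by (intro L2_diff XJ PJ i lebJ)
    have a: "L2 UNIV (\<lambda>t. \<theta> t * (P i t - X i t))" "r2 UNIV (\<lambda>t. \<theta> t * (P i t - X i t)) \<le> \<delta>"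
    proof -
      have "r2 ?J (\<lambda>t. P i t - X i t) = r2 ?J (\<lambda>t. X i t - P i t)" by (simp only: r2_def n2_minus_commute[of ?J "P i" "X i"])
      then show "L2 UNIV (\<lambda>t. \<theta> t * (P i t - X i t))" "r2 UNIV (\<lambda>t. \<theta> t * (P i t - X i t)) \<le> \<delta>"
        using le1[OF d] P(2)[OF i] z by (auto simp: r2U)
    qed
    have eq: "(\<lambda>t. u i t - X i t) = (\<lambda>t. \<theta> t * (P i t - X i t) + (\<theta> t - 1) * X i t)"
      by (simp add: u_def fun_eq_iff algebra_simps)
    have "r2 UNIV (\<lambda>t. u i t - X i t) \<le> 2 * \<delta> + 2 * (4 * e3)"
      unfolding eq
      by (rule order_trans[OF r2_add[OF a(1) tail(1)[OF X[OF i]]]])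
         (use a tail(2)[OF X[OF i]] R0[OF i R1(2)] in auto)
    moreover have "L2 UNIV (\<lambda>t. u i t - X i t)" unfolding eq by (intro L2_add a tail X i) auto
    ultimately show ?thesis by simp
  qed
  let ?res = "\<lambda>i t. - of_real \<alpha> * cderiv (cderiv (u i)) t + (\<Sum>j\<in>I. V i j t * u j t) - Y i t"
  \<comment> \<open>By the Leibniz rule the defect of \<theta> P is \<theta> E + (\<theta> - 1) Y -
    \<alpha> \<theta>'' P - 2 \<alpha> \<theta>' P'. The matrix contributes no commutator, as
    \<theta> is scalar.\<close>
  have res: "L2 UNIV (?res i) \<and> r2 UNIV (?res i) \<le> 4 * r2 ?J (E i) + 16 * e3
      + 4 * (\<alpha>\<^sup>2 * r2 ?J (\<lambda>t. cderiv (cderiv \<theta>) t * P i t)) + 4 * (4 * \<alpha>\<^sup>2 * r2 ?J (\<lambda>t. cderiv \<theta> t * cderiv (P i) t))" if i: "i \<in> I" for i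
  proof -
    note Ps = P(1)[OF i]
    have du: "cderiv (cderiv (u i)) t = \<theta> t * cderiv (cderiv (P i)) t + 2 * (cderiv \<theta> t * cderiv (P i) t) + cderiv (cderiv \<theta>) t * P i t" for t
      unfolding u_def using Ps \<theta>s
      by (simp add: cderiv_mult cderiv_add csmooth_mult csmooth_cderiv)
    let ?a = "\<lambda>t. \<theta> t * E i t" and ?b = "\<lambda>t. (\<theta> t - 1) * Y i t"
      and ?c = "\<lambda>t. (- of_real \<alpha>) * (cderiv (cderiv \<theta>) t * P i t)"
      and ?d = "\<lambda>t. (- 2 * of_real \<alpha>) * (cderiv \<theta> t * cderiv (P i) t)"
    have Vu: "(\<Sum>j\<in>I. V i j t * u j t) = \<theta> t * (\<Sum>j\<in>I. V i j t * P j t)" for t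
      by (simp add: u_def sum_distrib_left mult_ac)
    have eq: "?res i = (\<lambda>t. (?a t + ?b t) + (?c t + ?d t))"
      unfolding du E_def Vu by (simp add: fun_eq_iff algebra_simps)
    have a: "L2 UNIV ?a" "r2 UNIV ?a \<le> r2 ?J (E i)" using le1[OF EJ[OF i]] z by (auto simp: r2U)
    have b: "L2 UNIV ?b" "r2 UNIV ?b \<le> 4 * e3" using tail[OF Y[OF i]] R0[OF i R1(2)] by auto
    have c0: "L2 ?J (\<lambda>t. cderiv (cderiv \<theta>) t * P i t)" "L2 ?J (\<lambda>t. cderiv \<theta> t * cderiv (P i) t)"
      by (intro L2_csmooth csmooth_mult csmooth_cderiv \<theta>s Ps)+
    have c: "L2 UNIV ?c" "r2 UNIV ?c \<le> \<alpha>\<^sup>2 * r2 ?J (\<lambda>t. cderiv (cderiv \<theta>) t * P i t)"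
      using L2_cmult[OF c0(1) lebJ, of "- of_real \<alpha>"] r2_cmult[OF c0(1) lebJ, of "- of_real \<alpha>"] z by (auto simp: r2U)
    have d: "L2 UNIV ?d" "r2 UNIV ?d \<le> 4 * \<alpha>\<^sup>2 * r2 ?J (\<lambda>t. cderiv \<theta> t * cderiv (P i) t)"
      using L2_cmult[OF c0(2) lebJ, of "- 2 * of_real \<alpha>"] r2_cmult[OF c0(2) lebJ, of "- 2 * of_real \<alpha>"] z
      by (auto simp: r2U norm_mult power_mult_distrib)
    have U: "UNIV \<in> sets (lebesgue :: real measure)" by auto
    note ab = L2_add[OF a(1) b(1) U] and cd = L2_add[OF c(1) d(1) U]
    have "L2 UNIV (?res i)" unfolding eq by (rule L2_add[OF ab cd U])
    moreover have "r2 UNIV (?res i) \<le> 2 * (2 * r2 UNIV ?a + 2 * r2 UNIV ?b) + 2 * (2 * r2 UNIV ?c + 2 * r2 UNIV ?d)"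
      unfolding eq
      by (rule order_trans[OF r2_add[OF ab cd U]]) (intro add_mono mult_left_mono r2_add[OF a(1) b(1) U] r2_add[OF c(1) d(1) U]; simp)
    moreover have "\<dots> \<le> 2 * (2 * r2 ?J (E i) + 2 * (4 * e3)) + 2 * (2 * (\<alpha>\<^sup>2 * r2 ?J (\<lambda>t. cderiv (cderiv \<theta>) t * P i t))
        + 2 * (4 * \<alpha>\<^sup>2 * r2 ?J (\<lambda>t. cderiv \<theta> t * cderiv (P i) t)))"
      by (intro add_mono mult_left_mono a(2) b(2) c(2) d(2); simp)
    ultimately show ?thesis by simp
  qed
  show ?thesis
  proof (rule that[of "2 * R" u])
    show "test_fun (2 * R) (u i)" if "i \<in> I" for i using ut[OF that] .
    show "L2 UNIV (\<lambda>t. u i t - X i t)" "L2 UNIV (?res i)" if "i \<in> I" for i using uX[OF that] res[OF that] by auto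
    have "(\<Sum>i\<in>I. r2 UNIV (\<lambda>t. u i t - X i t)) \<le> (\<Sum>i\<in>I. 2 * \<delta> + 8 * e3)" by (intro sum_mono) (use uX in auto)
    also have "\<dots> = 2 * (real n * \<delta>) + 8 * (real n * e3)" by (simp add: n_def algebra_simps)
    also have "\<dots> < \<epsilon>" using \<delta>B \<mu> e3(2) \<epsilon> by linarith
    finally show "(\<Sum>i\<in>I. r2 UNIV (\<lambda>t. u i t - X i t)) < \<epsilon>" .
    have "(\<Sum>i\<in>I. r2 UNIV (?res i)) \<le> (\<Sum>i\<in>I. 4 * r2 ?J (E i) + 16 * e3
      + 4 * (\<alpha>\<^sup>2 * r2 ?J (\<lambda>t. cderiv (cderiv \<theta>) t * P i t)) + 4 * (4 * \<alpha>\<^sup>2 * r2 ?J (\<lambda>t. cderiv \<theta> t * cderiv (P i) t)))"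
      by (intro sum_mono) (use res in auto)
    also have "\<dots> = 4 * (\<Sum>i\<in>I. r2 ?J (E i)) + 16 * (real n * e3)
      + 4 * (\<alpha>\<^sup>2 * (\<Sum>i\<in>I. r2 ?J (\<lambda>t. cderiv (cderiv \<theta>) t * P i t)))
      + 4 * (4 * \<alpha>\<^sup>2 * (\<Sum>i\<in>I. r2 ?J (\<lambda>t. cderiv \<theta> t * cderiv (P i) t)))"
      by (simp add: sum.distrib sum_distrib_left n_def)
    also have "\<dots> \<le> 4 * \<mu> + 16 * (real n * e3) + 4 * (\<alpha>\<^sup>2 * (c2\<^sup>2 * pp / R\<^sup>2)) + 4 * (4 * \<alpha>\<^sup>2 * (K2 / R\<^sup>2))"
      using s2 R4[of "c2\<^sup>2 * pp"] pp0 ee cacc by (intro add_mono mult_left_mono) auto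
    also have "\<dots> = 4 * \<mu> + 16 * (real n * e3) + KK / R\<^sup>2" by (simp add: KK_def add_divide_distrib)
    also have "\<dots> < \<epsilon>" using KKR e3(2) \<mu> \<epsilon> by linarith
    finally show "(\<Sum>i\<in>I. r2 UNIV (?res i)) < \<epsilon>" .
  qed
qed

section \<open>Weights of basis labels\<close>

definition weight :: "(int \<Rightarrow> int) \<Rightarrow> (int \<Rightarrow> int) \<Rightarrow> fb \<Rightarrow> int" where
  "weight wb wc \<beta> = sum wb (fst \<beta>) + sum wc (snd \<beta>)"

text \<open>A grading of Fock space recorded by supports: conservation laws and energy shifts of an
  operator become statements about how it moves the set \<open>C\<close>. One calculus then serves
  kinetic energy, charge and axial charge.\<close>

definition weight_supp :: "(int \<Rightarrow> int) \<Rightarrow> (int \<Rightarrow> int) \<Rightarrow> int set \<Rightarrow> fvec \<Rightarrow> bool" where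
  "weight_supp wb wc C \<psi> \<longleftrightarrow> (\<forall>\<beta>. \<psi> \<beta> \<noteq> 0 \<longrightarrow> \<beta> \<in> fock_basis \<and> weight wb wc \<beta> \<in> C)"

lemma wsD: "weight_supp wb wc C \<psi> \<Longrightarrow> \<psi> \<beta> \<noteq> 0 \<Longrightarrow> \<beta> \<in> fock_basis \<and> weight wb wc \<beta> \<in> C"
  unfolding weight_supp_def by blast

lemma fock_iff: "(M, N) \<in> fock_basis \<longleftrightarrow> finite M \<and> finite N"
  by (simp add: fock_basis_def)

lemma weight_supp_bdag: "weight_supp wb wc C \<psi> \<Longrightarrow> weight_supp wb wc ((\<lambda>x. x + wb n) ` C) (bdag n \<psi>)"
  unfolding weight_supp_def
proof (intro allI impI)
  fix \<beta> assume a: "\<forall>\<beta>. \<psi> \<beta> \<noteq> 0 \<longrightarrow> \<beta> \<in> fock_basis \<and> weight wb wc \<beta> \<in> C" "bdag n \<psi> \<beta> \<noteq> 0"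
  obtain M N where \<beta>: "\<beta> = (M, N)" by fastforce
  have "(M, N) \<in> fock_basis" "n \<in> M" "\<psi> (M - {n}, N) \<noteq> 0"
    using a(2) by (auto simp: bdag_def \<beta> split: if_splits)
  moreover have "sum wb M = sum wb (M - {n}) + wb n" if "finite M" "n \<in> M"
    using sum.remove[OF that, of wb] by simp
  ultimately show "\<beta> \<in> fock_basis \<and> weight wb wc \<beta> \<in> (\<lambda>x. x + wb n) ` C"
    using a(1) by (force simp: \<beta> weight_def fock_iff)
qed

lemma weight_supp_bann: "weight_supp wb wc C \<psi> \<Longrightarrow> weight_supp wb wc ((\<lambda>x. x - wb n) ` C) (bann n \<psi>)"
  unfolding weight_supp_def
proof (intro allI impI)
  fix \<beta> assume a: "\<forall>\<beta>. \<psi> \<beta> \<noteq> 0 \<longrightarrow> \<beta> \<in> fock_basis \<and> weight wb wc \<beta> \<in> C" "bann n \<psi> \<beta> \<noteq> 0"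
  obtain M N where \<beta>: "\<beta> = (M, N)" by fastforce
  have "(M, N) \<in> fock_basis" "n \<notin> M" "\<psi> (insert n M, N) \<noteq> 0"
    using a(2) by (auto simp: bann_def \<beta> split: if_splits)
  then show "\<beta> \<in> fock_basis \<and> weight wb wc \<beta> \<in> (\<lambda>x. x - wb n) ` C"
    using a(1) by (force simp: \<beta> weight_def fock_iff)
qed

lemma weight_supp_cdag: "weight_supp wb wc C \<psi> \<Longrightarrow> weight_supp wb wc ((\<lambda>x. x + wc n) ` C) (cdag n \<psi>)"
  unfolding weight_supp_def
proof (intro allI impI)
  fix \<beta> assume a: "\<forall>\<beta>. \<psi> \<beta> \<noteq> 0 \<longrightarrow> \<beta> \<in> fock_basis \<and> weight wb wc \<beta> \<in> C" "cdag n \<psi> \<beta> \<noteq> 0"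
  obtain M N where \<beta>: "\<beta> = (M, N)" by fastforce
  have "(M, N) \<in> fock_basis" "n \<in> N" "\<psi> (M, N - {n}) \<noteq> 0"
    using a(2) by (auto simp: cdag_def \<beta> split: if_splits)
  moreover have "sum wc N = sum wc (N - {n}) + wc n" if "finite N" "n \<in> N"
    using sum.remove[OF that, of wc] by simp
  ultimately show "\<beta> \<in> fock_basis \<and> weight wb wc \<beta> \<in> (\<lambda>x. x + wc n) ` C"
    using a(1) by (force simp: \<beta> weight_def fock_iff)
qed

lemma weight_supp_cann: "weight_supp wb wc C \<psi> \<Longrightarrow> weight_supp wb wc ((\<lambda>x. x - wc n) ` C) (cann n \<psi>)"
  unfolding weight_supp_def
proof (intro allI impI)
  fix \<beta> assume a: "\<forall>\<beta>. \<psi> \<beta> \<noteq> 0 \<longrightarrow> \<beta> \<in> fock_basis \<and> weight wb wc \<beta> \<in> C" "cann n \<psi> \<beta> \<noteq> 0"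
  obtain M N where \<beta>: "\<beta> = (M, N)" by fastforce
  have "(M, N) \<in> fock_basis" "n \<notin> N" "\<psi> (M, insert n N) \<noteq> 0"
    using a(2) by (auto simp: cann_def \<beta> split: if_splits)
  then show "\<beta> \<in> fock_basis \<and> weight wb wc \<beta> \<in> (\<lambda>x. x - wc n) ` C"
    using a(1) by (force simp: \<beta> weight_def fock_iff)
qed

lemma infsum_nz: "infsum f A \<noteq> 0 \<Longrightarrow> \<exists>k\<in>A. f k \<noteq> 0"
  by (metis infsum_0)

text \<open>Only nonvanishing is traced back to a summand. This is insensitive to convergence, since
  a family of zeros has \<open>infsum\<close> 0 and a divergent family has it by default.\<close>

lemma three_nz:
  "- infsum f A + sum g B + infsum h C \<noteq> (0::complex) \<Longrightarrow> (\<exists>k\<in>A. f k \<noteq> 0) \<or> (\<exists>k\<in>B. g k \<noteq> 0) \<or> (\<exists>k\<in>C. h k \<noteq> 0)"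
  "infsum f A + sum g B - infsum h C \<noteq> (0::complex) \<Longrightarrow> (\<exists>k\<in>A. f k \<noteq> 0) \<or> (\<exists>k\<in>B. g k \<noteq> 0) \<or> (\<exists>k\<in>C. h k \<noteq> 0)"
  by (rule ccontr, simp add: infsum_0)+

lemma weight_supp_im: "weight_supp wb wc (f ` g ` C) \<phi> \<Longrightarrow> (\<And>x. f (g x) = h x) \<Longrightarrow> weight_supp wb wc (h ` C) \<phi>"
  by (simp add: image_image)

text \<open>The witness may depend on the label: at every label where \<open>f\<close> is nonzero
  some summand is nonzero too, and the support of that summand is already known.\<close>

lemma weight_supp_three:
  assumes "\<And>\<beta>. f \<beta> \<noteq> 0 \<Longrightarrow> \<exists>g. weight_supp wb wc C g \<and> g \<beta> \<noteq> 0"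
  shows "weight_supp wb wc C f"
  using assms by (auto simp: weight_supp_def)

text \<open>The three hypotheses belong to the three kinds of terms, hopping of c modes, pair
  creation and hopping of b modes; all must shift the weight by the same amount. For kinetic energy
  it is \<open>m\<close>, for both charges 0.\<close>

lemma weight_supp_rhoR_pos:
  assumes w: "weight_supp wb wc C \<psi>"
    and d: "\<And>k. int m < k \<Longrightarrow> wc k - wc (k - int m) = d"
      "\<And>k. 0 < k \<Longrightarrow> k \<le> int m \<Longrightarrow> wb (int m - k) + wc k = d"
      "\<And>k. 0 \<le> k \<Longrightarrow> wb (k + int m) - wb k = d"
  shows "weight_supp wb wc ((\<lambda>x. x + d) ` C) (rhoR_pos m \<psi>)"
proof (rule weight_supp_three)
  fix \<beta> assume "rhoR_pos m \<psi> \<beta> \<noteq> 0"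
  from three_nz(1)[OF this[unfolded rhoR_pos_def]] consider k where "int m < k" "cdag k (cann (k - int m) \<psi>) \<beta> \<noteq> 0"
    | k where "0 < k" "k \<le> int m" "bdag (int m - k) (cdag k \<psi>) \<beta> \<noteq> 0"
    | k where "0 \<le> k" "bdag (k + int m) (bann k \<psi>) \<beta> \<noteq> 0"
    by auto
  then show "\<exists>g. weight_supp wb wc ((\<lambda>x. x + d) ` C) g \<and> g \<beta> \<noteq> 0"
  proof cases
    case (1 k)
    have "weight_supp wb wc ((\<lambda>x. x + d) ` C) (cdag k (cann (k - int m) \<psi>))"
      by (rule weight_supp_im[OF weight_supp_cdag[OF weight_supp_cann[OF w, of "k - int m"], of k]]) (use d(1)[OF 1(1)] in simp)
    then show ?thesis using 1 by blast
  next
    case (2 k)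
    have "weight_supp wb wc ((\<lambda>x. x + d) ` C) (bdag (int m - k) (cdag k \<psi>))"
      by (rule weight_supp_im[OF weight_supp_bdag[OF weight_supp_cdag[OF w, of k], of "int m - k"]]) (use d(2)[OF 2(1,2)] in simp)
    then show ?thesis using 2 by blast
  next
    case (3 k)
    have "weight_supp wb wc ((\<lambda>x. x + d) ` C) (bdag (k + int m) (bann k \<psi>))"
      by (rule weight_supp_im[OF weight_supp_bdag[OF weight_supp_bann[OF w, of k], of "k + int m"]]) (use d(3)[OF 3(1)] in simp)
    then show ?thesis using 3 by blast
  qed
qed

lemma weight_supp_rhoR_neg:
  assumes w: "weight_supp wb wc C \<psi>"
    and d: "\<And>k. int m < k \<Longrightarrow> wc k - wc (k - int m) = d"
      "\<And>k. 0 < k \<Longrightarrow> k \<le> int m \<Longrightarrow> wb (int m - k) + wc k = d"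
      "\<And>k. 0 \<le> k \<Longrightarrow> wb (k + int m) - wb k = d"
  shows "weight_supp wb wc ((\<lambda>x. x - d) ` C) (rhoR_neg m \<psi>)"
proof (rule weight_supp_three)
  fix \<beta> assume "rhoR_neg m \<psi> \<beta> \<noteq> 0"
  from three_nz(1)[OF this[unfolded rhoR_neg_def]] consider k where "int m < k" "cdag (k - int m) (cann k \<psi>) \<beta> \<noteq> 0"
    | k where "0 < k" "k \<le> int m" "cann k (bann (int m - k) \<psi>) \<beta> \<noteq> 0"
    | k where "0 \<le> k" "bdag k (bann (k + int m) \<psi>) \<beta> \<noteq> 0"
    by auto
  then show "\<exists>g. weight_supp wb wc ((\<lambda>x. x - d) ` C) g \<and> g \<beta> \<noteq> 0"
  proof cases
    case (1 k)
    have "weight_supp wb wc ((\<lambda>x. x - d) ` C) (cdag (k - int m) (cann k \<psi>))"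
      by (rule weight_supp_im[OF weight_supp_cdag[OF weight_supp_cann[OF w, of k], of "k - int m"]]) (use d(1)[OF 1(1)] in simp)
    then show ?thesis using 1 by blast
  next
    case (2 k)
    have "weight_supp wb wc ((\<lambda>x. x - d) ` C) (cann k (bann (int m - k) \<psi>))"
      by (rule weight_supp_im[OF weight_supp_cann[OF weight_supp_bann[OF w, of "int m - k"], of k]]) (use d(2)[OF 2(1,2)] in simp)
    then show ?thesis using 2 by blast
  next
    case (3 k)
    have "weight_supp wb wc ((\<lambda>x. x - d) ` C) (bdag k (bann (k + int m) \<psi>))"
      by (rule weight_supp_im[OF weight_supp_bdag[OF weight_supp_bann[OF w, of "k + int m"], of k]]) (use d(3)[OF 3(1)] in simp)
    then show ?thesis using 3 by blast
  qed
qed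

lemma weight_supp_rhoL_pos:
  assumes w: "weight_supp wb wc C \<psi>"
    and d: "\<And>k. k < - int m \<Longrightarrow> wb k - wb (k + int m) = d"
      "\<And>k. - int m \<le> k \<Longrightarrow> k < 0 \<Longrightarrow> wc (- k - int m) + wb k = d"
      "\<And>k. k \<le> 0 \<Longrightarrow> wc (k - int m) - wc k = d"
  shows "weight_supp wb wc ((\<lambda>x. x - d) ` C) (rhoL_pos m \<psi>)"
proof (rule weight_supp_three)
  fix \<beta> assume "rhoL_pos m \<psi> \<beta> \<noteq> 0"
  from three_nz(2)[OF this[unfolded rhoL_pos_def]] consider k where "k < - int m" "bdag (k + int m) (bann k \<psi>) \<beta> \<noteq> 0"
    | k where "- int m \<le> k" "k < 0" "cann (- k - int m) (bann k \<psi>) \<beta> \<noteq> 0"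
    | k where "k \<le> 0" "cdag k (cann (k - int m) \<psi>) \<beta> \<noteq> 0"
    by auto
  then show "\<exists>g. weight_supp wb wc ((\<lambda>x. x - d) ` C) g \<and> g \<beta> \<noteq> 0"
  proof cases
    case (1 k)
    have "weight_supp wb wc ((\<lambda>x. x - d) ` C) (bdag (k + int m) (bann k \<psi>))"
      by (rule weight_supp_im[OF weight_supp_bdag[OF weight_supp_bann[OF w, of k], of "k + int m"]]) (use d(1)[OF 1(1)] in simp)
    then show ?thesis using 1 by blast
  next
    case (2 k)
    have "weight_supp wb wc ((\<lambda>x. x - d) ` C) (cann (- k - int m) (bann k \<psi>))"
      by (rule weight_supp_im[OF weight_supp_cann[OF weight_supp_bann[OF w, of k], of "- k - int m"]]) (use d(2)[OF 2(1,2)] in simp)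
    then show ?thesis using 2 by blast
  next
    case (3 k)
    have "weight_supp wb wc ((\<lambda>x. x - d) ` C) (cdag k (cann (k - int m) \<psi>))"
      by (rule weight_supp_im[OF weight_supp_cdag[OF weight_supp_cann[OF w, of "k - int m"], of k]]) (use d(3)[OF 3(1)] in simp)
    then show ?thesis using 3 by blast
  qed
qed

lemma weight_supp_rhoL_neg:
  assumes w: "weight_supp wb wc C \<psi>"
    and d: "\<And>k. k < - int m \<Longrightarrow> wb k - wb (k + int m) = d"
      "\<And>k. - int m \<le> k \<Longrightarrow> k < 0 \<Longrightarrow> wc (- k - int m) + wb k = d"
      "\<And>k. k \<le> 0 \<Longrightarrow> wc (k - int m) - wc k = d"
  shows "weight_supp wb wc ((\<lambda>x. x + d) ` C) (rhoL_neg m \<psi>)"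
proof (rule weight_supp_three)
  fix \<beta> assume "rhoL_neg m \<psi> \<beta> \<noteq> 0"
  from three_nz(2)[OF this[unfolded rhoL_neg_def]] consider k where "k < - int m" "bdag k (bann (k + int m) \<psi>) \<beta> \<noteq> 0"
    | k where "- int m \<le> k" "k < 0" "bdag k (cdag (- k - int m) \<psi>) \<beta> \<noteq> 0"
    | k where "k \<le> 0" "cdag (k - int m) (cann k \<psi>) \<beta> \<noteq> 0"
    by auto
  then show "\<exists>g. weight_supp wb wc ((\<lambda>x. x + d) ` C) g \<and> g \<beta> \<noteq> 0"
  proof cases
    case (1 k)
    have "weight_supp wb wc ((\<lambda>x. x + d) ` C) (bdag k (bann (k + int m) \<psi>))"
      by (rule weight_supp_im[OF weight_supp_bdag[OF weight_supp_bann[OF w, of "k + int m"], of k]]) (use d(1)[OF 1(1)] in simp)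
    then show ?thesis using 1 by blast
  next
    case (2 k)
    have "weight_supp wb wc ((\<lambda>x. x + d) ` C) (bdag k (cdag (- k - int m) \<psi>))"
      by (rule weight_supp_im[OF weight_supp_bdag[OF weight_supp_cdag[OF w, of "- k - int m"], of k]]) (use d(2)[OF 2(1,2)] in simp)
    then show ?thesis using 2 by blast
  next
    case (3 k)
    have "weight_supp wb wc ((\<lambda>x. x + d) ` C) (cdag (k - int m) (cann k \<psi>))"
      by (rule weight_supp_im[OF weight_supp_cdag[OF weight_supp_cann[OF w, of k], of "k - int m"]]) (use d(3)[OF 3(1)] in simp)
    then show ?thesis using 3 by blast
  qed
qed

section \<open>Kinetic energy, charge and axial charge as weights\<close>

abbreviation kin :: "fb \<Rightarrow> int" where "kin \<equiv> weight abs abs"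
abbreviation chg :: "fb \<Rightarrow> int" where "chg \<equiv> weight (\<lambda>_. 1) (\<lambda>_. - 1)"
abbreviation sb5 :: "int \<Rightarrow> int" where "sb5 \<equiv> \<lambda>k. if 0 \<le> k then 1 else - 1"
abbreviation sc5 :: "int \<Rightarrow> int" where "sc5 \<equiv> \<lambda>k. if 0 < k then - 1 else 1"
abbreviation q5 :: "fb \<Rightarrow> int" where "q5 \<equiv> weight sb5 sc5"

lemma kin_nonneg: "0 \<le> kin \<beta>"
  by (auto simp: weight_def intro!: add_nonneg_nonneg sum_nonneg)

text \<open>A single mode of modulus above \<open>c\<close> already exceeds the bound. The two zero
  modes carry no energy, but doubling each configuration twice keeps the set finite.\<close>

lemma finite_kin: "finite {\<beta> \<in> fock_basis. kin \<beta> \<le> c}"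
proof (rule finite_subset)
  show "{\<beta> \<in> fock_basis. kin \<beta> \<le> c} \<subseteq> Pow {-c..c} \<times> Pow {-c..c}"
  proof safe
    fix M N k assume a: "(M, N) \<in> fock_basis" "kin (M, N) \<le> c"
    have n: "0 \<le> sum abs N" "0 \<le> sum abs M" by (auto intro: sum_nonneg)
    { assume "k \<in> M"
      then have "\<bar>k\<bar> \<le> sum abs M" using a by (intro member_le_sum) (auto simp: fock_iff)
      then show "k \<in> {-c..c}" using n a unfolding weight_def atLeastAtMost_iff fst_conv snd_conv by linarith }
    { assume "k \<in> N"
      then have "\<bar>k\<bar> \<le> sum abs N" using a by (intro member_le_sum) (auto simp: fock_iff)
      then show "k \<in> {-c..c}" using n a unfolding weight_def atLeastAtMost_iff fst_conv snd_conv by linarith }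
  qed
qed auto

lemma weight_supp_kin_finite: "weight_supp abs abs {..c} \<psi> \<Longrightarrow> finite {\<beta>. \<psi> \<beta> \<noteq> 0}"
  by (rule finite_subset[OF _ finite_kin[of c]]) (auto simp: weight_supp_def)

lemma weight_supp_mono: "weight_supp wb wc C \<psi> \<Longrightarrow> C \<subseteq> D \<Longrightarrow> weight_supp wb wc D \<psi>"
  by (auto simp: weight_supp_def)

lemma kin_rho:
  assumes "weight_supp abs abs {..c} \<psi>"
  shows "weight_supp abs abs {..c + int m} (rhoR_pos m \<psi>)" "weight_supp abs abs {..c - int m} (rhoR_neg m \<psi>)"
    "weight_supp abs abs {..c - int m} (rhoL_pos m \<psi>)" "weight_supp abs abs {..c + int m} (rhoL_neg m \<psi>)"
proof -
  show "weight_supp abs abs {..c + int m} (rhoR_pos m \<psi>)"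
    by (rule weight_supp_mono[OF weight_supp_rhoR_pos[OF assms, of m "int m"]]) auto
  show "weight_supp abs abs {..c - int m} (rhoR_neg m \<psi>)"
    by (rule weight_supp_mono[OF weight_supp_rhoR_neg[OF assms, of m "int m"]]) auto
  show "weight_supp abs abs {..c - int m} (rhoL_pos m \<psi>)"
    by (rule weight_supp_mono[OF weight_supp_rhoL_pos[OF assms, of m "int m"]]) auto
  show "weight_supp abs abs {..c + int m} (rhoL_neg m \<psi>)"
    by (rule weight_supp_mono[OF weight_supp_rhoL_neg[OF assms, of m "int m"]]) auto
qed

lemma weight_supp_neg_zero: "weight_supp abs abs {..c} \<psi> \<Longrightarrow> c < 0 \<Longrightarrow> \<psi> = (\<lambda>_. 0)"
  using order_trans[OF kin_nonneg] unfolding weight_supp_def by (fastforce simp: fun_eq_iff)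

lemma ops_zero: "bdag n (\<lambda>_. 0) = (\<lambda>_. 0)" "bann n (\<lambda>_. 0) = (\<lambda>_. 0)"
  "cdag n (\<lambda>_. 0) = (\<lambda>_. 0)" "cann n (\<lambda>_. 0) = (\<lambda>_. 0)"
  by (auto simp: bdag_def bann_def cdag_def cann_def fun_eq_iff)

lemma rho_zero: "rhoR_pos m (\<lambda>_. 0) = (\<lambda>_. 0)" "rhoL_neg m (\<lambda>_. 0) = (\<lambda>_. 0)"
  by (auto simp: rhoR_pos_def rhoL_neg_def ops_zero fun_eq_iff)

definition rho_quad :: "nat \<Rightarrow> fvec \<Rightarrow> fvec" where
  "rho_quad m \<psi> = (\<lambda>\<beta>. rhoR_pos m (rhoR_neg m \<psi>) \<beta> + rhoL_neg m (rhoL_pos m \<psi>) \<beta>)"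

lemma rho_quad_kin: "weight_supp abs abs {..c} \<psi> \<Longrightarrow> weight_supp abs abs {..c} (rho_quad m \<psi>)"
  using kin_rho(1)[OF kin_rho(2), of c \<psi> m m] kin_rho(4)[OF kin_rho(3), of c \<psi> m m]
  unfolding weight_supp_def rho_quad_def by (metis add.right_neutral add_cancel_right_right diff_add_cancel)

text \<open>The inner currents lower the kinetic energy by \<open>m\<close>, which cannot fall below
  0. This is what makes the sum over \<open>m\<close> in the Hamiltonian finite on every finite
  vector.\<close>

lemma rho_quad_large: "weight_supp abs abs {..c} \<psi> \<Longrightarrow> c < int m \<Longrightarrow> rho_quad m \<psi> = (\<lambda>_. 0)"
  using weight_supp_neg_zero[OF kin_rho(2), of c \<psi> m] weight_supp_neg_zero[OF kin_rho(3), of c \<psi> m]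
  by (simp add: rho_quad_def rho_zero)

lemma rho_quad_weight:
  assumes "weight_supp wb wc C \<psi>" "(wb, wc) \<in> {(abs, abs), (\<lambda>_. 1, \<lambda>_. - 1), (sb5, sc5)}"
  shows "weight_supp wb wc C (rho_quad m \<psi>)"
proof -
  \<comment> \<open>The inner current shifts the weight by -d and the outer one by d, so the product
    conserves it: \<open>d\<close> is \<open>m\<close> for the kinetic energy and 0 for the two
    charges.\<close>
  define d where "d = (if (wb, wc) = (abs, abs) then int m else 0)"
  have ne: "(\<lambda>_. 1 :: int) \<noteq> (abs :: int \<Rightarrow> int)" "sb5 \<noteq> (abs :: int \<Rightarrow> int)"
    by (auto simp: fun_eq_iff intro: exI[of _ 2])
  have i: "(\<lambda>x. x + d) ` (\<lambda>x. x - d) ` C = C" by (simp add: image_image)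
  have 1: "weight_supp wb wc C (rhoR_pos m (rhoR_neg m \<psi>))"
    using weight_supp_rhoR_pos[OF weight_supp_rhoR_neg[OF assms(1), of m d], of m d] assms(2) ne
    unfolding i by (auto simp: d_def split: if_splits)
  have 2: "weight_supp wb wc C (rhoL_neg m (rhoL_pos m \<psi>))"
    using weight_supp_rhoL_neg[OF weight_supp_rhoL_pos[OF assms(1), of m d], of m d] assms(2) ne
    unfolding i by (auto simp: d_def split: if_splits)
  show ?thesis using 1 2 unfolding weight_supp_def rho_quad_def by (metis add.right_neutral)
qed

section \<open>Adjoints and positivity of the current terms\<close>

text \<open>Labels outside \<open>fock_basis\<close> are included because creation operators give 0
  there, so that the truncation below holds for every label.\<close>

definition label_bounded :: "nat \<Rightarrow> fb \<Rightarrow> bool" where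
  "label_bounded n \<beta> \<longleftrightarrow> \<beta> \<notin> fock_basis \<or> (\<forall>k\<in>fst \<beta> \<union> snd \<beta>. \<bar>k\<bar> \<le> int n)"

lemma label_bounded_mono: "label_bounded n \<beta> \<Longrightarrow> n \<le> n' \<Longrightarrow> label_bounded n' \<beta>"
  by (force simp: label_bounded_def)

lemma label_bounded_ex: "\<exists>n. label_bounded n \<beta>"
proof (cases "\<beta> \<in> fock_basis")
  case True
  define A where "A = fst \<beta> \<union> snd \<beta>"
  have f: "finite A" using True by (cases \<beta>) (auto simp: fock_basis_def A_def)
  have "\<bar>k\<bar> \<le> int (nat (\<Sum>k\<in>A. \<bar>k\<bar>))" if "k \<in> A" for k
    using member_le_sum[of k A abs] f that by (auto simp: sum_nonneg)
  then show ?thesis unfolding label_bounded_def A_def[symmetric] by blast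
qed (simp add: label_bounded_def)

lemma label_bounded_ex_finite: "finite S \<Longrightarrow> \<exists>n. \<forall>\<beta>\<in>S. label_bounded n \<beta>"
proof (induction S rule: finite_induct)
  case (insert x F)
  then obtain n n' where "\<forall>\<beta>\<in>F. label_bounded n \<beta>" "label_bounded n' x" using label_bounded_ex by blast
  then show ?case by (intro exI[of _ "max n n'"]) (auto intro: label_bounded_mono)
qed simp

lemma infsum_trunc:
  fixes f :: "int \<Rightarrow> complex"
  assumes "finite J" "\<And>k. f k \<noteq> 0 \<Longrightarrow> k \<in> J"
  shows "infsum f A = sum f (A \<inter> J)"
proof -
  have "infsum f A = infsum f (A \<inter> J)"
    by (rule infsum_cong_neutral) (use assms in auto)
  then show ?thesis using assms by simp
qed

lemma ops_nz:
  "bdag n \<psi> \<beta> \<noteq> 0 \<Longrightarrow> \<beta> \<in> fock_basis \<and> n \<in> fst \<beta>"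
  "cdag n \<psi> \<beta> \<noteq> 0 \<Longrightarrow> \<beta> \<in> fock_basis \<and> n \<in> snd \<beta>"
  by (auto simp: bdag_def cdag_def split: prod.splits if_splits)

abbreviation mode_window :: "nat \<Rightarrow> nat \<Rightarrow> int set" where "mode_window n m \<equiv> {- int (n + m) .. int (n + m)}"

text \<open>In each infinite sum the outermost operator creates a mode, which must then be occupied
  in \<open>\<beta>\<close>; this confines the summation index to a window. The sums over pair terms
  are finite from the start.\<close>

lemma rho_trunc:
  assumes "label_bounded n \<beta>"
  shows "rhoR_pos m \<psi> \<beta> = - (\<Sum>k\<in>{int m<..} \<inter> mode_window n m. cdag k (cann (k - int m) \<psi>) \<beta>)
      + (\<Sum>k\<in>{0<..int m}. bdag (int m - k) (cdag k \<psi>) \<beta>)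
      + (\<Sum>k\<in>{0..} \<inter> mode_window n m. bdag (k + int m) (bann k \<psi>) \<beta>)" (is ?A)
   and "rhoR_neg m \<psi> \<beta> = - (\<Sum>k\<in>{int m<..} \<inter> mode_window n m. cdag (k - int m) (cann k \<psi>) \<beta>)
      + (\<Sum>k\<in>{0<..int m}. cann k (bann (int m - k) \<psi>) \<beta>)
      + (\<Sum>k\<in>{0..} \<inter> mode_window n m. bdag k (bann (k + int m) \<psi>) \<beta>)" (is ?B)
   and "rhoL_pos m \<psi> \<beta> = (\<Sum>k\<in>{..< - int m} \<inter> mode_window n m. bdag (k + int m) (bann k \<psi>) \<beta>)
      + (\<Sum>k\<in>{- int m..<0}. cann (- k - int m) (bann k \<psi>) \<beta>)
      - (\<Sum>k\<in>{..0} \<inter> mode_window n m. cdag k (cann (k - int m) \<psi>) \<beta>)" (is ?C)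
   and "rhoL_neg m \<psi> \<beta> = (\<Sum>k\<in>{..< - int m} \<inter> mode_window n m. bdag k (bann (k + int m) \<psi>) \<beta>)
      + (\<Sum>k\<in>{- int m..<0}. bdag k (cdag (- k - int m) \<psi>) \<beta>)
      - (\<Sum>k\<in>{..0} \<inter> mode_window n m. cdag (k - int m) (cann k \<psi>) \<beta>)" (is ?D)
proof -
  have b: "k \<in> mode_window n m" if "bdag k \<phi> \<beta> \<noteq> 0 \<or> cdag k \<phi> \<beta> \<noteq> 0 \<or> bdag (k + int m) \<phi> \<beta> \<noteq> 0 \<or> cdag (k - int m) \<phi> \<beta> \<noteq> 0" for k \<phi>
  proof -
    have "\<bar>k\<bar> \<le> int n \<or> \<bar>k + int m\<bar> \<le> int n \<or> \<bar>k - int m\<bar> \<le> int n"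
      using that assms ops_nz unfolding label_bounded_def by blast
    then show ?thesis by auto
  qed
  have f: "finite (mode_window n m)" by simp
  show ?A unfolding rhoR_pos_def by (subst (1 2) infsum_trunc[OF f, OF b]) auto
  show ?B unfolding rhoR_neg_def by (subst (1 2) infsum_trunc[OF f, OF b]) auto
  show ?C unfolding rhoL_pos_def by (subst (1 2) infsum_trunc[OF f, OF b]) auto
  show ?D unfolding rhoL_neg_def by (subst (1 2) infsum_trunc[OF f, OF b]) auto
qed

lemma ops_lin:
  "bdag n (\<lambda>\<beta>. a * \<psi> \<beta> + \<phi> \<beta>) = (\<lambda>\<beta>. a * bdag n \<psi> \<beta> + bdag n \<phi> \<beta>)"
  "bann n (\<lambda>\<beta>. a * \<psi> \<beta> + \<phi> \<beta>) = (\<lambda>\<beta>. a * bann n \<psi> \<beta> + bann n \<phi> \<beta>)"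
  "cdag n (\<lambda>\<beta>. a * \<psi> \<beta> + \<phi> \<beta>) = (\<lambda>\<beta>. a * cdag n \<psi> \<beta> + cdag n \<phi> \<beta>)"
  "cann n (\<lambda>\<beta>. a * \<psi> \<beta> + \<phi> \<beta>) = (\<lambda>\<beta>. a * cann n \<psi> \<beta> + cann n \<phi> \<beta>)"
  by (auto simp: bdag_def bann_def cdag_def cann_def fun_eq_iff algebra_simps)

lemma rho_lin:
  "rhoR_pos m (\<lambda>\<beta>. a * \<psi> \<beta> + \<phi> \<beta>) = (\<lambda>\<beta>. a * rhoR_pos m \<psi> \<beta> + rhoR_pos m \<phi> \<beta>)"
  "rhoR_neg m (\<lambda>\<beta>. a * \<psi> \<beta> + \<phi> \<beta>) = (\<lambda>\<beta>. a * rhoR_neg m \<psi> \<beta> + rhoR_neg m \<phi> \<beta>)"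
  "rhoL_pos m (\<lambda>\<beta>. a * \<psi> \<beta> + \<phi> \<beta>) = (\<lambda>\<beta>. a * rhoL_pos m \<psi> \<beta> + rhoL_pos m \<phi> \<beta>)"
  "rhoL_neg m (\<lambda>\<beta>. a * \<psi> \<beta> + \<phi> \<beta>) = (\<lambda>\<beta>. a * rhoL_neg m \<psi> \<beta> + rhoL_neg m \<phi> \<beta>)"
proof -
  have "rhoR_pos m (\<lambda>\<beta>. a * \<psi> \<beta> + \<phi> \<beta>) \<beta> = a * rhoR_pos m \<psi> \<beta> + rhoR_pos m \<phi> \<beta> \<and>
    rhoR_neg m (\<lambda>\<beta>. a * \<psi> \<beta> + \<phi> \<beta>) \<beta> = a * rhoR_neg m \<psi> \<beta> + rhoR_neg m \<phi> \<beta> \<and>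
    rhoL_pos m (\<lambda>\<beta>. a * \<psi> \<beta> + \<phi> \<beta>) \<beta> = a * rhoL_pos m \<psi> \<beta> + rhoL_pos m \<phi> \<beta> \<and>
    rhoL_neg m (\<lambda>\<beta>. a * \<psi> \<beta> + \<phi> \<beta>) \<beta> = a * rhoL_neg m \<psi> \<beta> + rhoL_neg m \<phi> \<beta>" for \<beta>
  proof -
    obtain n where "label_bounded n \<beta>" using label_bounded_ex by blast
    then show ?thesis
      unfolding rho_trunc[OF \<open>label_bounded n \<beta>\<close>] ops_lin sum.distrib sum_distrib_left[symmetric]
      by (simp add: algebra_simps)
  qed
  then show "rhoR_pos m (\<lambda>\<beta>. a * \<psi> \<beta> + \<phi> \<beta>) = (\<lambda>\<beta>. a * rhoR_pos m \<psi> \<beta> + rhoR_pos m \<phi> \<beta>)"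
    "rhoR_neg m (\<lambda>\<beta>. a * \<psi> \<beta> + \<phi> \<beta>) = (\<lambda>\<beta>. a * rhoR_neg m \<psi> \<beta> + rhoR_neg m \<phi> \<beta>)"
    "rhoL_pos m (\<lambda>\<beta>. a * \<psi> \<beta> + \<phi> \<beta>) = (\<lambda>\<beta>. a * rhoL_pos m \<psi> \<beta> + rhoL_pos m \<phi> \<beta>)"
    "rhoL_neg m (\<lambda>\<beta>. a * \<psi> \<beta> + \<phi> \<beta>) = (\<lambda>\<beta>. a * rhoL_neg m \<psi> \<beta> + rhoL_neg m \<phi> \<beta>)"
    by blast+
qed

lemma rho_quad_lin: "rho_quad m (\<lambda>\<beta>. a * \<psi> \<beta> + \<phi> \<beta>) = (\<lambda>\<beta>. a * rho_quad m \<psi> \<beta> + rho_quad m \<phi> \<beta>)"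
  unfolding rho_quad_def rho_lin by (simp add: algebra_simps fun_eq_iff)

section \<open>The Fock inner product and adjoint currents\<close>

definition fock_ip :: "fvec \<Rightarrow> fvec \<Rightarrow> complex" where
  "fock_ip \<psi> \<phi> = (\<Sum>\<^sub>\<infinity>\<beta>. cnj (\<psi> \<beta>) * \<phi> \<beta>)"

lemma fock_ip_cnj: "cnj (fock_ip \<psi> \<phi>) = fock_ip \<phi> \<psi>"
  unfolding fock_ip_def by (subst infsum_cnj[symmetric]) (simp add: mult.commute)

lemma fock_ip_fin: "finite S \<Longrightarrow> (\<And>\<beta>. \<beta> \<notin> S \<Longrightarrow> \<psi> \<beta> = 0 \<or> \<phi> \<beta> = 0) \<Longrightarrow> fock_ip \<psi> \<phi> = (\<Sum>\<beta>\<in>S. cnj (\<psi> \<beta>) * \<phi> \<beta>)"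
  unfolding fock_ip_def
  by (subst infsum_cong_neutral[of S UNIV _ "\<lambda>\<beta>. cnj (\<psi> \<beta>) * \<phi> \<beta>"]) auto

lemma cnt_less_simps: "cnt_less (insert n M) n = cnt_less M n" "cnt_less (M - {n}) n = cnt_less M n"
  unfolding cnt_less_def by (rule arg_cong[where f=card], auto)+

text \<open>Inserting mode n is a bijection from the labels without it to those with it, and the
  sign on both sides is the same because the number of modes below n ignores n. As
  \<open>infsum\<close> is invariant under reindexing even where it diverges, the identity covers
  all coefficient functions.\<close>

lemma fock_ip_bdag: "fock_ip (bdag n \<psi>) \<phi> = fock_ip \<psi> (bann n \<phi>)"
proof -
  let ?A = "{(M, N). (M, N) \<in> fock_basis \<and> n \<in> M}" and ?B = "{(M, N). (M, N) \<in> fock_basis \<and> n \<notin> M}"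
  let ?h = "\<lambda>(M, N). (insert n M, N :: int set)"
  let ?f = "\<lambda>\<beta>. cnj (bdag n \<psi> \<beta>) * \<phi> \<beta>"
  have bij: "bij_betw ?h ?B ?A"
    by (rule bij_betw_byWitness[where f'="\<lambda>(M, N). (M - {n}, N)"]) (auto simp: fock_iff insert_absorb)
  have "fock_ip (bdag n \<psi>) \<phi> = infsum ?f ?A"
    unfolding fock_ip_def by (rule infsum_cong_neutral) (auto simp: bdag_def split: prod.splits)
  also have "\<dots> = infsum (\<lambda>\<beta>. ?f (?h \<beta>)) ?B"
    by (rule infsum_reindex_bij_betw[OF bij, symmetric])
  also have "\<dots> = infsum (\<lambda>\<beta>. cnj (\<psi> \<beta>) * bann n \<phi> \<beta>) ?B"
    by (rule infsum_cong) (auto simp: bdag_def bann_def fock_iff cnt_less_simps)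
  also have "\<dots> = fock_ip \<psi> (bann n \<phi>)"
    unfolding fock_ip_def by (rule infsum_cong_neutral) (auto simp: bann_def split: prod.splits)
  finally show ?thesis .
qed

lemma fock_ip_cdag: "fock_ip (cdag n \<psi>) \<phi> = fock_ip \<psi> (cann n \<phi>)"
proof -
  let ?A = "{(M, N). (M, N) \<in> fock_basis \<and> n \<in> N}" and ?B = "{(M, N). (M, N) \<in> fock_basis \<and> n \<notin> N}"
  let ?h = "\<lambda>(M :: int set, N). (M, insert n N)"
  let ?f = "\<lambda>\<beta>. cnj (cdag n \<psi> \<beta>) * \<phi> \<beta>"
  have bij: "bij_betw ?h ?B ?A"
    by (rule bij_betw_byWitness[where f'="\<lambda>(M, N). (M, N - {n})"]) (auto simp: fock_iff insert_absorb)
  have "fock_ip (cdag n \<psi>) \<phi> = infsum ?f ?A"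
    unfolding fock_ip_def by (rule infsum_cong_neutral) (auto simp: cdag_def split: prod.splits)
  also have "\<dots> = infsum (\<lambda>\<beta>. ?f (?h \<beta>)) ?B"
    by (rule infsum_reindex_bij_betw[OF bij, symmetric])
  also have "\<dots> = infsum (\<lambda>\<beta>. cnj (\<psi> \<beta>) * cann n \<phi> \<beta>) ?B"
    by (rule infsum_cong) (auto simp: cdag_def cann_def fock_iff cnt_less_simps)
  also have "\<dots> = fock_ip \<psi> (cann n \<phi>)"
    unfolding fock_ip_def by (rule infsum_cong_neutral) (auto simp: cann_def split: prod.splits)
  finally show ?thesis .
qed

lemma fock_ip_bann: "fock_ip (bann n \<psi>) \<phi> = fock_ip \<psi> (bdag n \<phi>)"
  by (metis fock_ip_bdag fock_ip_cnj)

lemma fock_ip_cann: "fock_ip (cann n \<psi>) \<phi> = fock_ip \<psi> (cdag n \<phi>)"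
  by (metis fock_ip_cdag fock_ip_cnj)

lemmas fock_ip_ops = fock_ip_bdag fock_ip_bann fock_ip_cdag fock_ip_cann

lemma fin_vec_iff: "fin_vec \<psi> \<longleftrightarrow> finite {\<beta>. \<psi> \<beta> \<noteq> 0} \<and> (\<forall>\<beta>. \<psi> \<beta> \<noteq> 0 \<longrightarrow> \<beta> \<in> fock_basis)"
  by (auto simp: fin_vec_def supp_vec_def)

lemma weight_supp_fin_vec: "weight_supp abs abs {..c} \<psi> \<Longrightarrow> fin_vec \<psi>"
  unfolding fin_vec_iff using weight_supp_kin_finite by (auto simp: weight_supp_def)

lemma fin_vec_weight_supp:
  assumes "fin_vec \<psi>" obtains c :: nat where "weight_supp abs abs {..int c} \<psi>"
proof -
  let ?S = "{\<beta>. \<psi> \<beta> \<noteq> 0}"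
  have f: "finite ?S" using assms by (simp add: fin_vec_iff)
  have "kin \<beta> \<le> int (nat (\<Sum>\<beta>\<in>?S. kin \<beta>))" if "\<psi> \<beta> \<noteq> 0" for \<beta>
    using member_le_sum[of \<beta> ?S kin] f that kin_nonneg by (auto simp: sum_nonneg)
  then show ?thesis using assms unfolding weight_supp_def fin_vec_iff by (intro that[of "nat (\<Sum>\<beta>\<in>?S. kin \<beta>)"]) (auto simp: weight_supp_def simp del: nat_eq_iff int_nat_eq)
qed

lemma sum_fock_ip_left:
  assumes "finite S" "\<And>\<beta>. \<beta> \<notin> S \<Longrightarrow> \<phi> \<beta> = 0"
  shows "(\<Sum>\<beta>\<in>S. cnj (\<Sum>k\<in>K. T k \<beta>) * \<phi> \<beta>) = (\<Sum>k\<in>K. fock_ip (T k) \<phi>)"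
proof -
  have "(\<Sum>k\<in>K. fock_ip (T k) \<phi>) = (\<Sum>k\<in>K. \<Sum>\<beta>\<in>S. cnj (T k \<beta>) * \<phi> \<beta>)"
    using assms by (intro sum.cong refl fock_ip_fin) auto
  also have "\<dots> = (\<Sum>\<beta>\<in>S. \<Sum>k\<in>K. cnj (T k \<beta>) * \<phi> \<beta>)" by (rule sum.swap)
  finally show ?thesis by (simp add: sum_distrib_right)
qed

lemma sum_fock_ip_right:
  assumes "finite S" "\<And>\<beta>. \<beta> \<notin> S \<Longrightarrow> \<psi> \<beta> = 0"
  shows "(\<Sum>\<beta>\<in>S. cnj (\<psi> \<beta>) * (\<Sum>k\<in>K. T k \<beta>)) = (\<Sum>k\<in>K. fock_ip \<psi> (T k))"
proof -
  have "(\<Sum>k\<in>K. fock_ip \<psi> (T k)) = (\<Sum>k\<in>K. \<Sum>\<beta>\<in>S. cnj (\<psi> \<beta>) * T k \<beta>)"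
    using assms by (intro sum.cong refl fock_ip_fin) auto
  also have "\<dots> = (\<Sum>\<beta>\<in>S. \<Sum>k\<in>K. cnj (\<psi> \<beta>) * T k \<beta>)" by (rule sum.swap)
  finally show ?thesis by (simp add: sum_distrib_left)
qed

text \<open>One mode window serves all labels in the finite joint support, so both sides become
  finite sums and the adjoint relations of the elementary operators apply term by term.\<close>

lemma rho_adjoint:
  assumes "fin_vec \<psi>" "fin_vec \<phi>"
  shows "fock_ip (rhoR_neg m \<psi>) \<phi> = fock_ip \<psi> (rhoR_pos m \<phi>)"
    "fock_ip (rhoL_pos m \<psi>) \<phi> = fock_ip \<psi> (rhoL_neg m \<phi>)"
proof -
  define S where "S = {\<beta>. \<psi> \<beta> \<noteq> 0} \<union> {\<beta>. \<phi> \<beta> \<noteq> 0}"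
  have S: "finite S" using assms by (simp add: S_def fin_vec_iff)
  have z: "\<beta> \<notin> S \<Longrightarrow> \<psi> \<beta> = 0" "\<beta> \<notin> S \<Longrightarrow> \<phi> \<beta> = 0" for \<beta> by (auto simp: S_def)
  obtain n where n: "\<And>\<beta>. \<beta> \<in> S \<Longrightarrow> label_bounded n \<beta>" using label_bounded_ex_finite[OF S] by blast
  have fin1: "fock_ip f \<phi> = (\<Sum>\<beta>\<in>S. cnj (f \<beta>) * \<phi> \<beta>)" for f using S z by (intro fock_ip_fin) auto
  have fin2: "fock_ip \<psi> f = (\<Sum>\<beta>\<in>S. cnj (\<psi> \<beta>) * f \<beta>)" for f using S z by (intro fock_ip_fin) auto
  have L: "(\<Sum>\<beta>\<in>S. cnj (\<Sum>k\<in>K. T k \<beta>) * \<phi> \<beta>) = (\<Sum>k\<in>K. fock_ip (T k) \<phi>)" for K and T :: "int \<Rightarrow> fvec"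
    by (rule sum_fock_ip_left[OF S z(2)])
  have Rr: "(\<Sum>\<beta>\<in>S. cnj (\<psi> \<beta>) * (\<Sum>k\<in>K. T k \<beta>)) = (\<Sum>k\<in>K. fock_ip \<psi> (T k))" for K and T :: "int \<Rightarrow> fvec"
    by (rule sum_fock_ip_right[OF S z(1)])
  have 1: "(\<Sum>\<beta>\<in>S. cnj (- (\<Sum>k\<in>A. f k \<beta>) + (\<Sum>k\<in>B. g k \<beta>) + (\<Sum>k\<in>C. h k \<beta>)) * \<phi> \<beta>) =
     - (\<Sum>k\<in>A. fock_ip (f k) \<phi>) + (\<Sum>k\<in>B. fock_ip (g k) \<phi>) + (\<Sum>k\<in>C. fock_ip (h k) \<phi>)" for A B C and f g h :: "int \<Rightarrow> fvec"
    unfolding L[symmetric]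
    by (simp only: complex_cnj_add complex_cnj_diff complex_cnj_minus distrib_right left_diff_distrib
        minus_mult_left[symmetric] sum.distrib sum_subtractf sum_negf)
  have 2: "(\<Sum>\<beta>\<in>S. cnj (\<psi> \<beta>) * (- (\<Sum>k\<in>A. f k \<beta>) + (\<Sum>k\<in>B. g k \<beta>) + (\<Sum>k\<in>C. h k \<beta>))) =
     - (\<Sum>k\<in>A. fock_ip \<psi> (f k)) + (\<Sum>k\<in>B. fock_ip \<psi> (g k)) + (\<Sum>k\<in>C. fock_ip \<psi> (h k))" for A B C and f g h :: "int \<Rightarrow> fvec"
    unfolding Rr[symmetric]
    by (simp only: distrib_left right_diff_distrib mult_minus_right sum.distrib sum_subtractf sum_negf)
  have 3: "(\<Sum>\<beta>\<in>S. cnj ((\<Sum>k\<in>A. f k \<beta>) + (\<Sum>k\<in>B. g k \<beta>) - (\<Sum>k\<in>C. h k \<beta>)) * \<phi> \<beta>) =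
     (\<Sum>k\<in>A. fock_ip (f k) \<phi>) + (\<Sum>k\<in>B. fock_ip (g k) \<phi>) - (\<Sum>k\<in>C. fock_ip (h k) \<phi>)" for A B C and f g h :: "int \<Rightarrow> fvec"
    unfolding L[symmetric]
    by (simp only: complex_cnj_add complex_cnj_diff complex_cnj_minus distrib_right left_diff_distrib
        minus_mult_left[symmetric] sum.distrib sum_subtractf sum_negf)
  have 4: "(\<Sum>\<beta>\<in>S. cnj (\<psi> \<beta>) * ((\<Sum>k\<in>A. f k \<beta>) + (\<Sum>k\<in>B. g k \<beta>) - (\<Sum>k\<in>C. h k \<beta>))) =
     (\<Sum>k\<in>A. fock_ip \<psi> (f k)) + (\<Sum>k\<in>B. fock_ip \<psi> (g k)) - (\<Sum>k\<in>C. fock_ip \<psi> (h k))" for A B C and f g h :: "int \<Rightarrow> fvec"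
    unfolding Rr[symmetric]
    by (simp only: distrib_left right_diff_distrib mult_minus_right sum.distrib sum_subtractf sum_negf)
  show "fock_ip (rhoR_neg m \<psi>) \<phi> = fock_ip \<psi> (rhoR_pos m \<phi>)"
  proof -
    have "fock_ip (rhoR_neg m \<psi>) \<phi> = (\<Sum>\<beta>\<in>S. cnj (- (\<Sum>k\<in>{int m<..} \<inter> mode_window n m. cdag (k - int m) (cann k \<psi>) \<beta>)
      + (\<Sum>k\<in>{0<..int m}. cann k (bann (int m - k) \<psi>) \<beta>)
      + (\<Sum>k\<in>{0..} \<inter> mode_window n m. bdag k (bann (k + int m) \<psi>) \<beta>)) * \<phi> \<beta>)"
      unfolding fin1 by (intro sum.cong refl) (simp only: rho_trunc(2)[OF n])
    also have "\<dots> = (\<Sum>\<beta>\<in>S. cnj (\<psi> \<beta>) * (- (\<Sum>k\<in>{int m<..} \<inter> mode_window n m. cdag k (cann (k - int m) \<phi>) \<beta>)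
      + (\<Sum>k\<in>{0<..int m}. bdag (int m - k) (cdag k \<phi>) \<beta>)
      + (\<Sum>k\<in>{0..} \<inter> mode_window n m. bdag (k + int m) (bann k \<phi>) \<beta>)))"
      unfolding 1 2 fock_ip_ops ..
    also have "\<dots> = fock_ip \<psi> (rhoR_pos m \<phi>)"
      unfolding fin2 by (intro sum.cong refl) (simp only: rho_trunc(1)[OF n])
    finally show ?thesis .
  qed
  show "fock_ip (rhoL_pos m \<psi>) \<phi> = fock_ip \<psi> (rhoL_neg m \<phi>)"
  proof -
    have "fock_ip (rhoL_pos m \<psi>) \<phi> = (\<Sum>\<beta>\<in>S. cnj ((\<Sum>k\<in>{..< - int m} \<inter> mode_window n m. bdag (k + int m) (bann k \<psi>) \<beta>)
      + (\<Sum>k\<in>{- int m..<0}. cann (- k - int m) (bann k \<psi>) \<beta>)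
      - (\<Sum>k\<in>{..0} \<inter> mode_window n m. cdag k (cann (k - int m) \<psi>) \<beta>)) * \<phi> \<beta>)"
      unfolding fin1 by (intro sum.cong refl) (simp only: rho_trunc(3)[OF n])
    also have "\<dots> = (\<Sum>\<beta>\<in>S. cnj (\<psi> \<beta>) * ((\<Sum>k\<in>{..< - int m} \<inter> mode_window n m. bdag k (bann (k + int m) \<phi>) \<beta>)
      + (\<Sum>k\<in>{- int m..<0}. bdag k (cdag (- k - int m) \<phi>) \<beta>)
      - (\<Sum>k\<in>{..0} \<inter> mode_window n m. cdag (k - int m) (cann k \<phi>) \<beta>)))"
      unfolding 3 4 fock_ip_ops ..
    also have "\<dots> = fock_ip \<psi> (rhoL_neg m \<phi>)"
      unfolding fin2 by (intro sum.cong refl) (simp only: rho_trunc(4)[OF n])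
    finally show ?thesis .
  qed
qed

lemma rho_fin_vec:
  assumes "fin_vec \<psi>"
  shows "fin_vec (rhoR_pos m \<psi>)" "fin_vec (rhoR_neg m \<psi>)" "fin_vec (rhoL_pos m \<psi>)" "fin_vec (rhoL_neg m \<psi>)" "fin_vec (rho_quad m \<psi>)"
proof -
  obtain c :: nat where "weight_supp abs abs {..int c} \<psi>" using fin_vec_weight_supp[OF assms] .
  from kin_rho[OF this] rho_quad_kin[OF this]
  show "fin_vec (rhoR_pos m \<psi>)" "fin_vec (rhoR_neg m \<psi>)" "fin_vec (rhoL_pos m \<psi>)" "fin_vec (rhoL_neg m \<psi>)" "fin_vec (rho_quad m \<psi>)"
    by (blast intro: weight_supp_fin_vec)+
qed

lemma fock_ip_add_right:
  assumes "fin_vec \<psi>" shows "fock_ip \<psi> (\<lambda>\<beta>. a * f \<beta> + g \<beta>) = a * fock_ip \<psi> f + fock_ip \<psi> g"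
proof -
  let ?S = "{\<beta>. \<psi> \<beta> \<noteq> 0}"
  have "finite ?S" using assms by (simp add: fin_vec_iff)
  then have "fock_ip \<psi> h = (\<Sum>\<beta>\<in>?S. cnj (\<psi> \<beta>) * h \<beta>)" for h by (intro fock_ip_fin) auto
  then show ?thesis by (simp add: algebra_simps sum.distrib sum_distrib_left)
qed

text \<open>The quadratic current term is a sum of two operators of the form A* A. Symmetry and
  positivity are both read off from this.\<close>

lemma rho_quad_fock_ip:
  assumes "fin_vec \<psi>" "fin_vec \<phi>"
  shows "fock_ip \<psi> (rho_quad m \<phi>) = fock_ip (rhoR_neg m \<psi>) (rhoR_neg m \<phi>) + fock_ip (rhoL_pos m \<psi>) (rhoL_pos m \<phi>)"
  using fock_ip_add_right[OF assms(1), of 1 "rhoR_pos m (rhoR_neg m \<phi>)" "rhoL_neg m (rhoL_pos m \<phi>)"]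
  by (simp add: rho_quad_def rho_adjoint rho_fin_vec assms)

lemma rho_quad_sym: "fin_vec \<psi> \<Longrightarrow> fin_vec \<phi> \<Longrightarrow> fock_ip (rho_quad m \<psi>) \<phi> = fock_ip \<psi> (rho_quad m \<phi>)"
  using rho_quad_fock_ip[of \<phi> \<psi> m] rho_quad_fock_ip[of \<psi> \<phi> m] fock_ip_cnj[of \<phi> "rho_quad m \<psi>"]
  by (metis complex_cnj_add fock_ip_cnj)

lemma fock_ip_self_nonneg: "fin_vec \<psi> \<Longrightarrow> 0 \<le> Re (fock_ip \<psi> \<psi>)"
  by (subst fock_ip_fin[of "{\<beta>. \<psi> \<beta> \<noteq> 0}"]) (auto simp: fin_vec_iff intro!: sum_nonneg)

lemma rho_quad_pos: "fin_vec \<psi> \<Longrightarrow> 0 \<le> Re (fock_ip \<psi> (rho_quad m \<psi>))"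
  by (simp add: rho_quad_fock_ip fock_ip_self_nonneg rho_fin_vec)

section \<open>The current part of the Hamiltonian and its matrix elements\<close>

definition K_part :: "real \<Rightarrow> real \<Rightarrow> fvec \<Rightarrow> fvec" where
  "K_part e L \<psi> = (\<lambda>\<beta>. \<Sum>\<^sub>\<infinity>m\<in>{1::nat..}. complex_of_real (omega e L m / real m) * rho_quad m \<psi> \<beta>)"

lemma K_part_fin:
  assumes "weight_supp abs abs {..int c} \<psi>"
  shows "K_part e L \<psi> \<beta> = (\<Sum>m\<in>{1..c}. complex_of_real (omega e L m / real m) * rho_quad m \<psi> \<beta>)"
proof -
  have "K_part e L \<psi> \<beta> = infsum (\<lambda>m. complex_of_real (omega e L m / real m) * rho_quad m \<psi> \<beta>) {1..c}"
    unfolding K_part_def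
  proof (rule infsum_cong_neutral)
    fix m :: nat assume "m \<in> {1..} - {1..c}"
    then have "int c < int m" by auto
    then show "complex_of_real (omega e L m / real m) * rho_quad m \<psi> \<beta> = 0" using rho_quad_large[OF assms] by simp
  qed auto
  then show ?thesis by simp
qed

lemma K_part_lin:
  assumes "fin_vec \<psi>" "fin_vec \<phi>"
  shows "K_part e L (\<lambda>\<beta>. a * \<psi> \<beta> + \<phi> \<beta>) = (\<lambda>\<beta>. a * K_part e L \<psi> \<beta> + K_part e L \<phi> \<beta>)"
proof
  fix \<beta>
  obtain c1 c2 :: nat where "weight_supp abs abs {..int c1} \<psi>" "weight_supp abs abs {..int c2} \<phi>"
    using fin_vec_weight_supp assms by metis
  then have w: "weight_supp abs abs {..int (max c1 c2)} \<psi>" "weight_supp abs abs {..int (max c1 c2)} \<phi>"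
    by (auto elim: weight_supp_mono)
  then have w3: "weight_supp abs abs {..int (max c1 c2)} (\<lambda>\<beta>. a * \<psi> \<beta> + \<phi> \<beta>)"
    unfolding weight_supp_def by (metis add_cancel_right_left mult_zero_right)
  show "K_part e L (\<lambda>\<beta>. a * \<psi> \<beta> + \<phi> \<beta>) \<beta> = a * K_part e L \<psi> \<beta> + K_part e L \<phi> \<beta>"
    unfolding K_part_fin[OF w(1)] K_part_fin[OF w(2)] K_part_fin[OF w3] rho_quad_lin
    by (simp add: sum_distrib_left sum.distrib algebra_simps)
qed

lemma K_part_weight:
  assumes "weight_supp wb wc C \<psi>" "(wb, wc) \<in> {(abs, abs), (\<lambda>_. 1, \<lambda>_. - 1), (sb5, sc5)}"
  shows "weight_supp wb wc C (K_part e L \<psi>)"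
proof (rule weight_supp_three)
  fix \<beta> assume "K_part e L \<psi> \<beta> \<noteq> 0"
  from infsum_nz[OF this[unfolded K_part_def]] obtain m where "rho_quad m \<psi> \<beta> \<noteq> 0" by auto
  then show "\<exists>g. weight_supp wb wc C g \<and> g \<beta> \<noteq> 0" using rho_quad_weight[OF assms] by blast
qed

lemma omega_nonneg: "0 \<le> omega e L m"
  by (simp add: omega_def)

lemma K_part_fock_ip:
  assumes "fin_vec \<psi>" "weight_supp abs abs {..int c} \<phi>"
  shows "fock_ip \<psi> (K_part e L \<phi>) = (\<Sum>m\<in>{1..c}. complex_of_real (omega e L m / real m) * fock_ip \<psi> (rho_quad m \<phi>))"
proof -
  let ?S = "{\<beta>. \<psi> \<beta> \<noteq> 0}"
  have "finite ?S" using assms by (simp add: fin_vec_iff)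
  then have *: "fock_ip \<psi> h = (\<Sum>\<beta>\<in>?S. cnj (\<psi> \<beta>) * h \<beta>)" for h by (intro fock_ip_fin) auto
  show ?thesis unfolding * K_part_fin[OF assms(2)] sum_distrib_left
    by (subst sum.swap) (simp add: mult_ac)
qed

lemma K_part_sym:
  assumes "fin_vec \<psi>" "fin_vec \<phi>"
  shows "fock_ip (K_part e L \<psi>) \<phi> = fock_ip \<psi> (K_part e L \<phi>)"
proof -
  obtain c1 c2 :: nat where "weight_supp abs abs {..int c1} \<psi>" "weight_supp abs abs {..int c2} \<phi>"
    using fin_vec_weight_supp assms by metis
  then have w: "weight_supp abs abs {..int (max c1 c2)} \<psi>" "weight_supp abs abs {..int (max c1 c2)} \<phi>"
    by (auto elim: weight_supp_mono)
  have "fock_ip (K_part e L \<psi>) \<phi> = cnj (fock_ip \<phi> (K_part e L \<psi>))" by (simp add: fock_ip_cnj)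
  also have "\<dots> = fock_ip \<psi> (K_part e L \<phi>)"
    unfolding K_part_fock_ip[OF assms(1) w(2)] K_part_fock_ip[OF assms(2) w(1)]
    by (simp add: fock_ip_cnj rho_quad_sym assms)
  finally show ?thesis .
qed

lemma K_part_pos: "fin_vec \<psi> \<Longrightarrow> 0 \<le> Re (fock_ip \<psi> (K_part e L \<psi>))"
proof -
  assume f: "fin_vec \<psi>"
  obtain c :: nat where w: "weight_supp abs abs {..int c} \<psi>" using fin_vec_weight_supp[OF f] .
  have "Re (fock_ip \<psi> (K_part e L \<psi>)) = (\<Sum>m\<in>{1..c}. (omega e L m / real m) * Re (fock_ip \<psi> (rho_quad m \<psi>)))"
    unfolding K_part_fock_ip[OF f w] Re_sum by (intro sum.cong refl) (simp only: Re_complex_of_real Im_complex_of_real times_complex.sel mult_zero_left diff_zero)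
  also have "\<dots> \<ge> 0" using rho_quad_pos[OF f] omega_nonneg by (intro sum_nonneg mult_nonneg_nonneg) auto
  finally show ?thesis .
qed

definition basis_vec :: "fb \<Rightarrow> fvec" where
  "basis_vec \<beta> = (\<lambda>\<beta>'. if \<beta>' = \<beta> then 1 else 0)"

definition K_entry :: "real \<Rightarrow> real \<Rightarrow> fb \<Rightarrow> fb \<Rightarrow> complex" where
  "K_entry e L \<beta> \<beta>' = K_part e L (basis_vec \<beta>') \<beta>"

lemma basis_vec_fin_vec: "\<beta> \<in> fock_basis \<Longrightarrow> fin_vec (basis_vec \<beta>)"
  by (auto simp: fin_vec_iff basis_vec_def)

lemma K_part_zero: "K_part e L (\<lambda>_. 0) = (\<lambda>_. 0)"
  using K_part_fin[of 0 "\<lambda>_. 0"] by (auto simp: weight_supp_def fun_eq_iff)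

lemma fin_vec_sub: "finite S \<Longrightarrow> S \<subseteq> fock_basis \<Longrightarrow> (\<And>\<beta>. \<beta> \<notin> S \<Longrightarrow> \<psi> \<beta> = 0) \<Longrightarrow> fin_vec \<psi>"
  unfolding fin_vec_iff by (metis (mono_tags, lifting) finite_subset mem_Collect_eq subset_eq)

lemma K_part_matrix:
  assumes "finite S" "S \<subseteq> fock_basis" "\<And>\<beta>. \<beta> \<notin> S \<Longrightarrow> \<psi> \<beta> = 0"
  shows "K_part e L \<psi> \<beta> = (\<Sum>\<beta>'\<in>S. K_entry e L \<beta> \<beta>' * \<psi> \<beta>')"
  using assms
proof (induction S arbitrary: \<psi> rule: finite_induct)
  case empty
  then have "\<psi> = (\<lambda>_. 0)" by auto
  then show ?case by (simp add: K_part_zero)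
next
  case (insert x S)
  let ?\<phi> = "\<lambda>\<beta>. if \<beta> = x then 0 else \<psi> \<beta>"
  have eq: "\<psi> = (\<lambda>\<beta>. \<psi> x * basis_vec x \<beta> + ?\<phi> \<beta>)" by (auto simp: basis_vec_def)
  have z: "\<And>\<beta>. \<beta> \<notin> S \<Longrightarrow> ?\<phi> \<beta> = 0" using insert.prems(2) by auto
  have f: "fin_vec ?\<phi>" by (rule fin_vec_sub[of S]) (use insert z in auto)
  have "K_part e L \<psi> \<beta> = \<psi> x * K_part e L (basis_vec x) \<beta> + K_part e L ?\<phi> \<beta>"
    by (subst eq, subst K_part_lin) (use f insert.prems(1) basis_vec_fin_vec in auto)
  also have "K_part e L ?\<phi> \<beta> = (\<Sum>\<beta>'\<in>S. K_entry e L \<beta> \<beta>' * ?\<phi> \<beta>')"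
    using insert.prems by (intro insert.IH z) auto
  also have "\<dots> = (\<Sum>\<beta>'\<in>S. K_entry e L \<beta> \<beta>' * \<psi> \<beta>')" using insert.hyps by (intro sum.cong) auto
  finally show ?case using insert.hyps by (simp add: K_entry_def mult.commute)
qed

text \<open>Applied to a basis vector, the operator can only reach labels with the same three
  weights. By \<open>finite_kin\<close> the kinetic energy alone leaves finitely many of
  them.\<close>

lemma K_entry_block:
  assumes "K_entry e L \<beta> \<beta>' \<noteq> 0" "\<beta>' \<in> fock_basis"
  shows "\<beta> \<in> fock_basis" "kin \<beta> = kin \<beta>'" "chg \<beta> = chg \<beta>'" "q5 \<beta> = q5 \<beta>'"
proof -
  have "weight_supp wb wc {weight wb wc \<beta>'} (basis_vec \<beta>')" for wb wc using assms(2) by (auto simp: weight_supp_def basis_vec_def)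
  from wsD[OF K_part_weight[OF this] assms(1)[unfolded K_entry_def]]
  have *: "(wb, wc) \<in> {(abs, abs), (\<lambda>_. 1, \<lambda>_. - 1), (sb5, sc5)} \<Longrightarrow>
     \<beta> \<in> fock_basis \<and> weight wb wc \<beta> = weight wb wc \<beta>'" for wb wc by simp
  show "\<beta> \<in> fock_basis" "kin \<beta> = kin \<beta>'" using *[of abs abs] by auto
  show "chg \<beta> = chg \<beta>'" using *[of "\<lambda>_. 1" "\<lambda>_. - 1"] by auto
  show "q5 \<beta> = q5 \<beta>'" using *[of sb5 sc5] by auto
qed

lemma fock_ip_basis_vec: "fock_ip (basis_vec \<beta>) \<phi> = \<phi> \<beta>"
  by (subst fock_ip_fin[of "{\<beta>}"]) (auto simp: basis_vec_def)

lemma K_entry_sym: "\<beta> \<in> fock_basis \<Longrightarrow> \<beta>' \<in> fock_basis \<Longrightarrow> K_entry e L \<beta> \<beta>' = cnj (K_entry e L \<beta>' \<beta>)"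
  unfolding K_entry_def using K_part_sym[of "basis_vec \<beta>" "basis_vec \<beta>'" e L] fock_ip_basis_vec basis_vec_fin_vec fock_ip_cnj by metis

lemma K_entry_pos:
  assumes "finite S" "S \<subseteq> fock_basis"
  shows "0 \<le> Re (\<Sum>\<beta>\<in>S. cnj (z \<beta>) * (\<Sum>\<beta>'\<in>S. K_entry e L \<beta> \<beta>' * z \<beta>'))"
proof -
  let ?\<psi> = "\<lambda>\<beta>. if \<beta> \<in> S then z \<beta> else 0"
  have f: "fin_vec ?\<psi>" by (rule fin_vec_sub[of S]) (use assms in auto)
  have "fock_ip ?\<psi> (K_part e L ?\<psi>) = (\<Sum>\<beta>\<in>S. cnj (?\<psi> \<beta>) * K_part e L ?\<psi> \<beta>)"
    using assms by (intro fock_ip_fin) auto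
  also have "\<dots> = (\<Sum>\<beta>\<in>S. cnj (z \<beta>) * (\<Sum>\<beta>'\<in>S. K_entry e L \<beta> \<beta>' * z \<beta>'))"
    using assms by (intro sum.cong refl) (simp add: K_part_matrix[OF assms])
  finally show ?thesis using K_part_pos[OF f, of e L] by simp
qed

section \<open>Diagonal form of the axial charge\<close>

lemma num_ops:
  assumes "(M, N) \<in> fock_basis"
  shows "bdag n (bann n \<psi>) (M, N) = (if n \<in> M then \<psi> (M, N) else 0)"
    "cdag n (cann n \<psi>) (M, N) = (if n \<in> N then \<psi> (M, N) else 0)"
  using assms
  by (auto simp: bdag_def bann_def cdag_def cann_def fock_iff cnt_less_simps insert_absorb
      simp flip: power_add mult_2 mult.assoc)

lemma infsum_count:
  assumes "finite M"
  shows "(\<Sum>\<^sub>\<infinity>n\<in>A. if n \<in> M then z else (0::complex)) = of_nat (card (M \<inter> A)) * z"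
proof -
  have "(\<Sum>\<^sub>\<infinity>n\<in>A. if n \<in> M then z else 0) = (\<Sum>\<^sub>\<infinity>n\<in>M \<inter> A. z)"
    by (rule infsum_cong_neutral) auto
  then show ?thesis using assms by simp
qed

lemma Q5_diag:
  assumes "\<beta> \<in> fock_basis"
  shows "Q5 \<psi> \<beta> = of_int (q5 \<beta>) * \<psi> \<beta>"
proof -
  obtain M N where \<beta>: "\<beta> = (M, N)" by fastforce
  have f: "finite M" "finite N" using assms by (auto simp: \<beta> fock_iff)
  have b: "sum sb5 M = int (card (M \<inter> {0..})) - int (card (M \<inter> {..<0}))"
  proof -
    have "M \<inter> {n. 0 \<le> n} = M \<inter> {0..}" "M \<inter> - {n. 0 \<le> n} = M \<inter> {..<0}" by auto
    then show ?thesis using f by (simp add: sum.If_cases sum_negf)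
  qed
  have c: "sum sc5 N = - int (card (N \<inter> {0<..})) + int (card (N \<inter> {..0}))"
  proof -
    have "N \<inter> {n. 0 < n} = N \<inter> {0<..}" "N \<inter> - {n. 0 < n} = N \<inter> {..0}" by auto
    then show ?thesis using f by (simp add: sum.If_cases sum_negf)
  qed
  have "Q5 \<psi> (M, N) = of_nat (card (M \<inter> {0..})) * \<psi> (M, N) - of_nat (card (M \<inter> {..<0})) * \<psi> (M, N)
      - of_nat (card (N \<inter> {0<..})) * \<psi> (M, N) + of_nat (card (N \<inter> {..0})) * \<psi> (M, N)"
    unfolding Q5_def num_ops[OF assms[unfolded \<beta>]] infsum_count[OF f(1)] infsum_count[OF f(2)] ..
  then show ?thesis
    unfolding \<beta> weight_def fst_conv snd_conv b c by (simp add: algebra_simps)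
qed

section \<open>The gauge transformation on basis labels\<close>

text \<open>\<Gamma> maps each basis vector to plus or minus another one; this is the induced map on labels. Mode 0 is exchanged between the two species.\<close>

definition gauge_label :: "fb \<Rightarrow> fb" where
  "gauge_label = (\<lambda>(M, N). ((\<lambda>k. k - 1) ` (M - {0}) \<union> (if 0 \<in> N then {} else {- 1}),
                   (\<lambda>k. k + 1) ` (N - {0}) \<union> (if 0 \<in> M then {} else {1})))"

definition gauge_label_inv :: "fb \<Rightarrow> fb" where
  "gauge_label_inv = (\<lambda>(M, N). ((\<lambda>k. k + 1) ` (M - {- 1}) \<union> (if 1 \<in> N then {} else {0}),
                   (\<lambda>k. k - 1) ` (N - {1}) \<union> (if - 1 \<in> M then {} else {0})))"

lemma gauge_label_mem:
  "k \<in> fst (gauge_label \<beta>) \<longleftrightarrow> (if k = - 1 then 0 \<notin> snd \<beta> else k + 1 \<in> fst \<beta>)"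
  "k \<in> snd (gauge_label \<beta>) \<longleftrightarrow> (if k = 1 then 0 \<notin> fst \<beta> else k - 1 \<in> snd \<beta>)"
  "k \<in> fst (gauge_label_inv \<beta>) \<longleftrightarrow> (if k = 0 then 1 \<notin> snd \<beta> else k - 1 \<in> fst \<beta>)"
  "k \<in> snd (gauge_label_inv \<beta>) \<longleftrightarrow> (if k = 0 then - 1 \<notin> fst \<beta> else k + 1 \<in> snd \<beta>)"
  by (cases \<beta>, force simp: gauge_label_def gauge_label_inv_def image_iff)+

lemma gauge_label_gauge_label_inv: "gauge_label (gauge_label_inv \<beta>) = \<beta>" "gauge_label_inv (gauge_label \<beta>) = \<beta>"
  by (rule prod_eqI; rule set_eqI; simp add: gauge_label_mem)+

lemma bij_gauge_label: "bij gauge_label"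
  by (rule o_bij[of gauge_label_inv]) (auto simp: gauge_label_gauge_label_inv)

lemma gauge_label_fock: "gauge_label \<beta> \<in> fock_basis \<longleftrightarrow> \<beta> \<in> fock_basis"
proof -
  have fin: "finite ((\<lambda>k::int. k - 1) ` A) \<longleftrightarrow> finite A" "finite ((\<lambda>k::int. k + 1) ` A) \<longleftrightarrow> finite A" for A
    by (auto intro!: finite_image_iff inj_onI)
  show ?thesis by (cases \<beta>) (simp add: gauge_label_def fock_iff fin)
qed

text \<open>The constant is the weight of the image ({-1}, {1}) of the vacuum. An occupied zero mode
  of one species removes the corresponding mode of the other from this image, whence the negative
  weights at k = 0.\<close>

lemma weight_gauge_label:
  assumes "\<beta> \<in> fock_basis"
  shows "weight wb wc (gauge_label \<beta>) = weight (\<lambda>k. if k = 0 then - wc 1 else wb (k - 1)) (\<lambda>k. if k = 0 then - wb (- 1) else wc (k + 1)) \<beta>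
     + (wb (- 1) + wc 1)"
proof -
  obtain M N where \<beta>: "\<beta> = (M, N)" by fastforce
  have f: "finite M" "finite N" using assms by (auto simp: \<beta> fock_iff)
  let ?wb = "\<lambda>k. if k = 0 then - wc 1 else wb (k - 1)" and ?wc = "\<lambda>k. if k = 0 then - wb (- 1) else wc (k + 1)"
  have 1: "sum wb ((\<lambda>k. k - 1) ` (M - {0}) \<union> (if 0 \<in> N then {} else {- 1})) = (\<Sum>k\<in>M - {0}. wb (k - 1)) + (if 0 \<in> N then 0 else wb (- 1))"
  proof -
    have "sum wb ((\<lambda>k. k - 1) ` (M - {0}) \<union> (if 0 \<in> N then {} else {- 1})) = sum wb ((\<lambda>k. k - 1) ` (M - {0})) + sum wb (if 0 \<in> N then {} else {- 1})"
      using f by (intro sum.union_disjoint) auto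
    also have "sum wb ((\<lambda>k. k - 1) ` (M - {0})) = (\<Sum>k\<in>M - {0}. wb (k - 1))"
      by (subst sum.reindex) (auto intro: inj_onI)
    finally show ?thesis by simp
  qed
  have 2: "sum wc ((\<lambda>k. k + 1) ` (N - {0}) \<union> (if 0 \<in> M then {} else {1})) = (\<Sum>k\<in>N - {0}. wc (k + 1)) + (if 0 \<in> M then 0 else wc 1)"
  proof -
    have "sum wc ((\<lambda>k. k + 1) ` (N - {0}) \<union> (if 0 \<in> M then {} else {1})) = sum wc ((\<lambda>k. k + 1) ` (N - {0})) + sum wc (if 0 \<in> M then {} else {1})"
      using f by (intro sum.union_disjoint) auto
    also have "sum wc ((\<lambda>k. k + 1) ` (N - {0})) = (\<Sum>k\<in>N - {0}. wc (k + 1))"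
      by (subst sum.reindex) (auto intro: inj_onI)
    finally show ?thesis by simp
  qed
  have 3: "sum ?wb M = (\<Sum>k\<in>M - {0}. wb (k - 1)) - (if 0 \<in> M then wc 1 else 0)"
  proof (cases "0 \<in> M")
    case True
    then show ?thesis using sum.remove[OF f(1) True, of ?wb] sum.cong[of "M - {0}" "M - {0}" ?wb "\<lambda>k. wb (k - 1)"] by simp
  next
    case False
    then have "M - {0} = M" by auto
    moreover have "sum ?wb M = (\<Sum>k\<in>M. wb (k - 1))" using False by (intro sum.cong) auto
    ultimately show ?thesis using False by simp
  qed
  have 4: "sum ?wc N = (\<Sum>k\<in>N - {0}. wc (k + 1)) - (if 0 \<in> N then wb (- 1) else 0)"
  proof (cases "0 \<in> N")
    case True
    then show ?thesis using sum.remove[OF f(2) True, of ?wc] sum.cong[of "N - {0}" "N - {0}" ?wc "\<lambda>k. wc (k + 1)"] by simp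
  next
    case False
    then have "N - {0} = N" by auto
    moreover have "sum ?wc N = (\<Sum>k\<in>N. wc (k + 1))" using False by (intro sum.cong) auto
    ultimately show ?thesis using False by simp
  qed
  show ?thesis unfolding \<beta> gauge_label_def weight_def by (simp only: prod.case fst_conv snd_conv 1 2 3 4) auto
qed

lemma chg_gauge_label: "\<beta> \<in> fock_basis \<Longrightarrow> chg (gauge_label \<beta>) = chg \<beta>"
  by (subst weight_gauge_label) (simp_all cong: if_cong)

lemma q5_gauge_label:
  assumes "\<beta> \<in> fock_basis" shows "q5 (gauge_label \<beta>) = q5 \<beta> - 2"
proof -
  have "(\<lambda>k. if k = 0 then - sc5 1 else sb5 (k - 1)) = sb5" "(\<lambda>k. if k = 0 then - sb5 (- 1) else sc5 (k + 1)) = sc5"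
    by (auto simp: fun_eq_iff)
  then show ?thesis unfolding weight_gauge_label[OF assms] by (simp only:) simp
qed

text \<open>Shifting a mode changes its energy by minus its axial charge, and the zero modes follow
  the same rule with their pulled-back weight. The constant 2 is the energy of the image of the
  vacuum.\<close>

lemma kin_gauge_label:
  assumes "\<beta> \<in> fock_basis" shows "kin (gauge_label \<beta>) = kin \<beta> - q5 \<beta> + 2"
proof -
  have "(\<lambda>k::int. if k = 0 then - \<bar>1\<bar> else \<bar>k - 1\<bar>) = (\<lambda>k. \<bar>k\<bar> - sb5 k)"
    "(\<lambda>k::int. if k = 0 then - \<bar>- 1\<bar> else \<bar>k + 1\<bar>) = (\<lambda>k. \<bar>k\<bar> - sc5 k)"
    by (auto simp: fun_eq_iff)
  then have "kin (gauge_label \<beta>) = weight (\<lambda>k. \<bar>k\<bar> - sb5 k) (\<lambda>k. \<bar>k\<bar> - sc5 k) \<beta> + 2"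
    unfolding weight_gauge_label[OF assms] by simp
  then show ?thesis by (simp add: weight_def sum_subtractf)
qed

text \<open>Four times the kinetic energy above the minimum \<open>Q\<^sup>5 (Q\<^sup>5 - 2) / 4\<close> of the axial charge sector; it is invariant under \<Gamma>, while the kinetic energy is not.\<close>

definition E4 :: "fb \<Rightarrow> int" where
  "E4 \<beta> = 4 * kin \<beta> - (q5 \<beta>)\<^sup>2 + 2 * q5 \<beta>"

lemma E4_gauge_label: "\<beta> \<in> fock_basis \<Longrightarrow> E4 (gauge_label \<beta>) = E4 \<beta>"
  unfolding E4_def by (simp add: kin_gauge_label q5_gauge_label power2_eq_square algebra_simps)

lemma charge0_iff: "\<beta> \<in> charge0_basis \<longleftrightarrow> \<beta> \<in> fock_basis \<and> chg \<beta> = 0"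
  by (cases \<beta>) (auto simp: charge0_basis_def fock_basis_def weight_def)

text \<open>Subtracting the vanishing charge makes every single contribution even. As \<Gamma>
  changes the axial charge by 2, every orbit of neutral labels therefore passes through axial charge
  0.\<close>

lemma even_q5: "\<beta> \<in> charge0_basis \<Longrightarrow> even (q5 \<beta>)"
proof -
  assume "\<beta> \<in> charge0_basis"
  then have "q5 \<beta> = q5 \<beta> - chg \<beta>" by (simp add: charge0_iff)
  also have "\<dots> = (\<Sum>k\<in>fst \<beta>. sb5 k - 1) + (\<Sum>k\<in>snd \<beta>. sc5 k + 1)"
    by (simp add: weight_def sum_subtractf sum.distrib)
  also have "even \<dots>"
  proof -
    have "even (sb5 k - 1)" "even (sc5 k + 1)" for k by auto
    then show ?thesis by (rule dvd_add[OF dvd_sum dvd_sum])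
  qed
  finally show ?thesis .
qed

section \<open>Integer powers of the label map and its orbits\<close>

definition gauge_iter :: "int \<Rightarrow> fb \<Rightarrow> fb" where
  "gauge_iter j = (if 0 \<le> j then gauge_label ^^ nat j else gauge_label_inv ^^ nat (- j))"

lemma gauge_iter_0 [simp]: "gauge_iter 0 \<beta> = \<beta>"
  by (simp add: gauge_iter_def)

lemma gauge_iter_Suc: "gauge_iter (j + 1) \<beta> = gauge_label (gauge_iter j \<beta>)"
proof (cases "0 \<le> j")
  case True
  then have "nat (j + 1) = Suc (nat j)" by simp
  then show ?thesis using True by (simp add: gauge_iter_def)
next
  case False
  then have "nat (- j) = Suc (nat (- (j + 1)))" by simp
  then show ?thesis using False by (cases "j = -1") (simp_all add: gauge_iter_def gauge_label_gauge_label_inv)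
qed

lemma gauge_iter_pred: "gauge_iter (j - 1) \<beta> = gauge_label_inv (gauge_iter j \<beta>)"
  using gauge_iter_Suc[of "j - 1" \<beta>] by (simp add: gauge_label_gauge_label_inv)

lemma int_all_induct: "P (0::int) \<Longrightarrow> (\<And>j. P j \<Longrightarrow> P (j + 1)) \<Longrightarrow> (\<And>j. P j \<Longrightarrow> P (j - 1)) \<Longrightarrow> P j"
  by (induction j rule: int_induct[of _ 0]) auto

lemma gauge_iter_add: "gauge_iter i (gauge_iter j \<beta>) = gauge_iter (i + j) \<beta>"
proof (induction i rule: int_all_induct)
  case (2 i)
  have "gauge_iter (i + 1) (gauge_iter j \<beta>) = gauge_iter (i + j + 1) \<beta>" using 2 by (simp only: gauge_iter_Suc)
  then show ?case by (simp only: add_ac)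
next
  case (3 i)
  have "gauge_iter (i - 1) (gauge_iter j \<beta>) = gauge_iter (i + j - 1) \<beta>" using 3 by (simp only: gauge_iter_pred)
  then show ?case by (simp add: algebra_simps)
qed simp

lemma gauge_label_inv_fock: "gauge_label_inv \<beta> \<in> fock_basis \<longleftrightarrow> \<beta> \<in> fock_basis"
  using gauge_label_fock[of "gauge_label_inv \<beta>"] by (simp add: gauge_label_gauge_label_inv)

lemma gauge_iter_fock: "gauge_iter j \<beta> \<in> fock_basis \<longleftrightarrow> \<beta> \<in> fock_basis"
  by (induction j rule: int_all_induct) (simp_all add: gauge_iter_Suc gauge_iter_pred gauge_label_fock gauge_label_inv_fock)

lemma gauge_iter_inv:
  assumes "\<beta> \<in> fock_basis" "\<And>\<beta>. \<beta> \<in> fock_basis \<Longrightarrow> f (gauge_label \<beta>) = f \<beta> + (d::int)"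
  shows "f (gauge_iter j \<beta>) = f \<beta> + j * d"
proof (induction j rule: int_all_induct)
  case (2 j)
  have "f (gauge_iter (j + 1) \<beta>) = f (gauge_iter j \<beta>) + d" unfolding gauge_iter_Suc using assms by (intro assms(2)) (simp add: gauge_iter_fock)
  then show ?case using 2 by (simp add: algebra_simps)
next
  case (3 j)
  have "f (gauge_label (gauge_iter (j - 1) \<beta>)) = f (gauge_iter (j - 1) \<beta>) + d" using assms by (intro assms(2)) (simp add: gauge_iter_fock)
  then show ?case using 3 gauge_iter_Suc[of "j - 1" \<beta>] by (simp add: algebra_simps)
qed simp

lemma gauge_iter_q5: "\<beta> \<in> fock_basis \<Longrightarrow> q5 (gauge_iter j \<beta>) = q5 \<beta> - 2 * j"
  using gauge_iter_inv[of \<beta> q5 "-2" j] q5_gauge_label by simp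

lemma gauge_iter_chg: "\<beta> \<in> fock_basis \<Longrightarrow> chg (gauge_iter j \<beta>) = chg \<beta>"
  using gauge_iter_inv[of \<beta> chg 0 j] chg_gauge_label by simp

lemma gauge_iter_E4: "\<beta> \<in> fock_basis \<Longrightarrow> E4 (gauge_iter j \<beta>) = E4 \<beta>"
  using gauge_iter_inv[of \<beta> E4 0 j] E4_gauge_label by simp

lemma gauge_iter_charge0: "gauge_iter j \<beta> \<in> charge0_basis \<longleftrightarrow> \<beta> \<in> charge0_basis"
  using gauge_iter_chg[of \<beta> j] gauge_iter_fock[of j \<beta>] by (auto simp: charge0_iff)

lemma charge0_fock: "\<beta> \<in> charge0_basis \<Longrightarrow> \<beta> \<in> fock_basis"
  by (simp add: charge0_iff)

text \<open>A fundamental domain: each orbit of neutral labels under the integer powers of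
  \<open>gauge_label\<close> meets it exactly once, since the axial charge drops by 2 at every
  step.\<close>

definition J0 :: "fb set" where
  "J0 = {\<beta> \<in> charge0_basis. q5 \<beta> = 0}"

text \<open>The power of \<Gamma> that leads from the representative in \<open>J0\<close> to the
  label; the minus sign is there because \<Gamma> lowers the axial charge.\<close>

definition sheet :: "fb \<Rightarrow> int" where
  "sheet \<beta> = - (q5 \<beta> div 2)"

definition base_label :: "fb \<Rightarrow> fb" where
  "base_label \<beta> = gauge_iter (- sheet \<beta>) \<beta>"

lemma J0_charge0: "r \<in> J0 \<Longrightarrow> r \<in> charge0_basis" and J0_fock: "r \<in> J0 \<Longrightarrow> r \<in> fock_basis" and J0_q5: "r \<in> J0 \<Longrightarrow> q5 r = 0"
  by (auto simp: J0_def charge0_iff)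

lemma base_label_J0: "\<beta> \<in> charge0_basis \<Longrightarrow> base_label \<beta> \<in> J0"
  using even_q5[of \<beta>] by (auto simp: J0_def base_label_def gauge_iter_charge0 gauge_iter_q5 charge0_fock sheet_def)

lemma gauge_iter_base_label: "gauge_iter (sheet \<beta>) (base_label \<beta>) = \<beta>"
  by (simp add: base_label_def gauge_iter_add)

lemma sheet_gauge_iter: "r \<in> J0 \<Longrightarrow> sheet (gauge_iter j r) = j"
  using J0_q5[of r] by (simp add: sheet_def gauge_iter_q5 J0_fock)

lemma base_label_gauge_iter: "r \<in> J0 \<Longrightarrow> base_label (gauge_iter j r) = r"
  by (simp add: base_label_def sheet_gauge_iter gauge_iter_add)

lemma gauge_iter_inj: "r \<in> J0 \<Longrightarrow> r' \<in> J0 \<Longrightarrow> gauge_iter j r = gauge_iter j' r' \<longleftrightarrow> j = j' \<and> r = r'"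
  by (metis sheet_gauge_iter base_label_gauge_iter)

lemma sheet_gauge_label: "\<beta> \<in> fock_basis \<Longrightarrow> sheet (gauge_label \<beta>) = sheet \<beta> + 1"
  by (simp add: sheet_def q5_gauge_label)

lemma base_label_gauge_label: "\<beta> \<in> fock_basis \<Longrightarrow> base_label (gauge_label \<beta>) = base_label \<beta>"
proof -
  assume b: "\<beta> \<in> fock_basis"
  have g: "gauge_label \<beta> = gauge_iter 1 \<beta>" using gauge_iter_Suc[of 0 \<beta>] by simp
  have "base_label (gauge_label \<beta>) = gauge_iter (- (sheet \<beta> + 1)) (gauge_label \<beta>)" unfolding base_label_def sheet_gauge_label[OF b] ..
  then show ?thesis unfolding g gauge_iter_add by (simp add: base_label_def)
qed

definition base_block :: "nat \<Rightarrow> fb set" where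
  "base_block n = {r \<in> J0. kin r \<le> int n}"

lemma finite_base_block: "finite (base_block n)"
  by (rule finite_subset[OF _ finite_kin[of "int n"]]) (auto simp: base_block_def J0_fock)

lemma base_block_ex: "r \<in> J0 \<Longrightarrow> \<exists>n. r \<in> base_block n"
  by (intro exI[of _ "nat (kin r)"]) (auto simp: base_block_def kin_nonneg)

lemma base_block_mono: "n \<le> m \<Longrightarrow> base_block n \<subseteq> base_block m"
  by (auto simp: base_block_def)

lemma base_block_J0: "base_block n \<subseteq> J0" by (auto simp: base_block_def)

text \<open>A matrix entry conserves the axial charge, hence the sheet, and together with the
  kinetic energy also \<open>E4\<close>. The latter is constant along orbits and equals four times
  the kinetic energy on \<open>J0\<close>. So the same finite set of representatives is a block on
  every sheet.\<close>

lemma K_entry_gauge_iter_block: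
  assumes "r \<in> base_block n" "K_entry e L \<beta> (gauge_iter j r) \<noteq> 0"
  shows "sheet \<beta> = j" "base_label \<beta> \<in> base_block n" "\<beta> \<in> charge0_basis"
proof -
  have r: "r \<in> J0" "kin r \<le> int n" using assms by (auto simp: base_block_def)
  have f: "gauge_iter j r \<in> fock_basis" using r by (simp add: gauge_iter_fock J0_fock)
  note k = K_entry_block[OF assms(2) f]
  show c: "\<beta> \<in> charge0_basis" using k gauge_iter_charge0[of j r] r by (simp add: charge0_iff J0_charge0[unfolded charge0_iff])
  show j: "sheet \<beta> = j" using k(4) sheet_gauge_iter[OF r(1), of j] by (simp add: sheet_def)
  have "E4 \<beta> = E4 (gauge_iter j r)" using k by (simp add: E4_def)
  then have "E4 \<beta> = E4 r" using gauge_iter_E4[of r j] r by (simp add: J0_fock)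
  moreover have "E4 (base_label \<beta>) = E4 \<beta>" unfolding base_label_def by (rule gauge_iter_E4[OF k(1)])
  ultimately have "4 * kin (base_label \<beta>) = 4 * kin r" using J0_q5[OF base_label_J0[OF c]] J0_q5[OF r(1)] by (simp add: E4_def)
  then show "base_label \<beta> \<in> base_block n" using r base_label_J0[OF c] by (simp add: base_block_def)
qed

section \<open>The action of \<Gamma> on basis vectors\<close>

definition sgd :: "fvec \<Rightarrow> fb \<Rightarrow> bool" where
  "sgd \<phi> \<beta> \<longleftrightarrow> (\<exists>s\<in>{1, - 1}. \<phi> = (\<lambda>\<beta>'. s * basis_vec \<beta> \<beta>'))"

lemma pm1: "(- 1) ^ n \<in> {1, - 1 :: complex}" "s \<in> {1, - 1 :: complex} \<Longrightarrow> t \<in> {1, - 1} \<Longrightarrow> s * t \<in> {1, - 1}"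
  by (auto simp: minus_one_power_iff)

lemma pm1_sq: "s \<in> {1, - 1 :: complex} \<Longrightarrow> s * s = 1"
  by auto

lemma ops_scale:
  "bdag n (\<lambda>\<beta>. s * \<phi> \<beta>) = (\<lambda>\<beta>. s * bdag n \<phi> \<beta>)" "bann n (\<lambda>\<beta>. s * \<phi> \<beta>) = (\<lambda>\<beta>. s * bann n \<phi> \<beta>)"
  "cdag n (\<lambda>\<beta>. s * \<phi> \<beta>) = (\<lambda>\<beta>. s * cdag n \<phi> \<beta>)" "cann n (\<lambda>\<beta>. s * \<phi> \<beta>) = (\<lambda>\<beta>. s * cann n \<phi> \<beta>)"
  using ops_lin[of n s \<phi> "\<lambda>_. 0"] by (simp_all add: ops_zero)

lemma ops_basis_vec:
  assumes "finite M" "finite N"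
  shows "n \<notin> M \<Longrightarrow> bdag n (basis_vec (M, N)) = (\<lambda>\<beta>. (-1) ^ cnt_less M n * basis_vec (insert n M, N) \<beta>)"
    "n \<in> M \<Longrightarrow> bann n (basis_vec (M, N)) = (\<lambda>\<beta>. (-1) ^ cnt_less M n * basis_vec (M - {n}, N) \<beta>)"
    "n \<notin> N \<Longrightarrow> cdag n (basis_vec (M, N)) = (\<lambda>\<beta>. (-1) ^ (card M + cnt_less N n) * basis_vec (M, insert n N) \<beta>)"
    "n \<in> N \<Longrightarrow> cann n (basis_vec (M, N)) = (\<lambda>\<beta>. (-1) ^ (card M + cnt_less N n) * basis_vec (M, N - {n}) \<beta>)"
  using assms
  by (auto simp: bdag_def bann_def cdag_def cann_def basis_vec_def fun_eq_iff fock_iff cnt_less_simps insert_absorb)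

lemma sgd_scale: "sgd \<phi> \<beta> \<Longrightarrow> s \<in> {1, - 1} \<Longrightarrow> sgd (\<lambda>x. s * \<phi> x) \<beta>"
  unfolding sgd_def by (auto simp: mult.assoc[symmetric])

text \<open>Fermionic signs are carried along without being evaluated: all that matters later is
  that each image is a basis vector times a sign, and that signs square to 1.\<close>

lemma sgd_ops:
  assumes "sgd \<phi> (M, N)" "finite M" "finite N"
  shows "n \<notin> M \<Longrightarrow> sgd (bdag n \<phi>) (insert n M, N)" "n \<in> M \<Longrightarrow> sgd (bann n \<phi>) (M - {n}, N)"
    "n \<notin> N \<Longrightarrow> sgd (cdag n \<phi>) (M, insert n N)" "n \<in> N \<Longrightarrow> sgd (cann n \<phi>) (M, N - {n})"
proof -
  obtain s where s: "s \<in> {1, - 1}" "\<phi> = (\<lambda>\<beta>. s * basis_vec (M, N) \<beta>)" using assms(1) unfolding sgd_def by blast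
  have d: "sgd (\<lambda>\<beta>'. (-1) ^ k * basis_vec \<beta> \<beta>') \<beta>" for k \<beta> using pm1(1) unfolding sgd_def by blast
  note o = ops_basis_vec[OF assms(2,3)]
  show "sgd (bdag n \<phi>) (insert n M, N)" if "n \<notin> M"
    unfolding s(2) ops_scale o(1)[OF that] by (rule sgd_scale[OF d s(1)])
  show "sgd (bann n \<phi>) (M - {n}, N)" if "n \<in> M"
    unfolding s(2) ops_scale o(2)[OF that] by (rule sgd_scale[OF d s(1)])
  show "sgd (cdag n \<phi>) (M, insert n N)" if "n \<notin> N"
    unfolding s(2) ops_scale o(3)[OF that] by (rule sgd_scale[OF d s(1)])
  show "sgd (cann n \<phi>) (M, N - {n})" if "n \<in> N"
    unfolding s(2) ops_scale o(4)[OF that] by (rule sgd_scale[OF d s(1)])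
qed

locale schwinger =
  fixes e L C0 :: real and G :: "fvec \<Rightarrow> fvec"
  assumes e: "0 < e" and L: "0 < L" and G: "is_large_gauge G"
begin

lemma G_rules:
  "fin_vec \<psi> \<Longrightarrow> fin_vec \<phi> \<Longrightarrow> G (\<lambda>\<beta>. \<psi> \<beta> + \<phi> \<beta>) = (\<lambda>\<beta>. G \<psi> \<beta> + G \<phi> \<beta>)"
  "fin_vec \<psi> \<Longrightarrow> G (\<lambda>\<beta>. z * \<psi> \<beta>) = (\<lambda>\<beta>. z * G \<psi> \<beta>)"
  "G vac = bdag (- 1) (cdag 1 vac)"
  "fin_vec \<psi> \<Longrightarrow> n \<noteq> 0 \<Longrightarrow> G (bdag n \<psi>) = bdag (n - 1) (G \<psi>)"
  "fin_vec \<psi> \<Longrightarrow> G (bdag 0 \<psi>) = cann 1 (G \<psi>)"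
  "fin_vec \<psi> \<Longrightarrow> n \<noteq> 0 \<Longrightarrow> G (cdag n \<psi>) = cdag (n + 1) (G \<psi>)"
  "fin_vec \<psi> \<Longrightarrow> G (cdag 0 \<psi>) = bann (- 1) (G \<psi>)"
proof -
  note G' = G[unfolded is_large_gauge_def]
  note c = G'[THEN conjunct1] G'[THEN conjunct2, THEN conjunct1] G'[THEN conjunct2, THEN conjunct2, THEN conjunct1]
    G'[THEN conjunct2, THEN conjunct2, THEN conjunct2, THEN conjunct1]
    G'[THEN conjunct2, THEN conjunct2, THEN conjunct2, THEN conjunct2, THEN conjunct1]
    G'[THEN conjunct2, THEN conjunct2, THEN conjunct2, THEN conjunct2, THEN conjunct2, THEN conjunct1]
    G'[THEN conjunct2, THEN conjunct2, THEN conjunct2, THEN conjunct2, THEN conjunct2, THEN conjunct2]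
  show "fin_vec \<psi> \<Longrightarrow> fin_vec \<phi> \<Longrightarrow> G (\<lambda>\<beta>. \<psi> \<beta> + \<phi> \<beta>) = (\<lambda>\<beta>. G \<psi> \<beta> + G \<phi> \<beta>)"
    by (rule c(1)[rule_format])
  show "fin_vec \<psi> \<Longrightarrow> G (\<lambda>\<beta>. z * \<psi> \<beta>) = (\<lambda>\<beta>. z * G \<psi> \<beta>)" by (rule c(2)[rule_format])
  show "G vac = bdag (- 1) (cdag 1 vac)" by (rule c(3))
  show "fin_vec \<psi> \<Longrightarrow> n \<noteq> 0 \<Longrightarrow> G (bdag n \<psi>) = bdag (n - 1) (G \<psi>)" by (rule c(4)[rule_format])
  show "fin_vec \<psi> \<Longrightarrow> G (bdag 0 \<psi>) = cann 1 (G \<psi>)" by (rule c(5)[rule_format])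
  show "fin_vec \<psi> \<Longrightarrow> n \<noteq> 0 \<Longrightarrow> G (cdag n \<psi>) = cdag (n + 1) (G \<psi>)" by (rule c(6)[rule_format])
  show "fin_vec \<psi> \<Longrightarrow> G (cdag 0 \<psi>) = bann (- 1) (G \<psi>)" by (rule c(7)[rule_format])
qed

text \<open>Creating mode n becomes creating mode n + 1, except for n = 0, where \<Gamma> turns it
  into the annihilation of b mode -1. That mode is occupied in the image exactly because 0 is absent
  from \<open>N\<close>.\<close>

lemma G_cdag_step:
  assumes f: "finite M" "finite N" and n: "n \<notin> N" and s: "sgd (G (basis_vec (M, N))) (gauge_label (M, N))"
  shows "sgd (G (basis_vec (M, insert n N))) (gauge_label (M, insert n N))"
proof -
  let ?s = "(-1) ^ (card M + cnt_less N n) :: complex"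
  have fv: "fin_vec (basis_vec (M, N))" "fin_vec (cdag n (basis_vec (M, N)))"
    using f unfolding ops_basis_vec(3)[OF f n] by (auto simp: fin_vec_iff basis_vec_def fock_iff)
  have "basis_vec (M, insert n N) = (\<lambda>\<beta>. ?s * cdag n (basis_vec (M, N)) \<beta>)"
    unfolding ops_basis_vec(3)[OF f n] by (simp add: mult.assoc[symmetric] pm1_sq[OF pm1(1)])
  then have eq: "G (basis_vec (M, insert n N)) = (\<lambda>\<beta>. ?s * G (cdag n (basis_vec (M, N))) \<beta>)"
    using G_rules(2)[OF fv(2)] by simp
  obtain M' N' where g: "gauge_label (M, N) = (M', N')" by fastforce
  have f': "finite M'" "finite N'" using gauge_label_fock[of "(M, N)"] f by (auto simp: g fock_iff)
  have "sgd (G (cdag n (basis_vec (M, N)))) (gauge_label (M, insert n N))"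
  proof (cases "n = 0")
    case True
    have "- 1 \<in> M'" using g n True by (auto simp: gauge_label_def)
    moreover have "gauge_label (M, insert n N) = (M' - {- 1}, N')" using g n True by (auto simp: gauge_label_def)
    ultimately show ?thesis using sgd_ops(2)[OF s[unfolded g] f', of "-1"] G_rules(7)[OF fv(1)] True by simp
  next
    case False
    have "n + 1 \<notin> N'" using g n False by (auto simp: gauge_label_def split: if_splits)
    moreover have "gauge_label (M, insert n N) = (M', insert (n + 1) N')" using g n False by (auto simp: gauge_label_def split: if_splits)
    ultimately show ?thesis using sgd_ops(3)[OF s[unfolded g] f', of "n + 1"] G_rules(6)[OF fv(1) False] by simp
  qed
  then show ?thesis unfolding eq by (rule sgd_scale[OF _ pm1(1)])
qed

lemma G_bdag_step:
  assumes f: "finite M" "finite N" and n: "n \<notin> M" and s: "sgd (G (basis_vec (M, N))) (gauge_label (M, N))"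
  shows "sgd (G (basis_vec (insert n M, N))) (gauge_label (insert n M, N))"
proof -
  let ?s = "(-1) ^ (cnt_less M n) :: complex"
  have fv: "fin_vec (basis_vec (M, N))" "fin_vec (bdag n (basis_vec (M, N)))"
    using f unfolding ops_basis_vec(1)[OF f n] by (auto simp: fin_vec_iff basis_vec_def fock_iff)
  have "basis_vec (insert n M, N) = (\<lambda>\<beta>. ?s * bdag n (basis_vec (M, N)) \<beta>)"
    unfolding ops_basis_vec(1)[OF f n] by (simp add: mult.assoc[symmetric] pm1_sq[OF pm1(1)])
  then have eq: "G (basis_vec (insert n M, N)) = (\<lambda>\<beta>. ?s * G (bdag n (basis_vec (M, N))) \<beta>)"
    using G_rules(2)[OF fv(2)] by simp
  obtain M' N' where g: "gauge_label (M, N) = (M', N')" by fastforce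
  have f': "finite M'" "finite N'" using gauge_label_fock[of "(M, N)"] f by (auto simp: g fock_iff)
  have "sgd (G (bdag n (basis_vec (M, N)))) (gauge_label (insert n M, N))"
  proof (cases "n = 0")
    case True
    have "1 \<in> N'" using g n True by (auto simp: gauge_label_def)
    moreover have "gauge_label (insert n M, N) = (M', N' - {1})" using g n True by (auto simp: gauge_label_def)
    ultimately show ?thesis using sgd_ops(4)[OF s[unfolded g] f', of 1] G_rules(5)[OF fv(1)] True by simp
  next
    case False
    have "n - 1 \<notin> M'" using g n False by (auto simp: gauge_label_def split: if_splits)
    moreover have "gauge_label (insert n M, N) = (insert (n - 1) M', N')" using g n False by (auto simp: gauge_label_def split: if_splits)
    ultimately show ?thesis using sgd_ops(1)[OF s[unfolded g] f', of "n - 1"] G_rules(4)[OF fv(1) False] by simp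
  qed
  then show ?thesis unfolding eq by (rule sgd_scale[OF _ pm1(1)])
qed

text \<open>Basis vectors are built up from the vacuum, whose image is prescribed: the c modes,
  which stand next to the vacuum, are added before the b modes.\<close>

lemma G_basis_vec: "\<beta> \<in> fock_basis \<Longrightarrow> sgd (G (basis_vec \<beta>)) (gauge_label \<beta>)"
proof -
  have v: "vac = basis_vec ({}, {})" by (auto simp: vac_def basis_vec_def fun_eq_iff)
  have "sgd (basis_vec \<beta>) \<beta>" for \<beta> unfolding sgd_def by (intro bexI[of _ 1]) auto
  then have "sgd (bdag (- 1) (cdag 1 (basis_vec ({}, {})))) (insert (- 1) {}, insert 1 {})"
    by (intro sgd_ops) auto
  then have 0: "sgd (G (basis_vec ({}, {}))) (gauge_label ({}, {}))"
    using G_rules(3) by (simp add: v gauge_label_def)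
  have 1: "finite N \<Longrightarrow> sgd (G (basis_vec ({}, N))) (gauge_label ({}, N))" for N
    by (induction N rule: finite_induct) (auto intro: 0 G_cdag_step)
  have 2: "finite M \<Longrightarrow> finite N \<Longrightarrow> sgd (G (basis_vec (M, N))) (gauge_label (M, N))" for M N
    by (induction M rule: finite_induct) (auto intro: 1 G_bdag_step)
  assume "\<beta> \<in> fock_basis"
  then show ?thesis using 2 by (cases \<beta>) (auto simp: fock_iff)
qed

text \<open>The value 1 outside \<open>fock_basis\<close> keeps the sign in {1, -1} for every label,
  so that squares and products of signs can be cancelled without side conditions.\<close>

definition gauge_sign :: "fb \<Rightarrow> complex" where
  "gauge_sign \<beta> = (if \<beta> \<in> fock_basis then G (basis_vec \<beta>) (gauge_label \<beta>) else 1)"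

lemma gauge_sign_pm: "gauge_sign \<beta> \<in> {1, - 1}"
proof (cases "\<beta> \<in> fock_basis")
  case True
  then obtain s where "s \<in> {1, -1}" "G (basis_vec \<beta>) = (\<lambda>\<beta>'. s * basis_vec (gauge_label \<beta>) \<beta>')" using G_basis_vec unfolding sgd_def by blast
  then show ?thesis using True by (auto simp: gauge_sign_def basis_vec_def)
qed (simp add: gauge_sign_def)

lemma G_basis_vec_eq: "\<beta> \<in> fock_basis \<Longrightarrow> G (basis_vec \<beta>) = (\<lambda>\<beta>'. gauge_sign \<beta> * basis_vec (gauge_label \<beta>) \<beta>')"
  using G_basis_vec[of \<beta>] unfolding sgd_def gauge_sign_def by (auto simp: basis_vec_def)

text \<open>\<open>is_large_gauge\<close> constrains \<open>G\<close> on finite vectors only, so its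
  linearity is exhausted by induction over a finite set containing the support.\<close>

lemma G_matrix:
  assumes "finite S" "S \<subseteq> fock_basis" "\<And>\<beta>. \<beta> \<notin> S \<Longrightarrow> \<psi> \<beta> = 0"
  shows "G \<psi> \<beta> = (\<Sum>\<beta>'\<in>S. gauge_sign \<beta>' * \<psi> \<beta>' * basis_vec (gauge_label \<beta>') \<beta>)"
  using assms
proof (induction S arbitrary: \<psi> rule: finite_induct)
  case empty
  then have \<psi>: "\<psi> = (\<lambda>\<beta>. 0 * vac \<beta>)" by auto
  have "fin_vec vac" by (auto simp: fin_vec_iff vac_def fock_iff)
  then show ?case using G_rules(2)[of vac 0] unfolding \<psi> by simp
next
  case (insert x S)
  let ?\<phi> = "\<lambda>\<beta>. if \<beta> = x then 0 else \<psi> \<beta>"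
  have eq: "\<psi> = (\<lambda>\<beta>. \<psi> x * basis_vec x \<beta> + ?\<phi> \<beta>)" by (auto simp: basis_vec_def)
  have z: "\<And>\<beta>. \<beta> \<notin> S \<Longrightarrow> ?\<phi> \<beta> = 0" using insert.prems(2) by auto
  have f: "fin_vec ?\<phi>" by (rule fin_vec_sub[of S]) (use insert z in auto)
  have x: "x \<in> fock_basis" using insert.prems(1) by auto
  have fx: "fin_vec (\<lambda>\<beta>. \<psi> x * basis_vec x \<beta>)" by (rule fin_vec_sub[of "{x}"]) (use x in \<open>auto simp: basis_vec_def\<close>)
  have "G \<psi> \<beta> = G (\<lambda>\<beta>. \<psi> x * basis_vec x \<beta>) \<beta> + G ?\<phi> \<beta>"
    by (subst eq, subst G_rules(1)[OF fx f]) simp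
  also have "G (\<lambda>\<beta>. \<psi> x * basis_vec x \<beta>) \<beta> = gauge_sign x * \<psi> x * basis_vec (gauge_label x) \<beta>"
    unfolding G_rules(2)[OF basis_vec_fin_vec[OF x]] G_basis_vec_eq[OF x] by simp
  also have "G ?\<phi> \<beta> = (\<Sum>\<beta>'\<in>S. gauge_sign \<beta>' * ?\<phi> \<beta>' * basis_vec (gauge_label \<beta>') \<beta>)"
    using insert.prems by (intro insert.IH z) auto
  also have "\<dots> = (\<Sum>\<beta>'\<in>S. gauge_sign \<beta>' * \<psi> \<beta>' * basis_vec (gauge_label \<beta>') \<beta>)" using insert.hyps by (intro sum.cong) auto
  finally show ?case using insert.hyps by simp
qed

lemma G_apply:
  assumes "fin_vec \<psi>"
  shows "G \<psi> (gauge_label \<beta>) = gauge_sign \<beta> * \<psi> \<beta>"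
proof -
  let ?S = "{\<beta>. \<psi> \<beta> \<noteq> 0}"
  have S: "finite ?S" "?S \<subseteq> fock_basis" using assms by (auto simp: fin_vec_iff)
  have "G \<psi> (gauge_label \<beta>) = (\<Sum>\<beta>'\<in>?S. gauge_sign \<beta>' * \<psi> \<beta>' * basis_vec (gauge_label \<beta>') (gauge_label \<beta>))"
    by (rule G_matrix[OF S]) auto
  also have "\<dots> = (\<Sum>\<beta>'\<in>?S. if \<beta>' = \<beta> then gauge_sign \<beta> * \<psi> \<beta> else 0)"
    using bij_gauge_label by (intro sum.cong refl) (auto simp: basis_vec_def bij_def inj_eq)
  also have "\<dots> = gauge_sign \<beta> * \<psi> \<beta>" using S by simp
  finally show ?thesis .
qed

lemma G_eq_iff:
  assumes "fin_vec \<psi>"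
  shows "G \<psi> = \<phi> \<longleftrightarrow> (\<forall>\<beta>. \<phi> (gauge_label \<beta>) = gauge_sign \<beta> * \<psi> \<beta>)"
proof -
  have "G \<psi> = \<phi> \<longleftrightarrow> (\<forall>\<beta>. G \<psi> (gauge_label \<beta>) = \<phi> (gauge_label \<beta>))"
    using bij_gauge_label by (metis bij_pointE ext)
  then show ?thesis using G_apply[OF assms] by auto
qed

text \<open>\<open>\<Gamma>\<^sup>j\<close> sends the basis vector of \<open>r\<close> to \<open>iter_sign j r\<close> times that of \<open>gauge_iter j r\<close>; for each \<open>j\<close> one of the two products is empty.\<close>

definition iter_sign :: "int \<Rightarrow> fb \<Rightarrow> complex" where
  "iter_sign j r = (\<Prod>i\<in>{0..<j}. gauge_sign (gauge_iter i r)) * (\<Prod>i\<in>{j..<0}. gauge_sign (gauge_iter i r))"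

lemma iter_sign_pm: "iter_sign j r \<in> {1, - 1}"
proof -
  have "(\<Prod>i\<in>A. gauge_sign (gauge_iter i r)) \<in> {1, - 1}" for A
  proof (induction A rule: infinite_finite_induct)
    case (insert x F)
    then show ?case using pm1(2)[OF gauge_sign_pm[of "gauge_iter x r"] insert.IH] by (simp only: prod.insert[OF insert.hyps])
  qed simp_all
  then show ?thesis unfolding iter_sign_def by (intro pm1(2))
qed

lemma iter_sign_Suc: "iter_sign (j + 1) r = gauge_sign (gauge_iter j r) * iter_sign j r"
proof (cases "0 \<le> j")
  case True
  then have "{0..<j + 1} = insert j {0..<j}" by auto
  then show ?thesis using True by (simp add: iter_sign_def)
next
  case False
  then have "{j..<0} = insert j {j + 1..<0}" by auto
  then show ?thesis using False pm1_sq[OF gauge_sign_pm] by (simp add: iter_sign_def mult.assoc[symmetric])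
qed

lemma iter_sign_sq: "iter_sign j r * iter_sign j r = 1" "cnj (iter_sign j r) = iter_sign j r" "cmod (iter_sign j r) = 1"
  using iter_sign_pm[of j r] by auto

end

section \<open>Unfolding the circle to the line\<close>

declare split_paired_All [simp del] split_paired_Ex [simp del]

text \<open>Membership in \<open>Kspace\<close> without the finite norm. The norm identities below
  hold in the extended nonnegative reals and thus can be stated before finiteness is known.\<close>

definition K_admissible :: "real \<Rightarrow> (real \<Rightarrow> fvec) \<Rightarrow> bool" where
  "K_admissible L x \<longleftrightarrow> (\<forall>\<beta>. set_borel_measurable lebesgue (Iv L) (\<lambda>a. x a \<beta>)) \<and>
     (\<forall>a\<in>Iv L. \<forall>\<beta>. x a \<beta> \<noteq> 0 \<longrightarrow> \<beta> \<in> charge0_basis)"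

lemma Kspace_iff: "x \<in> Kspace L \<longleftrightarrow> K_admissible L x \<and> Knorm2 L x < \<infinity>"
  by (auto simp: Kspace_def K_admissible_def supp_vec_def)

lemma K_admissible_diff: "K_admissible L x \<Longrightarrow> K_admissible L y \<Longrightarrow> K_admissible L (x - y)"
proof -
  assume x: "K_admissible L x" and y: "K_admissible L y"
  have "set_borel_measurable lebesgue (Iv L) (\<lambda>a. x a \<beta> - y a \<beta>)" for \<beta>
    using x y borel_measurable_diff[of "\<lambda>a. indicat_real (Iv L) a *\<^sub>R x a \<beta>" lebesgue "\<lambda>a. indicat_real (Iv L) a *\<^sub>R y a \<beta>"]
    unfolding K_admissible_def set_borel_measurable_def by (simp add: scaleR_diff_right)
  then show ?thesis using x y unfolding K_admissible_def by (auto simp: fun_diff_def) metis+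
qed

lemma countable_charge0: "countable charge0_basis"
proof (rule countable_subset)
  show "charge0_basis \<subseteq> {A. finite A} \<times> {A. finite A}" by (auto simp: charge0_basis_def)
qed (intro countable_SIGMA countable_Collect_finite)

lemma Iv_sets [measurable]: "Iv L \<in> sets lebesgue"
  by (simp add: Iv_def)

lemma K_admissible_meas: "K_admissible L x \<Longrightarrow> (\<lambda>a. indicat_real (Iv L) a *\<^sub>R x a \<beta>) \<in> borel_measurable lebesgue"
  by (simp add: K_admissible_def set_borel_measurable_def)

lemma n2_indicator: "n2 S f = (\<integral>\<^sup>+a. ennreal ((cmod (indicat_real S a *\<^sub>R f a))\<^sup>2) \<partial>lebesgue)"
  unfolding n2_def by (intro nn_integral_cong) (auto split: split_indicator)

text \<open>Exchanging the time integral with the sum over labels requires a countable index set.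
  The label type is uncountable, but supports lie in the countable set
  \<open>charge0_basis\<close>.\<close>

lemma Knorm2_sum:
  assumes x: "K_admissible L x"
  shows "Knorm2 L x = (\<integral>\<^sup>+\<beta>. n2 (Iv L) (\<lambda>a. x a \<beta>) \<partial>count_space charge0_basis)"
proof -
  have "Knorm2 L x = (\<integral>\<^sup>+a. (\<integral>\<^sup>+\<beta>. ennreal ((cmod (indicat_real (Iv L) a *\<^sub>R x a \<beta>))\<^sup>2) \<partial>count_space charge0_basis) \<partial>lebesgue)"
    unfolding Knorm2_def
  proof (rule nn_integral_cong)
    fix a :: real
    show "(\<integral>\<^sup>+\<beta>. ennreal ((cmod (x a \<beta>))\<^sup>2) \<partial>count_space UNIV) * indicator (Iv L) a =
      (\<integral>\<^sup>+\<beta>. ennreal ((cmod (indicat_real (Iv L) a *\<^sub>R x a \<beta>))\<^sup>2) \<partial>count_space charge0_basis)"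
    proof (cases "a \<in> Iv L")
      case True
      have "(\<integral>\<^sup>+\<beta>. ennreal ((cmod (x a \<beta>))\<^sup>2) \<partial>count_space UNIV) = (\<integral>\<^sup>+\<beta>. ennreal ((cmod (x a \<beta>))\<^sup>2) \<partial>count_space charge0_basis)"
      proof (rule nn_integral_count_space_eq)
        fix \<beta> assume "\<beta> \<in> UNIV - charge0_basis"
        then have "x a \<beta> = 0" using x True unfolding K_admissible_def by blast
        then show "ennreal ((cmod (x a \<beta>))\<^sup>2) = 0" by simp
      qed auto
      then show ?thesis using True by simp
    qed simp
  qed
  also have "\<dots> = (\<integral>\<^sup>+\<beta>. (\<integral>\<^sup>+a. ennreal ((cmod (indicat_real (Iv L) a *\<^sub>R x a \<beta>))\<^sup>2) \<partial>lebesgue) \<partial>count_space charge0_basis)"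
    by (rule nn_integral_count_space_nn_integral[OF countable_charge0]) (use K_admissible_meas[OF x] in measurable)
  finally show ?thesis by (simp add: n2_indicator)
qed

context schwinger
begin

definition ell :: real where "ell = 2 * pi / L"

lemma ell_pos: "0 < ell"
  using L by (simp add: ell_def)

lemma Iv_eq: "Iv L = {0..ell}"
  by (simp add: Iv_def ell_def)

text \<open>Time \<open>t\<close> on the line stands for \<open>a = t - j ell\<close> in the \<open>j\<close>-th copy of the circle, and the sign undoes that of \<open>\<Gamma>\<^sup>j\<close>.\<close>

definition unfold_fn :: "(real \<Rightarrow> fvec) \<Rightarrow> fb \<Rightarrow> real \<Rightarrow> complex" where
  "unfold_fn x r t = iter_sign \<lfloor>t / ell\<rfloor> r * x (t - \<lfloor>t / ell\<rfloor> * ell) (gauge_iter \<lfloor>t / ell\<rfloor> r)"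

text \<open>The half-open cell makes the translates tile the line without overlap; it differs from
  the closed interval \<open>Iv L\<close> by the null set {ell}.\<close>

definition cell_piece :: "(real \<Rightarrow> fvec) \<Rightarrow> fb \<Rightarrow> int \<Rightarrow> real \<Rightarrow> complex" where
  "cell_piece x r j t = indicat_real {0..<ell} (t - j * ell) *\<^sub>R x (t - j * ell) (gauge_iter j r)"

lemma floor_cell: "t - j * ell \<in> {0..<ell} \<longleftrightarrow> \<lfloor>t / ell\<rfloor> = j"
  using ell_pos by (auto simp: floor_eq_iff field_simps)

lemma unfold_fn_cell_piece: "unfold_fn x r t = iter_sign \<lfloor>t / ell\<rfloor> r * cell_piece x r \<lfloor>t / ell\<rfloor> t"
  using floor_cell[of t "\<lfloor>t / ell\<rfloor>"] by (simp add: unfold_fn_def cell_piece_def)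

lemma shift_meas: "(f :: real \<Rightarrow> 'a::euclidean_space) \<in> borel_measurable lebesgue \<Longrightarrow> (\<lambda>t. f (t - c)) \<in> borel_measurable lebesgue"
  using borel_measurable_affine[of f 1 "-c"] by simp

lemma cell_meas: "K_admissible L x \<Longrightarrow> (\<lambda>a. indicat_real {0..<ell} a *\<^sub>R x a \<beta>) \<in> borel_measurable lebesgue"
proof -
  assume "K_admissible L x"
  have "(\<lambda>a. indicat_real {0..<ell} a *\<^sub>R (indicat_real (Iv L) a *\<^sub>R x a \<beta>)) \<in> borel_measurable lebesgue"
    by (rule borel_measurable_scaleR[OF _ K_admissible_meas[OF \<open>K_admissible L x\<close>]]) (rule borel_measurable_indicator, simp)
  also have "(\<lambda>a. indicat_real {0..<ell} a *\<^sub>R (indicat_real (Iv L) a *\<^sub>R x a \<beta>)) = (\<lambda>a. indicat_real {0..<ell} a *\<^sub>R x a \<beta>)"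
    by (auto simp: fun_eq_iff Iv_eq split: split_indicator)
  finally show ?thesis .
qed

lemma cell_piece_meas: "K_admissible L x \<Longrightarrow> cell_piece x r j \<in> borel_measurable lebesgue"
  unfolding cell_piece_def using shift_meas[OF cell_meas] by blast

lemma floor_meas: "(\<lambda>t. \<lfloor>t / ell\<rfloor>) \<in> lebesgue \<rightarrow>\<^sub>M count_space UNIV"
  by (rule measurable_completion) simp

lemma unfold_fn_meas: "K_admissible L x \<Longrightarrow> unfold_fn x r \<in> borel_measurable lebesgue"
proof -
  assume x: "K_admissible L x"
  have "(\<lambda>t. iter_sign j r * cell_piece x r j t) \<in> borel_measurable lebesgue" for j
    using cell_piece_meas[OF x] by (intro borel_measurable_times borel_measurable_const)
  from measurable_compose_countable[OF this floor_meas]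
  show ?thesis by (simp add: unfold_fn_cell_piece[abs_def])
qed

lemma n2_cell: "n2 (Iv L) f = n2 {0..<ell} f"
proof -
  have "AE a in lebesgue. a \<noteq> ell" using AE_completion[OF AE_lborel_singleton[of ell]] by simp
  then have "AE a in lebesgue. ennreal ((cmod (f a))\<^sup>2) * indicator {0..ell} a = ennreal ((cmod (f a))\<^sup>2) * indicator {0..<ell} a"
    by eventually_elim (auto split: split_indicator)
  then show ?thesis unfolding n2_def Iv_eq by (rule nn_integral_cong_AE)
qed

text \<open>At each time exactly one cell is active, so the square of the modulus is a sum over all
  cells with one possibly nonzero term; exchanging sum and integral and translating each cell back
  gives the claim.\<close>

lemma n2_unfold_fn:
  assumes x: "K_admissible L x"
  shows "n2 UNIV (unfold_fn x r) = (\<integral>\<^sup>+j. n2 (Iv L) (\<lambda>a. x a (gauge_iter j r)) \<partial>count_space UNIV)"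
proof -
  note [measurable] = cell_piece_meas[OF x]
  have eq: "ennreal ((cmod (unfold_fn x r t))\<^sup>2) = (\<integral>\<^sup>+j. ennreal ((cmod (cell_piece x r j t))\<^sup>2) \<partial>count_space UNIV)" for t
  proof -
    have "(\<integral>\<^sup>+j. ennreal ((cmod (cell_piece x r j t))\<^sup>2) \<partial>count_space UNIV) = (\<Sum>j\<in>{\<lfloor>t / ell\<rfloor>}. ennreal ((cmod (cell_piece x r j t))\<^sup>2))"
      using floor_cell[of t] by (intro nn_integral_count_space') (auto simp: cell_piece_def split: split_indicator)
    then show ?thesis by (simp add: unfold_fn_cell_piece norm_mult iter_sign_sq)
  qed
  have "n2 UNIV (unfold_fn x r) = (\<integral>\<^sup>+t. (\<integral>\<^sup>+j. ennreal ((cmod (cell_piece x r j t))\<^sup>2) \<partial>count_space UNIV) \<partial>lebesgue)"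
    unfolding n2_def eq by simp
  also have "\<dots> = (\<integral>\<^sup>+j. (\<integral>\<^sup>+t. ennreal ((cmod (cell_piece x r j t))\<^sup>2) \<partial>lebesgue) \<partial>count_space UNIV)"
    by (rule nn_integral_count_space_nn_integral) auto
  also have "(\<lambda>j. \<integral>\<^sup>+t. ennreal ((cmod (cell_piece x r j t))\<^sup>2) \<partial>lebesgue) = (\<lambda>j. n2 (Iv L) (\<lambda>a. x a (gauge_iter j r)))"
  proof
    fix j
    have "(\<integral>\<^sup>+t. ennreal ((cmod (cell_piece x r j t))\<^sup>2) \<partial>lebesgue) = (\<integral>\<^sup>+t. ennreal ((cmod (cell_piece x r j (j * ell + 1 * t)))\<^sup>2) \<partial>lebesgue)"
      by (subst nn_integral_real_affine_lebesgue[where c=1 and t="j * ell"]) auto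
    also have "\<dots> = n2 {0..<ell} (\<lambda>a. x a (gauge_iter j r))"
      by (simp add: n2_indicator cell_piece_def)
    also have "\<dots> = n2 (Iv L) (\<lambda>a. x a (gauge_iter j r))"
      by (rule n2_cell[symmetric])
    finally show "(\<integral>\<^sup>+t. ennreal ((cmod (cell_piece x r j t))\<^sup>2) \<partial>lebesgue) = n2 (Iv L) (\<lambda>a. x a (gauge_iter j r))" .
  qed
  finally show ?thesis .
qed

lemma bij_gauge_iter: "bij_betw (\<lambda>(r, j). gauge_iter j r) (J0 \<times> UNIV) charge0_basis"
  by (rule bij_betw_byWitness[where f'="\<lambda>\<beta>. (base_label \<beta>, sheet \<beta>)"])
     (auto simp: base_label_gauge_iter sheet_gauge_iter gauge_iter_base_label gauge_iter_charge0 J0_charge0 base_label_J0)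

lemma countable_J0: "countable J0"
  using countable_subset[OF _ countable_charge0] by (auto simp: J0_def)

text \<open>Unfolding is isometric: pairs of a representative in \<open>J0\<close> and an integer
  enumerate the neutral labels bijectively, and summing over the integers reassembles one function
  on the line.\<close>

lemma Knorm2_unfold_fn:
  assumes x: "K_admissible L x"
  shows "Knorm2 L x = (\<integral>\<^sup>+r. n2 UNIV (unfold_fn x r) \<partial>count_space J0)"
proof -
  let ?A = "\<lambda>\<beta>. n2 (Iv L) (\<lambda>a. x a \<beta>)"
  have "Knorm2 L x = (\<integral>\<^sup>+p. ?A ((\<lambda>(r, j). gauge_iter j r) p) \<partial>count_space (J0 \<times> UNIV))"
    unfolding Knorm2_sum[OF x] by (rule nn_integral_bij_count_space[OF bij_gauge_iter, symmetric])
  also have "\<dots> = (\<integral>\<^sup>+p. ?A ((\<lambda>(r, j). gauge_iter j r) p) \<partial>(count_space J0 \<Otimes>\<^sub>M count_space UNIV))"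
    by (subst pair_measure_countable) (use countable_J0 in auto)
  also have "\<dots> = (\<integral>\<^sup>+r. (\<integral>\<^sup>+j. ?A (gauge_iter j r) \<partial>count_space UNIV) \<partial>count_space J0)"
  proof -
    interpret sigma_finite_measure "count_space (UNIV :: int set)"
      by (rule sigma_finite_measure_count_space_countable) auto
    have "(\<lambda>p. ?A ((\<lambda>(r, j). gauge_iter j r) p)) \<in> borel_measurable (count_space J0 \<Otimes>\<^sub>M count_space UNIV)"
      by (subst pair_measure_countable) (use countable_J0 in auto)
    from nn_integral_fst[OF this] show ?thesis by simp
  qed
  finally show ?thesis by (simp add: n2_unfold_fn[OF x])
qed

lemma unfold_fn_diff: "unfold_fn (x - y) r t = unfold_fn x r t - unfold_fn y r t"
  by (simp add: unfold_fn_def algebra_simps)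

lemma unfold_fn_L2:
  assumes x: "x \<in> Kspace L" and r: "r \<in> J0"
  shows "L2 UNIV (unfold_fn x r)"
proof -
  have x': "K_admissible L x" "Knorm2 L x < \<infinity>" using x by (auto simp: Kspace_iff)
  have "n2 UNIV (unfold_fn x r) = (\<integral>\<^sup>+r'. n2 UNIV (unfold_fn x r') * indicator {r} r' \<partial>count_space J0)"
    using r by (subst nn_integral_indicator_singleton) auto
  also have "\<dots> \<le> Knorm2 L x" unfolding Knorm2_unfold_fn[OF x'(1)] by (intro nn_integral_mono) (auto split: split_indicator)
  finally show ?thesis using x' unfold_fn_meas by (auto simp: L2_def)
qed

lemma Knorm2_tail:
  assumes x: "x \<in> Kspace L" and \<epsilon>: "0 < \<epsilon>"
  obtains n0 where "\<And>n. n0 \<le> n \<Longrightarrow> (\<integral>\<^sup>+r. n2 UNIV (unfold_fn x r) * indicator (J0 - base_block n) r \<partial>count_space J0) < ennreal \<epsilon>"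
proof -
  have x': "K_admissible L x" "Knorm2 L x < \<infinity>" using x by (auto simp: Kspace_iff)
  have "(\<lambda>n. \<integral>\<^sup>+r. n2 UNIV (unfold_fn x r) * indicator (J0 - base_block n) r \<partial>count_space J0) \<longlonglongrightarrow> (\<integral>\<^sup>+r. 0 \<partial>count_space J0)"
  proof (rule nn_integral_dominated_convergence[where w="\<lambda>r. n2 UNIV (unfold_fn x r)"])
    show "AE r in count_space J0. (\<lambda>n. n2 UNIV (unfold_fn x r) * indicator (J0 - base_block n) r) \<longlonglongrightarrow> 0"
    proof (rule AE_I2)
      fix r assume "r \<in> space (count_space J0)"
      then obtain n where n: "r \<in> base_block n" using base_block_ex[of r] by auto
      have "\<forall>\<^sub>F m in sequentially. n2 UNIV (unfold_fn x r) * indicator (J0 - base_block m) r = 0"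
        unfolding eventually_sequentially using base_block_mono n by (intro exI[of _ n]) (auto split: split_indicator)
      then show "(\<lambda>n. n2 UNIV (unfold_fn x r) * indicator (J0 - base_block n) r) \<longlonglongrightarrow> 0" by (rule tendsto_eventually)
    qed
    show "(\<integral>\<^sup>+r. n2 UNIV (unfold_fn x r) \<partial>count_space J0) < \<infinity>" using x'(2) by (simp add: Knorm2_unfold_fn[OF x'(1)])
  qed (auto split: split_indicator)
  then have "\<forall>\<^sub>F n in sequentially. (\<integral>\<^sup>+r. n2 UNIV (unfold_fn x r) * indicator (J0 - base_block n) r \<partial>count_space J0) < ennreal \<epsilon>"
    using \<epsilon> by (intro order_tendstoD) auto
  then show ?thesis using that by (auto simp: eventually_sequentially)
qed

lemma Knorm2_split:
  assumes x: "K_admissible L x" and y: "K_admissible L y" and z: "\<And>r t. r \<in> J0 - base_block n \<Longrightarrow> unfold_fn x r t = 0"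
  shows "Knorm2 L (x - y) = (\<Sum>r\<in>base_block n. n2 UNIV (\<lambda>t. unfold_fn x r t - unfold_fn y r t)) +
    (\<integral>\<^sup>+r. n2 UNIV (unfold_fn y r) * indicator (J0 - base_block n) r \<partial>count_space J0)"
proof -
  have "Knorm2 L (x - y) = (\<integral>\<^sup>+r. n2 UNIV (\<lambda>t. unfold_fn x r t - unfold_fn y r t) \<partial>count_space J0)"
    unfolding Knorm2_unfold_fn[OF K_admissible_diff[OF x y]] by (simp add: unfold_fn_diff[abs_def])
  also have "\<dots> = (\<integral>\<^sup>+r. n2 UNIV (\<lambda>t. unfold_fn x r t - unfold_fn y r t) * indicator (base_block n) r + n2 UNIV (unfold_fn y r) * indicator (J0 - base_block n) r \<partial>count_space J0)"
  proof (rule nn_integral_cong)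
    fix r assume "r \<in> space (count_space J0)"
    then show "n2 UNIV (\<lambda>t. unfold_fn x r t - unfold_fn y r t) = n2 UNIV (\<lambda>t. unfold_fn x r t - unfold_fn y r t) * indicator (base_block n) r + n2 UNIV (unfold_fn y r) * indicator (J0 - base_block n) r"
      using z[of r] by (cases "r \<in> base_block n") (auto simp: n2_uminus)
  qed
  also have "\<dots> = (\<integral>\<^sup>+r. n2 UNIV (\<lambda>t. unfold_fn x r t - unfold_fn y r t) * indicator (base_block n) r \<partial>count_space J0) +
    (\<integral>\<^sup>+r. n2 UNIV (unfold_fn y r) * indicator (J0 - base_block n) r \<partial>count_space J0)"
    by (rule nn_integral_add) auto
  also have "(\<integral>\<^sup>+r. n2 UNIV (\<lambda>t. unfold_fn x r t - unfold_fn y r t) * indicator (base_block n) r \<partial>count_space J0) = (\<Sum>r\<in>base_block n. n2 UNIV (\<lambda>t. unfold_fn x r t - unfold_fn y r t))"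
    using nn_integral_count_space'[OF finite_base_block, of J0 n "\<lambda>r. n2 UNIV (\<lambda>t. unfold_fn x r t - unfold_fn y r t) * indicator (base_block n) r"] base_block_J0 by auto
  finally show ?thesis .
qed

section \<open>Refolding: from functions on the line to the domain\<close>

definition refold :: "fb set \<Rightarrow> (fb \<Rightarrow> real \<Rightarrow> complex) \<Rightarrow> real \<Rightarrow> fvec" where
  "refold B f t \<beta> = (if \<beta> \<in> charge0_basis \<and> base_label \<beta> \<in> B then iter_sign (sheet \<beta>) (base_label \<beta>) * f (base_label \<beta>) (t + sheet \<beta> * ell) else 0)"

text \<open>Refolding inverts unfolding on families supported in \<open>B\<close>. It is defined for
  all real times, which is what membership in the domain requires, and the signs cancel because they
  occur twice.\<close>

lemma unfold_fn_refold: "r \<in> J0 \<Longrightarrow> unfold_fn (refold B f) r t = (if r \<in> B then f r t else 0)"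
  by (simp add: unfold_fn_def refold_def gauge_iter_charge0 J0_charge0 base_label_gauge_iter sheet_gauge_iter mult.assoc[symmetric] iter_sign_sq)

lemma refold_supp_finite:
  assumes B: "finite B" and f: "\<And>r. r \<in> B \<Longrightarrow> test_fun R (f r)"
  shows "finite (\<Union>t\<in>{a<..<b}. {\<beta>. refold B f t \<beta> \<noteq> 0})"
proof (rule finite_subset)
  \<comment> \<open>A nonzero value at a time in the window forces |t + j ell| < R on sheet j, hence
    |j ell| <= |R| + |a| + |b|: only finitely many sheets are met.\<close>
  define N where "N = \<lceil>(\<bar>R\<bar> + \<bar>a\<bar> + \<bar>b\<bar>) / ell\<rceil>"
  show "(\<Union>t\<in>{a<..<b}. {\<beta>. refold B f t \<beta> \<noteq> 0}) \<subseteq> (\<lambda>(r, j). gauge_iter j r) ` (B \<times> {-N..N})"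
  proof safe
    fix t \<beta> assume t: "t \<in> {a<..<b}" "refold B f t \<beta> \<noteq> 0"
    then have b: "base_label \<beta> \<in> B" "f (base_label \<beta>) (t + sheet \<beta> * ell) \<noteq> 0" by (auto simp: refold_def split: if_splits)
    then have "\<bar>t + sheet \<beta> * ell\<bar> < R" using f[OF b(1)] by (auto simp: test_fun_def not_le[symmetric])
    then have "\<bar>sheet \<beta> * ell\<bar> \<le> \<bar>R\<bar> + \<bar>a\<bar> + \<bar>b\<bar>" using t by auto
    then have "\<bar>real_of_int (sheet \<beta>)\<bar> \<le> (\<bar>R\<bar> + \<bar>a\<bar> + \<bar>b\<bar>) / ell" using ell_pos by (simp add: abs_mult field_simps)
    also have "\<dots> \<le> real_of_int N" by (simp add: N_def)
    finally have "sheet \<beta> \<in> {-N..N}" by auto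
    then show "\<beta> \<in> (\<lambda>(r, j). gauge_iter j r) ` (B \<times> {-N..N})"
      using b(1) gauge_iter_base_label[of \<beta>] by (intro image_eqI[of _ _ "(base_label \<beta>, sheet \<beta>)"]) auto
  qed
qed (use B in auto)

lemma refold_F0_smooth:
  assumes B: "finite B" and f: "\<And>r. r \<in> B \<Longrightarrow> test_fun R (f r)"
  shows "F0_smooth (refold B f)"
  unfolding F0_smooth_def
proof (intro conjI allI)
  fix a
  have fin: "finite (\<Union>t\<in>{a - 1<..<a + 1}. {\<beta>. refold B f t \<beta> \<noteq> 0})" by (rule refold_supp_finite[OF B f])
  then show "\<exists>\<epsilon>>0. finite (\<Union>t\<in>{a - \<epsilon><..<a + \<epsilon>}. supp_vec (refold B f t))"
    unfolding supp_vec_def by (intro exI[of _ 1]) auto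
  have "finite (supp_vec (refold B f a))" by (rule finite_subset[OF _ fin]) (auto simp: supp_vec_def intro!: bexI[of _ a])
  then show "refold B f a \<in> F0" by (auto simp: F0_def supp_vec_def refold_def split: if_splits)
next
  fix \<beta>
  show "csmooth (\<lambda>t. refold B f t \<beta>)"
  proof (cases "\<beta> \<in> charge0_basis \<and> base_label \<beta> \<in> B")
    case True
    then have "csmooth (f (base_label \<beta>))" using f test_fun_csmooth by blast
    then have "csmooth (\<lambda>t. iter_sign (sheet \<beta>) (base_label \<beta>) * f (base_label \<beta>) (t + sheet \<beta> * ell))"
      by (intro csmooth_mult csmooth_const csmooth_shift)
    then show ?thesis using True by (simp add: refold_def)
  next
    case False
    then have "(\<lambda>t. refold B f t \<beta>) = (\<lambda>t. 0)" by (auto simp: refold_def)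
    then show ?thesis by simp
  qed
qed

text \<open>In coefficients, moving one sheet up is the same, up to sign, as waiting for one period.
  This is why following a representative through all sheets produces a single smooth function on the
  line.\<close>

lemma DomH_iff: "\<Psi> \<in> DomH L G \<longleftrightarrow> F0_smooth \<Psi> \<and> (\<forall>a \<beta>. \<Psi> a (gauge_label \<beta>) = gauge_sign \<beta> * \<Psi> (a + ell) \<beta>)"
proof -
  have "G (\<Psi> (a + 2 * pi / L)) = \<Psi> a \<longleftrightarrow> (\<forall>\<beta>. \<Psi> a (gauge_label \<beta>) = gauge_sign \<beta> * \<Psi> (a + ell) \<beta>)" if "F0_smooth \<Psi>" for a
  proof -
    have "fin_vec (\<Psi> (a + 2 * pi / L))"
      using that charge0_fock by (auto simp: F0_smooth_def F0_def fin_vec_def)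
    from G_eq_iff[OF this] show ?thesis by (simp add: ell_def)
  qed
  then show ?thesis by (auto simp: DomH_def)
qed

lemma refold_DomH:
  assumes B: "finite B" and f: "\<And>r. r \<in> B \<Longrightarrow> test_fun R (f r)"
  shows "refold B f \<in> DomH L G"
  unfolding DomH_iff
proof (intro conjI allI refold_F0_smooth[OF B f])
  fix a \<beta>
  have c: "gauge_label \<beta> \<in> charge0_basis \<longleftrightarrow> \<beta> \<in> charge0_basis" using gauge_iter_charge0[of 1 \<beta>] gauge_iter_Suc[of 0 \<beta>] by simp
  show "refold B f a (gauge_label \<beta>) = gauge_sign \<beta> * refold B f (a + ell) \<beta>"
  proof (cases "\<beta> \<in> charge0_basis")
    case True
    then have "\<beta> \<in> fock_basis" by (rule charge0_fock)
    then show ?thesis using True iter_sign_Suc[of "sheet \<beta>" "base_label \<beta>"]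
      by (simp add: refold_def c sheet_gauge_label base_label_gauge_label gauge_iter_base_label algebra_simps)
  qed (simp add: refold_def c)
qed

end

section \<open>Symmetry of the Hamiltonian\<close>

lemma borel_continuous_Iv:
  assumes "continuous_on (Iv L) (f :: real \<Rightarrow> complex)"
  shows "(\<lambda>a. indicat_real (Iv L) a *\<^sub>R f a) \<in> borel_measurable lebesgue"
proof -
  have "(\<lambda>a. indicat_real (Iv L) a *\<^sub>R f a) \<in> borel_measurable borel"
    by (rule borel_measurable_continuous_on_indicator) (use assms in \<open>auto simp: Iv_def\<close>)
  then show ?thesis by (intro measurable_completion) simp
qed

text \<open>Extension by zero outside the interval, so that integrals run over the whole line and
  the lemmas for \<open>UNIV\<close> apply.\<close>

definition component :: "real \<Rightarrow> (real \<Rightarrow> fvec) \<Rightarrow> fb \<Rightarrow> real \<Rightarrow> complex" where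
  "component L x \<beta> a = indicat_real (Iv L) a *\<^sub>R x a \<beta>"

lemma n2_component: "n2 UNIV (component L x \<beta>) = n2 (Iv L) (\<lambda>a. x a \<beta>)"
  by (simp add: n2_indicator component_def)

lemma component_L2:
  assumes "x \<in> Kspace L"
  shows "L2 UNIV (component L x \<beta>)"
proof -
  have x: "K_admissible L x" "Knorm2 L x < \<infinity>" using assms by (auto simp: Kspace_iff)
  have m: "component L x \<beta> \<in> borel_measurable lebesgue" using K_admissible_meas[OF x(1)] by (simp add: component_def[abs_def])
  have "n2 UNIV (component L x \<beta>) < \<infinity>"
  proof (cases "\<beta> \<in> charge0_basis")
    case True
    have "n2 (Iv L) (\<lambda>a. x a \<beta>) = (\<integral>\<^sup>+\<beta>'. n2 (Iv L) (\<lambda>a. x a \<beta>') * indicator {\<beta>} \<beta>' \<partial>count_space charge0_basis)"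
      using True by (subst nn_integral_indicator_singleton) auto
    also have "\<dots> \<le> Knorm2 L x" unfolding Knorm2_sum[OF x(1)] by (intro nn_integral_mono) (auto split: split_indicator)
    finally show ?thesis using x(2) by (simp add: n2_component)
  next
    case False
    then have "component L x \<beta> a = 0" for a using x(1) unfolding K_admissible_def component_def by (cases "a \<in> Iv L") auto
    then show ?thesis by (simp add: n2_def)
  qed
  with m show ?thesis by (simp add: L2_def)
qed

lemma component_integrable:
  assumes "x \<in> Kspace L" "y \<in> Kspace L"
  shows "integrable lebesgue (\<lambda>a. cnj (component L x \<beta> a) * component L y \<beta> a)"
    "set_integrable lebesgue (Iv L) (\<lambda>a. cnj (x a \<beta>) * y a \<beta>)"
    "(LINT a:Iv L|lebesgue. cnj (x a \<beta>) * y a \<beta>) = (LINT a|lebesgue. cnj (component L x \<beta> a) * component L y \<beta> a)"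
proof -
  have "set_integrable lebesgue UNIV (\<lambda>a. cnj (component L x \<beta> a) * component L y \<beta> a)"
    by (rule L2_CS(1)) (auto intro: component_L2 L2_cnj assms)
  then show i: "integrable lebesgue (\<lambda>a. cnj (component L x \<beta> a) * component L y \<beta> a)" by (simp add: set_integrable_def)
  have eq: "(\<lambda>a. cnj (component L x \<beta> a) * component L y \<beta> a) = (\<lambda>a. indicat_real (Iv L) a *\<^sub>R (cnj (x a \<beta>) * y a \<beta>))"
    by (auto simp: component_def fun_eq_iff split: split_indicator)
  show "set_integrable lebesgue (Iv L) (\<lambda>a. cnj (x a \<beta>) * y a \<beta>)"
    using i unfolding set_integrable_def eq .
  show "(LINT a:Iv L|lebesgue. cnj (x a \<beta>) * y a \<beta>) = (LINT a|lebesgue. cnj (component L x \<beta> a) * component L y \<beta> a)"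
    unfolding set_lebesgue_integral_def eq ..
qed

lemma Kspace_continuous:
  assumes F: "finite F" "F \<subseteq> charge0_basis" and z: "\<And>a \<beta>. a \<in> Iv L \<Longrightarrow> \<beta> \<notin> F \<Longrightarrow> x a \<beta> = 0"
    and c: "\<And>\<beta>. \<beta> \<in> F \<Longrightarrow> continuous_on (Iv L) (\<lambda>a. x a \<beta>)"
  shows "x \<in> Kspace L"
proof -
  have c': "continuous_on (Iv L) (\<lambda>a. x a \<beta>)" for \<beta>
  proof (cases "\<beta> \<in> F")
    case False
    then have "continuous_on (Iv L) (\<lambda>a. x a \<beta>) \<longleftrightarrow> continuous_on (Iv L) (\<lambda>a. 0::complex)"
      using z by (intro continuous_on_cong) auto
    then show ?thesis by simp
  qed (rule c)
  have K: "K_admissible L x"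
    unfolding K_admissible_def set_borel_measurable_def using borel_continuous_Iv[OF c'] z F by blast
  have fin: "n2 (Iv L) (\<lambda>a. x a \<beta>) < \<infinity>" for \<beta>
  proof (cases "0 \<le> 2 * pi / L")
    case True
    obtain M where M: "\<And>a. a \<in> Iv L \<Longrightarrow> cmod (x a \<beta>) \<le> M"
      using cont_bounded[of 0 "2 * pi / L" "\<lambda>a. x a \<beta>"] c'[of \<beta>] unfolding Iv_def by metis
    have "L2 {0..2 * pi / L} (component L x \<beta>)"
      using K_admissible_meas[OF K] M True by (intro L2_bounded(1)[where M=M]) (auto simp: component_def[abs_def] Iv_def)
    moreover have "n2 {0..2 * pi / L} (component L x \<beta>) = n2 (Iv L) (\<lambda>a. x a \<beta>)"
      unfolding Iv_def by (rule n2_cong) (simp add: component_def Iv_def)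
    ultimately show ?thesis by (simp add: L2_def)
  qed (simp add: n2_def Iv_def)
  have "Knorm2 L x = (\<Sum>\<beta>\<in>F. n2 (Iv L) (\<lambda>a. x a \<beta>))"
    unfolding Knorm2_sum[OF K]
  proof (rule nn_integral_count_space'[OF F(1) _ F(2)])
    fix \<beta> assume "\<beta> \<notin> F"
    then have "n2 (Iv L) (\<lambda>a. x a \<beta>) = n2 (Iv L) (\<lambda>a. 0)" using z by (intro n2_cong) auto
    then show "n2 (Iv L) (\<lambda>a. x a \<beta>) = 0" by (simp add: n2_def)
  qed
  also have "\<dots> < \<infinity>" using fin F(1) by (simp add: less_top)
  finally show ?thesis using K by (simp add: Kspace_iff)
qed

lemma Kinner_finite:
  assumes x: "x \<in> Kspace L" and y: "y \<in> Kspace L" and F: "finite F"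
    and z: "\<And>a \<beta>. a \<in> Iv L \<Longrightarrow> \<beta> \<notin> F \<Longrightarrow> x a \<beta> = 0 \<or> y a \<beta> = 0"
  shows "Kinner L x y = (\<Sum>\<beta>\<in>F. LINT a:Iv L|lebesgue. cnj (x a \<beta>) * y a \<beta>)"
    "Kinner L x y = (LINT a:Iv L|lebesgue. (\<Sum>\<beta>\<in>F. cnj (x a \<beta>) * y a \<beta>))"
    "set_integrable lebesgue (Iv L) (\<lambda>a. \<Sum>\<beta>\<in>F. cnj (x a \<beta>) * y a \<beta>)"
proof -
  have "(\<Sum>\<^sub>\<infinity>\<beta>. cnj (x a \<beta>) * y a \<beta>) = (\<Sum>\<beta>\<in>F. cnj (x a \<beta>) * y a \<beta>)" if "a \<in> Iv L" for a
    using fock_ip_fin[OF F, of "x a" "y a"] z[OF that] by (simp add: fock_ip_def)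
  then show 1: "Kinner L x y = (LINT a:Iv L|lebesgue. (\<Sum>\<beta>\<in>F. cnj (x a \<beta>) * y a \<beta>))"
    unfolding Kinner_def by (intro set_lebesgue_integral_cong) auto
  note i = component_integrable(2)[OF x y]
  show "set_integrable lebesgue (Iv L) (\<lambda>a. \<Sum>\<beta>\<in>F. cnj (x a \<beta>) * y a \<beta>)"
    using i unfolding set_integrable_def scaleR_sum_right by (intro Bochner_Integration.integrable_sum)
  show "Kinner L x y = (\<Sum>\<beta>\<in>F. LINT a:Iv L|lebesgue. cnj (x a \<beta>) * y a \<beta>)"
    unfolding 1 using i unfolding set_integrable_def set_lebesgue_integral_def scaleR_sum_right
    by (intro Bochner_Integration.integral_sum)
qed

context schwinger
begin

definition kin_coef :: real where "kin_coef = e\<^sup>2 / (2 * L)"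

lemma kin_coef_pos: "0 < kin_coef" using e L by (simp add: kin_coef_def)

text \<open>The potential as a function on the line. On sheet j the axial charge is -2j and a = t -
  j ell; since ell L / pi = 2, the expression Q - aL/pi - 1 becomes -(tL/pi + 1), independent of
  j.\<close>

definition osc_pot :: "real \<Rightarrow> real" where
  "osc_pot t = pi / (2 * L) * (t * L / pi + 1)\<^sup>2 + C0"

lemma osc_pot_ge: "- \<bar>C0\<bar> \<le> osc_pot t"
proof -
  have "0 \<le> pi / (2 * L) * (t * L / pi + 1)\<^sup>2" using L by simp
  then show ?thesis by (simp add: osc_pot_def)
qed

lemma Hop_fock:
  assumes "\<beta> \<in> fock_basis"
  shows "Hop e L C0 u a \<beta> = - of_real kin_coef * cderiv (cderiv (\<lambda>t. u t \<beta>)) a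
    + of_real (pi / (2 * L) * (of_int (q5 \<beta>) - (a * L / pi + 1))\<^sup>2 + C0) * u a \<beta> + K_part e L (u a) \<beta>"
proof -
  have K: "(\<Sum>\<^sub>\<infinity>m\<in>{1::nat..}. complex_of_real (omega e L m / real m) *
            (rhoR_pos m (rhoR_neg m (u a)) \<beta> + rhoL_neg m (rhoL_pos m (u a)) \<beta>)) = K_part e L (u a) \<beta>"
    unfolding K_part_def rho_quad_def ..
  define s where "s = of_int (q5 \<beta>) - (a * L / pi + 1)"
  have Q: "shiftQ L a \<psi> \<beta> = of_real s * \<psi> \<beta>" for \<psi>
    unfolding shiftQ_def Q5_diag[OF assms] s_def by (simp add: algebra_simps)
  show ?thesis
    unfolding Hop_def K Q kin_coef_def s_def[symmetric] by (simp add: numeral_2_eq_2 power2_eq_square algebra_simps)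
qed

lemma Hop_nofock:
  assumes "\<beta> \<notin> fock_basis" "\<And>t. u t \<beta> = 0"
  shows "Hop e L C0 u a \<beta> = K_part e L (u a) \<beta>"
proof -
  have "Q5 \<psi> \<beta> = 0" for \<psi>
    using assms(1) unfolding Q5_def by (cases \<beta>) (simp add: bdag_def cdag_def)
  then have Q: "shiftQ L a (shiftQ L a (u a)) \<beta> = 0" by (simp add: shiftQ_def assms)
  have c: "cderiv (\<lambda>t. 0) = (\<lambda>t. 0)" by (rule cderiv_eqI) simp
  show ?thesis unfolding Hop_def Q by (simp add: assms(2) numeral_2_eq_2 c K_part_def rho_quad_def)
qed

section \<open>Finite label blocks for elements of the domain\<close>

definition label_block :: "nat \<Rightarrow> fb set" where
  "label_block c = {\<beta> \<in> charge0_basis. kin \<beta> \<le> int c}"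

lemma label_block_finite: "finite (label_block c)"
  by (rule finite_subset[OF _ finite_kin[of "int c"]]) (auto simp: label_block_def charge0_fock)

lemma label_block_fock: "label_block c \<subseteq> fock_basis"
  by (auto simp: label_block_def charge0_fock)

lemma label_block_charge0: "label_block c \<subseteq> charge0_basis"
  by (auto simp: label_block_def)

lemma label_block_ex: "finite F \<Longrightarrow> F \<subseteq> charge0_basis \<Longrightarrow> \<exists>c. F \<subseteq> label_block c"
proof -
  assume F: "finite F" "F \<subseteq> charge0_basis"
  have "kin \<beta> \<le> int (nat (\<Sum>\<beta>\<in>F. kin \<beta>))" if "\<beta> \<in> F" for \<beta>
    using member_le_sum[of \<beta> F kin] F that kin_nonneg by (simp add: sum_nonneg)
  then show ?thesis using F(2) unfolding label_block_def by blast
qed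

lemma label_block_mono: "c \<le> d \<Longrightarrow> label_block c \<subseteq> label_block d"
  by (auto simp: label_block_def)

text \<open>Kinetic energy and charge are conserved, so the finite set \<open>label_block c\<close>
  is preserved and the current part acts there as a finite matrix. It contains several sheets at
  once, unlike the blocks of representatives.\<close>

lemma K_part_label_block:
  assumes "\<And>\<beta>. \<psi> \<beta> \<noteq> 0 \<Longrightarrow> \<beta> \<in> label_block c"
  shows "K_part e L \<psi> \<beta> = (\<Sum>\<beta>'\<in>label_block c. K_entry e L \<beta> \<beta>' * \<psi> \<beta>')" "K_part e L \<psi> \<beta> \<noteq> 0 \<Longrightarrow> \<beta> \<in> label_block c"
proof -
  show "K_part e L \<psi> \<beta> = (\<Sum>\<beta>'\<in>label_block c. K_entry e L \<beta> \<beta>' * \<psi> \<beta>')"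
    by (rule K_part_matrix[OF label_block_finite label_block_fock]) (use assms in auto)
  have "weight_supp abs abs {..int c} \<psi>" "weight_supp (\<lambda>_. 1) (\<lambda>_. - 1) {0} \<psi>"
    using assms by (auto simp: weight_supp_def label_block_def charge0_iff)
  from K_part_weight[OF this(1)] K_part_weight[OF this(2)]
  have "weight_supp abs abs {..int c} (K_part e L \<psi>)" "weight_supp (\<lambda>_. 1) (\<lambda>_. - 1) {0} (K_part e L \<psi>)" by blast+
  then show "K_part e L \<psi> \<beta> \<noteq> 0 \<Longrightarrow> \<beta> \<in> label_block c"
    unfolding weight_supp_def label_block_def charge0_iff by auto
qed

lemma DomH_smooth: "u \<in> DomH L G \<Longrightarrow> csmooth (\<lambda>t. u t \<beta>)"
  by (simp add: DomH_def F0_smooth_def)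

lemma DomH_charge0: "u \<in> DomH L G \<Longrightarrow> u t \<beta> \<noteq> 0 \<Longrightarrow> \<beta> \<in> charge0_basis"
  by (auto simp: DomH_def F0_smooth_def F0_def supp_vec_def)

text \<open>Locally finite supports and compactness yield one finite block for all times in the
  interval. The margin of 1 on each side ensures that labels outside the block have vanishing
  derivatives at the end points as well.\<close>

lemma DomH_bounded:
  assumes u: "u \<in> DomH L G"
  obtains c where "\<And>t \<beta>. t \<in> {-1..ell+1} \<Longrightarrow> u t \<beta> \<noteq> 0 \<Longrightarrow> \<beta> \<in> label_block c"
proof -
  have "\<exists>d. 0 < d \<and> finite (\<Union>t\<in>{a - d<..<a + d}. supp_vec (u t))" for a
    using u unfolding DomH_def F0_smooth_def by blast
  then obtain d where d: "\<And>a. 0 < d a" "\<And>a. finite (\<Union>t\<in>{a - d a<..<a + d a}. supp_vec (u t))" by metis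
  have "compact {-1..ell+1}" by simp
  then obtain D where D: "D \<subseteq> {-1..ell+1}" "finite D" "{-1..ell+1} \<subseteq> (\<Union>a\<in>D. {a - d a<..<a + d a})"
  proof (rule compactE_image[where C="{-1..ell+1}" and f="\<lambda>a. {a - d a<..<a + d a}"])
    show "{-1..ell+1} \<subseteq> (\<Union>a\<in>{-1..ell+1}. {a - d a<..<a + d a})"
    proof
      fix t assume "t \<in> {-1..ell+1}"
      then show "t \<in> (\<Union>a\<in>{-1..ell+1}. {a - d a<..<a + d a})" using d(1)[of t] by (intro UN_I[of t]) auto
    qed
  qed auto
  define F where "F = (\<Union>a\<in>D. \<Union>t\<in>{a - d a<..<a + d a}. supp_vec (u t))"
  have "finite F" unfolding F_def using D(2) d(2) by blast
  moreover have "F \<subseteq> charge0_basis" unfolding F_def supp_vec_def using DomH_charge0[OF u] by blast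
  ultimately obtain c where c: "F \<subseteq> label_block c" using label_block_ex by blast
  have "\<beta> \<in> label_block c" if tt: "t \<in> {-1..ell+1}" "u t \<beta> \<noteq> 0" for t \<beta>
  proof -
    obtain a where "a \<in> D" "t \<in> {a - d a<..<a + d a}" using D(3) tt(1) by blast
    then have "\<beta> \<in> F" unfolding F_def supp_vec_def using tt(2) by blast
    then show ?thesis using c by blast
  qed
  then show ?thesis by (rule that)
qed

lemma cderiv2_zero_near:
  assumes "\<And>t. t \<in> {-1..ell+1} \<Longrightarrow> f t = 0" "a \<in> Iv L"
  shows "cderiv f a = 0" "cderiv (cderiv f) a = 0"
proof -
  have d: "cderiv h t = 0" if "\<And>t. t \<in> {-1<..<ell+1} \<Longrightarrow> h t = 0" "t \<in> {-1<..<ell+1}" for h :: "real \<Rightarrow> complex" and t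
  proof -
    have "((\<lambda>x. 0) has_vector_derivative 0) (at t)" by simp
    then have "(h has_vector_derivative 0) (at t)"
      by (rule has_vector_derivative_transform_within_open[of _ _ _ "{-1<..<ell+1}"]) (use that in auto)
    then show ?thesis by (simp add: cderiv_def vector_derivative_at)
  qed
  have a: "a \<in> {-1<..<ell+1}" using assms(2) by (auto simp: Iv_eq)
  have 1: "cderiv f t = 0" if "t \<in> {-1<..<ell+1}" for t by (rule d) (use assms(1) that in auto)
  show "cderiv f a = 0" by (rule 1[OF a])
  show "cderiv (cderiv f) a = 0" by (rule d[OF 1 a])
qed

lemma Hop_Iv:
  assumes u: "u \<in> DomH L G" and c: "\<And>t \<beta>. t \<in> {-1..ell+1} \<Longrightarrow> u t \<beta> \<noteq> 0 \<Longrightarrow> \<beta> \<in> label_block c" and a: "a \<in> Iv L"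
  shows "\<beta> \<notin> label_block c \<Longrightarrow> Hop e L C0 u a \<beta> = 0"
    "\<beta> \<in> fock_basis \<Longrightarrow> Hop e L C0 u a \<beta> = - of_real kin_coef * cderiv (cderiv (\<lambda>t. u t \<beta>)) a
    + of_real (pi / (2 * L) * (of_int (q5 \<beta>) - (a * L / pi + 1))\<^sup>2 + C0) * u a \<beta> + (\<Sum>\<beta>'\<in>label_block c. K_entry e L \<beta> \<beta>' * u a \<beta>')"
proof -
  have a': "a \<in> {-1..ell+1}" using a by (auto simp: Iv_eq)
  have k: "K_part e L (u a) \<beta> = (\<Sum>\<beta>'\<in>label_block c. K_entry e L \<beta> \<beta>' * u a \<beta>')" "K_part e L (u a) \<beta> \<noteq> 0 \<Longrightarrow> \<beta> \<in> label_block c" for \<beta>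
    by (rule K_part_label_block; use c[OF a'] in blast)+
  show "\<beta> \<in> fock_basis \<Longrightarrow> Hop e L C0 u a \<beta> = - of_real kin_coef * cderiv (cderiv (\<lambda>t. u t \<beta>)) a
    + of_real (pi / (2 * L) * (of_int (q5 \<beta>) - (a * L / pi + 1))\<^sup>2 + C0) * u a \<beta> + (\<Sum>\<beta>'\<in>label_block c. K_entry e L \<beta> \<beta>' * u a \<beta>')"
    unfolding Hop_fock k(1)[symmetric] ..
  assume n: "\<beta> \<notin> label_block c"
  then have z: "u t \<beta> = 0" if "t \<in> {-1..ell+1}" for t using c[OF that] by blast
  have k0: "K_part e L (u a) \<beta> = 0" using k(2) n by blast
  show "Hop e L C0 u a \<beta> = 0"
  proof (cases "\<beta> \<in> fock_basis")
    case True
    then show ?thesis using cderiv2_zero_near(2)[OF z a] z[OF a'] k0 by (simp add: Hop_fock)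
  next
    case False
    then have "u t \<beta> = 0" for t using DomH_charge0[OF u] charge0_fock by blast
    then show ?thesis using Hop_nofock[OF False] k0 by simp
  qed
qed

lemma DomH_Kspace:
  assumes u: "u \<in> DomH L G"
  shows "u \<in> Kspace L" "Hop e L C0 u \<in> Kspace L"
proof -
  obtain c where c: "\<And>t \<beta>. t \<in> {-1..ell+1} \<Longrightarrow> u t \<beta> \<noteq> 0 \<Longrightarrow> \<beta> \<in> label_block c" using DomH_bounded[OF u] by metis
  have sub: "t \<in> {-1..ell+1}" if "t \<in> Iv L" for t using that by (auto simp: Iv_eq)
  have uc: "continuous_on S (\<lambda>t. u t \<beta>)" for \<beta> S by (intro csmooth_cont DomH_smooth u)
  show "u \<in> Kspace L"
    by (rule Kspace_continuous[OF label_block_finite label_block_charge0, of L c]) (use c[OF sub] uc in blast)+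
  show "Hop e L C0 u \<in> Kspace L"
  proof (rule Kspace_continuous[OF label_block_finite label_block_charge0, of L c])
    show "Hop e L C0 u a \<beta> = 0" if "a \<in> Iv L" "\<beta> \<notin> label_block c" for a \<beta>
      by (rule Hop_Iv(1)[OF u c that]) auto
    fix \<beta> assume "\<beta> \<in> label_block c"
    then have f: "\<beta> \<in> fock_basis" using label_block_fock by blast
    have "continuous_on (Iv L) (\<lambda>a. Hop e L C0 u a \<beta>) \<longleftrightarrow> continuous_on (Iv L) (\<lambda>a. - of_real kin_coef * cderiv (cderiv (\<lambda>t. u t \<beta>)) a
    + of_real (pi / (2 * L) * (of_int (q5 \<beta>) - (a * L / pi + 1))\<^sup>2 + C0) * u a \<beta> + (\<Sum>\<beta>'\<in>label_block c. K_entry e L \<beta> \<beta>' * u a \<beta>'))"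
      by (rule continuous_on_cong[OF refl]) (rule Hop_Iv(2)[OF u c _ f])
    also have "\<dots>"
      by (intro continuous_intros uc csmooth_cont csmooth_cderiv DomH_smooth[OF u]) simp
    finally show "continuous_on (Iv L) (\<lambda>a. Hop e L C0 u a \<beta>)" .
  qed
qed

lemma gauge_label_inj: "gauge_label \<beta> = gauge_label \<beta>' \<longleftrightarrow> \<beta> = \<beta>'"
  using bij_gauge_label by (auto simp: bij_def inj_eq)

lemma gauge_label_surj: "\<exists>\<beta>'. \<beta> = gauge_label \<beta>'"
  using gauge_label_gauge_label_inv by metis

text \<open>The potential is real and the matrix hermitian, so the two integrands differ only by the
  second derivatives, which form the derivative of the Wronskian \<open>W\<close>. Covariance gives
  \<open>W ell = W 0\<close>: \<Gamma> permutes labels and the signs, occurring in pairs,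
  cancel.\<close>

lemma Hop_symmetric:
  assumes u: "u \<in> DomH L G" and v: "v \<in> DomH L G"
  shows "Kinner L (Hop e L C0 u) v = Kinner L u (Hop e L C0 v)"
proof -
  obtain c1 where c1: "\<And>t \<beta>. t \<in> {-1..ell+1} \<Longrightarrow> u t \<beta> \<noteq> 0 \<Longrightarrow> \<beta> \<in> label_block c1" using DomH_bounded[OF u] by metis
  obtain c2 where c2: "\<And>t \<beta>. t \<in> {-1..ell+1} \<Longrightarrow> v t \<beta> \<noteq> 0 \<Longrightarrow> \<beta> \<in> label_block c2" using DomH_bounded[OF v] by metis
  define c where "c = max c1 c2"
  have cu: "\<And>t \<beta>. t \<in> {-1..ell+1} \<Longrightarrow> u t \<beta> \<noteq> 0 \<Longrightarrow> \<beta> \<in> label_block c"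
    and cv: "\<And>t \<beta>. t \<in> {-1..ell+1} \<Longrightarrow> v t \<beta> \<noteq> 0 \<Longrightarrow> \<beta> \<in> label_block c"
    using c1 c2 label_block_mono[of c1 c] label_block_mono[of c2 c] unfolding c_def by (blast intro: max.cobounded1 max.cobounded2)+
  have sub: "t \<in> {-1..ell+1}" if "t \<in> Iv L" for t using that by (auto simp: Iv_eq)
  have uz: "u a \<beta> = 0" and vz: "v a \<beta> = 0" if "a \<in> Iv L" "\<beta> \<notin> label_block c" for a \<beta>
    using cu[OF sub] cv[OF sub] that by blast+
  define w where "w = (\<lambda>\<beta> t. cnj (cderiv (\<lambda>t. u t \<beta>) t) * v t \<beta> - cnj (u t \<beta>) * cderiv (\<lambda>t. v t \<beta>) t)"
  note us = DomH_smooth[OF u] and vs = DomH_smooth[OF v]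
  have weight_supp: "csmooth (w \<beta>)" for \<beta>
    unfolding w_def by (intro csmooth_diff csmooth_mult csmooth_cnj csmooth_cderiv us vs)
  have dw: "cderiv (w \<beta>) t = cnj (cderiv (cderiv (\<lambda>t. u t \<beta>)) t) * v t \<beta> - cnj (u t \<beta>) * cderiv (cderiv (\<lambda>t. v t \<beta>)) t" for \<beta> t
  proof -
    have "w \<beta> = (\<lambda>t. cnj (cderiv (\<lambda>t. u t \<beta>) t) * v t \<beta> + (- 1) * (cnj (u t \<beta>) * cderiv (\<lambda>t. v t \<beta>) t))"
      by (simp add: w_def)
    then show ?thesis
      using us[of \<beta>] vs[of \<beta>]
      by (simp only: cderiv_add cderiv_cmult cderiv_mult cderiv_cnj csmooth_mult csmooth_cnj csmooth_cderiv csmooth_const)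
         (simp add: algebra_simps)
  qed
  define W where "W = (\<lambda>t. - of_real kin_coef * (\<Sum>\<beta>\<in>label_block c. w \<beta> t))"
  have Ws: "csmooth W" unfolding W_def by (intro csmooth_mult csmooth_const csmooth_sum weight_supp)
  have dW: "cderiv W t = - of_real kin_coef * (\<Sum>\<beta>\<in>label_block c. cderiv (w \<beta>) t)" for t
  proof -
    have "((\<lambda>t. \<Sum>\<beta>\<in>label_block c. w \<beta> t) has_vector_derivative (\<Sum>\<beta>\<in>label_block c. cderiv (w \<beta>) t)) (at t)" for t
      by (intro has_vector_derivative_sum csmooth_deriv weight_supp)
    then have "cderiv (\<lambda>t. \<Sum>\<beta>\<in>label_block c. w \<beta> t) = (\<lambda>t. \<Sum>\<beta>\<in>label_block c. cderiv (w \<beta>) t)" by (rule cderiv_eqI)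
    moreover have "csmooth (\<lambda>t. \<Sum>\<beta>\<in>label_block c. w \<beta> t)" by (intro csmooth_sum weight_supp)
    from cderiv_cmult[OF this, of "- of_real kin_coef"]
    have "cderiv W = (\<lambda>t. - of_real kin_coef * cderiv (\<lambda>t. \<Sum>\<beta>\<in>label_block c. w \<beta> t) t)" unfolding W_def .
    ultimately show ?thesis by simp
  qed
  have Wper: "W ell = W 0"
  proof -
    have cov: "u t (gauge_label \<beta>) = gauge_sign \<beta> * u (t + ell) \<beta>" "v t (gauge_label \<beta>) = gauge_sign \<beta> * v (t + ell) \<beta>" for t \<beta>
      using u v by (auto simp: DomH_iff)
    have cd: "cderiv (\<lambda>t. u t (gauge_label \<beta>)) t = gauge_sign \<beta> * cderiv (\<lambda>t. u t \<beta>) (t + ell)"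
      "cderiv (\<lambda>t. v t (gauge_label \<beta>)) t = gauge_sign \<beta> * cderiv (\<lambda>t. v t \<beta>) (t + ell)" for t \<beta>
    proof -
      have *: "cderiv (\<lambda>t. g * f (t + ell)) = (\<lambda>t. g * cderiv f (t + ell))" if "csmooth f" for f g
        using cderiv_cmult[OF csmooth_shift[OF that], of g ell] cderiv_shift[OF that, of ell] by simp
      show "cderiv (\<lambda>t. u t (gauge_label \<beta>)) t = gauge_sign \<beta> * cderiv (\<lambda>t. u t \<beta>) (t + ell)"
        unfolding cov *[OF us[of \<beta>]] ..
      show "cderiv (\<lambda>t. v t (gauge_label \<beta>)) t = gauge_sign \<beta> * cderiv (\<lambda>t. v t \<beta>) (t + ell)"
        unfolding cov *[OF vs[of \<beta>]] ..
    qed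
    have wcov: "w (gauge_label \<beta>) 0 = w \<beta> ell" for \<beta>
      unfolding w_def cd unfolding cov using gauge_sign_pm[of \<beta>] by auto
    have I0: "0 \<in> Iv L" "ell \<in> Iv L" using ell_pos by (auto simp: Iv_eq)
    have wz: "w \<beta> t = 0" if "\<beta> \<notin> label_block c" "t \<in> Iv L" for \<beta> t
      using uz[OF that(2,1)] vz[OF that(2,1)] by (simp add: w_def)
    \<comment> \<open>\<open>gauge_label\<close> need not preserve the block, so both sums are
      compared on the union of the block and its image; the added terms vanish because one of the
      two factors is outside the block at an end point.\<close>
    have "(\<Sum>\<beta>\<in>label_block c. w \<beta> ell) = (\<Sum>\<beta>\<in>gauge_label ` label_block c. w \<beta> 0)"
      by (subst sum.reindex) (auto simp: wcov inj_on_def gauge_label_inj)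
    also have "\<dots> = (\<Sum>\<beta>\<in>label_block c \<union> gauge_label ` label_block c. w \<beta> 0)"
    proof (rule sum.mono_neutral_left)
      show "\<forall>\<beta>\<in>(label_block c \<union> gauge_label ` label_block c) - gauge_label ` label_block c. w \<beta> 0 = 0"
      proof
        fix \<beta> assume b: "\<beta> \<in> (label_block c \<union> gauge_label ` label_block c) - gauge_label ` label_block c"
        obtain \<beta>' where "\<beta> = gauge_label \<beta>'" using gauge_label_surj by blast
        then show "w \<beta> 0 = 0" using b wz[OF _ I0(2), of \<beta>'] by (auto simp: wcov)
      qed
    qed (use label_block_finite in auto)
    also have "\<dots> = (\<Sum>\<beta>\<in>label_block c. w \<beta> 0)"
      by (rule sum.mono_neutral_right) (use label_block_finite wz I0 in auto)
    finally show ?thesis by (simp add: W_def)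
  qed
  let ?f = "\<lambda>a. \<Sum>\<beta>\<in>label_block c. cnj (Hop e L C0 u a \<beta>) * v a \<beta>" and ?g = "\<lambda>a. \<Sum>\<beta>\<in>label_block c. cnj (u a \<beta>) * Hop e L C0 v a \<beta>"
  have pw: "?f a - ?g a = cderiv W a" if a: "a \<in> Iv L" for a
  proof -
    let ?p = "\<lambda>\<beta>. complex_of_real (pi / (2 * L) * (of_int (q5 \<beta>) - (a * L / pi + 1))\<^sup>2 + C0)"
    let ?ud = "\<lambda>\<beta>. cderiv (cderiv (\<lambda>t. u t \<beta>)) a" and ?vd = "\<lambda>\<beta>. cderiv (cderiv (\<lambda>t. v t \<beta>)) a"
    have Kc: "(\<Sum>\<beta>\<in>label_block c. cnj (\<Sum>\<beta>'\<in>label_block c. K_entry e L \<beta> \<beta>' * u a \<beta>') * v a \<beta>) = (\<Sum>\<beta>\<in>label_block c. cnj (u a \<beta>) * (\<Sum>\<beta>'\<in>label_block c. K_entry e L \<beta> \<beta>' * v a \<beta>'))"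
    proof -
      have "(\<Sum>\<beta>\<in>label_block c. cnj (\<Sum>\<beta>'\<in>label_block c. K_entry e L \<beta> \<beta>' * u a \<beta>') * v a \<beta>) = (\<Sum>\<beta>\<in>label_block c. \<Sum>\<beta>'\<in>label_block c. cnj (u a \<beta>') * (K_entry e L \<beta>' \<beta> * v a \<beta>))"
        unfolding cnj_sum sum_distrib_right
      proof (intro sum.cong refl)
        fix \<beta> \<beta>' assume "\<beta> \<in> label_block c" "\<beta>' \<in> label_block c"
        then have "K_entry e L \<beta>' \<beta> = cnj (K_entry e L \<beta> \<beta>')" using label_block_fock by (intro K_entry_sym) auto
        then show "cnj (K_entry e L \<beta> \<beta>' * u a \<beta>') * v a \<beta> = cnj (u a \<beta>') * (K_entry e L \<beta>' \<beta> * v a \<beta>)" by simp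
      qed
      also have "\<dots> = (\<Sum>\<beta>'\<in>label_block c. \<Sum>\<beta>\<in>label_block c. cnj (u a \<beta>') * (K_entry e L \<beta>' \<beta> * v a \<beta>))" by (rule sum.swap)
      finally show ?thesis by (simp add: sum_distrib_left)
    qed
    have "?f a = (\<Sum>\<beta>\<in>label_block c. - of_real kin_coef * (cnj (?ud \<beta>) * v a \<beta>) + ?p \<beta> * (cnj (u a \<beta>) * v a \<beta>)
        + cnj (\<Sum>\<beta>'\<in>label_block c. K_entry e L \<beta> \<beta>' * u a \<beta>') * v a \<beta>)"
    proof (rule sum.cong[OF refl])
      fix \<beta> assume "\<beta> \<in> label_block c"
      then have b: "\<beta> \<in> fock_basis" using label_block_fock by blast
      have "Hop e L C0 u a \<beta> = - of_real kin_coef * ?ud \<beta> + ?p \<beta> * u a \<beta> + (\<Sum>\<beta>'\<in>label_block c. K_entry e L \<beta> \<beta>' * u a \<beta>')"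
        by (rule Hop_Iv(2)[OF u _ a b]) (rule cu; assumption)
      then show "cnj (Hop e L C0 u a \<beta>) * v a \<beta> = - of_real kin_coef * (cnj (?ud \<beta>) * v a \<beta>) + ?p \<beta> * (cnj (u a \<beta>) * v a \<beta>)
        + cnj (\<Sum>\<beta>'\<in>label_block c. K_entry e L \<beta> \<beta>' * u a \<beta>') * v a \<beta>"
        by (simp only: complex_cnj_add complex_cnj_mult complex_cnj_minus complex_cnj_complex_of_real distrib_right mult.assoc)
    qed
    moreover have "?g a = (\<Sum>\<beta>\<in>label_block c. - of_real kin_coef * (cnj (u a \<beta>) * ?vd \<beta>) + ?p \<beta> * (cnj (u a \<beta>) * v a \<beta>)
        + cnj (u a \<beta>) * (\<Sum>\<beta>'\<in>label_block c. K_entry e L \<beta> \<beta>' * v a \<beta>'))"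
    proof (rule sum.cong[OF refl])
      fix \<beta> assume "\<beta> \<in> label_block c"
      then have b: "\<beta> \<in> fock_basis" using label_block_fock by blast
      have "Hop e L C0 v a \<beta> = - of_real kin_coef * ?vd \<beta> + ?p \<beta> * v a \<beta> + (\<Sum>\<beta>'\<in>label_block c. K_entry e L \<beta> \<beta>' * v a \<beta>')"
        by (rule Hop_Iv(2)[OF v _ a b]) (rule cv; assumption)
      then show "cnj (u a \<beta>) * Hop e L C0 v a \<beta> = - of_real kin_coef * (cnj (u a \<beta>) * ?vd \<beta>) + ?p \<beta> * (cnj (u a \<beta>) * v a \<beta>)
        + cnj (u a \<beta>) * (\<Sum>\<beta>'\<in>label_block c. K_entry e L \<beta> \<beta>' * v a \<beta>')"
        by (simp only: distrib_left mult.left_commute[of "cnj (u a \<beta>)"])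
    qed
    ultimately have "?f a - ?g a = (\<Sum>\<beta>\<in>label_block c. - of_real kin_coef * (cnj (?ud \<beta>) * v a \<beta>)) - (\<Sum>\<beta>\<in>label_block c. - of_real kin_coef * (cnj (u a \<beta>) * ?vd \<beta>))"
      by (simp only: sum.distrib Kc) simp
    also have "\<dots> = cderiv W a"
      unfolding dW dw by (simp add: sum_distrib_left sum_subtractf right_diff_distrib)
    finally show ?thesis .
  qed
  have f: "Kinner L (Hop e L C0 u) v = (LINT a:Iv L|lebesgue. ?f a)" "set_integrable lebesgue (Iv L) ?f"
    by (rule Kinner_finite[OF DomH_Kspace(2)[OF u] DomH_Kspace(1)[OF v] label_block_finite]; use vz in blast)+
  have g: "Kinner L u (Hop e L C0 v) = (LINT a:Iv L|lebesgue. ?g a)" "set_integrable lebesgue (Iv L) ?g"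
    by (rule Kinner_finite[OF DomH_Kspace(1)[OF u] DomH_Kspace(2)[OF v] label_block_finite]; use uz in blast)+
  have "Kinner L (Hop e L C0 u) v - Kinner L u (Hop e L C0 v) = (LINT a:Iv L|lebesgue. ?f a - ?g a)"
    unfolding f(1) g(1) by (rule set_integral_diff(2)[OF f(2) g(2), symmetric])
  also have "\<dots> = (LINT a:Iv L|lebesgue. cderiv W a)"
    by (rule set_lebesgue_integral_cong) (use pw in auto)
  also have "\<dots> = W ell - W 0" unfolding Iv_eq using ell_pos by (intro csmooth_FTC Ws) auto
  finally show ?thesis using Wper by simp
qed

end

section \<open>The inner product and density\<close>

lemma infinite_charge0: "infinite charge0_basis"
proof
  assume "finite charge0_basis"
  moreover have "(\<lambda>n::int. ({n}, {n})) ` UNIV \<subseteq> charge0_basis" by (auto simp: charge0_basis_def)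
  ultimately have "finite ((\<lambda>n::int. ({n}, {n})) ` UNIV)" by (rule finite_subset[rotated])
  then have "finite (UNIV :: int set)" by (rule finite_imageD) (auto intro: inj_onI)
  then show False by simp
qed

text \<open>An enumeration turns sums over neutral labels into series, for which termwise
  integration is available.\<close>

definition enum0 :: "nat \<Rightarrow> fb" where "enum0 = from_nat_into charge0_basis"

lemma bij_enum0: "bij_betw enum0 UNIV charge0_basis"
  unfolding enum0_def by (rule bij_betw_from_nat_into[OF countable_charge0 infinite_charge0])

definition Knorm2_real :: "real \<Rightarrow> (real \<Rightarrow> fvec) \<Rightarrow> real" where "Knorm2_real L x = enn2real (Knorm2 L x)"

lemma Knorm2_real_nonneg [simp]: "0 \<le> Knorm2_real L x" by (simp add: Knorm2_real_def)

lemma Knorm2_Knorm2_real: "x \<in> Kspace L \<Longrightarrow> Knorm2 L x = ennreal (Knorm2_real L x)"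
  by (simp add: Knorm2_real_def Kspace_iff)

lemma Knorm2_enum0:
  assumes "x \<in> Kspace L"
  shows "(\<Sum>n. ennreal (r2 UNIV (component L x (enum0 n)))) = Knorm2 L x"
proof -
  have K: "K_admissible L x" using assms by (simp add: Kspace_iff)
  have "Knorm2 L x = (\<integral>\<^sup>+n. n2 (Iv L) (\<lambda>a. x a (enum0 n)) \<partial>count_space UNIV)"
    unfolding Knorm2_sum[OF K] by (rule nn_integral_bij_count_space[OF bij_enum0, symmetric])
  also have "\<dots> = (\<Sum>n. n2 UNIV (component L x (enum0 n)))" by (simp add: nn_integral_count_space_nat n2_component)
  finally show ?thesis by (simp add: L2_n2[OF component_L2[OF assms]])
qed

lemma Knorm2_real_sums: "x \<in> Kspace L \<Longrightarrow> (\<lambda>n. r2 UNIV (component L x (enum0 n))) sums Knorm2_real L x"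
proof -
  assume x: "x \<in> Kspace L"
  have "(\<Sum>n. ennreal (r2 UNIV (component L x (enum0 n)))) = ennreal (Knorm2_real L x)" using Knorm2_enum0[OF x] Knorm2_Knorm2_real[OF x] by simp
  moreover from this have s: "summable (\<lambda>n. r2 UNIV (component L x (enum0 n)))" by (intro summable_suminf_not_top) auto
  ultimately have "ennreal (\<Sum>n. r2 UNIV (component L x (enum0 n))) = ennreal (Knorm2_real L x)" by (subst suminf_ennreal_eq[symmetric]) (auto simp: summable_sums)
  then have "(\<Sum>n. r2 UNIV (component L x (enum0 n))) = Knorm2_real L x" using s by (simp add: suminf_nonneg)
  then show ?thesis using s by (simp add: sums_iff)
qed

lemma weighted_am_gm:
  assumes "0 < (c::real)" shows "a * b \<le> (c * a\<^sup>2 + b\<^sup>2 / c) / 2"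
proof -
  have "0 \<le> (c * a - b)\<^sup>2 / c" using assms by simp
  also have "\<dots> = c * a\<^sup>2 + b\<^sup>2 / c - 2 * (a * b)" using assms by (simp add: power2_eq_square field_simps)
  finally show ?thesis by simp
qed

text \<open>The free weight \<open>c\<close> makes the arithmetic-geometric mean do the work of
  Cauchy-Schwarz after summation over labels; it later becomes a smallness parameter.\<close>

lemma component_norm_bound:
  assumes x: "x \<in> Kspace L" and y: "y \<in> Kspace L" and c: "0 < c"
  shows "(LINT a|lebesgue. norm (cnj (component L x \<beta> a) * component L y \<beta> a)) \<le> (c * r2 UNIV (component L x \<beta>) + r2 UNIV (component L y \<beta>) / c) / 2"
proof -
  have i: "integrable lebesgue (\<lambda>a. (cmod (component L z \<beta> a))\<^sup>2)" "r2 UNIV (component L z \<beta>) = (LINT a|lebesgue. (cmod (component L z \<beta> a))\<^sup>2)"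
    if "z \<in> Kspace L" for z
    using L2_set_integrable[OF component_L2[OF that], of \<beta>] by (simp_all add: set_integrable_def set_lebesgue_integral_def)
  have "(LINT a|lebesgue. norm (cnj (component L x \<beta> a) * component L y \<beta> a)) \<le>
    (LINT a|lebesgue. (c * (cmod (component L x \<beta> a))\<^sup>2 + (cmod (component L y \<beta> a))\<^sup>2 / c) / 2)"
  proof (rule integral_mono)
    show "integrable lebesgue (\<lambda>a. norm (cnj (component L x \<beta> a) * component L y \<beta> a))"
      by (rule integrable_norm[OF component_integrable(1)[OF x y]])
    show "integrable lebesgue (\<lambda>a. (c * (cmod (component L x \<beta> a))\<^sup>2 + (cmod (component L y \<beta> a))\<^sup>2 / c) / 2)"
      using i(1)[OF x] i(1)[OF y] by simp
    show "norm (cnj (component L x \<beta> a) * component L y \<beta> a) \<le> (c * (cmod (component L x \<beta> a))\<^sup>2 + (cmod (component L y \<beta> a))\<^sup>2 / c) / 2" for a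
      using weighted_am_gm[OF c, of "cmod (component L x \<beta> a)" "cmod (component L y \<beta> a)"] by (simp add: norm_mult)
  qed
  also have "\<dots> = (c * r2 UNIV (component L x \<beta>) + r2 UNIV (component L y \<beta>) / c) / 2"
    using i[OF x] i[OF y] by simp
  finally show ?thesis .
qed

text \<open>The sum over labels in the definition of \<open>Kinner\<close> has the junk value 0 where it does not converge absolutely; this happens only on a null set.\<close>

lemma Kinner_series:
  assumes x: "x \<in> Kspace L" and y: "y \<in> Kspace L"
  shows "(\<lambda>n. LINT a|lebesgue. cnj (component L x (enum0 n) a) * component L y (enum0 n) a) sums Kinner L x y"
    and "0 < c \<Longrightarrow> cmod (Kinner L x y) \<le> (c * Knorm2_real L x + Knorm2_real L y / c) / 2"
proof -
  define f where "f = (\<lambda>n a. cnj (component L x (enum0 n) a) * component L y (enum0 n) a)"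
  have fi: "integrable lebesgue (f n)" for n unfolding f_def by (rule component_integrable(1)[OF x y])
  have b: "(LINT a|lebesgue. norm (f n a)) \<le> (c * r2 UNIV (component L x (enum0 n)) + r2 UNIV (component L y (enum0 n)) / c) / 2" if "0 < c" for c n
    unfolding f_def by (rule component_norm_bound[OF x y that])
  have bs: "(\<lambda>n. (c * r2 UNIV (component L x (enum0 n)) + r2 UNIV (component L y (enum0 n)) / c) / 2) sums ((c * Knorm2_real L x + Knorm2_real L y / c) / 2)" for c
    by (intro sums_divide sums_add sums_mult Knorm2_real_sums x y)
  have n0: "0 \<le> (LINT a|lebesgue. norm (f n a))" for n by (rule integral_nonneg_AE) auto
  have s: "summable (\<lambda>n. LINT a|lebesgue. norm (f n a))"
    by (rule summable_comparison_test'[OF sums_summable[OF bs[of 1]], of 0]) (use b[of 1] n0 in auto)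
  have AEs: "AE a in lebesgue. summable (\<lambda>n. norm (f n a))"
  proof -
    have fm: "(\<lambda>a. ennreal (norm (f n a))) \<in> borel_measurable lebesgue" for n
    proof -
      have [measurable]: "f n \<in> borel_measurable lebesgue" by (rule borel_measurable_integrable[OF fi])
      show ?thesis by measurable
    qed
    have "(\<integral>\<^sup>+a. (\<Sum>n. ennreal (norm (f n a))) \<partial>lebesgue) = (\<Sum>n. \<integral>\<^sup>+a. ennreal (norm (f n a)) \<partial>lebesgue)"
      by (rule nn_integral_suminf[OF fm])
    also have "\<dots> = (\<Sum>n. ennreal (LINT a|lebesgue. norm (f n a)))"
      using fi by (intro suminf_cong nn_integral_eq_integral) auto
    also have "\<dots> = ennreal (\<Sum>n. LINT a|lebesgue. norm (f n a))"
      by (rule suminf_ennreal_eq[OF n0 summable_sums[OF s]])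
    finally have "(\<integral>\<^sup>+a. (\<Sum>n. ennreal (norm (f n a))) \<partial>lebesgue) \<noteq> \<infinity>" by simp
    then have "AE a in lebesgue. (\<Sum>n. ennreal (norm (f n a))) \<noteq> \<infinity>"
      using fm by (intro nn_integral_PInf_AE borel_measurable_suminf_order) auto
    then show ?thesis by eventually_elim (auto intro: summable_suminf_not_top)
  qed
  note isu = integrable_suminf[OF fi AEs s] and su = integral_suminf[OF fi AEs s]
  have eq: "AE a in lebesgue. (\<Sum>n. f n a) = indicat_real (Iv L) a *\<^sub>R (\<Sum>\<^sub>\<infinity>\<beta>. cnj (x a \<beta>) * y a \<beta>)"
    using AEs
  proof eventually_elim
    case (elim a)
    show ?case
    proof (cases "a \<in> Iv L")
      case True
      have "(\<Sum>\<^sub>\<infinity>\<beta>. cnj (x a \<beta>) * y a \<beta>) = (\<Sum>\<^sub>\<infinity>\<beta>\<in>charge0_basis. cnj (x a \<beta>) * y a \<beta>)"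
      proof (rule infsum_cong_neutral)
        fix \<beta> assume "\<beta> \<in> UNIV - charge0_basis"
        then have "x a \<beta> = 0" using x True unfolding Kspace_iff K_admissible_def by blast
        then show "cnj (x a \<beta>) * y a \<beta> = 0" by simp
      qed auto
      also have "\<dots> = (\<Sum>\<^sub>\<infinity>n. cnj (x a (enum0 n)) * y a (enum0 n))"
        by (rule infsum_reindex_bij_betw[OF bij_enum0, symmetric])
      also have "\<dots> = (\<Sum>\<^sub>\<infinity>n. f n a)" using True by (simp add: f_def component_def)
      also have "\<dots> = (\<Sum>n. f n a)"
        by (rule infsumI) (rule norm_summable_imp_has_sum[OF elim summable_sums[OF summable_norm_cancel[OF elim]]])
      finally show ?thesis using True by simp
    qed (simp add: f_def component_def)
  qed
  have "(LINT a|lebesgue. (\<Sum>n. f n a)) = Kinner L x y"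
    unfolding Kinner_def set_lebesgue_integral_def
    by (rule integral_cong_AE[OF _ _ eq])
       (use borel_measurable_integrable[OF isu] borel_measurable_AE[OF _ eq] in auto)
  moreover have "summable (\<lambda>n. LINT a|lebesgue. f n a)"
    by (rule summable_comparison_test'[OF s, of 0]) (auto intro: integral_norm_bound)
  ultimately have S: "(\<lambda>n. LINT a|lebesgue. f n a) sums Kinner L x y"
    using su by (simp add: sums_iff)
  then show "(\<lambda>n. LINT a|lebesgue. cnj (component L x (enum0 n) a) * component L y (enum0 n) a) sums Kinner L x y"
    by (simp add: f_def)
  assume c: "0 < c"
  have "norm (\<Sum>n. LINT a|lebesgue. f n a) \<le> (\<Sum>n. (c * r2 UNIV (component L x (enum0 n)) + r2 UNIV (component L y (enum0 n)) / c) / 2)"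
    by (rule norm_suminf_le[OF order_trans[OF integral_norm_bound b[OF c]] sums_summable[OF bs]])
  then show "cmod (Kinner L x y) \<le> (c * Knorm2_real L x + Knorm2_real L y / c) / 2"
    using S bs[of c] by (simp add: sums_iff)
qed

lemma component_diff: "component L (x - y) \<beta> a = component L x \<beta> a - component L y \<beta> a"
  by (simp add: component_def scaleR_diff_right)

lemma Kspace_diff:
  assumes x: "x \<in> Kspace L" and y: "y \<in> Kspace L"
  shows "x - y \<in> Kspace L" "Knorm2_real L (x - y) \<le> 2 * Knorm2_real L x + 2 * Knorm2_real L y"
proof -
  have K: "K_admissible L x" "K_admissible L y" using x y by (auto simp: Kspace_iff)
  have b: "n2 (Iv L) (\<lambda>a. (x - y) a \<beta>) \<le> 2 * n2 (Iv L) (\<lambda>a. x a \<beta>) + 2 * n2 (Iv L) (\<lambda>a. y a \<beta>)" for \<beta>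
    using n2_add[of "component L x \<beta>" "\<lambda>a. - component L y \<beta> a" UNIV] L2_meas[OF component_L2[OF x]] L2_meas[OF component_L2[OF y]]
    unfolding n2_component[symmetric] component_diff[abs_def] by (simp add: n2_uminus)
  have "Knorm2 L (x - y) \<le> (\<integral>\<^sup>+\<beta>. 2 * n2 (Iv L) (\<lambda>a. x a \<beta>) + 2 * n2 (Iv L) (\<lambda>a. y a \<beta>) \<partial>count_space charge0_basis)"
    unfolding Knorm2_sum[OF K_admissible_diff[OF K]] by (intro nn_integral_mono b)
  also have "\<dots> = 2 * Knorm2 L x + 2 * Knorm2 L y"
    unfolding Knorm2_sum[OF K(1)] Knorm2_sum[OF K(2)] by (subst nn_integral_add) (auto simp: nn_integral_cmult)
  also have "\<dots> = ennreal (2 * Knorm2_real L x + 2 * Knorm2_real L y)"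
    unfolding Knorm2_Knorm2_real[OF x] Knorm2_Knorm2_real[OF y] by (simp add: ennreal_mult' flip: ennreal_numeral)
  finally have le: "Knorm2 L (x - y) \<le> ennreal (2 * Knorm2_real L x + 2 * Knorm2_real L y)" .
  then have "Knorm2 L (x - y) < \<infinity>" by (auto intro: le_less_trans)
  then show k: "x - y \<in> Kspace L" using K_admissible_diff[OF K] by (simp add: Kspace_iff)
  show "Knorm2_real L (x - y) \<le> 2 * Knorm2_real L x + 2 * Knorm2_real L y" using le unfolding Knorm2_Knorm2_real[OF k] by (subst (asm) ennreal_le_iff) auto
qed

lemma Knorm2_minus_commute: "Knorm2 L (x - y) = Knorm2 L (y - x)"
  by (simp add: Knorm2_def norm_minus_commute)

lemma Kinner_diff:
  assumes x: "x \<in> Kspace L" and y: "y \<in> Kspace L" and z: "z \<in> Kspace L"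
  shows "Kinner L (x - y) z = Kinner L x z - Kinner L y z" "Kinner L z (x - y) = Kinner L z x - Kinner L z y"
proof -
  note i = component_integrable(1)
  have "(\<lambda>n. (LINT a|lebesgue. cnj (component L x (enum0 n) a) * component L z (enum0 n) a) - (LINT a|lebesgue. cnj (component L y (enum0 n) a) * component L z (enum0 n) a)) sums (Kinner L x z - Kinner L y z)"
    by (intro sums_diff Kinner_series(1) x y z)
  moreover have "(LINT a|lebesgue. cnj (component L x \<beta> a) * component L z \<beta> a) - (LINT a|lebesgue. cnj (component L y \<beta> a) * component L z \<beta> a) = (LINT a|lebesgue. cnj (component L (x - y) \<beta> a) * component L z \<beta> a)" for \<beta>
    using i[OF x z, of \<beta>] i[OF y z, of \<beta>] by (subst Bochner_Integration.integral_diff[symmetric]) (auto simp: component_diff algebra_simps)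
  ultimately have "(\<lambda>n. LINT a|lebesgue. cnj (component L (x - y) (enum0 n) a) * component L z (enum0 n) a) sums (Kinner L x z - Kinner L y z)" by simp
  with Kinner_series(1)[OF Kspace_diff(1)[OF x y] z] show "Kinner L (x - y) z = Kinner L x z - Kinner L y z" by (rule sums_unique2)
  have "(\<lambda>n. (LINT a|lebesgue. cnj (component L z (enum0 n) a) * component L x (enum0 n) a) - (LINT a|lebesgue. cnj (component L z (enum0 n) a) * component L y (enum0 n) a)) sums (Kinner L z x - Kinner L z y)"
    by (intro sums_diff Kinner_series(1) x y z)
  moreover have "(LINT a|lebesgue. cnj (component L z \<beta> a) * component L x \<beta> a) - (LINT a|lebesgue. cnj (component L z \<beta> a) * component L y \<beta> a) = (LINT a|lebesgue. cnj (component L z \<beta> a) * component L (x - y) \<beta> a)" for \<beta>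
    using i[OF z x, of \<beta>] i[OF z y, of \<beta>] by (subst Bochner_Integration.integral_diff[symmetric]) (auto simp: component_diff algebra_simps)
  ultimately have "(\<lambda>n. LINT a|lebesgue. cnj (component L z (enum0 n) a) * component L (x - y) (enum0 n) a) sums (Kinner L z x - Kinner L z y)" by simp
  with Kinner_series(1)[OF z Kspace_diff(1)[OF x y]] show "Kinner L z (x - y) = Kinner L z x - Kinner L z y" by (rule sums_unique2)
qed

text \<open>The squared distances are below s^2. Choosing the weights 1/s and s in the bound for
  \<open>Kinner\<close> balances them against the bounded norms and leaves an error of order
  s.\<close>

lemma Kinner_close:
  assumes K: "v \<in> Kspace L" "v' \<in> Kspace L" "x \<in> Kspace L" "x' \<in> Kspace L"
    and s: "0 < s" "s \<le> 1" "Knorm2 L (v' - v) < ennreal (s\<^sup>2)" "Knorm2 L (x' - x) < ennreal (s\<^sup>2)"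
  shows "cmod (Kinner L v x - Kinner L v' x') \<le> s * (Knorm2_real L x + Knorm2_real L v + 2)"
proof -
  have d: "Knorm2_real L (v - v') < s\<^sup>2" "Knorm2_real L (x - x') < s\<^sup>2"
    using s(3,4) Knorm2_Knorm2_real[OF Kspace_diff(1)[OF K(1,2)]] Knorm2_Knorm2_real[OF Kspace_diff(1)[OF K(3,4)]]
    by (simp_all add: Knorm2_minus_commute[of L v'] Knorm2_minus_commute[of L x'] ennreal_less_iff)
  have v': "Knorm2_real L v' \<le> 2 * Knorm2_real L v + 2 * s\<^sup>2"
  proof -
    have "v - (v - v') = v'" by (simp add: fun_diff_def)
    then show ?thesis using Kspace_diff(2)[OF K(1) Kspace_diff(1)[OF K(1,2)]] d(1) by simp
  qed
  have s2: "s\<^sup>2 \<le> 1" using s by (simp add: power_le_one)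
  have "Kinner L v x - Kinner L v' x' = Kinner L (v - v') x + Kinner L v' (x - x')"
    using K by (simp add: Kinner_diff)
  then have "cmod (Kinner L v x - Kinner L v' x') \<le> cmod (Kinner L (v - v') x) + cmod (Kinner L v' (x - x'))"
    by (metis norm_triangle_ineq)
  also have "cmod (Kinner L (v - v') x) \<le> ((1 / s) * Knorm2_real L (v - v') + Knorm2_real L x / (1 / s)) / 2"
    using s by (intro Kinner_series(2) Kspace_diff K) auto
  also have "\<dots> \<le> ((1 / s) * s\<^sup>2 + Knorm2_real L x / (1 / s)) / 2"
    using s d(1) by (intro divide_right_mono add_right_mono mult_left_mono) auto
  also have "\<dots> = s * (1 + Knorm2_real L x) / 2" using s by (simp add: power2_eq_square field_simps)
  also have "cmod (Kinner L v' (x - x')) \<le> (s * Knorm2_real L v' + Knorm2_real L (x - x') / s) / 2"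
    using s by (intro Kinner_series(2) Kspace_diff K) auto
  also have "\<dots> \<le> (s * (2 * Knorm2_real L v + 2 * 1) + s\<^sup>2 / s) / 2"
    using s d(2) v' s2 by (intro divide_right_mono add_mono mult_left_mono) auto
  also have "\<dots> = s * (2 * Knorm2_real L v + 3) / 2" using s by (simp add: power2_eq_square field_simps)
  finally have "cmod (Kinner L v x - Kinner L v' x') \<le> s * (1 + Knorm2_real L x) / 2 + s * (2 * Knorm2_real L v + 3) / 2" by simp
  also have "\<dots> = s * (Knorm2_real L x / 2 + Knorm2_real L v + 2)" by (simp add: field_simps)
  also have "\<dots> \<le> s * (Knorm2_real L x + Knorm2_real L v + 2)" using s by (intro mult_left_mono) auto
  finally show ?thesis .
qed

text \<open>For pairs in the graph itself the adjoint relation is symmetry; it passes to limits in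
  both arguments because \<open>Kinner\<close> is jointly continuous, quantified here by an error
  proportional to \<open>s\<close>.\<close>

lemma closure_subset_adjoint:
  assumes T: "\<And>u. u \<in> D \<Longrightarrow> u \<in> Kspace L" "\<And>u. u \<in> D \<Longrightarrow> T u \<in> Kspace L"
    and sym: "\<And>u v. u \<in> D \<Longrightarrow> v \<in> D \<Longrightarrow> Kinner L (T u) v = Kinner L u (T v)"
  shows "closure_graph L (op_graph D T) \<subseteq> adjoint_graph L (closure_graph L (op_graph D T))"
proof (rule subrelI)
  fix x y assume xy: "(x, y) \<in> closure_graph L (op_graph D T)"
  have "Kinner L v x = Kinner L u y" if uv: "(u, v) \<in> closure_graph L (op_graph D T)" for u v
  proof -
    have K: "x \<in> Kspace L" "y \<in> Kspace L" "u \<in> Kspace L" "v \<in> Kspace L" using xy uv by (auto simp: closure_graph_def)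
    define M where "M = (Knorm2_real L x + Knorm2_real L v + 2) + (Knorm2_real L y + Knorm2_real L u + 2)"
    have M: "0 < M" unfolding M_def using Knorm2_real_nonneg[of L x] Knorm2_real_nonneg[of L v] Knorm2_real_nonneg[of L y] Knorm2_real_nonneg[of L u] by linarith
    have le: "cmod (Kinner L v x - Kinner L u y) \<le> s * M" if s: "0 < s" "s \<le> 1" for s
    proof -
      have s2: "0 < s\<^sup>2" using s by simp
      obtain x1 where x1: "x1 \<in> D" "Knorm2 L (x1 - x) < ennreal (s\<^sup>2)" "Knorm2 L (T x1 - y) < ennreal (s\<^sup>2)"
        using xy s2 unfolding closure_graph_def op_graph_def by blast
      obtain u1 where u1: "u1 \<in> D" "Knorm2 L (u1 - u) < ennreal (s\<^sup>2)" "Knorm2 L (T u1 - v) < ennreal (s\<^sup>2)"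
        using uv s2 unfolding closure_graph_def op_graph_def by blast
      have a: "cmod (Kinner L v x - Kinner L (T u1) x1) \<le> s * (Knorm2_real L x + Knorm2_real L v + 2)"
        by (rule Kinner_close) (use K T x1 u1 s in auto)
      have b: "cmod (Kinner L u y - Kinner L u1 (T x1)) \<le> s * (Knorm2_real L y + Knorm2_real L u + 2)"
        by (rule Kinner_close) (use K T x1 u1 s in auto)
      have "Kinner L v x - Kinner L u y = (Kinner L v x - Kinner L (T u1) x1) - (Kinner L u y - Kinner L u1 (T x1))"
        using sym[OF u1(1) x1(1)] by simp
      then have "cmod (Kinner L v x - Kinner L u y) \<le> s * (Knorm2_real L x + Knorm2_real L v + 2) + s * (Knorm2_real L y + Knorm2_real L u + 2)"
        using norm_triangle_ineq4[of "Kinner L v x - Kinner L (T u1) x1" "Kinner L u y - Kinner L u1 (T x1)"] a b by simp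
      then show ?thesis by (simp add: M_def algebra_simps)
    qed
    show ?thesis
    proof (rule ccontr)
      assume "Kinner L v x \<noteq> Kinner L u y"
      then have p: "0 < cmod (Kinner L v x - Kinner L u y)" by simp
      define s where "s = min 1 (cmod (Kinner L v x - Kinner L u y) / (2 * M))"
      have s: "0 < s" "s \<le> 1" using p M by (auto simp: s_def)
      have "s * M \<le> cmod (Kinner L v x - Kinner L u y) / 2"
        using M mult_right_mono[of s "cmod (Kinner L v x - Kinner L u y) / (2 * M)" M] by (simp add: s_def)
      then show False using le[OF s] p by linarith
    qed
  qed
  then show "(x, y) \<in> adjoint_graph L (closure_graph L (op_graph D T))"
    using xy unfolding adjoint_graph_def closure_graph_def by blast
qed

lemma n2_split: "S \<in> sets lebesgue \<Longrightarrow> f \<in> borel_measurable lebesgue \<Longrightarrow> n2 UNIV f = n2 S f + n2 (- S) f"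
  unfolding n2_def
  by (subst nn_integral_add[symmetric]) (auto intro!: nn_integral_cong split: split_indicator)

lemma L2_approx_UNIV:
  assumes f: "L2 UNIV f" and \<epsilon>: "0 < \<epsilon>"
  obtains \<phi> R where "test_fun R \<phi>" "n2 UNIV (\<lambda>t. \<phi> t - f t) < ennreal \<epsilon>"
proof -
  obtain R0 where R0: "\<And>R. R0 \<le> R \<Longrightarrow> r2 (- {-R..R}) f < \<epsilon> / 2" using L2_tail[OF f, of "\<epsilon>/2"] \<epsilon> by auto
  define R where "R = max R0 1"
  have R: "0 < R" "R0 \<le> R" by (auto simp: R_def)
  have fI: "L2 {-R..R} f" "L2 (- {-R..R}) f" using L2_mono_set[OF f] by auto
  obtain \<phi> where \<phi>: "test_fun R \<phi>" "r2 {-R..R} (\<lambda>t. f t - \<phi> t) < \<epsilon> / 2" using L2_approx_test_fun[OF fI(1) _ R(1), of "\<epsilon>/2"] \<epsilon> by auto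
  have d: "L2 {-R..R} (\<lambda>t. f t - \<phi> t)" using fI(1) L2_csmooth[OF test_fun_csmooth[OF \<phi>(1)]] by (intro L2_diff) auto
  have m: "(\<lambda>t. \<phi> t - f t) \<in> borel_measurable lebesgue"
    using csmooth_measurable[OF test_fun_csmooth[OF \<phi>(1)]] L2_meas[OF f] by (intro borel_measurable_diff)
  have "n2 UNIV (\<lambda>t. \<phi> t - f t) = n2 {-R..R} (\<lambda>t. \<phi> t - f t) + n2 (- {-R..R}) (\<lambda>t. \<phi> t - f t)"
    by (rule n2_split[OF _ m]) auto
  also have "n2 {-R..R} (\<lambda>t. \<phi> t - f t) = ennreal (r2 {-R..R} (\<lambda>t. f t - \<phi> t))"
    by (subst n2_minus_commute) (rule L2_n2[OF d])
  also have "n2 (- {-R..R}) (\<lambda>t. \<phi> t - f t) = n2 (- {-R..R}) f"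
  proof (rule n2_cong)
    fix t assume "t \<in> - {-R..R}"
    then have "R \<le> \<bar>t\<bar>" by auto
    then show "cmod (\<phi> t - f t) = cmod (f t)" using \<phi>(1) by (simp add: test_fun_def)
  qed
  also have "\<dots> = ennreal (r2 (- {-R..R}) f)" by (rule L2_n2[OF fI(2)])
  also have "ennreal (r2 {-R..R} (\<lambda>t. f t - \<phi> t)) + ennreal (r2 (- {-R..R}) f) = ennreal (r2 {-R..R} (\<lambda>t. f t - \<phi> t) + r2 (- {-R..R}) f)"
    by simp
  also have "\<dots> < ennreal \<epsilon>" using \<phi>(2) R0[OF R(2)] \<epsilon> by (intro ennreal_lessI) auto
  finally show ?thesis using \<phi>(1) that by blast
qed

lemma ennreal_sum_less:
  assumes "a < ennreal (\<epsilon> / 2)" "b < ennreal (\<epsilon> / 2)" "0 < \<epsilon>"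
  shows "a + b < ennreal \<epsilon>"
  using assms by (cases a; cases b) (auto simp: ennreal_less_iff simp flip: ennreal_plus)

context schwinger
begin

text \<open>Representatives of high energy carry little norm and are dropped; each of the finitely
  many remaining functions on the line is approximated by a test function, and refolding returns to
  the domain.\<close>

lemma DomH_dense: "dense_in_K L (DomH L G)"
  unfolding dense_in_K_def
proof (intro conjI ballI allI impI)
  show "DomH L G \<subseteq> Kspace L" using DomH_Kspace by blast
  fix x \<epsilon> assume x: "x \<in> Kspace L" and \<epsilon>: "0 < (\<epsilon>::real)"
  obtain n0 where n0: "\<And>n. n0 \<le> n \<Longrightarrow> (\<integral>\<^sup>+r. n2 UNIV (unfold_fn x r) * indicator (J0 - base_block n) r \<partial>count_space J0) < ennreal (\<epsilon>/2)"
    using Knorm2_tail[OF x, of "\<epsilon>/2"] \<epsilon> by auto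
  let ?B = "base_block n0"
  \<comment> \<open>The added 1 makes the sum over the block strictly smaller than \<epsilon>/2 and
    covers an empty block.\<close>
  define \<delta> where "\<delta> = \<epsilon> / (2 * (real (card ?B) + 1))"
  have \<delta>: "0 < \<delta>" using \<epsilon> by (simp add: \<delta>_def)
  have "\<exists>\<phi> R. test_fun R \<phi> \<and> n2 UNIV (\<lambda>t. \<phi> t - unfold_fn x r t) < ennreal \<delta>" if "r \<in> ?B" for r
  proof -
    have "r \<in> J0" using base_block_J0 that by blast
    from L2_approx_UNIV[OF unfold_fn_L2[OF x this] \<delta>] show ?thesis by metis
  qed
  then obtain f R where f: "\<And>r. r \<in> ?B \<Longrightarrow> test_fun (R r) (f r)" "\<And>r. r \<in> ?B \<Longrightarrow> n2 UNIV (\<lambda>t. f r t - unfold_fn x r t) < ennreal \<delta>"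
    by metis
  define R' where "R' = (\<Sum>r\<in>?B. \<bar>R r\<bar>)"
  have fR: "test_fun R' (f r)" if "r \<in> ?B" for r
  proof (rule test_fun_mono[OF f(1)[OF that]])
    have "\<bar>R r\<bar> \<le> R'" unfolding R'_def using that finite_base_block by (intro member_le_sum) auto
    then show "R r \<le> R'" by simp
  qed
  let ?u = "refold ?B f"
  have u: "?u \<in> DomH L G" by (rule refold_DomH[OF finite_base_block fR])
  have "Knorm2 L (?u - x) = (\<Sum>r\<in>?B. n2 UNIV (\<lambda>t. unfold_fn ?u r t - unfold_fn x r t)) +
    (\<integral>\<^sup>+r. n2 UNIV (unfold_fn x r) * indicator (J0 - ?B) r \<partial>count_space J0)"
    by (rule Knorm2_split) (use DomH_Kspace(1)[OF u] x in \<open>auto simp: Kspace_iff unfold_fn_refold\<close>)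
  also have "\<dots> < ennreal \<epsilon>"
  proof (rule ennreal_sum_less[OF _ n0 \<epsilon>])
    have "(\<Sum>r\<in>?B. n2 UNIV (\<lambda>t. unfold_fn ?u r t - unfold_fn x r t)) \<le> (\<Sum>r\<in>?B. ennreal \<delta>)"
    proof (rule sum_mono)
      fix r assume r: "r \<in> ?B"
      then have "unfold_fn ?u r t = f r t" for t using base_block_J0 unfold_fn_refold[of r ?B f t] by auto
      then show "n2 UNIV (\<lambda>t. unfold_fn ?u r t - unfold_fn x r t) \<le> ennreal \<delta>" using f(2)[OF r] by simp
    qed
    also have "\<dots> = ennreal (real (card ?B) * \<delta>)" using \<delta> by (simp add: ennreal_mult' ennreal_of_nat_eq_real_of_nat)
    also have "\<dots> < ennreal (\<epsilon> / 2)" using \<epsilon> by (intro ennreal_lessI) (auto simp: \<delta>_def field_simps)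
    finally show "(\<Sum>r\<in>?B. n2 UNIV (\<lambda>t. unfold_fn ?u r t - unfold_fn x r t)) < ennreal (\<epsilon> / 2)" .
  qed simp
  finally show "\<exists>y\<in>DomH L G. Knorm2 L (x - y) < ennreal \<epsilon>" using u Knorm2_minus_commute by metis
qed

end

section \<open>Essential self-adjointness\<close>

context schwinger
begin

text \<open>The multiplication part of the Hamiltonian seen on the line: in cell j the current
  matrix between labels on sheet j, conjugated by the signs of the j-th power of \<Gamma>, and the
  oscillator potential on the diagonal.\<close>

definition V_entry :: "fb \<Rightarrow> fb \<Rightarrow> real \<Rightarrow> complex" where
  "V_entry r r' t = iter_sign \<lfloor>t / ell\<rfloor> r * iter_sign \<lfloor>t / ell\<rfloor> r' * K_entry e L (gauge_iter \<lfloor>t / ell\<rfloor> r) (gauge_iter \<lfloor>t / ell\<rfloor> r')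
     + (if r = r' then of_real (osc_pot t) else 0)"

text \<open>The operator acts within one sheet, so at the label on sheet j only the values at the
  shifted time a + j ell enter; for a representative outside the block the result vanishes, which
  decouples the block from the rest.\<close>

lemma Hop_refold:
  assumes f: "\<And>r. r \<in> base_block n \<Longrightarrow> test_fun R (f r)" and r: "r \<in> J0" and a: "a \<in> Iv L"
  shows "Hop e L C0 (refold (base_block n) f) a (gauge_iter j r) = iter_sign j r * (if r \<in> base_block n then
     - of_real kin_coef * cderiv (cderiv (f r)) (a + j * ell) + of_real (osc_pot (a + j * ell)) * f r (a + j * ell)
     + (\<Sum>r'\<in>base_block n. iter_sign j r * iter_sign j r' * K_entry e L (gauge_iter j r) (gauge_iter j r') * f r' (a + j * ell)) else 0)"
proof -
  let ?u = "refold (base_block n) f" and ?\<beta> = "gauge_iter j r"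
  have u: "?u \<in> DomH L G" by (rule refold_DomH[OF finite_base_block f])
  have b0: "?\<beta> \<in> charge0_basis" using r by (simp add: gauge_iter_charge0 J0_charge0)
  have fk: "?\<beta> \<in> fock_basis" using b0 by (rule charge0_fock)
  have ueq: "?u t (gauge_iter j r') = (if r' \<in> base_block n then iter_sign j r' * f r' (t + j * ell) else 0)" if "r' \<in> J0" for t r'
    using that by (simp add: refold_def gauge_iter_charge0 J0_charge0 base_label_gauge_iter sheet_gauge_iter)
  obtain c where c: "\<And>t \<beta>. t \<in> {-1..ell+1} \<Longrightarrow> ?u t \<beta> \<noteq> 0 \<Longrightarrow> \<beta> \<in> label_block c" using DomH_bounded[OF u] by metis
  have a': "a \<in> {-1..ell+1}" using a by (auto simp: Iv_eq)
  have K: "K_part e L (?u a) ?\<beta> = (\<Sum>\<beta>'\<in>label_block c. K_entry e L ?\<beta> \<beta>' * ?u a \<beta>')"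
    by (rule K_part_label_block(1)) (use c[OF a'] in blast)
  \<comment> \<open>A nonzero entry joins labels of the same sheet and pulls the representative of
    the target label into the block too. Both the restriction to sheet j and the vanishing outside
    the block come from here.\<close>
  have nz: "\<beta>' \<in> gauge_iter j ` base_block n \<and> r \<in> base_block n" if "K_entry e L ?\<beta> \<beta>' * ?u a \<beta>' \<noteq> 0" for \<beta>'
  proof -
    have n1: "K_entry e L ?\<beta> \<beta>' \<noteq> 0" "?u a \<beta>' \<noteq> 0" using that by auto
    then have rb: "base_label \<beta>' \<in> base_block n" by (auto simp: refold_def split: if_splits)
    have g: "gauge_iter (sheet \<beta>') (base_label \<beta>') = \<beta>'" by (rule gauge_iter_base_label)
    have "K_entry e L ?\<beta> (gauge_iter (sheet \<beta>') (base_label \<beta>')) \<noteq> 0" using n1 g by simp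
    from K_entry_gauge_iter_block[OF rb this] have "sheet ?\<beta> = sheet \<beta>'" "base_label ?\<beta> \<in> base_block n" by auto
    then have "sheet \<beta>' = j" "r \<in> base_block n" using r by (auto simp: sheet_gauge_iter base_label_gauge_iter)
    then show ?thesis using rb g by (metis image_eqI)
  qed
  have inj: "inj_on (gauge_iter j) (base_block n)" using base_block_J0 gauge_iter_inj by (intro inj_onI) blast
  have "(\<Sum>\<beta>'\<in>label_block c. K_entry e L ?\<beta> \<beta>' * ?u a \<beta>') = (\<Sum>\<beta>'\<in>label_block c \<union> gauge_iter j ` base_block n. K_entry e L ?\<beta> \<beta>' * ?u a \<beta>')"
    by (rule sum.mono_neutral_left) (use label_block_finite finite_base_block c[OF a'] in auto)
  also have "\<dots> = (\<Sum>\<beta>'\<in>gauge_iter j ` base_block n. K_entry e L ?\<beta> \<beta>' * ?u a \<beta>')"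
    by (rule sum.mono_neutral_right) (use label_block_finite finite_base_block nz in auto)
  also have "\<dots> = (\<Sum>r'\<in>base_block n. K_entry e L ?\<beta> (gauge_iter j r') * ?u a (gauge_iter j r'))"
    by (subst sum.reindex[OF inj]) simp
  also have "\<dots> = (\<Sum>r'\<in>base_block n. K_entry e L ?\<beta> (gauge_iter j r') * (iter_sign j r' * f r' (a + j * ell)))"
  proof (rule sum.cong[OF refl])
    fix r' assume "r' \<in> base_block n"
    moreover from this have "r' \<in> J0" using base_block_J0 by blast
    ultimately show "K_entry e L ?\<beta> (gauge_iter j r') * ?u a (gauge_iter j r') = K_entry e L ?\<beta> (gauge_iter j r') * (iter_sign j r' * f r' (a + j * ell))"
      by (simp add: ueq)
  qed
  finally have K2: "K_part e L (?u a) ?\<beta> = (\<Sum>r'\<in>base_block n. K_entry e L ?\<beta> (gauge_iter j r') * (iter_sign j r' * f r' (a + j * ell)))"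
    using K by simp
  \<comment> \<open>One period changes aL/pi by 2, which compensates the change of the axial charge
    from one sheet to the next.\<close>
  have q: "of_int (q5 ?\<beta>) - (a * L / pi + 1) = - ((a + j * ell) * L / pi + 1)"
    using r L by (simp add: gauge_iter_q5 J0_fock J0_q5 ell_def field_simps)
  have osc_pot: "pi / (2 * L) * (of_int (q5 ?\<beta>) - (a * L / pi + 1))\<^sup>2 + C0 = osc_pot (a + j * ell)"
    unfolding q osc_pot_def power2_minus ..
  note H = Hop_fock[OF fk, of ?u a, unfolded osc_pot]
  show ?thesis
  proof (cases "r \<in> base_block n")
    case True
    have fs: "csmooth (f r)" using f[OF True] by (rule test_fun_csmooth)
    have "(\<lambda>t. ?u t ?\<beta>) = (\<lambda>t. iter_sign j r * f r (t + j * ell))" using ueq[OF r] True by simp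
    then have d: "cderiv (cderiv (\<lambda>t. ?u t ?\<beta>)) a = iter_sign j r * cderiv (cderiv (f r)) (a + j * ell)"
      by (simp add: cderiv_cmult[OF csmooth_shift[OF fs]] cderiv_shift[OF fs]
          cderiv_cmult[OF csmooth_shift[OF csmooth_cderiv[OF fs]]] cderiv_shift[OF csmooth_cderiv[OF fs]])
    have S: "iter_sign j r * (\<Sum>r'\<in>base_block n. iter_sign j r * iter_sign j r' * K_entry e L ?\<beta> (gauge_iter j r') * f r' (a + j * ell)) =
      (\<Sum>r'\<in>base_block n. K_entry e L ?\<beta> (gauge_iter j r') * (iter_sign j r' * f r' (a + j * ell)))"
      unfolding sum_distrib_left
    proof (rule sum.cong[OF refl])
      fix r'
      have "iter_sign j r * (iter_sign j r * iter_sign j r' * K_entry e L ?\<beta> (gauge_iter j r') * f r' (a + j * ell)) =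
        (iter_sign j r * iter_sign j r) * (K_entry e L ?\<beta> (gauge_iter j r') * (iter_sign j r' * f r' (a + j * ell)))" by (simp only: mult_ac)
      then show "iter_sign j r * (iter_sign j r * iter_sign j r' * K_entry e L ?\<beta> (gauge_iter j r') * f r' (a + j * ell)) =
        K_entry e L ?\<beta> (gauge_iter j r') * (iter_sign j r' * f r' (a + j * ell))" by (simp only: iter_sign_sq(1) mult_1)
    qed
    show ?thesis unfolding H d K2 unfolding ueq[OF r] S[symmetric] if_P[OF True] distrib_left by (simp only: mult_ac)
  next
    case False
    have z: "(\<lambda>t. ?u t ?\<beta>) = (\<lambda>t. 0)" using ueq[OF r] False by simp
    have cz: "cderiv (\<lambda>t. 0) = (\<lambda>t. 0)" by (rule cderiv_eqI) simp
    have k0: "K_entry e L ?\<beta> \<beta>' * ?u a \<beta>' = 0" for \<beta>' using nz[of \<beta>'] False by blast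
    then have "K_part e L (?u a) ?\<beta> = 0" unfolding K k0 by simp
    then show ?thesis unfolding H z using fun_cong[OF z, of a] False by (simp add: cz)
  qed
qed

text \<open>Unfolding intertwines the Hamiltonian with a matrix Schroedinger operator on the line,
  block by block.\<close>

lemma unfold_fn_Hop:
  assumes f: "\<And>r. r \<in> base_block n \<Longrightarrow> test_fun R (f r)" and r: "r \<in> J0"
  shows "unfold_fn (Hop e L C0 (refold (base_block n) f)) r t = (if r \<in> base_block n then
     - of_real kin_coef * cderiv (cderiv (f r)) t + (\<Sum>r'\<in>base_block n. V_entry r r' t * f r' t) else 0)"
proof -
  define j where "j = \<lfloor>t / ell\<rfloor>"
  have "t - j * ell \<in> Iv L" using floor_cell[of t j] by (auto simp: j_def Iv_eq)
  then have H: "Hop e L C0 (refold (base_block n) f) (t - j * ell) (gauge_iter j r) = iter_sign j r * (if r \<in> base_block n then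
     - of_real kin_coef * cderiv (cderiv (f r)) (t - j * ell + j * ell) + of_real (osc_pot (t - j * ell + j * ell)) * f r (t - j * ell + j * ell)
     + (\<Sum>r'\<in>base_block n. iter_sign j r * iter_sign j r' * K_entry e L (gauge_iter j r) (gauge_iter j r') * f r' (t - j * ell + j * ell)) else 0)"
    by (intro Hop_refold[where R=R] f r)
  have tt: "t - real_of_int j * ell + real_of_int j * ell = t" by simp
  have S: "(\<Sum>r'\<in>base_block n. V_entry r r' t * f r' t) = of_real (osc_pot t) * f r t + (\<Sum>r'\<in>base_block n. iter_sign j r * iter_sign j r' * K_entry e L (gauge_iter j r) (gauge_iter j r') * f r' t)"
    if "r \<in> base_block n"
  proof -
    have "(\<Sum>r'\<in>base_block n. V_entry r r' t * f r' t) = (\<Sum>r'\<in>base_block n. iter_sign j r * iter_sign j r' * K_entry e L (gauge_iter j r) (gauge_iter j r') * f r' t + (if r' = r then of_real (osc_pot t) * f r t else 0))"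
      unfolding V_entry_def j_def[symmetric] by (intro sum.cong refl) (auto simp: distrib_right)
    then show ?thesis using that finite_base_block by (simp add: sum.distrib)
  qed
  have "unfold_fn (Hop e L C0 (refold (base_block n) f)) r t = iter_sign j r * Hop e L C0 (refold (base_block n) f) (t - j * ell) (gauge_iter j r)"
    by (simp add: unfold_fn_def j_def)
  also have "\<dots> = (if r \<in> base_block n then - of_real kin_coef * cderiv (cderiv (f r)) t + of_real (osc_pot t) * f r t
     + (\<Sum>r'\<in>base_block n. iter_sign j r * iter_sign j r' * K_entry e L (gauge_iter j r) (gauge_iter j r') * f r' t) else 0)"
    unfolding H tt by (simp add: mult.assoc[symmetric] iter_sign_sq)
  finally show ?thesis using S by simp
qed

lemma V_entry_hermitian: "r \<in> J0 \<Longrightarrow> r' \<in> J0 \<Longrightarrow> cnj (V_entry r r' t) = V_entry r' r t"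
  using K_entry_sym[of "gauge_iter \<lfloor>t / ell\<rfloor> r'" "gauge_iter \<lfloor>t / ell\<rfloor> r" e L] by (simp add: V_entry_def gauge_iter_fock J0_fock iter_sign_sq mult.commute)

lemma V_entry_measurable: "V_entry r r' \<in> borel_measurable lebesgue"
proof -
  have 1: "(\<lambda>t. (\<lambda>j. iter_sign j r * iter_sign j r' * K_entry e L (gauge_iter j r) (gauge_iter j r')) \<lfloor>t / ell\<rfloor>) \<in> borel_measurable lebesgue"
    by (rule measurable_compose[OF floor_meas]) simp
  have "(\<lambda>t. complex_of_real (osc_pot t)) \<in> borel_measurable lborel"
    unfolding osc_pot_def by measurable
  then have 2: "(\<lambda>t. complex_of_real (osc_pot t)) \<in> borel_measurable lebesgue" by (rule measurable_completion)
  show ?thesis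
  proof (cases "r = r'")
    case True
    then show ?thesis using borel_measurable_add[OF 1 2] by (simp add: V_entry_def[abs_def])
  qed (use 1 in \<open>simp add: V_entry_def[abs_def]\<close>)
qed

text \<open>A bounded time window meets finitely many cells, and in each of them the current part
  between members of the block takes finitely many values; the oscillator part is bounded by its
  size at |R|.\<close>

lemma V_entry_bounded: "\<exists>M. \<forall>r\<in>base_block n. \<forall>r'\<in>base_block n. \<forall>t. \<bar>t\<bar> \<le> R \<longrightarrow> cmod (V_entry r r' t) \<le> M"
proof -
  define N where "N = \<lceil>\<bar>R\<bar> / ell\<rceil> + 1"
  define T where "T = {-N..N} \<times> base_block n \<times> base_block n"
  define k where "k = (\<lambda>(j, r, r'). cmod (K_entry e L (gauge_iter j r) (gauge_iter j r')))"
  have T: "finite T" using finite_base_block by (simp add: T_def)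
  show ?thesis
  proof (intro exI ballI allI impI)
    fix r r' t assume r: "r \<in> base_block n" "r' \<in> base_block n" and t: "\<bar>t\<bar> \<le> R"
    define j where "j = \<lfloor>t / ell\<rfloor>"
    have "\<bar>t / ell\<bar> \<le> \<bar>R\<bar> / ell" using t ell_pos by (simp add: divide_right_mono)
    also have "\<dots> \<le> of_int (N - 1)" by (simp add: N_def)
    finally have "- of_int N \<le> t / ell" "t / ell < of_int N + 1" unfolding of_int_diff of_int_1 by linarith+
    then have "j \<in> {-N..N}" unfolding j_def by (simp add: le_floor_iff floor_le_iff)
    then have "(j, r, r') \<in> T" using r by (simp add: T_def)
    then have "k (j, r, r') \<le> (\<Sum>p\<in>T. k p)" using T by (intro member_le_sum) (auto simp: k_def)
    then have 1: "cmod (iter_sign j r * iter_sign j r' * K_entry e L (gauge_iter j r) (gauge_iter j r')) \<le> (\<Sum>p\<in>T. k p)"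
      by (simp add: k_def norm_mult iter_sign_sq)
    have 2: "\<bar>osc_pot t\<bar> \<le> pi / (2 * L) * (\<bar>R\<bar> * L / pi + 1)\<^sup>2 + \<bar>C0\<bar>"
    proof -
      have "\<bar>t * L / pi + 1\<bar> \<le> \<bar>t\<bar> * L / pi + 1" using L abs_triangle_ineq[of "t * L / pi" 1] by (simp add: abs_mult)
      also have "\<dots> \<le> \<bar>R\<bar> * L / pi + 1" using t L by (intro add_right_mono divide_right_mono mult_right_mono) auto
      finally have "(t * L / pi + 1)\<^sup>2 \<le> (\<bar>R\<bar> * L / pi + 1)\<^sup>2" by (metis power2_abs abs_ge_zero power_mono)
      then have "pi / (2 * L) * (t * L / pi + 1)\<^sup>2 \<le> pi / (2 * L) * (\<bar>R\<bar> * L / pi + 1)\<^sup>2" using L by (intro mult_left_mono) auto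
      moreover have "0 \<le> pi / (2 * L) * (t * L / pi + 1)\<^sup>2" using L by simp
      ultimately show ?thesis unfolding osc_pot_def by linarith
    qed
    have "cmod (V_entry r r' t) \<le> cmod (iter_sign j r * iter_sign j r' * K_entry e L (gauge_iter j r) (gauge_iter j r')) + cmod (if r = r' then of_real (osc_pot t) else 0)"
      unfolding V_entry_def j_def[symmetric] by (rule norm_triangle_ineq)
    also have "\<dots> \<le> (\<Sum>p\<in>T. k p) + (pi / (2 * L) * (\<bar>R\<bar> * L / pi + 1)\<^sup>2 + \<bar>C0\<bar>)"
      using 1 2 L by (intro add_mono) auto
    finally show "cmod (V_entry r r' t) \<le> (\<Sum>p\<in>T. k p) + (pi / (2 * L) * (\<bar>R\<bar> * L / pi + 1)\<^sup>2 + \<bar>C0\<bar>)" .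
  qed
qed

text \<open>The current part is nonnegative at every time and the oscillator part is a square plus
  \<open>C0\<close>. Hence the bound is uniform in time and does not depend on the block
  either.\<close>

lemma V_entry_lower:
  "- \<bar>C0\<bar> * (\<Sum>r\<in>base_block n. (cmod (z r))\<^sup>2) \<le> Re (\<Sum>r\<in>base_block n. cnj (z r) * (\<Sum>r'\<in>base_block n. V_entry r r' t * z r'))"
proof -
  define j where "j = \<lfloor>t / ell\<rfloor>"
  \<comment> \<open>The vector \<open>z\<close> transported to sheet j together with its signs; the
    current part of the form at time \<open>t\<close> is the form of the current matrix at
    \<open>w\<close>.\<close>
  define w where "w = (\<lambda>\<beta>. iter_sign j (base_label \<beta>) * z (base_label \<beta>))"
  have inj: "inj_on (gauge_iter j) (base_block n)" using base_block_J0 gauge_iter_inj by (intro inj_onI) blast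
  have wg: "w (gauge_iter j r) = iter_sign j r * z r" if "r \<in> base_block n" for r
  proof -
    have "r \<in> J0" using that base_block_J0 by blast
    then show ?thesis by (simp add: w_def base_label_gauge_iter)
  qed
  have "gauge_iter j r \<in> fock_basis" if "r \<in> base_block n" for r using that base_block_J0 J0_fock gauge_iter_fock by blast
  then have fin: "finite (gauge_iter j ` base_block n)" "gauge_iter j ` base_block n \<subseteq> fock_basis" using finite_base_block by blast+
  have "0 \<le> Re (\<Sum>\<beta>\<in>gauge_iter j ` base_block n. cnj (w \<beta>) * (\<Sum>\<beta>'\<in>gauge_iter j ` base_block n. K_entry e L \<beta> \<beta>' * w \<beta>'))"
    by (rule K_entry_pos[OF fin])
  also have "(\<Sum>\<beta>\<in>gauge_iter j ` base_block n. cnj (w \<beta>) * (\<Sum>\<beta>'\<in>gauge_iter j ` base_block n. K_entry e L \<beta> \<beta>' * w \<beta>')) =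
     (\<Sum>r\<in>base_block n. cnj (z r) * (\<Sum>r'\<in>base_block n. iter_sign j r * iter_sign j r' * K_entry e L (gauge_iter j r) (gauge_iter j r') * z r'))"
    unfolding sum.reindex[OF inj] o_def
  proof (rule sum.cong[OF refl])
    fix r assume r: "r \<in> base_block n"
    have "(\<Sum>r'\<in>base_block n. K_entry e L (gauge_iter j r) (gauge_iter j r') * w (gauge_iter j r')) = (\<Sum>r'\<in>base_block n. iter_sign j r' * K_entry e L (gauge_iter j r) (gauge_iter j r') * z r')"
      by (intro sum.cong refl) (simp add: wg)
    then show "cnj (w (gauge_iter j r)) * (\<Sum>r'\<in>base_block n. K_entry e L (gauge_iter j r) (gauge_iter j r') * w (gauge_iter j r')) =
      cnj (z r) * (\<Sum>r'\<in>base_block n. iter_sign j r * iter_sign j r' * K_entry e L (gauge_iter j r) (gauge_iter j r') * z r')"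
      using r by (simp add: wg iter_sign_sq sum_distrib_left mult_ac)
  qed
  finally have 1: "0 \<le> Re (\<Sum>r\<in>base_block n. cnj (z r) * (\<Sum>r'\<in>base_block n. iter_sign j r * iter_sign j r' * K_entry e L (gauge_iter j r) (gauge_iter j r') * z r'))" .
  have "(\<Sum>r\<in>base_block n. cnj (z r) * (\<Sum>r'\<in>base_block n. V_entry r r' t * z r')) =
    (\<Sum>r\<in>base_block n. cnj (z r) * (\<Sum>r'\<in>base_block n. iter_sign j r * iter_sign j r' * K_entry e L (gauge_iter j r) (gauge_iter j r') * z r')) + (\<Sum>r\<in>base_block n. of_real (osc_pot t * (cmod (z r))\<^sup>2))"
    unfolding sum.distrib[symmetric]
  proof (rule sum.cong[OF refl])
    fix r assume r: "r \<in> base_block n"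
    have "(\<Sum>r'\<in>base_block n. V_entry r r' t * z r') = (\<Sum>r'\<in>base_block n. iter_sign j r * iter_sign j r' * K_entry e L (gauge_iter j r) (gauge_iter j r') * z r' + (if r' = r then of_real (osc_pot t) * z r else 0))"
      unfolding V_entry_def j_def[symmetric] by (intro sum.cong refl) (auto simp: distrib_right)
    also have "\<dots> = (\<Sum>r'\<in>base_block n. iter_sign j r * iter_sign j r' * K_entry e L (gauge_iter j r) (gauge_iter j r') * z r') + of_real (osc_pot t) * z r"
      using r finite_base_block by (simp add: sum.distrib)
    finally have eq: "(\<Sum>r'\<in>base_block n. V_entry r r' t * z r') = (\<Sum>r'\<in>base_block n. iter_sign j r * iter_sign j r' * K_entry e L (gauge_iter j r) (gauge_iter j r') * z r') + of_real (osc_pot t) * z r" .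
    have "cnj (z r) * (of_real (osc_pot t) * z r) = of_real (osc_pot t * (cmod (z r))\<^sup>2)"
      unfolding of_real_mult complex_norm_square by (simp only: mult_ac)
    then show "cnj (z r) * (\<Sum>r'\<in>base_block n. V_entry r r' t * z r') =
      cnj (z r) * (\<Sum>r'\<in>base_block n. iter_sign j r * iter_sign j r' * K_entry e L (gauge_iter j r) (gauge_iter j r') * z r') + of_real (osc_pot t * (cmod (z r))\<^sup>2)"
      unfolding eq distrib_left by simp
  qed
  then have "Re (\<Sum>r\<in>base_block n. cnj (z r) * (\<Sum>r'\<in>base_block n. V_entry r r' t * z r')) \<ge> (\<Sum>r\<in>base_block n. osc_pot t * (cmod (z r))\<^sup>2)"
    using 1 by (simp only: plus_complex.sel Re_sum Re_complex_of_real)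
  moreover have "(\<Sum>r\<in>base_block n. osc_pot t * (cmod (z r))\<^sup>2) \<ge> - \<bar>C0\<bar> * (\<Sum>r\<in>base_block n. (cmod (z r))\<^sup>2)"
    unfolding sum_distrib_left using osc_pot_ge[of t] by (intro sum_mono mult_right_mono) auto
  ultimately show ?thesis by linarith
qed

text \<open>Unfolding preserves inner products. The left vector is confined to finitely many labels
  over the circle, so that only finite sums are exchanged with integrals, while the right one is an
  arbitrary element of the space.\<close>

lemma Kinner_unfold_fn:
  assumes x: "x \<in> Kspace L" and y: "y \<in> Kspace L" and J: "finite J"
    and z: "\<And>a \<beta>. a \<in> Iv L \<Longrightarrow> x a \<beta> \<noteq> 0 \<Longrightarrow> \<beta> \<in> charge0_basis \<and> base_label \<beta> \<in> base_block n \<and> sheet \<beta> \<in> J"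
  shows "Kinner L x y = (\<Sum>r\<in>base_block n. LINT t|lebesgue. cnj (unfold_fn x r t) * unfold_fn y r t)"
proof -
  define I where "I = (\<lambda>\<beta>. LINT a|lebesgue. cnj (component L x \<beta> a) * component L y \<beta> a)"
  have K: "K_admissible L x" "K_admissible L y" using x y by (auto simp: Kspace_iff)
  have piece: "integrable lebesgue (\<lambda>t. cnj (cell_piece x r j t) * cell_piece y r j t)"
    "(LINT t|lebesgue. cnj (cell_piece x r j t) * cell_piece y r j t) = I (gauge_iter j r)" for r j
  proof -
    let ?h = "\<lambda>t. cnj (cell_piece x r j t) * cell_piece y r j t"
    let ?g = "\<lambda>t. cnj (indicat_real {0..<ell} t *\<^sub>R x t (gauge_iter j r)) * (indicat_real {0..<ell} t *\<^sub>R y t (gauge_iter j r))"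
    have hg: "(\<lambda>t. ?h (j * ell + 1 * t)) = ?g" by (simp add: cell_piece_def)
    have gm: "?g \<in> borel_measurable lebesgue"
      by (intro borel_measurable_times cnj_measurable cell_meas K)
    have "AE a in lebesgue. a \<noteq> ell" using AE_completion[OF AE_lborel_singleton[of ell]] by simp
    then have ae: "AE a in lebesgue. cnj (component L x (gauge_iter j r) a) * component L y (gauge_iter j r) a = ?g a"
      by eventually_elim (auto simp: component_def Iv_eq split: split_indicator)
    note ci = component_integrable(1)[OF x y, of "gauge_iter j r"]
    have gauge_iter: "integrable lebesgue ?g" by (rule integrable_cong_AE_imp[OF ci gm ae])
    have gI: "(LINT t|lebesgue. ?g t) = I (gauge_iter j r)"
      unfolding I_def by (rule integral_cong_AE[OF gm borel_measurable_integrable[OF ci]]) (use ae in auto)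
    show "integrable lebesgue ?h"
      using gauge_iter unfolding hg[symmetric] by (subst (asm) lebesgue_integrable_real_affine_iff) auto
    show "(LINT t|lebesgue. ?h t) = I (gauge_iter j r)"
      using lebesgue_integral_real_affine[of 1 ?h "j * ell"] unfolding hg gI by simp
  qed
  have "(LINT t|lebesgue. cnj (unfold_fn x r t) * unfold_fn y r t) = (\<Sum>j\<in>J. I (gauge_iter j r))" if r: "r \<in> base_block n" for r
  proof -
    have rJ: "r \<in> J0" using r base_block_J0 by blast
    have "cnj (unfold_fn x r t) * unfold_fn y r t = (\<Sum>j\<in>J. cnj (cell_piece x r j t) * cell_piece y r j t)" for t
    proof -
      define i where "i = \<lfloor>t / ell\<rfloor>"
      have o: "cell_piece x r j t = 0" if "j \<noteq> i" for j
        using floor_cell[of t j] that by (simp add: cell_piece_def i_def split: split_indicator)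
      have "(\<Sum>j\<in>J. cnj (cell_piece x r j t) * cell_piece y r j t) = (\<Sum>j\<in>J. if j = i then cnj (cell_piece x r i t) * cell_piece y r i t else 0)"
        by (intro sum.cong refl) (auto simp: o)
      also have "\<dots> = cnj (cell_piece x r i t) * cell_piece y r i t"
      proof (cases "i \<in> J")
        case False
        have "t - i * ell \<in> Iv L" using floor_cell[of t i] by (auto simp: i_def Iv_eq)
        from z[OF this, of "gauge_iter i r"] have "x (t - i * ell) (gauge_iter i r) = 0" using False rJ by (auto simp: sheet_gauge_iter)
        then show ?thesis using False J by (simp add: cell_piece_def)
      qed (use J in simp)
      also have "\<dots> = cnj (unfold_fn x r t) * unfold_fn y r t"
        unfolding unfold_fn_cell_piece i_def[symmetric] complex_cnj_mult iter_sign_sq(2) using iter_sign_sq(1)[of i r]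
        by (metis (no_types, lifting) mult.assoc mult.left_commute mult_1)
      finally show ?thesis ..
    qed
    then have "(LINT t|lebesgue. cnj (unfold_fn x r t) * unfold_fn y r t) = (LINT t|lebesgue. (\<Sum>j\<in>J. cnj (cell_piece x r j t) * cell_piece y r j t))" by simp
    also have "\<dots> = (\<Sum>j\<in>J. LINT t|lebesgue. cnj (cell_piece x r j t) * cell_piece y r j t)"
      by (rule Bochner_Integration.integral_sum) (rule piece(1))
    finally show ?thesis by (simp add: piece(2))
  qed
  then have "(\<Sum>r\<in>base_block n. LINT t|lebesgue. cnj (unfold_fn x r t) * unfold_fn y r t) = (\<Sum>r\<in>base_block n. \<Sum>j\<in>J. I (gauge_iter j r))" by simp
  also have "\<dots> = (\<Sum>(r, j)\<in>base_block n \<times> J. I (gauge_iter j r))" by (rule sum.cartesian_product)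
  also have "\<dots> = (\<Sum>\<beta>\<in>(\<lambda>(r, j). gauge_iter j r) ` (base_block n \<times> J). I \<beta>)"
  proof (subst sum.reindex)
    show "inj_on (\<lambda>(r, j). gauge_iter j r) (base_block n \<times> J)" using gauge_iter_inj base_block_J0 by (intro inj_onI) (auto dest!: subsetD[OF base_block_J0])
  qed (simp add: case_prod_unfold)
  also have "\<dots> = Kinner L x y"
  proof (subst Kinner_finite(1)[OF x y, of "(\<lambda>(r, j). gauge_iter j r) ` (base_block n \<times> J)"])
    show "finite ((\<lambda>(r, j). gauge_iter j r) ` (base_block n \<times> J))" using finite_base_block J by simp
    fix a \<beta> assume "a \<in> Iv L" "\<beta> \<notin> (\<lambda>(r, j). gauge_iter j r) ` (base_block n \<times> J)"
    moreover have "\<beta> = (\<lambda>(r, j). gauge_iter j r) (base_label \<beta>, sheet \<beta>)" by (simp add: gauge_iter_base_label)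
    ultimately show "x a \<beta> = 0 \<or> y a \<beta> = 0" using z[of a \<beta>] by (metis image_eqI mem_Sigma_iff)
  qed (simp add: I_def component_integrable(3)[OF x y])
  finally show ?thesis ..
qed

text \<open>This supplies the finiteness condition for inner products with a refolded family and
  with its image: compactness bounds the sheets, and decoupling keeps the representatives in the
  block.\<close>

lemma refold_finite_supp:
  assumes f: "\<And>r. r \<in> base_block n \<Longrightarrow> test_fun R (f r)"
  obtains J where "finite J"
    "\<And>a \<beta>. a \<in> Iv L \<Longrightarrow> refold (base_block n) f a \<beta> \<noteq> 0 \<Longrightarrow> \<beta> \<in> charge0_basis \<and> base_label \<beta> \<in> base_block n \<and> sheet \<beta> \<in> J"
    "\<And>a \<beta>. a \<in> Iv L \<Longrightarrow> Hop e L C0 (refold (base_block n) f) a \<beta> \<noteq> 0 \<Longrightarrow> \<beta> \<in> charge0_basis \<and> base_label \<beta> \<in> base_block n \<and> sheet \<beta> \<in> J"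
proof -
  let ?u = "refold (base_block n) f"
  have u: "?u \<in> DomH L G" by (rule refold_DomH[OF finite_base_block f])
  obtain c where c: "\<And>t \<beta>. t \<in> {-1..ell+1} \<Longrightarrow> ?u t \<beta> \<noteq> 0 \<Longrightarrow> \<beta> \<in> label_block c" using DomH_bounded[OF u] by metis
  show ?thesis
  proof (rule that[of "sheet ` label_block c"])
    show "finite (sheet ` label_block c)" using label_block_finite by simp
    fix a \<beta> assume a: "a \<in> Iv L"
    then have a': "a \<in> {-1..ell+1}" by (auto simp: Iv_eq)
    show "\<beta> \<in> charge0_basis \<and> base_label \<beta> \<in> base_block n \<and> sheet \<beta> \<in> sheet ` label_block c" if "?u a \<beta> \<noteq> 0"
      using c[OF a' that] that by (auto simp: refold_def split: if_splits)
    show "\<beta> \<in> charge0_basis \<and> base_label \<beta> \<in> base_block n \<and> sheet \<beta> \<in> sheet ` label_block c" if h: "Hop e L C0 ?u a \<beta> \<noteq> 0"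
    proof -
      have b: "\<beta> \<in> label_block c"
      proof (rule ccontr)
        assume n: "\<beta> \<notin> label_block c"
        have "Hop e L C0 ?u a \<beta> = 0" by (rule Hop_Iv(1)[OF u _ a n]) (rule c; assumption)
        then show False using h by simp
      qed
      then have b0: "\<beta> \<in> charge0_basis" using label_block_charge0 by blast
      have "base_label \<beta> \<in> base_block n"
      proof (rule ccontr)
        assume n: "base_label \<beta> \<notin> base_block n"
        have "Hop e L C0 ?u a (gauge_iter (sheet \<beta>) (base_label \<beta>)) = 0"
          by (subst Hop_refold[OF f base_label_J0[OF b0] a]) (use n in auto)
        then show False using h by (simp add: gauge_iter_base_label)
      qed
      then show ?thesis using b b0 by blast
    qed
  qed
qed

lemma weak_equation:
  assumes x: "x \<in> Kspace L" and y: "y \<in> Kspace L"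
    and adj: "\<And>u. u \<in> DomH L G \<Longrightarrow> Kinner L (Hop e L C0 u) x = Kinner L u y"
    and \<phi>: "test_fun R \<phi>" and r0: "r0 \<in> base_block n"
  shows "(LINT t:{-R..R}|lebesgue. - of_real kin_coef * cderiv (cderiv \<phi>) t * unfold_fn x r0 t + \<phi> t * (\<Sum>r\<in>base_block n. V_entry r0 r t * unfold_fn x r t))
      = (LINT t:{-R..R}|lebesgue. \<phi> t * unfold_fn y r0 t)"
proof -
  \<comment> \<open>Testing with the conjugate of \<open>\<phi>\<close> at the single representative
    \<open>r0\<close>: the left slot of \<open>Kinner\<close> is antilinear, so
    \<open>\<phi>\<close> itself appears in the result, and hermiticity turns column
    \<open>r0\<close> of the matrix into its row.\<close>
  define f where "f = (\<lambda>r t. if r = r0 then cnj (\<phi> t) else 0)"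
  have \<phi>s: "csmooth \<phi>" using \<phi> by (rule test_fun_csmooth)
  have f: "test_fun R (f r)" for r
    using \<phi> csmooth_cnj[OF \<phi>s] by (cases "r = r0") (auto simp: f_def test_fun_def)
  let ?u = "refold (base_block n) f"
  have u: "?u \<in> DomH L G" by (rule refold_DomH[OF finite_base_block f])
  obtain J where J: "finite J"
    "\<And>a \<beta>. a \<in> Iv L \<Longrightarrow> ?u a \<beta> \<noteq> 0 \<Longrightarrow> \<beta> \<in> charge0_basis \<and> base_label \<beta> \<in> base_block n \<and> sheet \<beta> \<in> J"
    "\<And>a \<beta>. a \<in> Iv L \<Longrightarrow> Hop e L C0 ?u a \<beta> \<noteq> 0 \<Longrightarrow> \<beta> \<in> charge0_basis \<and> base_label \<beta> \<in> base_block n \<and> sheet \<beta> \<in> J"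
    by (rule refold_finite_supp[OF f]) (rule that; assumption)
  have dcz: "cderiv (\<lambda>t. 0) = (\<lambda>t. 0)" by (rule cderiv_eqI) simp
  have df: "cderiv (cderiv (f r)) t = (if r = r0 then cnj (cderiv (cderiv \<phi>) t) else 0)" for r t
    using \<phi>s by (cases "r = r0") (simp_all add: f_def cderiv_cnj csmooth_cderiv dcz)
  have B0: "r \<in> base_block n \<Longrightarrow> r \<in> J0" for r using base_block_J0 by blast
  have uH: "cnj (unfold_fn (Hop e L C0 ?u) r t) = (if r = r0 then - of_real kin_coef * cderiv (cderiv \<phi>) t else 0) + \<phi> t * V_entry r0 r t" if r: "r \<in> base_block n" for r t
  proof -
    have "(\<Sum>r'\<in>base_block n. V_entry r r' t * f r' t) = (\<Sum>r'\<in>base_block n. if r' = r0 then V_entry r r0 t * cnj (\<phi> t) else 0)"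
      by (intro sum.cong refl) (auto simp: f_def)
    also have "\<dots> = V_entry r r0 t * cnj (\<phi> t)" using r0 finite_base_block by simp
    finally have "unfold_fn (Hop e L C0 ?u) r t = - of_real kin_coef * (if r = r0 then cnj (cderiv (cderiv \<phi>) t) else 0) + V_entry r r0 t * cnj (\<phi> t)"
      using unfold_fn_Hop[OF f B0[OF r], where n=n and t=t] r by (simp add: df)
    then show ?thesis using V_entry_hermitian[OF B0[OF r] B0[OF r0], of t] by simp
  qed
  have int: "integrable lebesgue (\<lambda>t. cnj (unfold_fn z r t) * unfold_fn z' r t)" if "z \<in> Kspace L" "z' \<in> Kspace L" "r \<in> base_block n" for z z' r
  proof -
    have "set_integrable lebesgue UNIV (\<lambda>t. cnj (unfold_fn z r t) * unfold_fn z' r t)"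
      by (rule L2_CS(1)) (auto intro: L2_cnj unfold_fn_L2 that B0)
    then show ?thesis by (simp add: set_integrable_def)
  qed
  have out: "\<phi> t = 0" "cderiv (cderiv \<phi>) t = 0" if "t \<notin> {-R..R}" for t
  proof -
    have "R \<le> \<bar>t\<bar>" using that by auto
    then show "\<phi> t = 0" "cderiv (cderiv \<phi>) t = 0"
      using \<phi> test_fun_cderiv[OF test_fun_cderiv[OF \<phi>]] by (auto simp: test_fun_def)
  qed
  have "Kinner L (Hop e L C0 ?u) x = (\<Sum>r\<in>base_block n. LINT t|lebesgue. cnj (unfold_fn (Hop e L C0 ?u) r t) * unfold_fn x r t)"
    by (rule Kinner_unfold_fn[OF DomH_Kspace(2)[OF u] x J(1)]) (rule J(3))
  also have "\<dots> = (LINT t|lebesgue. (\<Sum>r\<in>base_block n. cnj (unfold_fn (Hop e L C0 ?u) r t) * unfold_fn x r t))"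
    by (rule Bochner_Integration.integral_sum[symmetric]) (rule int[OF DomH_Kspace(2)[OF u] x])
  also have "\<dots> = (LINT t|lebesgue. indicat_real {-R..R} t *\<^sub>R (- of_real kin_coef * cderiv (cderiv \<phi>) t * unfold_fn x r0 t + \<phi> t * (\<Sum>r\<in>base_block n. V_entry r0 r t * unfold_fn x r t)))"
  proof (rule Bochner_Integration.integral_cong[OF refl])
    fix t :: real
    have "(\<Sum>r\<in>base_block n. cnj (unfold_fn (Hop e L C0 ?u) r t) * unfold_fn x r t) =
      (\<Sum>r\<in>base_block n. (if r = r0 then - of_real kin_coef * cderiv (cderiv \<phi>) t * unfold_fn x r0 t else 0) + \<phi> t * (V_entry r0 r t * unfold_fn x r t))"
      by (intro sum.cong refl) (auto simp: uH algebra_simps)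
    also have "\<dots> = - of_real kin_coef * cderiv (cderiv \<phi>) t * unfold_fn x r0 t + \<phi> t * (\<Sum>r\<in>base_block n. V_entry r0 r t * unfold_fn x r t)"
      using r0 finite_base_block by (simp add: sum.distrib sum_distrib_left)
    also have "\<dots> = indicat_real {-R..R} t *\<^sub>R (- of_real kin_coef * cderiv (cderiv \<phi>) t * unfold_fn x r0 t + \<phi> t * (\<Sum>r\<in>base_block n. V_entry r0 r t * unfold_fn x r t))"
      using out[of t] by (auto split: split_indicator)
    finally show "(\<Sum>r\<in>base_block n. cnj (unfold_fn (Hop e L C0 ?u) r t) * unfold_fn x r t) =
      indicat_real {-R..R} t *\<^sub>R (- of_real kin_coef * cderiv (cderiv \<phi>) t * unfold_fn x r0 t + \<phi> t * (\<Sum>r\<in>base_block n. V_entry r0 r t * unfold_fn x r t))" .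
  qed
  finally have 1: "Kinner L (Hop e L C0 ?u) x = (LINT t:{-R..R}|lebesgue. - of_real kin_coef * cderiv (cderiv \<phi>) t * unfold_fn x r0 t + \<phi> t * (\<Sum>r\<in>base_block n. V_entry r0 r t * unfold_fn x r t))"
    by (simp add: set_lebesgue_integral_def)
  have "Kinner L ?u y = (\<Sum>r\<in>base_block n. LINT t|lebesgue. cnj (unfold_fn ?u r t) * unfold_fn y r t)"
    by (rule Kinner_unfold_fn[OF DomH_Kspace(1)[OF u] y J(1)]) (rule J(2))
  also have "\<dots> = (\<Sum>r\<in>base_block n. if r = r0 then (LINT t|lebesgue. \<phi> t * unfold_fn y r0 t) else 0)"
    by (intro sum.cong refl) (auto simp: unfold_fn_refold B0 f_def)
  also have "\<dots> = (LINT t|lebesgue. \<phi> t * unfold_fn y r0 t)" using r0 finite_base_block by simp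
  also have "\<dots> = (LINT t:{-R..R}|lebesgue. \<phi> t * unfold_fn y r0 t)"
    unfolding set_lebesgue_integral_def
    by (rule Bochner_Integration.integral_cong[OF refl]) (use out in \<open>auto split: split_indicator\<close>)
  finally show ?thesis using 1 adj[OF u] by simp
qed

text \<open>The adjoint relation, tested on the domain, says that the unfolded pair solves the weak
  equation on every finite block. The approximating family for one block, refolded, is in the
  domain, and neither it nor its image leaves the block; outside, only the tails of \<open>x\<close>
  and \<open>y\<close> remain.\<close>

lemma adjoint_subset_closure:
  "adjoint_graph L (closure_graph L (op_graph (DomH L G) (Hop e L C0))) \<subseteq> closure_graph L (op_graph (DomH L G) (Hop e L C0))"
proof (rule subrelI)
  fix x y assume xy: "(x, y) \<in> adjoint_graph L (closure_graph L (op_graph (DomH L G) (Hop e L C0)))"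
  then have x: "x \<in> Kspace L" and y: "y \<in> Kspace L" by (auto simp: adjoint_graph_def)
  have self0: "Knorm2 L (z - z) < ennreal \<epsilon>" if "0 < \<epsilon>" for z \<epsilon> using that by (simp add: Knorm2_def)
  have adj: "Kinner L (Hop e L C0 u) x = Kinner L u y" if u: "u \<in> DomH L G" for u
  proof -
    have "(u, Hop e L C0 u) \<in> closure_graph L (op_graph (DomH L G) (Hop e L C0))"
      unfolding closure_graph_def op_graph_def using DomH_Kspace[OF u] u self0 by blast
    then show ?thesis using xy unfolding adjoint_graph_def by blast
  qed
  have "\<exists>u\<in>DomH L G. Knorm2 L (u - x) < ennreal \<epsilon> \<and> Knorm2 L (Hop e L C0 u - y) < ennreal \<epsilon>" if \<epsilon>: "0 < \<epsilon>" for \<epsilon>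
  proof -
    have \<epsilon>2: "0 < \<epsilon> / 2" using \<epsilon> by simp
    obtain n1 where n1: "\<And>n. n1 \<le> n \<Longrightarrow> (\<integral>\<^sup>+r. n2 UNIV (unfold_fn x r) * indicator (J0 - base_block n) r \<partial>count_space J0) < ennreal (\<epsilon>/2)"
      using Knorm2_tail[OF x \<epsilon>2] by metis
    obtain n2' where n2': "\<And>n. n2' \<le> n \<Longrightarrow> (\<integral>\<^sup>+r. n2 UNIV (unfold_fn y r) * indicator (J0 - base_block n) r \<partial>count_space J0) < ennreal (\<epsilon>/2)"
      using Knorm2_tail[OF y \<epsilon>2] by metis
    \<comment> \<open>A common block is needed for which the tails of both \<open>x\<close> and
      \<open>y\<close> are small, since it bounds the distance in the graph norm.\<close>
    define n where "n = max n1 n2'"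
    have B0: "r \<in> base_block n \<Longrightarrow> r \<in> J0" for r using base_block_J0 by blast
    obtain f R where f: "\<And>r. r \<in> base_block n \<Longrightarrow> test_fun R (f r)" "(\<Sum>r\<in>base_block n. r2 UNIV (\<lambda>t. f r t - unfold_fn x r t)) < \<epsilon> / 2"
      "(\<Sum>r\<in>base_block n. r2 UNIV (\<lambda>t. - of_real kin_coef * cderiv (cderiv (f r)) t + (\<Sum>r'\<in>base_block n. V_entry r r' t * f r' t) - unfold_fn y r t)) < \<epsilon> / 2"
      "\<And>r. r \<in> base_block n \<Longrightarrow> L2 UNIV (\<lambda>t. f r t - unfold_fn x r t)"
      "\<And>r. r \<in> base_block n \<Longrightarrow> L2 UNIV (\<lambda>t. - of_real kin_coef * cderiv (cderiv (f r)) t + (\<Sum>r'\<in>base_block n. V_entry r r' t * f r' t) - unfold_fn y r t)"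
    proof (rule schroedinger_core[of "base_block n" kin_coef "\<bar>C0\<bar>" "\<epsilon> / 2" "\<lambda>r. unfold_fn x r" "\<lambda>r. unfold_fn y r" V_entry])
      show "\<And>R. \<exists>M. \<forall>i\<in>base_block n. \<forall>j\<in>base_block n. \<forall>t. \<bar>t\<bar> \<le> R \<longrightarrow> cmod (V_entry i j t) \<le> M" by (rule V_entry_bounded)
      show "- \<bar>C0\<bar> * (\<Sum>i\<in>base_block n. (cmod (z i))\<^sup>2) \<le> Re (\<Sum>i\<in>base_block n. cnj (z i) * (\<Sum>j\<in>base_block n. V_entry i j t * z j))" for z t
        by (rule V_entry_lower)
      show "(LINT t:{-R..R}|lebesgue. - of_real kin_coef * cderiv (cderiv \<phi>) t * unfold_fn x i t + \<phi> t * (\<Sum>j\<in>base_block n. V_entry i j t * unfold_fn x j t))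
        = (LINT t:{-R..R}|lebesgue. \<phi> t * unfold_fn y i t)" if "test_fun R \<phi>" "i \<in> base_block n" for \<phi> i R
        by (rule weak_equation[OF x y adj that])
    qed (use finite_base_block kin_coef_pos \<epsilon>2 unfold_fn_L2[OF x] unfold_fn_L2[OF y] B0 V_entry_measurable in auto)
    let ?u = "refold (base_block n) f"
    have u: "?u \<in> DomH L G" by (rule refold_DomH[OF finite_base_block f(1)])
    have K: "K_admissible L ?u" "K_admissible L (Hop e L C0 ?u)" "K_admissible L x" "K_admissible L y"
      using DomH_Kspace[OF u] x y by (auto simp: Kspace_iff)
    have uH: "unfold_fn (Hop e L C0 ?u) r t = (if r \<in> base_block n then - of_real kin_coef * cderiv (cderiv (f r)) t + (\<Sum>r'\<in>base_block n. V_entry r r' t * f r' t) else 0)"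
      if "r \<in> J0" for r t by (rule unfold_fn_Hop[OF f(1) that])
    have "Knorm2 L (?u - x) = (\<Sum>r\<in>base_block n. n2 UNIV (\<lambda>t. unfold_fn ?u r t - unfold_fn x r t)) +
      (\<integral>\<^sup>+r. n2 UNIV (unfold_fn x r) * indicator (J0 - base_block n) r \<partial>count_space J0)"
      by (rule Knorm2_split[OF K(1,3)]) (auto simp: unfold_fn_refold)
    also have "\<dots> < ennreal \<epsilon>"
    proof (rule ennreal_sum_less[OF _ _ \<epsilon>])
      have "(\<Sum>r\<in>base_block n. n2 UNIV (\<lambda>t. unfold_fn ?u r t - unfold_fn x r t)) = (\<Sum>r\<in>base_block n. ennreal (r2 UNIV (\<lambda>t. f r t - unfold_fn x r t)))"
        by (intro sum.cong refl) (simp add: unfold_fn_refold B0 L2_n2[OF f(4)])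
      also have "\<dots> = ennreal (\<Sum>r\<in>base_block n. r2 UNIV (\<lambda>t. f r t - unfold_fn x r t))" by (rule sum_ennreal) simp
      also have "\<dots> < ennreal (\<epsilon> / 2)" using f(2) \<epsilon>2 by (intro ennreal_lessI)
      finally show "(\<Sum>r\<in>base_block n. n2 UNIV (\<lambda>t. unfold_fn ?u r t - unfold_fn x r t)) < ennreal (\<epsilon> / 2)" .
    qed (rule n1, simp add: n_def)
    finally have 1: "Knorm2 L (?u - x) < ennreal \<epsilon>" .
    have "Knorm2 L (Hop e L C0 ?u - y) = (\<Sum>r\<in>base_block n. n2 UNIV (\<lambda>t. unfold_fn (Hop e L C0 ?u) r t - unfold_fn y r t)) +
      (\<integral>\<^sup>+r. n2 UNIV (unfold_fn y r) * indicator (J0 - base_block n) r \<partial>count_space J0)"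
      by (rule Knorm2_split[OF K(2,4)]) (auto simp: uH)
    also have "\<dots> < ennreal \<epsilon>"
    proof (rule ennreal_sum_less[OF _ _ \<epsilon>])
      have "(\<Sum>r\<in>base_block n. n2 UNIV (\<lambda>t. unfold_fn (Hop e L C0 ?u) r t - unfold_fn y r t)) = (\<Sum>r\<in>base_block n. ennreal (r2 UNIV (\<lambda>t. - of_real kin_coef * cderiv (cderiv (f r)) t + (\<Sum>r'\<in>base_block n. V_entry r r' t * f r' t) - unfold_fn y r t)))"
      proof (rule sum.cong[OF refl])
        fix r assume r: "r \<in> base_block n"
        have eq: "(\<lambda>t. unfold_fn (Hop e L C0 ?u) r t - unfold_fn y r t) = (\<lambda>t. - of_real kin_coef * cderiv (cderiv (f r)) t + (\<Sum>r'\<in>base_block n. V_entry r r' t * f r' t) - unfold_fn y r t)"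
          unfolding uH[OF B0[OF r]] using r by simp
        show "n2 UNIV (\<lambda>t. unfold_fn (Hop e L C0 ?u) r t - unfold_fn y r t) = ennreal (r2 UNIV (\<lambda>t. - of_real kin_coef * cderiv (cderiv (f r)) t + (\<Sum>r'\<in>base_block n. V_entry r r' t * f r' t) - unfold_fn y r t))"
          unfolding eq by (rule L2_n2[OF f(5)[OF r]])
      qed
      also have "\<dots> = ennreal (\<Sum>r\<in>base_block n. r2 UNIV (\<lambda>t. - of_real kin_coef * cderiv (cderiv (f r)) t + (\<Sum>r'\<in>base_block n. V_entry r r' t * f r' t) - unfold_fn y r t))"
        by (rule sum_ennreal) simp
      also have "\<dots> < ennreal (\<epsilon> / 2)" using f(3) \<epsilon>2 by (intro ennreal_lessI)
      finally show "(\<Sum>r\<in>base_block n. n2 UNIV (\<lambda>t. unfold_fn (Hop e L C0 ?u) r t - unfold_fn y r t)) < ennreal (\<epsilon> / 2)" .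
    qed (rule n2', simp add: n_def)
    finally show ?thesis using 1 u by blast
  qed
  then show "(x, y) \<in> closure_graph L (op_graph (DomH L G) (Hop e L C0))"
    unfolding closure_graph_def op_graph_def using x y by blast
qed

lemma symmetric: "symmetric_op L (DomH L G) (Hop e L C0)"
  unfolding symmetric_op_def
  by (intro conjI ballI DomH_dense DomH_Kspace(2) Hop_symmetric)

lemma ess_self_adjoint: "essentially_self_adjoint L (DomH L G) (Hop e L C0)"
  unfolding essentially_self_adjoint_def self_adjoint_graph_def
proof (intro conjI)
  let ?C = "closure_graph L (op_graph (DomH L G) (Hop e L C0))"
  show "?C \<subseteq> Kspace L \<times> Kspace L" by (auto simp: closure_graph_def)
  show "adjoint_graph L ?C = ?C"
    using adjoint_subset_closure closure_subset_adjoint[OF DomH_Kspace Hop_symmetric] by blast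
  have self0: "Knorm2 L (z - z) < ennreal \<epsilon>" if "0 < \<epsilon>" for z \<epsilon> using that by (simp add: Knorm2_def)
  have "DomH L G \<subseteq> fst ` ?C"
  proof
    fix u assume u: "u \<in> DomH L G"
    have "(u, Hop e L C0 u) \<in> ?C"
      unfolding closure_graph_def op_graph_def using DomH_Kspace[OF u] u self0 by blast
    then show "u \<in> fst ` ?C" by force
  qed
  moreover have "fst ` ?C \<subseteq> Kspace L" by (auto simp: closure_graph_def)
  ultimately show "dense_in_K L (fst ` ?C)"
    using DomH_dense unfolding dense_in_K_def by (meson subsetD)
qed

end

theorem theorem8:
  fixes e L C0 :: real and G :: "fvec \<Rightarrow> fvec"
  assumes "e > 0" and "L > 0" and "is_large_gauge G"
  shows "symmetric_op L (DomH L G) (Hop e L C0) \<and>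
         essentially_self_adjoint L (DomH L G) (Hop e L C0)"
proof -
  interpret schwinger e L C0 G using assms by unfold_locales
  show ?thesis using symmetric ess_self_adjoint by blast
qed

end
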